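(* Let $n\ge 2$ and let $\Sigma^n\subseteq\mathbb{R}^{n,1}$ be a smooth, compact, spacelike hypersurface (with boundary $\partial\Sigma$). Let $f$ be any smooth positive function on $\Sigma$. Then $$\int_\Sigma\sqrt{|\nabla f|^2+f^2\|H\|^2} + \int_{\partial\Sigma}f \;\geq\; C_{n,\tau}\left(\int_\Sigma f^{\frac{n}{n-1}}\right)^{\frac{n-1}{n}},$$ where $\tau=\tau(\Sigma)$ is the maximal slope of $\Sigma$ and $$C_{n,\tau}=2^{-1}n\,\omega_n^{\frac{1}{n}}(n+1)^{-\frac{1}{n}}\tau^{-\frac{1}{n}}\left(\tau+\sqrt{\tau^2-1}\right)^{-1}.$$
   Context: $\mathbb{R}^{n,1}$ is Minkowski space, i.e. $\mathbb{R}^{n+1}$ with coordinates $(x_0,\dots,x_n)$ and metric $\bar g=\langle\cdot,\cdot\rangle=-dx_0^2+dx_1^2+\cdots+dx_n^2$; write $|Y|^2=\langle Y,Y\rangle$. $\Sigma$ is spacelike if the induced metric $g$ is Riemannian; gradients, norms of tangent vectors, and integrals over $\Sigma$ and $\partial\Sigma$ are taken with respect to $g$ and the metric it induces on $\partial\Sigma$. $\bar\nabla$ and $\nabla$ are the Levi-Civita connections of $\bar g$ and $g$. The (normal-vector-valued) second fundamental form $h$ is defined by $\bar\nabla_Y Z=\nabla_Y Z-h(Y,Z)$ for tangent vector fields $Y,Z$, and the mean curvature vector is its trace $H=\operatorname{tr}_g h$. Since $H$ is normal to a spacelike hypersurface it is zero or timelike, and $\|H\|^2=-|H|^2\ge 0$.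 The maximal slope is $\tau(\Sigma)=\sup\{|\nu_0(x)|: x\in\Sigma,\ \nu(x)\in T_x^\bot\Sigma,\ |\nu(x)|^2=-1\}$, where $\nu_0$ is the $x_0$-coordinate of $\nu$. $\omega_n$ is the volume of the unit ball in $\mathbb{R}^n$. *)

theory Defs
  imports "HOL-Analysis.Analysis"
begin

section \<open>Minkowski space\<close>

text \<open>The first component of \<^typ>\<open>real \<times> (real^'n)\<close> is the time coordinate $x_0$.\<close>

type_synonym 'n minkowski = "real \<times> (real, 'n) vec"

definition mink :: "'n::finite minkowski \<Rightarrow> 'n minkowski \<Rightarrow> real" where
  "mink X Y = - (fst X * fst Y) + snd X \<bullet> snd Y"


section \<open>Smooth maps\<close>

text \<open>\<^term>\<open>U\<close> is meant to be open; all iterated directional derivatives exist and are continuous.\<close>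

primrec Ck_on :: "nat \<Rightarrow> 'a::real_normed_vector set \<Rightarrow> ('a \<Rightarrow> 'b::real_normed_vector) \<Rightarrow> bool" where
  "Ck_on 0 U f \<longleftrightarrow> continuous_on U f"
| "Ck_on (Suc k) U f \<longleftrightarrow>
     f differentiable_on U \<and> (\<forall>v. Ck_on k U (\<lambda>x. frechet_derivative f (at x) v))"

definition smooth_on :: "'a::real_normed_vector set \<Rightarrow> ('a \<Rightarrow> 'b::real_normed_vector) \<Rightarrow> bool" where
  "smooth_on U f \<longleftrightarrow> (\<forall>k. Ck_on k U f)"

text \<open>Smooth functions on an arbitrary subset: those with local smooth extensions.\<close>

definition smooth_function :: "'a::real_normed_vector set \<Rightarrow> ('a \<Rightarrow> real) \<Rightarrow> bool" where
  "smooth_function S f \<longleftrightarrow>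
     (\<forall>p\<in>S. \<exists>U F. open U \<and> p \<in> U \<and> smooth_on U F \<and> (\<forall>x\<in>S \<inter> U. F x = f x))"


section \<open>Embedded hypersurfaces with boundary\<close>

text \<open>
  A local parametrization is the restriction of a smooth map \<open>par c\<close>, given on an open set
  \<open>region c\<close>, to the part of that set in the closed half space \<open>{u. 0 \<le> u $ face c}\<close>.
  Which coordinate cuts out the half space is immaterial, and it is left free because a type
  of class \<^class>\<open>finite\<close> has no distinguished element. Interior charts are those
  whose region does not meet the hyperplane \<open>{u. u $ face c = 0}\<close>.
\<close>

datatype 'n chart =
  Chart (face: 'n) (region: "(real, 'n) vec set") (par: "(real, 'n) vec \<Rightarrow> 'n minkowski")

definition half_region :: "'n::finite chart \<Rightarrow> (real^'n) set" where
  "half_region c = {u \<in> region c. 0 \<le> u $ face c}"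

definition patch :: "'n::finite chart \<Rightarrow> 'n minkowski set" where
  "patch c = par c ` half_region c"

definition charts :: "'n::finite minkowski set \<Rightarrow> 'n chart set" where
  "charts S = {c. open (region c) \<and> smooth_on (region c) (par c) \<and>
     (\<forall>u\<in>half_region c. inj (frechet_derivative (par c) (at u))) \<and>
     (\<exists>q. homeomorphism (half_region c) (patch c) (par c) q) \<and>
     openin (top_of_set S) (patch c)}"

definition hypersurface :: "'n::finite minkowski set \<Rightarrow> bool" where
  "hypersurface S \<longleftrightarrow> S \<subseteq> (\<Union>c\<in>charts S. patch c)"

definition tangent_space :: "'n::finite minkowski set \<Rightarrow> 'n minkowski \<Rightarrow> 'n minkowski set" where
  "tangent_space S p = {frechet_derivative (par c) (at u) v | c u v.
     c \<in> charts S \<and> u \<in> half_region c \<and> par c u = p}"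

definition normal_space :: "'n::finite minkowski set \<Rightarrow> 'n minkowski \<Rightarrow> 'n minkowski set" where
  "normal_space S p = {N. \<forall>X\<in>tangent_space S p. mink N X = 0}"

definition spacelike :: "'n::finite minkowski set \<Rightarrow> bool" where
  "spacelike S \<longleftrightarrow> (\<forall>p\<in>S. \<forall>X\<in>tangent_space S p. X \<noteq> 0 \<longrightarrow> mink X X > 0)"

definition max_slope :: "'n::finite minkowski set \<Rightarrow> real" where
  "max_slope S = Sup {\<bar>fst N\<bar> | N. \<exists>p\<in>S. N \<in> normal_space S p \<and> mink N N = -1}"


section \<open>Gradient and mean curvature\<close>

text \<open>
  The derivative within \<open>S\<close> is determined only on vectors tangent to \<open>S\<close>, which is
  all that is used here: on those it is the differential of \<open>f\<close>.
\<close>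

definition gradient :: "'n::finite minkowski set \<Rightarrow> ('n minkowski \<Rightarrow> real) \<Rightarrow> 'n minkowski \<Rightarrow> 'n minkowski" where
  "gradient S f p = (THE X. X \<in> tangent_space S p \<and>
     (\<forall>Y\<in>tangent_space S p. mink X Y = frechet_derivative f (at p within S) Y))"

definition partial :: "'n::finite \<Rightarrow> (real^'n \<Rightarrow> 'b::real_normed_vector) \<Rightarrow> real^'n \<Rightarrow> 'b" where
  "partial i F u = frechet_derivative F (at u) (axis i 1)"

text \<open>The coefficients $g_{ij}$ of the induced metric in a parametrization.\<close>

definition metric :: "(real^'n \<Rightarrow> 'n minkowski) \<Rightarrow> real^'n \<Rightarrow> real^'n^'n::finite" where
  "metric \<phi> u = (\<chi> i j. mink (partial i \<phi> u) (partial j \<phi> u))"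

text \<open>
  The Levi-Civita connection of the induced metric: \<open>christoffel \<phi> k i j\<close> is
  $\Gamma^k_{ij}$, so that $\nabla_{\partial_i}\partial_j = \sum_k \Gamma^k_{ij}\partial_k$.
\<close>

definition christoffel ::
  "(real^'n \<Rightarrow> 'n minkowski) \<Rightarrow> 'n \<Rightarrow> 'n \<Rightarrow> 'n \<Rightarrow> real^'n \<Rightarrow> real" where
  "christoffel \<phi> k i j u = (\<Sum>l\<in>(UNIV::'n::finite set).
     matrix_inv (metric \<phi> u) $ k $ l *
       (partial i (\<lambda>w. metric \<phi> w $ j $ l) u
        + partial j (\<lambda>w. metric \<phi> w $ i $ l) u
        - partial l (\<lambda>w. metric \<phi> w $ i $ j) u)) / 2"

text \<open>
  $h(\partial_i,\partial_j) = \nabla_{\partial_i}\partial_j - \bar\nabla_{\partial_i}\partial_j$;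
  the ambient connection is flat, so the last term is the second partial derivative of the
  parametrization.
\<close>

definition second_fundamental_form ::
  "(real^'n \<Rightarrow> 'n minkowski) \<Rightarrow> 'n \<Rightarrow> 'n \<Rightarrow> real^'n \<Rightarrow> 'n::finite minkowski" where
  "second_fundamental_form \<phi> i j u =
     (\<Sum>k\<in>UNIV. christoffel \<phi> k i j u *\<^sub>R partial k \<phi> u) - partial i (partial j \<phi>) u"

definition chart_mean_curvature ::
  "(real^'n \<Rightarrow> 'n minkowski) \<Rightarrow> real^'n \<Rightarrow> 'n::finite minkowski" where
  "chart_mean_curvature \<phi> u =
     (\<Sum>i\<in>UNIV. \<Sum>j\<in>UNIV. matrix_inv (metric \<phi> u) $ i $ j *\<^sub>R second_fundamental_form \<phi> i j u)"

text \<open>The value does not depend on the parametrization around \<open>p\<close>.\<close>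

definition mean_curvature :: "'n::finite minkowski set \<Rightarrow> 'n minkowski \<Rightarrow> 'n minkowski" where
  "mean_curvature S p = (SOME H. \<exists>c\<in>charts S. \<exists>u\<in>half_region c.
     par c u = p \<and> H = chart_mean_curvature (par c) u)"


section \<open>Integration over the hypersurface and its boundary\<close>

text \<open>
  A compact hypersurface has a finite atlas. It is cut into disjoint Borel pieces, each lying in
  one patch, and the integral is the sum over the pieces of the integrals in coordinates against
  the Riemannian density; the result does not depend on the atlas. \<open>piece cs m\<close> is the
  coordinate domain of the part of the \<open>m\<close>-th patch not covered by earlier ones.
\<close>

definition finite_atlas :: "'n::finite minkowski set \<Rightarrow> 'n chart list" where
  "finite_atlas S = (SOME cs. set cs \<subseteq> charts S \<and> S \<subseteq> (\<Union>c\<in>set cs. patch c))"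

definition piece :: "'n::finite chart list \<Rightarrow> nat \<Rightarrow> (real^'n) set" where
  "piece cs m = {u \<in> half_region (cs ! m). \<forall>j<m. par (cs ! m) u \<notin> patch (cs ! j)}"

definition surface_integral :: "'n::finite minkowski set \<Rightarrow> ('n minkowski \<Rightarrow> real) \<Rightarrow> real" where
  "surface_integral S f =
     (let cs = finite_atlas S in
       \<Sum>m<length cs. LINT u:piece cs m|lborel.
         f (par (cs ! m) u) * sqrt (det (metric (par (cs ! m)) u)))"

text \<open>
  The boundary is parametrized by the faces \<open>u $ k = 0\<close> of the charts, with coordinates
  \<open>y i\<close> for \<open>i \<noteq> k\<close>. Its metric coefficients are the $g_{ij}$ with
  $i,j \neq k$; the determinant of that submatrix is the determinant of the full-size
  matrix in which row and column \<open>k\<close> are replaced by those of the identity. The pieces can be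
  reused because a boundary point lying in a patch lies in the face of that patch.
\<close>

definition face_point :: "'n \<Rightarrow> ('n \<Rightarrow> real) \<Rightarrow> real^'n::finite" where
  "face_point k y = (\<chi> i. if i = k then 0 else y i)"

definition face_metric :: "'n \<Rightarrow> (real^'n \<Rightarrow> 'n minkowski) \<Rightarrow> real^'n \<Rightarrow> real^'n^'n::finite" where
  "face_metric k \<phi> u = (\<chi> i j. if i = k \<or> j = k then (if i = j then 1 else 0) else metric \<phi> u $ i $ j)"

definition boundary_integral :: "'n::finite minkowski set \<Rightarrow> ('n minkowski \<Rightarrow> real) \<Rightarrow> real" where
  "boundary_integral S f =
     (let cs = finite_atlas S in
       \<Sum>m<length cs. let k = face (cs ! m); \<phi> = par (cs ! m) in
         LINT y:{y. face_point k y \<in> piece cs m}|PiM (UNIV - {k}) (\<lambda>_. lborel).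
           f (\<phi> (face_point k y)) * sqrt (det (face_metric k \<phi> (face_point k y))))"


definition sobolev_constant :: "'n::finite itself \<Rightarrow> real \<Rightarrow> real" where
  "sobolev_constant _ \<tau> =
     (let n = real CARD('n); \<omega> = measure lborel (ball (0::real^'n) 1) in
       1 / 2 * n * \<omega> powr (1 / n) * (n + 1) powr (- 1 / n) * \<tau> powr (- 1 / n)
         * inverse (\<tau> + sqrt (\<tau>\<^sup>2 - 1)))"

end

theory Submission
  imports Defs
begin

text \<open>
  Projecting along the time axis reduces the inequality to one in flat space. The tangent space of
  a spacelike hypersurface at \<open>y\<close> is the graph over space of a linear form with vector \<open>slope y\<close> of
  norm less than $1$. So the projection \<open>snd\<close> is a local diffeomorphism in the interior; the induced
  volume element is the projected one times \<open>sqrt (1 - slope y \<bullet> slope y)\<close>, a factor between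
  \<open>1 / max_slope S\<close> and $1$ (\<open>max_slope_bound\<close>); similar bounds hold on the boundary
  (\<open>det_face_metric\<close>); and the metric gradient is at least as long as the Euclidean gradient in the
  spatial coordinates (\<open>gradient_ge\<close>). The mean curvature vector is timelike, so its term is
  non-negative and is dropped (\<open>integrand_ge\<close>). What remains is a Sobolev inequality for
  a function on a compact flat domain spread in sheets over space, with its boundary values.

  That inequality follows the proof of Gagliardo and Nirenberg, sheet by sheet. From each point of
  the fibre over \<open>x\<close> a line through \<open>x\<close> is lifted in both directions until it reaches the boundary
  (\<open>lift_exists\<close>). Along each half, \<open>f\<close> is at most its final boundary value plus the integral of its
  directional derivative. Different lifts stay apart, so twice the fibre sum of \<open>f\<close> at \<open>x\<close> is
  bounded by quantities on the whole line, which do not depend on the position of \<open>x\<close> in it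
  (\<open>line_inequality\<close>). With one such bound for each coordinate axis, the Loomis--Whitney inequality
  bounds the $L^{n/(n-1)}$ norm of the fibre sum by a geometric mean of directional variations
  (\<open>gagliardo_nirenberg\<close>), which area formulas turn into integrals in the charts (\<open>interior_area\<close>,
  \<open>boundary_area\<close>).

  The arithmetic-geometric mean inequality replaces the geometric mean by the $\ell^1$ norm of the
  gradient. In a single frame this would cost a factor $\sqrt n$ against the Euclidean norm, which is
  too much for the constant when $n$ is large. Averaging with a second frame, in which pairs of axes
  are turned by 45 degrees, lowers it to $\kappa = \sqrt{0.86\,n + 0.14}$ (\<open>balanced_frame\<close>). The result is
  $(\int f^{n/(n-1)})^{(n-1)/n} \le \frac{\kappa\tau}{2n} (\ldots)$, and the theorem
  follows from $C_{n,\tau}\,\kappa\tau \le 2n$, which amounts to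
  $\omega_n \kappa^n \le 4^n (n+1)$ (\<open>unit_ball_vol_bound\<close>).
\<close>

section \<open>Powers of extended reals and the Loomis--Whitney inequality\<close>

text \<open>
  Real powers on \<^typ>\<open>ennreal\<close>. The value \<open>top\<close> at \<open>top\<close> is right for positive exponents,
  and those are the only ones at which the inequalities below use it.
\<close>

definition epow :: "ennreal \<Rightarrow> real \<Rightarrow> ennreal" where
  "epow x w = (if x = top then top else ennreal (enn2real x powr w))"

lemma epow_ennreal: "0 \<le> r \<Longrightarrow> epow (ennreal r) w = ennreal (r powr w)"
  by (simp add: epow_def)

lemma epow_top [simp]: "epow top w = top"
  by (simp add: epow_def)

lemma epow_0 [simp]: "epow 0 w = 0"
  by (simp add: epow_def)

lemma epow_one [simp]: "epow 1 w = 1"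
  by (simp add: epow_def)

lemma epow_exponent_one [simp]: "epow x 1 = x"
  by (cases x) (auto simp: epow_def)

lemma epow_eq_0_iff: "epow x w = 0 \<longleftrightarrow> x = 0"
  by (cases x) (auto simp: epow_def ennreal_eq_0_iff)

lemma epow_mult: "epow (x * y) w = epow x w * epow y w"
proof (cases x)
  case (real r)
  show ?thesis
  proof (cases y)
    case (real s)
    with \<open>x = ennreal r\<close> \<open>0 \<le> r\<close> show ?thesis
      by (simp add: epow_ennreal ennreal_mult[symmetric] powr_mult del: ennreal_mult)
  next
    case top
    then show ?thesis
      by (cases "x = 0") (auto simp: epow_eq_0_iff ennreal_mult_top ennreal_top_mult)
  qed
next
  case top
  then show ?thesis
    by (cases "y = 0") (auto simp: epow_eq_0_iff ennreal_mult_top ennreal_top_mult)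
qed

lemma epow_prod: "epow (\<Prod>i\<in>I. x i) w = (\<Prod>i\<in>I. epow (x i) w)"
  by (induction I rule: infinite_finite_induct) (auto simp: epow_mult)

lemma epow_epow: "epow (epow x a) b = epow x (a * b)"
  by (cases x) (auto simp: epow_ennreal powr_powr)

lemma epow_mono: "x \<le> y \<Longrightarrow> 0 < w \<Longrightarrow> epow x w \<le> epow y w"
  by (cases x; cases y) (auto simp: epow_ennreal powr_mono2 top_unique)

lemma measurable_epow [measurable]:
  assumes [measurable]: "u \<in> borel_measurable M"
  shows "(\<lambda>x. epow (u x) w) \<in> borel_measurable M"
  unfolding epow_def by measurable

lemma weighted_arith_geom_mean:
  fixes x w :: "'a \<Rightarrow> real"
  assumes I: "finite I" "I \<noteq> {}" and w: "\<And>i. i \<in> I \<Longrightarrow> 0 < w i" "sum w I = 1"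
    and x: "\<And>i. i \<in> I \<Longrightarrow> 0 \<le> x i"
  shows "(\<Prod>i\<in>I. x i powr w i) \<le> (\<Sum>i\<in>I. w i * x i)"
proof (cases "\<exists>i\<in>I. x i = 0")
  case True
  then have "(\<Prod>i\<in>I. x i powr w i) = 0"
    using I by (auto simp: prod_zero_iff)
  also have "0 \<le> (\<Sum>i\<in>I. w i * x i)"
    using w x by (intro sum_nonneg mult_nonneg_nonneg) (auto intro: less_imp_le)
  finally show ?thesis .
next
  case False
  then have pos: "0 < x i" if "i \<in> I" for i
    using x that by (metis less_eq_real_def)
  have "exp (\<Sum>i\<in>I. w i *\<^sub>R ln (x i)) \<le> (\<Sum>i\<in>I. w i * exp (ln (x i)))"
    using I w by (intro convex_on_sum[OF _ _ exp_convex]) (auto intro: less_imp_le)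
  moreover have "exp (\<Sum>i\<in>I. w i *\<^sub>R ln (x i)) = (\<Prod>i\<in>I. x i powr w i)"
    unfolding exp_sum[OF I(1)] using pos by (intro prod.cong) (fastforce simp: powr_def)+
  ultimately show ?thesis
    using pos by simp
qed

text \<open>
  After normalising each factor to integral $1$ this is the weighted arithmetic-geometric mean
  inequality under the integral sign; the degenerate cases are a factor of integral $0$, which
  vanishes almost everywhere, and one of integral \<open>top\<close>.
\<close>

lemma nn_integral_holder:
  fixes u :: "'i \<Rightarrow> 'a \<Rightarrow> ennreal"
  assumes I: "finite I" "I \<noteq> {}" and w: "\<And>i. i \<in> I \<Longrightarrow> 0 < w i" "sum w I = 1"
    and u[measurable]: "\<And>i. i \<in> I \<Longrightarrow> u i \<in> borel_measurable M"
  shows "(\<integral>\<^sup>+x. (\<Prod>i\<in>I. epow (u i x) (w i)) \<partial>M) \<le> (\<Prod>i\<in>I. epow (\<integral>\<^sup>+x. u i x \<partial>M) (w i))"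
proof -
  define A where "A i = (\<integral>\<^sup>+x. u i x \<partial>M)" for i
  consider (zero) "\<exists>i\<in>I. A i = 0" | (top) "\<forall>i\<in>I. A i \<noteq> 0" "\<exists>i\<in>I. A i = top"
    | (fin) "\<forall>i\<in>I. A i \<noteq> 0 \<and> A i \<noteq> top"
    by blast
  then show ?thesis
  proof cases
    case zero
    then obtain i where i: "i \<in> I" "A i = 0" by blast
    then have "AE x in M. u i x = 0"
      by (simp add: A_def nn_integral_0_iff_AE)
    then have "AE x in M. (\<Prod>i\<in>I. epow (u i x) (w i)) = 0"
      by eventually_elim (use I i in \<open>auto simp: prod_zero_iff intro!: bexI[of _ i]\<close>)
    then have "(\<integral>\<^sup>+x. (\<Prod>i\<in>I. epow (u i x) (w i)) \<partial>M) = (\<integral>\<^sup>+x. 0 \<partial>M)"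
      by (rule nn_integral_cong_AE)
    then show ?thesis by simp
  next
    case top
    then obtain i where i: "i \<in> I" "A i = top" by blast
    have "(\<Prod>i\<in>I. epow (A i) (w i)) = epow (A i) (w i) * (\<Prod>i\<in>I - {i}. epow (A i) (w i))"
      using I i by (simp add: prod.remove)
    also have "\<dots> = top"
      using I i top by (simp add: ennreal_top_mult prod_zero_iff epow_eq_0_iff)
    finally show ?thesis by (simp add: A_def)
  next
    case fin
    define a where "a i = enn2real (A i)" for i
    have a: "0 < a i" "A i = ennreal (a i)" if "i \<in> I" for i
      using fin that by (auto simp: a_def enn2real_positive_iff less_top[symmetric] zero_less_iff_neq_zero)
    define P where "P = (\<Prod>i\<in>I. a i powr w i)"
    have P: "0 \<le> P" by (auto simp: P_def intro!: prod_nonneg)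
    have fi: "AE x in M. \<forall>i\<in>I. u i x \<noteq> top"
      unfolding AE_finite_all[OF I(1)]
    proof
      fix i assume "i \<in> I"
      then show "AE x in M. u i x \<noteq> top"
        using nn_integral_noteq_infinite[of "u i" M] fin by (auto simp: A_def)
    qed
    have "AE x in M. (\<Prod>i\<in>I. epow (u i x) (w i)) \<le> ennreal P * (\<Sum>i\<in>I. ennreal (w i / a i) * u i x)"
      using fi
    proof eventually_elim
      case (elim x)
      define r where "r i = enn2real (u i x)" for i
      have r: "u i x = ennreal (r i)" "0 \<le> r i" if "i \<in> I" for i
        using elim that by (auto simp: r_def less_top)
      have "(\<Prod>i\<in>I. r i powr w i) = P * (\<Prod>i\<in>I. (r i / a i) powr w i)"
        unfolding P_def prod.distrib[symmetric] using a r
        by (intro prod.cong) (auto simp: powr_mult[symmetric] less_imp_le less_imp_neq[symmetric])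
      also have "\<dots> \<le> P * (\<Sum>i\<in>I. w i * (r i / a i))"
        using I w a r P by (intro mult_left_mono weighted_arith_geom_mean) (auto simp: less_imp_le)
      finally have "(\<Prod>i\<in>I. r i powr w i) \<le> P * (\<Sum>i\<in>I. w i * (r i / a i))" .
      moreover have "(\<Prod>i\<in>I. epow (u i x) (w i)) = ennreal (\<Prod>i\<in>I. r i powr w i)"
        using r by (subst prod_ennreal[symmetric]) (auto simp: epow_ennreal intro!: prod.cong)
      moreover have "(\<Sum>i\<in>I. ennreal (w i / a i) * u i x) = ennreal (\<Sum>i\<in>I. w i * (r i / a i))"
        using r w a
        by (subst sum_ennreal[symmetric]) (auto simp: ennreal_mult[symmetric] less_imp_le intro!: sum.cong)
      ultimately show ?case
        using P by (simp add: ennreal_mult'[symmetric] ennreal_leI del: ennreal_mult')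
    qed
    then have "(\<integral>\<^sup>+x. (\<Prod>i\<in>I. epow (u i x) (w i)) \<partial>M)
      \<le> (\<integral>\<^sup>+x. ennreal P * (\<Sum>i\<in>I. ennreal (w i / a i) * u i x) \<partial>M)"
      by (rule nn_integral_mono_AE)
    also have "\<dots> = ennreal P * (\<Sum>i\<in>I. ennreal (w i / a i) * A i)"
      by (simp add: nn_integral_cmult nn_integral_sum A_def)
    also have "(\<Sum>i\<in>I. ennreal (w i / a i) * A i) = (\<Sum>i\<in>I. ennreal (w i))"
      using a w by (intro sum.cong refl) (fastforce simp: ennreal_mult[symmetric] less_imp_le)+
    also have "\<dots> = 1"
      using w by (simp add: sum_ennreal less_imp_le)
    also have "ennreal P * 1 = (\<Prod>i\<in>I. epow (A i) (w i))"
      using a unfolding P_def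
      by (simp add: prod_ennreal[symmetric] epow_ennreal less_imp_le)
    finally show ?thesis by (simp add: A_def)
  qed
qed

text \<open>
  Induction on the set of coordinates; two coordinates are Tonelli. For a fixed value of one coordinate,
  Hoelder separates the factor that does not depend on it from the others, to which the induction
  hypothesis applies, and a second use of Hoelder integrates over that value.
\<close>

lemma loomis_whitney_PiM:
  fixes g :: "'i \<Rightarrow> ('i \<Rightarrow> real) \<Rightarrow> ennreal"
  assumes I: "finite I" "2 \<le> card I"
    and g: "\<And>i. i \<in> I \<Longrightarrow> g i \<in> borel_measurable (PiM (I - {i}) (\<lambda>_. lborel))"
  shows "(\<integral>\<^sup>+x. (\<Prod>i\<in>I. epow (g i (restrict x (I - {i}))) (1 / (real (card I) - 1)))
            \<partial>PiM I (\<lambda>_. lborel))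
       \<le> (\<Prod>i\<in>I. epow (\<integral>\<^sup>+x. g i x \<partial>PiM (I - {i}) (\<lambda>_. lborel)) (1 / (real (card I) - 1)))"
  using I g
proof (induction "card I" arbitrary: I g rule: less_induct)
  case (less I)
  interpret product_sigma_finite "\<lambda>_::'i. lborel :: real measure" ..
  note [measurable] = less.prems(3)
  obtain a where a: "a \<in> I" using less.prems by fastforce
  define J where "J = I - {a}"
  have J: "finite J" "a \<notin> J" "I = insert a J" "card I = Suc (card J)"
    using less.prems a card_Suc_Diff1[of I a] by (auto simp: J_def)
  show ?case
  proof (cases "card J = 1")
    case True
    then obtain b where b: "J = {b}" by (auto simp: card_1_singleton_iff)
    have ab: "a \<noteq> b" "I = {a, b}" "I - {a} = {b}" "I - {b} = {a}"
      using J b by auto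
    have ga: "g a \<in> borel_measurable (PiM {b} (\<lambda>_. lborel))"
      and gb: "g b \<in> borel_measurable (PiM {a} (\<lambda>_. lborel))"
      using less.prems(3)[of a] less.prems(3)[of b] ab by auto
    have r: "restrict x {b} \<in> {b} \<rightarrow>\<^sub>E UNIV" for x :: "'i \<Rightarrow> real" by auto
    have [measurable]: "(\<lambda>x. g a (restrict x {b}) * g b (restrict x {a}))
        \<in> borel_measurable (PiM (insert a {b}) (\<lambda>_. lborel))"
      using ga gb by (intro borel_measurable_times_ennreal measurable_compose[OF measurable_restrict_subset]) auto
    have "(\<integral>\<^sup>+x. g a (restrict x {b}) * g b (restrict x {a}) \<partial>PiM (insert a {b}) (\<lambda>_. lborel))
      = (\<integral>\<^sup>+x. (\<integral>\<^sup>+y. g a (restrict (x(a:=y)) {b}) * g b (restrict (x(a:=y)) {a}) \<partial>lborel)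
          \<partial>PiM {b} (\<lambda>_. lborel))"
      using ab by (subst product_nn_integral_insert) auto
    also have "\<dots> = (\<integral>\<^sup>+x. (\<integral>\<^sup>+y. g a x * g b (\<lambda>i\<in>{a}. y) \<partial>lborel) \<partial>PiM {b} (\<lambda>_. lborel))"
    proof (intro nn_integral_cong)
      fix x :: "'i \<Rightarrow> real" and y :: real assume "x \<in> space (PiM {b} (\<lambda>_. lborel))"
      then have "restrict (x(a:=y)) {b} = x"
        using ab by (auto simp: space_PiM PiE_def extensional_def restrict_def fun_eq_iff)
      moreover have "restrict (x(a:=y)) {a} = (\<lambda>i\<in>{a}. y)"
        by (auto simp: restrict_def fun_eq_iff)
      ultimately show "g a (restrict (x(a:=y)) {b}) * g b (restrict (x(a:=y)) {a}) = g a x * g b (\<lambda>i\<in>{a}. y)"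
        by simp
    qed
    also have "\<dots> = (\<integral>\<^sup>+x. g a x \<partial>PiM {b} (\<lambda>_. lborel)) * (\<integral>\<^sup>+y. g b (\<lambda>i\<in>{a}. y) \<partial>lborel)"
    proof -
      have [measurable]: "(\<lambda>y. g b (\<lambda>i\<in>{a}. y)) \<in> borel_measurable lborel"
        by (rule measurable_compose[OF _ gb]) (auto intro!: measurable_restrict)
      show ?thesis using ga by (simp add: nn_integral_cmult nn_integral_multc)
    qed
    also have "(\<integral>\<^sup>+y. g b (\<lambda>i\<in>{a}. y) \<partial>lborel) = (\<integral>\<^sup>+x. g b x \<partial>PiM {a} (\<lambda>_. lborel))"
    proof -
      have "(\<integral>\<^sup>+x. g b x \<partial>PiM {a} (\<lambda>_. lborel)) = (\<integral>\<^sup>+x. g b (\<lambda>i\<in>{a}. x a) \<partial>PiM {a} (\<lambda>_. lborel))"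
        by (intro nn_integral_cong arg_cong[of _ _ "g b"])
          (auto simp: space_PiM PiE_def extensional_def restrict_def fun_eq_iff)
      also have "\<dots> = (\<integral>\<^sup>+y. g b (\<lambda>i\<in>{a}. y) \<partial>lborel)"
        by (rule product_nn_integral_singleton)
          (rule measurable_compose[OF _ gb], auto intro!: measurable_restrict)
      finally show ?thesis by simp
    qed
    finally have E: "(\<integral>\<^sup>+x. g a (restrict x {b}) * g b (restrict x {a}) \<partial>PiM (insert a {b}) (\<lambda>_. lborel))
      = (\<integral>\<^sup>+x. g a x \<partial>PiM {b} (\<lambda>_. lborel)) * (\<integral>\<^sup>+x. g b x \<partial>PiM {a} (\<lambda>_. lborel))" .
    have c: "1 / (real (card I) - 1) = 1" using ab by simp
    have p: "(\<Prod>i\<in>I. h i) = h a * h b" for h :: "'i \<Rightarrow> ennreal"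
      using ab by simp
    show ?thesis
      unfolding c p epow_exponent_one ab(3,4) using E ab(2) by (metis order_refl)
  next
    case False
    then have cJ: "2 \<le> card J" using less.prems J by auto
    define m where "m = real (card J)"
    have m: "2 \<le> m" "real (card I) - 1 = m" using cJ J by (auto simp: m_def)
    define G where "G i y = (\<integral>\<^sup>+x. g i (x(a:=y)) \<partial>PiM (J - {i}) (\<lambda>_. lborel))" for i y
    have Ia: "I - {a} = J" using J by auto
    have Ii: "I - {i} = insert a (J - {i})" if "i \<in> J" for i using J that by auto
    have mga: "g a \<in> borel_measurable (PiM J (\<lambda>_. lborel))"
      using less.prems(3)[of a] a Ia by simp
    have mgi: "g i \<in> borel_measurable (PiM (insert a (J - {i})) (\<lambda>_. lborel))" if "i \<in> J" for i
      using less.prems(3)[of i] J that Ii by auto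
    have mg2: "(\<lambda>(x, y). g i (x(a:=y))) \<in> borel_measurable (PiM (J - {i}) (\<lambda>_. lborel) \<Otimes>\<^sub>M lborel)"
      if "i \<in> J" for i
      using measurable_compose[OF measurable_add_dim[of a "J - {i}" "\<lambda>_. lborel"] mgi[OF that]]
      by (simp add: split_def)
    have mg3: "(\<lambda>x. g i (x(a:=y))) \<in> borel_measurable (PiM (J - {i}) (\<lambda>_. lborel))" if "i \<in> J" for i y
      using measurable_compose[OF measurable_Pair2' mg2[OF that], of y] by (simp add: measurable_split_conv)
    have mG [measurable]: "G i \<in> borel_measurable lborel" if "i \<in> J" for i
    proof -
      interpret s: sigma_finite_measure "PiM (J - {i}) (\<lambda>_. lborel :: real measure)"
        using J by (intro sigma_finite) auto
      have "(\<lambda>(y, x). g i (x(a:=y))) \<in> borel_measurable (lborel \<Otimes>\<^sub>M PiM (J - {i}) (\<lambda>_. lborel))"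
        using measurable_compose[OF measurable_pair_swap' mg2[OF that]] by (simp add: split_def)
      then show ?thesis unfolding G_def by (rule s.borel_measurable_nn_integral)
    qed
    have mres: "(\<lambda>x. g i ((restrict x (J - {i}))(a := y))) \<in> borel_measurable (PiM J (\<lambda>_. lborel))"
      if "i \<in> J" for i y
      using measurable_compose[OF measurable_restrict_subset mg3[OF that], of J] by auto
    have mres2: "(\<lambda>x. \<Prod>i\<in>I. epow (g i (restrict x (I - {i}))) (1 / (real (card I) - 1)))
        \<in> borel_measurable (PiM (insert a J) (\<lambda>_. lborel))"
      unfolding J(3)[symmetric]
      by (intro borel_measurable_prod_ennreal measurable_epow measurable_compose[OF measurable_restrict_subset less.prems(3)]) auto
    have "(\<integral>\<^sup>+x. (\<Prod>i\<in>I. epow (g i (restrict x (I - {i}))) (1 / (real (card I) - 1)))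
            \<partial>PiM I (\<lambda>_. lborel))
      = (\<integral>\<^sup>+y. (\<integral>\<^sup>+x. (\<Prod>i\<in>I. epow (g i (restrict (x(a:=y)) (I - {i}))) (1 / m))
            \<partial>PiM J (\<lambda>_. lborel)) \<partial>lborel)"
      using product_nn_integral_insert_rev[OF J(1,2) mres2] J(3) m by simp
    also have "\<dots> = (\<integral>\<^sup>+y. (\<integral>\<^sup>+x. epow (g a x) (1/m) *
          (\<Prod>i\<in>J. epow (g i ((restrict x (J - {i}))(a:=y))) (1 / m)) \<partial>PiM J (\<lambda>_. lborel)) \<partial>lborel)"
    proof (intro nn_integral_cong)
      fix x :: "'i \<Rightarrow> real" and y :: real assume x: "x \<in> space (PiM J (\<lambda>_. lborel))"
      have "restrict (x(a:=y)) (I - {a}) = x"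
        using x J by (auto simp: space_PiM PiE_def extensional_def restrict_def fun_eq_iff)
      moreover have "restrict (x(a:=y)) (I - {i}) = (restrict x (J - {i}))(a := y)" if "i \<in> J" for i
        using that J by (auto simp: restrict_def fun_eq_iff)
      ultimately show "(\<Prod>i\<in>I. epow (g i (restrict (x(a:=y)) (I - {i}))) (1 / m)) =
         epow (g a x) (1/m) * (\<Prod>i\<in>J. epow (g i ((restrict x (J - {i}))(a:=y))) (1 / m))"
        unfolding J(3) using J(1,2) by (subst prod.insert) (auto intro!: arg_cong2[of _ _ _ _ "(*)"] prod.cong)
    qed
    also have "\<dots> \<le> (\<integral>\<^sup>+y. epow (\<integral>\<^sup>+x. g a x \<partial>PiM J (\<lambda>_. lborel)) (1/m) * (\<Prod>i\<in>J. epow (G i y) (1/m)) \<partial>lborel)"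
    proof (intro nn_integral_mono)
      fix y :: real
      define v where "v x = (\<Prod>i\<in>J. epow (g i ((restrict x (J - {i}))(a:=y))) (1 / (m - 1)))" for x
      have mv: "v \<in> borel_measurable (PiM J (\<lambda>_. lborel))"
        unfolding v_def using mres by (intro borel_measurable_prod_ennreal measurable_epow) auto
      have vw: "(\<Prod>i\<in>J. epow (g i ((restrict x (J - {i}))(a:=y))) (1 / m)) = epow (v x) ((m - 1) / m)" for x
        unfolding v_def using m by (simp add: epow_prod epow_epow)
      have "(\<integral>\<^sup>+x. epow (g a x) (1/m) *
          (\<Prod>i\<in>J. epow (g i ((restrict x (J - {i}))(a:=y))) (1 / m)) \<partial>PiM J (\<lambda>_. lborel))
        = (\<integral>\<^sup>+x. (\<Prod>i\<in>{True, False}. epow ((if i then g a x else v x)) (if i then 1/m else (m-1)/m)) \<partial>PiM J (\<lambda>_. lborel))"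
        unfolding vw by (simp add: ac_simps)
      also have "\<dots> \<le> (\<Prod>i\<in>{True, False}. epow (\<integral>\<^sup>+x. (if i then g a x else v x) \<partial>PiM J (\<lambda>_. lborel)) (if i then 1/m else (m-1)/m))"
      proof (rule nn_integral_holder)
        show "(\<lambda>x. if i then g a x else v x) \<in> borel_measurable (Pi\<^sub>M J (\<lambda>_. lborel))" for i
          by (cases i) (auto simp: mga mv)
      qed (use m in \<open>auto simp: field_simps\<close>)
      also have "\<dots> = epow (\<integral>\<^sup>+x. g a x \<partial>PiM J (\<lambda>_. lborel)) (1/m) * epow (\<integral>\<^sup>+x. v x \<partial>PiM J (\<lambda>_. lborel)) ((m-1)/m)"
        by (simp add: ac_simps)
      also have "\<dots> \<le> epow (\<integral>\<^sup>+x. g a x \<partial>PiM J (\<lambda>_. lborel)) (1/m) * (\<Prod>i\<in>J. epow (G i y) (1/m))"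
      proof (rule mult_left_mono)
        have "(\<integral>\<^sup>+x. (\<Prod>i\<in>J. epow ((\<lambda>i x. g i (x(a:=y))) i (restrict x (J - {i}))) (1 / (real (card J) - 1)))
            \<partial>PiM J (\<lambda>_. lborel))
          \<le> (\<Prod>i\<in>J. epow (\<integral>\<^sup>+x. g i (x(a:=y)) \<partial>PiM (J - {i}) (\<lambda>_. lborel)) (1 / (real (card J) - 1)))"
          using J cJ mg3 by (intro less.hyps) auto
        then have "(\<integral>\<^sup>+x. v x \<partial>PiM J (\<lambda>_. lborel)) \<le> (\<Prod>i\<in>J. epow (G i y) (1 / (m - 1)))"
          by (simp only: v_def G_def m_def)
        then have "epow (\<integral>\<^sup>+x. v x \<partial>PiM J (\<lambda>_. lborel)) ((m-1)/m) \<le>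
            epow (\<Prod>i\<in>J. epow (G i y) (1 / (m - 1))) ((m-1)/m)"
          using m by (intro epow_mono) auto
        also have "\<dots> = (\<Prod>i\<in>J. epow (G i y) (1/m))"
          using m by (simp add: epow_prod epow_epow)
        finally show "epow (\<integral>\<^sup>+x. v x \<partial>PiM J (\<lambda>_. lborel)) ((m-1)/m) \<le> (\<Prod>i\<in>J. epow (G i y) (1/m))" .
      qed simp
      finally show "(\<integral>\<^sup>+x. epow (g a x) (1/m) *
          (\<Prod>i\<in>J. epow (g i ((restrict x (J - {i}))(a:=y))) (1 / m)) \<partial>PiM J (\<lambda>_. lborel))
        \<le> epow (\<integral>\<^sup>+x. g a x \<partial>PiM J (\<lambda>_. lborel)) (1/m) * (\<Prod>i\<in>J. epow (G i y) (1/m))" .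
    qed
    also have "\<dots> = epow (\<integral>\<^sup>+x. g a x \<partial>PiM J (\<lambda>_. lborel)) (1/m) * (\<integral>\<^sup>+y. (\<Prod>i\<in>J. epow (G i y) (1/m)) \<partial>lborel)"
      using mG by (intro nn_integral_cmult) measurable
    also have "\<dots> \<le> epow (\<integral>\<^sup>+x. g a x \<partial>PiM J (\<lambda>_. lborel)) (1/m) * (\<Prod>i\<in>J. epow (\<integral>\<^sup>+y. G i y \<partial>lborel) (1/m))"
      using J cJ m by (intro mult_left_mono nn_integral_holder) (auto simp: m_def mG)
    also have "(\<Prod>i\<in>J. epow (\<integral>\<^sup>+y. G i y \<partial>lborel) (1/m)) =
        (\<Prod>i\<in>J. epow (\<integral>\<^sup>+x. g i x \<partial>PiM (I - {i}) (\<lambda>_. lborel)) (1/m))"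
    proof (intro prod.cong refl)
      fix i assume i: "i \<in> J"
      show "epow (\<integral>\<^sup>+y. G i y \<partial>lborel) (1/m) = epow (\<integral>\<^sup>+x. g i x \<partial>PiM (I - {i}) (\<lambda>_. lborel)) (1/m)"
        unfolding Ii[OF i] G_def using J product_nn_integral_insert_rev[OF _ _ mgi[OF i]] by auto
    qed
    finally have fin: "(\<integral>\<^sup>+x. (\<Prod>i\<in>I. epow (g i (restrict x (I - {i}))) (1 / (real (card I) - 1)))
            \<partial>PiM I (\<lambda>_. lborel)) \<le> epow (\<integral>\<^sup>+x. g a x \<partial>PiM J (\<lambda>_. lborel)) (1/m) *
        (\<Prod>i\<in>J. epow (\<integral>\<^sup>+x. g i x \<partial>PiM (I - {i}) (\<lambda>_. lborel)) (1/m))" .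
    have p: "(\<Prod>i\<in>I. h i) = h a * (\<Prod>i\<in>J. h i)" for h :: "'i \<Rightarrow> ennreal"
      unfolding J(3) using J by simp
    show ?thesis
      by (rule order_trans[OF fin]) (simp only: p m(2) Ia order_refl)
  qed
qed

section \<open>Coordinate lines and the Gagliardo--Nirenberg inequality\<close>

definition upd :: "real^'n \<Rightarrow> 'n \<Rightarrow> real \<Rightarrow> real^'n::finite" where
  "upd x i t = (\<chi> j. if j = i then t else x $ j)"

lemma upd_nth [simp]: "upd x i t $ j = (if j = i then t else x $ j)"
  by (simp add: upd_def)

lemma upd_upd [simp]: "upd (upd x i s) i t = upd x i t"
  by (simp add: vec_eq_iff)

lemma upd_self [simp]: "upd x i (x $ i) = x"
  by (simp add: vec_eq_iff)

lemma measurable_vec_lambda [measurable]: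
  assumes [measurable]: "\<And>i. (\<lambda>x. f x i) \<in> borel_measurable M"
  shows "(\<lambda>x. (\<chi> i. f x i) :: real^'n::finite) \<in> borel_measurable M"
proof -
  have "(\<lambda>x. (\<chi> i. f x i) \<bullet> b) \<in> borel_measurable M" if "b \<in> Basis" for b :: "real^'n"
    using that by (auto simp: Basis_vec_def inner_axis)
  then show ?thesis by (subst borel_measurable_euclidean_space) auto
qed

lemma measurable_vec_nth [measurable]: "(\<lambda>x::real^'n. x $ i) \<in> borel_measurable borel"
  by (intro borel_measurable_continuous_onI continuous_intros)

lemma measurable_upd [measurable]:
  assumes [measurable]: "f \<in> borel_measurable M" "t \<in> borel_measurable M"
  shows "(\<lambda>x. upd (f x) i (t x)) \<in> borel_measurable M"
proof -
  have "(\<lambda>x. f x $ j) \<in> borel_measurable M" for j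
    by (rule measurable_compose[OF assms(1) measurable_vec_nth])
  then show ?thesis unfolding upd_def by measurable
qed

lemma lborel_vec_eq_PiM:
  "(lborel :: (real^'n) measure) = distr (PiM UNIV (\<lambda>_. lborel)) borel (\<lambda>f. \<chi> i. f i)"
proof (rule lborel_eqI)
  interpret product_sigma_finite "\<lambda>_::'n. lborel :: real measure" ..
  fix l u :: "real^'n" assume lu: "\<And>b. b \<in> Basis \<Longrightarrow> l \<bullet> b \<le> u \<bullet> b"
  have le: "l $ i \<le> u $ i" for i
    using lu[of "axis i 1"] by (simp add: inner_axis axis_in_Basis_iff)
  have "emeasure (distr (PiM UNIV (\<lambda>_. lborel)) borel (\<lambda>f. \<chi> i::'n. f i)) (box l u)
    = emeasure (PiM UNIV (\<lambda>_. lborel)) (PiE UNIV (\<lambda>i. {l $ i <..< u $ i}))"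
    by (subst emeasure_distr) (auto simp: space_PiM mem_box_cart PiE_UNIV_domain Pi_iff intro!: arg_cong2[of _ _ _ _ emeasure])
  also have "\<dots> = (\<Prod>i\<in>UNIV. ennreal (u $ i - l $ i))"
    using le by (subst emeasure_PiM) auto
  also have "\<dots> = (\<Prod>b\<in>Basis. (u - l) \<bullet> b)"
  proof -
    have "(\<Prod>b\<in>Basis. (u - l) \<bullet> b) = (\<Prod>i\<in>UNIV. (u - l) \<bullet> axis i (1::real))"
      unfolding Basis_vec_def
      by (subst prod.reindex_bij_betw[symmetric, of "\<lambda>i. axis i 1" UNIV])
        (auto simp: bij_betw_def inj_on_def axis_eq_axis)
    then show ?thesis
      using le by (simp add: inner_axis prod_ennreal)
  qed
  finally show "emeasure (distr (PiM UNIV (\<lambda>_. lborel)) borel (\<lambda>f. \<chi> i. f i)) (box l u)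
      = (\<Prod>b\<in>Basis. (u - l) \<bullet> b)" .
qed simp

lemma nn_integral_lborel_vec:
  fixes F :: "real^'n \<Rightarrow> ennreal"
  assumes [measurable]: "F \<in> borel_measurable borel"
  shows "(\<integral>\<^sup>+x. F x \<partial>lborel) = (\<integral>\<^sup>+f. F (\<chi> i. f i) \<partial>PiM UNIV (\<lambda>_. lborel))"
  by (subst lborel_vec_eq_PiM, subst nn_integral_distr) auto

lemma measurable_insert_coordinate:
  "(\<lambda>(f, t). \<chi> j. if j = i then t else f j)
      \<in> borel_measurable (PiM (UNIV - {i::'n::finite}) (\<lambda>_. lborel :: real measure) \<Otimes>\<^sub>M (lborel::real measure))"
proof -
  have "(\<lambda>(f, t). if j = i then t else f j)
      \<in> borel_measurable (PiM (UNIV - {i}) (\<lambda>_. lborel :: real measure) \<Otimes>\<^sub>M (lborel::real measure))" for j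
    by (cases "j = i") (auto simp: split_def)
  then show ?thesis
    unfolding split_def by (intro measurable_vec_lambda) auto
qed

lemma nn_integral_lborel_vec_line:
  fixes F :: "real^'n \<Rightarrow> ennreal"
  assumes F [measurable]: "F \<in> borel_measurable borel"
  shows "(\<integral>\<^sup>+x. F x \<partial>lborel) =
    (\<integral>\<^sup>+f. (\<integral>\<^sup>+t. F (\<chi> j. if j = i then t else f j) \<partial>lborel) \<partial>PiM (UNIV - {i}) (\<lambda>_. lborel))"
proof -
  interpret product_sigma_finite "\<lambda>_::'n. lborel :: real measure" ..
  have UNIV: "UNIV = insert i (UNIV - {i})" by auto
  have "(\<lambda>f. F (\<chi> i. f i)) \<in> borel_measurable (PiM UNIV (\<lambda>_. lborel))"
    by measurable
  then have m: "(\<lambda>f. F (\<chi> i. f i)) \<in> borel_measurable (PiM (insert i (UNIV - {i})) (\<lambda>_. lborel))"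
    by (metis UNIV)
  have "(\<integral>\<^sup>+x. F x \<partial>lborel) = (\<integral>\<^sup>+f. F (\<chi> i. f i) \<partial>PiM (insert i (UNIV - {i})) (\<lambda>_. lborel))"
    using nn_integral_lborel_vec[OF F] UNIV by metis
  also have "\<dots> = (\<integral>\<^sup>+f. (\<integral>\<^sup>+t. F (\<chi> j. (f(i := t)) j) \<partial>lborel) \<partial>PiM (UNIV - {i}) (\<lambda>_. lborel))"
    by (rule product_nn_integral_insert[OF _ _ m]) auto
  finally show ?thesis by (simp add: fun_upd_def)
qed

text \<open>
  Fubini: a null set meets almost every coordinate line in a null set of parameters.
\<close>

lemma AE_line:
  assumes "AE x in lborel. P (x :: real^'n)"
  shows "AE x in lborel. AE t in lborel. P (upd x i t)"
proof -
  obtain N where N: "{x. \<not> P x} \<subseteq> N" "N \<in> null_sets (lborel :: (real^'n) measure)"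
    using assms by (auto simp: eventually_ae_filter)
  then have [measurable]: "N \<in> sets borel" and N0: "emeasure lborel N = 0"
    by (auto simp: null_sets_def)
  define k where "k x = (\<integral>\<^sup>+t. indicator N (upd x i t) \<partial>lborel)" for x :: "real^'n"
  have [measurable]: "k \<in> borel_measurable borel"
    unfolding k_def by measurable
  have u: "upd (\<chi> j. if j = i then s else f j) i t = (\<chi> j. if j = i then t else f j)"
    for s t and f :: "'n \<Rightarrow> real"
    by (simp add: vec_eq_iff)
  have "(\<integral>\<^sup>+f. (\<integral>\<^sup>+t. indicator N (\<chi> j. if j = i then t else f j) \<partial>lborel) \<partial>PiM (UNIV - {i}) (\<lambda>_. lborel))
      = (\<integral>\<^sup>+x. indicator N x \<partial>lborel)"
    by (rule nn_integral_lborel_vec_line[symmetric]) measurable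
  also have "\<dots> = 0" using N0 by simp
  finally have 0: "(\<integral>\<^sup>+f. (\<integral>\<^sup>+t. indicator N (\<chi> j. if j = i then t else f j) \<partial>lborel) \<partial>PiM (UNIV - {i}) (\<lambda>_. lborel)) = 0" .
  have m: "(\<lambda>f. \<integral>\<^sup>+t. indicator N (\<chi> j. if j = i then t else f j) \<partial>lborel)
      \<in> borel_measurable (PiM (UNIV - {i}) (\<lambda>_. lborel :: real measure))"
  proof (rule lborel.borel_measurable_nn_integral)
    show "(\<lambda>(f, t). indicator N (\<chi> j. if j = i then t else f j) :: ennreal)
       \<in> borel_measurable (Pi\<^sub>M (UNIV - {i}) (\<lambda>_. lborel) \<Otimes>\<^sub>M lborel)"
      using measurable_compose[OF measurable_insert_coordinate[of i] borel_measurable_indicator[of N borel]]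
      by (simp add: split_def)
  qed
  have "(\<integral>\<^sup>+x. k x \<partial>lborel) =
    (\<integral>\<^sup>+f. (\<integral>\<^sup>+s. (\<integral>\<^sup>+t. indicator N (\<chi> j. if j = i then t else f j) \<partial>lborel) \<partial>(lborel :: real measure)) \<partial>PiM (UNIV - {i}) (\<lambda>_. lborel))"
    by (subst nn_integral_lborel_vec_line[of _ i]) (auto simp: k_def u)
  also have "\<dots> = 0"
    using 0 m by (simp add: nn_integral_multc)
  finally have "AE x in lborel. k x = 0"
    by (subst (asm) nn_integral_0_iff_AE) auto
  then show ?thesis
  proof eventually_elim
    case (elim x)
    have "AE t in lborel. indicator N (upd x i t) = (0::ennreal)"
      using elim unfolding k_def by (subst (asm) nn_integral_0_iff_AE) auto
    then show ?case
      by eventually_elim (use N(1) in \<open>auto simp: indicator_def split: if_splits\<close>)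
  qed
qed

text \<open>
  Each hypothesis bounds \<open>F\<close> by a function that does not depend on one of the coordinates. The
  product of the $n$ bounds therefore has the shape required by Loomis--Whitney, whose
  right-hand side is a product of total integrals.
\<close>

lemma gagliardo_nirenberg:
  fixes F :: "real^'n \<Rightarrow> ennreal" and M :: "'n \<Rightarrow> real^'n \<Rightarrow> ennreal"
  assumes n: "2 \<le> CARD('n)"
    and F [measurable]: "F \<in> borel_measurable borel"
    and M [measurable]: "\<And>i. M i \<in> borel_measurable borel"
    and le: "\<And>i. AE x in lborel. F x \<le> (\<integral>\<^sup>+t. M i (upd x i t) \<partial>lborel)"
  shows "epow (\<integral>\<^sup>+x. epow (F x) (real CARD('n) / (real CARD('n) - 1)) \<partial>lborel)
            ((real CARD('n) - 1) / real CARD('n))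
       \<le> (\<Prod>i\<in>UNIV. epow (\<integral>\<^sup>+x. M i x \<partial>lborel) (1 / real CARD('n)))"
proof -
  define n where "n = real CARD('n)"
  have n2: "2 \<le> n" using n by (simp add: n_def)
  define g where "g i f = (\<integral>\<^sup>+t. M i (\<chi> j. if j = i then t else f j) \<partial>lborel)" for i and f :: "'n \<Rightarrow> real"
  have mg: "g i \<in> borel_measurable (PiM (UNIV - {i}) (\<lambda>_. lborel))" for i
    unfolding g_def
  proof (rule lborel.borel_measurable_nn_integral)
    show "(\<lambda>(f, t). M i (\<chi> j. if j = i then t else f j))
       \<in> borel_measurable (Pi\<^sub>M (UNIV - {i}) (\<lambda>_. lborel) \<Otimes>\<^sub>M lborel)"
      using measurable_compose[OF measurable_insert_coordinate[of i] M[of i]]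
      by (simp add: split_def)
  qed
  have g_upd: "g i (restrict f (UNIV - {i})) = (\<integral>\<^sup>+t. M i (upd (\<chi> j. f j) i t) \<partial>lborel)" for i f
  proof -
    have "(\<chi> j. if j = i then t else restrict f (UNIV - {i}) j) = upd (\<chi> j. f j) i t" for t
      by (simp add: vec_eq_iff)
    then show ?thesis by (simp add: g_def)
  qed
  have "AE x in lborel. \<forall>i\<in>UNIV. F x \<le> (\<integral>\<^sup>+t. M i (upd x i t) \<partial>lborel)"
    unfolding AE_finite_all[OF finite] using le by blast
  then have "AE x in lborel. epow (F x) (n / (n - 1)) \<le> (\<Prod>i\<in>UNIV. epow (\<integral>\<^sup>+t. M i (upd x i t) \<partial>lborel) (1 / (n - 1)))"
  proof eventually_elim
    case (elim x)
    have "epow (F x) (n / (n - 1)) = (\<Prod>i\<in>(UNIV::'n set). epow (F x) (1 / (n - 1)))"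
    proof (cases "F x")
      case (real r)
      then have "(\<Prod>i\<in>(UNIV::'n set). epow (F x) (1 / (n - 1))) = ennreal ((r powr (1 / (n - 1))) ^ CARD('n))"
        by (simp add: epow_ennreal ennreal_power)
      also have "(r powr (1 / (n - 1))) ^ CARD('n) = r powr (n / (n - 1))"
      proof (cases "r = 0")
        case True
        then show ?thesis using n by (simp add: power_0_left)
      next
        case False
        then show ?thesis using real n2
          by (simp add: powr_realpow[symmetric] powr_powr n_def[symmetric])
      qed
      finally show ?thesis using real by (simp add: epow_ennreal)
    next
      case top
      then show ?thesis using n by (simp add: power_eq_top_ennreal_iff)
    qed
    also have "\<dots> \<le> (\<Prod>i\<in>UNIV. epow (\<integral>\<^sup>+t. M i (upd x i t) \<partial>lborel) (1 / (n - 1)))"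
      using elim n2 by (intro prod_mono_ennreal epow_mono) auto
    finally show ?case .
  qed
  then have "(\<integral>\<^sup>+x. epow (F x) (n / (n - 1)) \<partial>lborel) \<le>
      (\<integral>\<^sup>+x. (\<Prod>i\<in>UNIV. epow (\<integral>\<^sup>+t. M i (upd x i t) \<partial>lborel) (1 / (n - 1))) \<partial>lborel)"
    by (rule nn_integral_mono_AE)
  also have "\<dots> = (\<integral>\<^sup>+f. (\<Prod>i\<in>UNIV. epow (g i (restrict f (UNIV - {i}))) (1 / (n - 1))) \<partial>PiM UNIV (\<lambda>_. lborel))"
    by (subst nn_integral_lborel_vec) (auto simp: g_upd)
  also have "\<dots> \<le> (\<Prod>i\<in>UNIV. epow (\<integral>\<^sup>+f. g i f \<partial>PiM (UNIV - {i}) (\<lambda>_. lborel)) (1 / (n - 1)))"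
    unfolding n_def using n mg by (intro loomis_whitney_PiM) auto
  also have "\<dots> = (\<Prod>i\<in>UNIV. epow (\<integral>\<^sup>+x. M i x \<partial>lborel) (1 / (n - 1)))"
    unfolding g_def by (subst nn_integral_lborel_vec_line[symmetric]) auto
  finally have "epow (\<integral>\<^sup>+x. epow (F x) (n / (n - 1)) \<partial>lborel) ((n - 1) / n) \<le>
      epow (\<Prod>i\<in>UNIV. epow (\<integral>\<^sup>+x. M i x \<partial>lborel) (1 / (n - 1))) ((n - 1) / n)"
    using n2 by (intro epow_mono) auto
  also have "\<dots> = (\<Prod>i\<in>UNIV. epow (\<integral>\<^sup>+x. M i x \<partial>lborel) (1 / n))"
    using n2 by (simp add: epow_prod epow_epow)
  finally show ?thesis by (simp add: n_def)
qed

section \<open>Countable unions of compact sets\<close>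

text \<open>
  The class of sets on which area formulas are proved: it contains the coordinate pieces of the
  atlas, all its members are Borel, and on increasing compact sets monotone convergence applies.
\<close>

definition sigma_compact :: "'a::topological_space set \<Rightarrow> bool" where
  "sigma_compact E \<longleftrightarrow> (\<exists>K :: nat \<Rightarrow> 'a set. (\<forall>n. compact (K n)) \<and> E = (\<Union>n. K n))"

lemma sigma_compact_Int:
  fixes A B :: "'a::t2_space set"
  assumes "sigma_compact A" "sigma_compact B"
  shows "sigma_compact (A \<inter> B)"
proof -
  obtain K where K: "\<And>n. compact (K n)" "A = (\<Union>n::nat. K n)"
    using assms(1) unfolding sigma_compact_def by blast
  obtain L where L: "\<And>n. compact (L n)" "B = (\<Union>n::nat. L n)"
    using assms(2) unfolding sigma_compact_def by blast
  show ?thesis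
    unfolding sigma_compact_def
  proof (intro exI[of _ "\<lambda>n. K (fst (prod_decode n)) \<inter> L (snd (prod_decode n))"] conjI allI)
    show "A \<inter> B = (\<Union>n. K (fst (prod_decode n)) \<inter> L (snd (prod_decode n)))"
    proof (intro equalityI subsetI)
      fix x assume "x \<in> A \<inter> B"
      then obtain m n where "x \<in> K m" "x \<in> L n" using K L by auto
      then show "x \<in> (\<Union>n. K (fst (prod_decode n)) \<inter> L (snd (prod_decode n)))"
        by (intro UN_I[of "prod_encode (m, n)"]) auto
    qed (use K L in auto)
  qed (use K L in \<open>auto intro: compact_Int\<close>)
qed

lemma closed_imp_sigma_compact:
  fixes C :: "'a::heine_borel set"
  assumes "closed C"
  shows "sigma_compact C"
  unfolding sigma_compact_def
proof (intro exI[of _ "\<lambda>n. cball (SOME x. True) (real n) \<inter> C"] conjI allI)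
  show "C = (\<Union>n. cball (SOME x. True) (real n) \<inter> C)"
    by (auto intro: real_arch_simple)
qed (use assms in \<open>auto simp: compact_Int_closed\<close>)

lemma open_imp_sigma_compact:
  fixes U :: "'a::euclidean_space set"
  assumes "open U"
  shows "sigma_compact U"
proof -
  obtain C where "\<And>n. compact (C n)" "\<And>n. C n \<subseteq> U" "\<And>n. C n \<subseteq> interior (C (Suc n))"
    "\<Union>(range C) = U" "\<And>K. \<lbrakk>compact K; K \<subseteq> U\<rbrakk> \<Longrightarrow> \<exists>N. \<forall>n\<ge>N. K \<subseteq> C n"
    by (rule open_Union_compact_subsets[OF assms]) (rule that)
  then show ?thesis unfolding sigma_compact_def by (intro exI[of _ C]) auto
qed

lemma sigma_compact_borel:
  fixes E :: "'a::t2_space set"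
  assumes "sigma_compact E"
  shows "E \<in> sets borel"
proof -
  obtain K where K: "\<And>n. compact (K n)" "E = (\<Union>n::nat. K n)"
    using assms unfolding sigma_compact_def by blast
  have "K n \<in> sets borel" for n using K by (intro borel_closed compact_imp_closed)
  then have "range K \<subseteq> sets borel" by blast
  from sets.countable_UN[OF this] show ?thesis by (simp only: K(2))
qed

lemma sigma_compact_incseq:
  assumes "sigma_compact E"
  obtains K :: "nat \<Rightarrow> 'a::topological_space set"
  where "\<And>n. compact (K n)" "incseq K" "E = (\<Union>n. K n)"
proof -
  obtain K where K: "\<And>n. compact (K n)" "E = (\<Union>n::nat. K n)"
    using assms unfolding sigma_compact_def by blast
  show ?thesis
  proof
    show "compact (\<Union>i\<le>n. K i)" for n using K by (intro compact_UN) auto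
    show "incseq (\<lambda>n. \<Union>i\<le>n. K i)" by (auto simp: incseq_def intro: order_trans)
    show "E = (\<Union>n. \<Union>i\<le>n. K i)" using K by auto
  qed
qed

lemma sigma_compact_openin:
  fixes E :: "'a::euclidean_space set"
  assumes E: "sigma_compact E" and U: "openin (top_of_set E) U"
  shows "sigma_compact U"
proof -
  obtain T where T: "open T" "U = E \<inter> T" using U unfolding openin_open by blast
  show ?thesis unfolding T(2) by (rule sigma_compact_Int[OF E open_imp_sigma_compact[OF T(1)]])
qed

lemma sigma_compact_closedin:
  fixes E :: "'a::euclidean_space set"
  assumes E: "sigma_compact E" and U: "closedin (top_of_set E) U"
  shows "sigma_compact U"
proof -
  obtain T where T: "closed T" "U = E \<inter> T" using U unfolding closedin_closed by blast
  show ?thesis unfolding T(2) by (rule sigma_compact_Int[OF E closed_imp_sigma_compact[OF T(1)]])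
qed

section \<open>Transport to a well-ordered index type\<close>

text \<open>
  The change of variables theorem for integrals is stated over index types that carry a
  well-order. Any finite type is ordered through an injection into the natural numbers, and neither
  Lebesgue measure nor determinants notice the relabelling of the coordinates.
\<close>

typedef 'a wo = "UNIV :: 'a set" morphisms from_wo to_wo ..

instance wo :: (finite) finite
proof
  have "(UNIV :: 'a wo set) = to_wo ` UNIV"
    by (metis UNIV_I from_wo_inverse surjI surj_def)
  then show "finite (UNIV :: 'a wo set)" by (metis finite_imageI finite)
qed

definition wo_index :: "'a::finite \<Rightarrow> nat" where
  "wo_index = (SOME f. inj f)"

lemma inj_wo_index: "inj (wo_index :: 'a::finite \<Rightarrow> nat)"
  unfolding wo_index_def using finite_imp_inj_to_nat_seg[OF finite_class.finite_UNIV] by (metis someI_ex)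

instantiation wo :: (finite) wellorder
begin

definition less_eq_wo :: "'a wo \<Rightarrow> 'a wo \<Rightarrow> bool" where
  "less_eq_wo x y \<longleftrightarrow> wo_index (from_wo x) \<le> wo_index (from_wo y)"

definition less_wo :: "'a wo \<Rightarrow> 'a wo \<Rightarrow> bool" where
  "less_wo x y \<longleftrightarrow> wo_index (from_wo x) < wo_index (from_wo y)"

instance
proof
  fix x y z :: "'a wo"
  show "x < y \<longleftrightarrow> x \<le> y \<and> \<not> y \<le> x" "x \<le> x" "x \<le> y \<or> y \<le> x"
    by (simp_all only: less_eq_wo_def less_wo_def) linarith+
  show "x \<le> z" if "x \<le> y" "y \<le> z"
    using that unfolding less_eq_wo_def by (rule order_trans)
  show "x = y" if "x \<le> y" "y \<le> x"
  proof -
    have "wo_index (from_wo x) = wo_index (from_wo y)"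
      using that unfolding less_eq_wo_def by (rule order_antisym)
    then have "from_wo x = from_wo y" by (rule injD[OF inj_wo_index])
    then show ?thesis unfolding from_wo_inject .
  qed
next
  fix P :: "'a wo \<Rightarrow> bool" and a :: "'a wo"
  assume step: "\<And>x. (\<And>y. y < x \<Longrightarrow> P y) \<Longrightarrow> P x"
  show "P a"
  proof (induction "wo_index (from_wo a)" arbitrary: a rule: less_induct)
    case less
    show ?case by (rule step, rule less) (simp only: less_wo_def)
  qed
qed

end

definition unwo :: "real^'n wo \<Rightarrow> real^'n::finite" where
  "unwo x = (\<chi> i. x $ to_wo i)"

definition mkwo :: "real^'n::finite \<Rightarrow> real^'n wo" where
  "mkwo x = (\<chi> i. x $ from_wo i)"

lemma unwo_mkwo [simp]: "unwo (mkwo x) = x" and mkwo_unwo [simp]: "mkwo (unwo y) = y"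
  by (auto simp: unwo_def mkwo_def vec_eq_iff to_wo_inverse from_wo_inverse)

lemma linear_unwo: "linear unwo" and linear_mkwo: "linear mkwo"
  by (auto simp: unwo_def mkwo_def vec_eq_iff intro!: linearI)

lemma bij_to_wo: "bij to_wo" and bij_from_wo: "bij from_wo"
  by (metis bijI' from_wo_inverse to_wo_inverse UNIV_I)+

lemma lborel_unwo: "distr lborel borel unwo = (lborel :: (real^'n::finite) measure)"
proof (rule lborel_eqI[symmetric])
  have [measurable]: "unwo \<in> borel_measurable (borel :: (real^'n wo) measure)"
    by (intro borel_measurable_continuous_onI linear_continuous_on) (simp add: linear_unwo linear_conv_bounded_linear[symmetric])
  have prod: "(\<Prod>b\<in>Basis. (u - l) \<bullet> b) = (\<Prod>i\<in>UNIV. u $ i - l $ i)" for u l :: "real^'k"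
  proof -
    have "(\<Prod>b\<in>Basis. (u - l) \<bullet> b) = (\<Prod>i\<in>UNIV. (u - l) \<bullet> axis i (1::real))"
      unfolding Basis_vec_def
      by (subst prod.reindex_bij_betw[symmetric, of "\<lambda>i. axis i 1" UNIV])
        (auto simp: bij_betw_def inj_on_def axis_eq_axis)
    then show ?thesis by (simp add: inner_axis)
  qed
  fix l u :: "real^'n" assume lu: "\<And>b. b \<in> Basis \<Longrightarrow> l \<bullet> b \<le> u \<bullet> b"
  have le: "l $ i \<le> u $ i" for i
    using lu[of "axis i 1"] by (simp add: inner_axis axis_in_Basis_iff)
  have "unwo -` box l u = box (mkwo l) (mkwo u)"
    by (auto simp: mem_box_cart unwo_def mkwo_def) (metis from_wo_inverse to_wo_inverse UNIV_I)+
  then have "emeasure (distr lborel borel unwo) (box l u) = emeasure lborel (box (mkwo l) (mkwo u))"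
    by (subst emeasure_distr) auto
  also have "\<dots> = (\<Prod>b\<in>Basis. (mkwo u - mkwo l) \<bullet> b)"
    by (rule emeasure_lborel_box) (use le in \<open>auto simp: Basis_vec_def inner_axis mkwo_def\<close>)
  also have "(\<Prod>b\<in>Basis. (mkwo u - mkwo l) \<bullet> b) = (\<Prod>b\<in>Basis. (u - l) \<bullet> b)"
    unfolding prod by (simp add: mkwo_def prod.reindex_bij_betw[OF bij_from_wo, of "\<lambda>i. u $ i - l $ i"])
  finally show "emeasure (distr lborel borel unwo) (box l u) = (\<Prod>b\<in>Basis. (u - l) \<bullet> b)" .
qed simp

lemma det_wo:
  fixes A :: "real^'n^'n::finite"
  shows "det (\<chi> i j. A $ from_wo i $ from_wo j) = det A"
proof -
  define c where "c p = map_permutation UNIV (to_wo :: 'n \<Rightarrow> 'n wo) p" for p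
  have c: "c p (to_wo i) = to_wo (p i)" for p i
    unfolding c_def using bij_to_wo by (intro map_permutation_apply) (auto simp: bij_def)
  have c': "c p i = to_wo (p (from_wo i))" for p i
    using c[of p "from_wo i"] by (simp add: from_wo_inverse)
  have bij: "bij_betw c {p. p permutes UNIV} {p. p permutes UNIV}"
  proof (rule bij_betw_byWitness[where f' = "\<lambda>q. map_permutation UNIV from_wo q"])
    show "\<forall>a\<in>{p. p permutes UNIV}. map_permutation UNIV from_wo (c a) = a"
      unfolding c_def using bij_to_wo bij_from_wo
      by (auto intro!: map_permutation_compose_inv simp: bij_def to_wo_inverse)
    show "\<forall>a\<in>{p. p permutes UNIV}. c (map_permutation UNIV from_wo a) = a"
      unfolding c_def using bij_to_wo bij_from_wo
      by (auto intro!: map_permutation_compose_inv simp: bij_def from_wo_inverse)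
    show "c ` {p. p permutes UNIV} \<subseteq> {p. p permutes UNIV}"
      unfolding c_def using map_permutation_permutes[OF bij_to_wo] by auto
    show "map_permutation UNIV from_wo ` {p. p permutes UNIV} \<subseteq> {p. p permutes UNIV}"
      using map_permutation_permutes[OF bij_from_wo] by auto
  qed
  have s: "sign (c p) = sign p" if "p permutes UNIV" for p
    unfolding c_def using bij_to_wo that by (intro sign_map_permutation) (auto simp: bij_def)
  have "det (\<chi> i j. A $ from_wo i $ from_wo j)
    = (\<Sum>q | q permutes UNIV. of_int (sign q) * (\<Prod>i\<in>UNIV. A $ from_wo i $ from_wo (q i)))"
    by (simp add: det_def)
  also have "\<dots> = (\<Sum>p | p permutes UNIV. of_int (sign (c p)) * (\<Prod>i\<in>UNIV. A $ from_wo i $ from_wo (c p i)))"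
    by (rule sum.reindex_bij_betw[OF bij, symmetric])
  also have "\<dots> = (\<Sum>p | p permutes UNIV. of_int (sign p) * (\<Prod>i\<in>UNIV. A $ i $ p i))"
  proof (intro sum.cong refl)
    fix p :: "'n \<Rightarrow> 'n" assume "p \<in> {p. p permutes UNIV}"
    moreover have "(\<Prod>i\<in>UNIV. A $ from_wo i $ from_wo (c p i)) = (\<Prod>i\<in>UNIV. A $ i $ p i)"
      using prod.reindex_bij_betw[OF bij_from_wo, of "\<lambda>i. A $ i $ p i"] by (simp add: c' to_wo_inverse)
    ultimately show "of_int (sign (c p)) * (\<Prod>i\<in>UNIV. A $ from_wo i $ from_wo (c p i))
       = of_int (sign p) * (\<Prod>i\<in>UNIV. A $ i $ p i)"
      using s by simp
  qed
  finally show ?thesis by (simp add: det_def)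
qed

lemma det_matrix_wo:
  fixes g :: "real^'n::finite \<Rightarrow> real^'n"
  shows "det (matrix (mkwo \<circ> g \<circ> unwo)) = det (matrix g)"
proof -
  have *: "unwo (axis j 1) = axis (from_wo j) (1::real)" for j
    by (auto simp: unwo_def axis_def vec_eq_iff to_wo_inverse from_wo_inverse)
  then have "matrix (mkwo \<circ> g \<circ> unwo) = (\<chi> i j. matrix g $ from_wo i $ from_wo j)"
    by (subst vec_eq_iff, intro allI, subst vec_eq_iff) (simp add: matrix_def mkwo_def *)
  then show ?thesis by (simp only: det_wo)
qed

section \<open>Area formula\<close>

text \<open>
  The multiplicity-weighted push-forward of \<open>h\<close> along \<open>\<Psi>\<close>: a sheeted cover turns a function on the
  sheets into the sum over each fibre.
\<close>

definition fibre_sum :: "('a \<Rightarrow> 'b) \<Rightarrow> ('a \<Rightarrow> real) \<Rightarrow> 'a set \<Rightarrow> 'b \<Rightarrow> ennreal" where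
  "fibre_sum \<Psi> h A x = (\<integral>\<^sup>+u. ennreal (h u) * indicator A u * indicator {x} (\<Psi> u) \<partial>count_space UNIV)"

lemma fibre_sum_disjoint_UN:
  assumes "disjoint_family A"
  shows "fibre_sum \<Psi> h (\<Union>k::nat. A k) x = (\<Sum>k. fibre_sum \<Psi> h (A k) x)"
proof -
  have *: "ennreal (h u) * indicator (\<Union>k. A k) u * indicator {x} (\<Psi> u)
      = (\<Sum>k. ennreal (h u) * indicator (A k) u * indicator {x} (\<Psi> u))" for u
    using suminf_indicator[OF assms, of u] by (simp add: mult.assoc mult.commute[of _ "indicator {x} _"])
  show ?thesis
    unfolding fibre_sum_def by (subst nn_integral_suminf[symmetric]) (simp_all only: * measurable_count_space_eq1 space_borel UNIV_I Pi_UNIV)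
qed

lemma fibre_sum_incseq_UN:
  assumes "incseq A"
  shows "fibre_sum \<Psi> h (\<Union>k::nat. A k) x = (SUP k. fibre_sum \<Psi> h (A k) x)"
proof -
  have "(SUP k. ennreal (h u) * indicator (A k) u * indicator {x} (\<Psi> u))
     = ennreal (h u) * indicator (\<Union>k. A k) u * indicator {x} (\<Psi> u)" for u
  proof (cases "\<exists>k. u \<in> A k")
    case True
    then obtain k where "u \<in> A k" by blast
    then show ?thesis
      by (intro antisym SUP_least SUP_upper2[of k]) (auto simp: indicator_def)
  next
    case False
    then show ?thesis by simp
  qed
  moreover have "incseq (\<lambda>k u. ennreal (h u) * indicator (A k) u * indicator {x} (\<Psi> u))"
    using assms by (auto simp: incseq_def le_fun_def indicator_def)
  ultimately show ?thesis
    unfolding fibre_sum_def by (subst nn_integral_monotone_convergence_SUP[symmetric]) auto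
qed

lemma fibre_sum_inj:
  fixes \<Psi> :: "'a \<Rightarrow> 'b"
  assumes "inj_on \<Psi> A"
  shows "fibre_sum \<Psi> h A x = ennreal (h (the_inv_into A \<Psi> x)) * indicator (\<Psi> ` A) x"
proof (cases "x \<in> \<Psi> ` A")
  case True
  then obtain u where u: "u \<in> A" "\<Psi> u = x" by auto
  have "fibre_sum \<Psi> h A x = (\<integral>\<^sup>+v. ennreal (h u) * indicator {u} v \<partial>count_space UNIV)"
    unfolding fibre_sum_def using u assms
    by (intro nn_integral_cong) (auto simp: indicator_def dest: inj_onD)
  also have "\<dots> = ennreal (h u)" by (simp add: nn_integral_cmult)
  finally show ?thesis using True u assms by (simp add: the_inv_into_f_f[OF assms, symmetric] the_inv_into_f_eq)
next
  case False
  then have "fibre_sum \<Psi> h A x = (\<integral>\<^sup>+v. 0 \<partial>count_space (UNIV :: 'a set))"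
    unfolding fibre_sum_def by (intro nn_integral_cong) (auto simp: indicator_def)
  then show ?thesis using False by simp
qed

lemma borel_measurable_ennreal_continuous_on:
  fixes F :: "'a::topological_space \<Rightarrow> real"
  assumes "E \<in> sets borel" "continuous_on E F"
  shows "(\<lambda>u. ennreal (F u) * indicator E u) \<in> borel_measurable borel"
proof -
  have "(\<lambda>u. indicator E u *\<^sub>R F u) \<in> borel_measurable borel"
    by (rule borel_measurable_continuous_on_indicator[OF assms])
  then have "(\<lambda>u. ennreal (indicator E u *\<^sub>R F u)) \<in> borel_measurable borel"
    by measurable
  also have "(\<lambda>u. ennreal (indicator E u *\<^sub>R F u)) = (\<lambda>u. ennreal (F u) * indicator E u)"
    by (auto simp: indicator_def)
  finally show ?thesis .
qed

lemma area_formula_compact_inj: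
  fixes \<Psi> :: "real^'n::finite \<Rightarrow> real^'n"
  assumes K: "compact K" and der: "\<And>u. u \<in> K \<Longrightarrow> (\<Psi> has_derivative \<Psi>' u) (at u)"
    and inj: "inj_on \<Psi> K" and h: "continuous_on K h" "\<And>u. u \<in> K \<Longrightarrow> 0 \<le> h u"
    and cdet: "continuous_on K (\<lambda>u. det (matrix (\<Psi>' u)))"
  shows "fibre_sum \<Psi> h K \<in> borel_measurable borel"
    and "(\<integral>\<^sup>+x. fibre_sum \<Psi> h K x \<partial>lborel) =
      (\<integral>\<^sup>+u. ennreal (h u * \<bar>det (matrix (\<Psi>' u))\<bar>) * indicator K u \<partial>lborel)"
proof -
  have c\<Psi>: "continuous_on K \<Psi>"
    using der by (meson continuous_at_imp_continuous_on has_derivative_continuous)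
  define k where "k x = h (the_inv_into K \<Psi> x)" for x
  have kc: "continuous_on (\<Psi> ` K) k"
    unfolding k_def
    by (rule continuous_on_compose2[OF h(1) continuous_on_inv_into[OF c\<Psi> K inj]]) (auto simp: the_inv_into_into[OF inj])
  have k\<Psi>: "k (\<Psi> u) = h u" if "u \<in> K" for u
    using that inj by (simp add: k_def the_inv_into_f_f)
  have cK: "compact (\<Psi> ` K)" using c\<Psi> K by (rule compact_continuous_image)
  then have bK: "\<Psi> ` K \<in> sets borel" by (intro borel_closed compact_imp_closed)
  have fs: "fibre_sum \<Psi> h K x = ennreal (indicator (\<Psi> ` K) x *\<^sub>R k x)" for x
    using fibre_sum_inj[OF inj] by (simp add: k_def indicator_def)
  show "fibre_sum \<Psi> h K \<in> borel_measurable borel"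
    unfolding fs using bK kc by (intro measurable_compose[OF _ measurable_ennreal] borel_measurable_continuous_on_indicator)
  let ?K = "mkwo ` K" and ?g = "mkwo \<circ> \<Psi> \<circ> unwo" and ?g' = "\<lambda>v. mkwo \<circ> \<Psi>' (unwo v) \<circ> unwo"
  let ?f = "\<lambda>y. vec (k (unwo y)) :: real^1"
  have blu: "bounded_linear unwo" and blm: "bounded_linear mkwo"
    using linear_unwo linear_mkwo by (simp_all add: linear_conv_bounded_linear)
  have cu: "continuous_on A unwo" and cm: "continuous_on B mkwo" for A B
    by (simp_all add: linear_continuous_on blu blm)
  have cK': "compact ?K" by (rule compact_continuous_image[OF cm K])
  have gK: "?g ` ?K = mkwo ` (\<Psi> ` K)" by force
  have cgK: "compact (?g ` ?K)" unfolding gK by (rule compact_continuous_image[OF cm cK])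
  have unK: "unwo ` (?g ` ?K) = \<Psi> ` K" by force
  have memK: "y \<in> mkwo ` A \<longleftrightarrow> unwo y \<in> A" for y A by force
  have fc: "continuous_on (?g ` ?K) (\<lambda>y. k (unwo y))"
    by (rule continuous_on_compose2[OF kc cu]) (use unK in auto)
  have int: "integrable lborel (\<lambda>y. indicator (?g ` ?K) y *\<^sub>R k (unwo y))"
    by (rule borel_integrable_compact[OF cgK fc])
  then have "(\<lambda>y. k (unwo y)) absolutely_integrable_on (?g ` ?K)"
    unfolding set_integrable_def by (rule integrable_completion[THEN iffD2, rotated]) (use int in auto)
  then have f_int: "?f absolutely_integrable_on (?g ` ?K)"
    by (simp add: absolutely_integrable_on_1_iff)
  have "?K \<in> sets lebesgue" using cK' by (simp add: fmeasurableD lmeasurable_compact)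
  moreover have "(?g has_derivative ?g' x) (at x within ?K)" if "x \<in> ?K" for x
  proof -
    have "unwo x \<in> K" using that by auto
    then have "(\<Psi> has_derivative \<Psi>' (unwo x)) (at (unwo x) within unwo ` ?K)"
      by (rule der[THEN has_derivative_at_withinI])
    then have "((\<Psi> \<circ> unwo) has_derivative (\<Psi>' (unwo x) \<circ> unwo)) (at x within ?K)"
      by (intro diff_chain_within bounded_linear_imp_has_derivative[OF blu]) auto
    from diff_chain_within[OF this bounded_linear_imp_has_derivative[OF blm]] show ?thesis
      by (simp add: comp_assoc)
  qed
  moreover have "inj_on ?g ?K"
    using inj by (auto simp: inj_on_def) (metis mkwo_unwo unwo_mkwo)
  ultimately have *: "(\<lambda>x. \<bar>det (matrix (?g' x))\<bar> *\<^sub>R ?f (?g x)) absolutely_integrable_on ?K"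
    "integral ?K (\<lambda>x. \<bar>det (matrix (?g' x))\<bar> *\<^sub>R ?f (?g x)) = integral (?g ` ?K) ?f"
    using has_absolute_integral_change_of_variables[of ?K ?g ?g' ?f "integral (?g ` ?K) ?f"] f_int by blast+
  let ?F = "\<lambda>v. h v * \<bar>det (matrix (\<Psi>' v))\<bar>"
  have eq: "(\<bar>det (matrix (?g' x))\<bar> *\<^sub>R ?f (?g x)) $ 1 = ?F (unwo x)" if "x \<in> ?K" for x
    using that k\<Psi> by (auto simp: det_matrix_wo)
  have i1: "(\<lambda>x. (\<bar>det (matrix (?g' x))\<bar> *\<^sub>R ?f (?g x)) $ 1) absolutely_integrable_on ?K"
    using *(1) unfolding absolutely_integrable_on_1_iff .
  have "(\<lambda>x. ?F (unwo x)) absolutely_integrable_on ?K"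
    by (rule iffD1[OF set_integrable_cong[OF refl refl eq] i1])
  then have "((\<lambda>x. ?F (unwo x)) has_integral integral ?K (\<lambda>x. ?F (unwo x))) ?K"
    by (simp add: absolutely_integrable_on_def has_integral_integral)
  moreover have "integral ?K (\<lambda>x. ?F (unwo x)) = integral (?g ` ?K) (\<lambda>y. k (unwo y))"
  proof -
    have "integral ?K (\<lambda>x. ?F (unwo x)) = integral ?K (\<lambda>x. (\<bar>det (matrix (?g' x))\<bar> *\<^sub>R ?f (?g x)) $ 1)"
      by (rule integral_cong[OF eq[symmetric]])
    also have "\<dots> = integral (?g ` ?K) (\<lambda>y. ?f y $ 1)"
    proof -
      have "integral ?K (\<lambda>x. \<bar>det (matrix (?g' x))\<bar> *\<^sub>R ?f (?g x)) $ 1 = integral (?g ` ?K) ?f $ 1"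
        by (rule arg_cong[OF *(2)])
      then show ?thesis by (simp only: integral_on_1_eq vec_component)
    qed
    finally show ?thesis by simp
  qed
  ultimately have R: "((\<lambda>x. ?F (unwo x)) has_integral integral (?g ` ?K) (\<lambda>y. k (unwo y))) ?K" by (simp only:)
  have L: "((\<lambda>y. k (unwo y)) has_integral integral (?g ` ?K) (\<lambda>y. k (unwo y))) (?g ` ?K)"
    using f_int by (auto simp: absolutely_integrable_on_1_iff absolutely_integrable_on_def has_integral_integral)
  have knn: "0 \<le> k (unwo y)" if "y \<in> ?g ` ?K" for y
    using that k\<Psi> h(2) by auto
  have Fnn: "0 \<le> ?F (unwo x)" if "x \<in> ?K" for x using that h(2) by auto
  have [measurable]: "unwo \<in> borel_measurable borel" by (intro borel_measurable_continuous_onI cu)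
  have dist: "(\<integral>\<^sup>+x. G x \<partial>lborel) = (\<integral>\<^sup>+x. G (unwo x) \<partial>lborel)" if "G \<in> borel_measurable borel" for G :: "real^'n \<Rightarrow> ennreal"
    using that by (subst lborel_unwo[symmetric], subst nn_integral_distr) auto
  have Fm: "(\<lambda>u. ennreal (?F u) * indicator K u) \<in> borel_measurable borel"
    using h(1) cdet K
    by (intro borel_measurable_ennreal_continuous_on continuous_intros borel_closed compact_imp_closed)
  obtain G where G: "G = ?g ` ?K" by simp
  have memG: "x \<in> G \<longleftrightarrow> unwo x \<in> \<Psi> ` K" for x unfolding G gK memK ..
  have "(\<integral>\<^sup>+x. fibre_sum \<Psi> h K x \<partial>lborel) = (\<integral>\<^sup>+y. ennreal (k (unwo y)) * indicator G y \<partial>lborel)"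
    using \<open>fibre_sum \<Psi> h K \<in> borel_measurable borel\<close>
    by (subst dist) (auto simp: fs memG indicator_def intro!: nn_integral_cong)
  also have "\<dots> = (\<integral>\<^sup>+x. ennreal (?F (unwo x)) * indicator ?K x \<partial>lborel)"
    unfolding G using nn_integral_has_integral_lebesgue'[OF knn L] nn_integral_has_integral_lebesgue'[OF Fnn R]
    by (simp only:)
  also have "\<dots> = (\<integral>\<^sup>+u. ennreal (?F u) * indicator K u \<partial>lborel)"
    by (subst dist[OF Fm]) (auto simp: memK indicator_def intro!: nn_integral_cong)
  finally show "(\<integral>\<^sup>+x. fibre_sum \<Psi> h K x \<partial>lborel) =
      (\<integral>\<^sup>+u. ennreal (?F u) * indicator K u \<partial>lborel)" .
qed

lemma locally_injective:
  fixes \<Psi> :: "'a::euclidean_space \<Rightarrow> 'b::euclidean_space"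
  assumes \<Omega>: "open \<Omega>" "a \<in> \<Omega>" and der: "\<And>u. u \<in> \<Omega> \<Longrightarrow> (\<Psi> has_derivative \<Psi>' u) (at u)"
    and cont: "\<And>v. continuous_on \<Omega> (\<lambda>u. \<Psi>' u v)" and inj: "inj (\<Psi>' a)"
  obtains r where "r > 0" "ball a r \<subseteq> \<Omega>" "inj_on \<Psi> (ball a r)"
proof -
  have lin: "linear (\<Psi>' u)" if "u \<in> \<Omega>" for u
    using der[OF that] by (rule has_derivative_linear)
  obtain g' where g': "linear g'" "g' \<circ> \<Psi>' a = id"
    using linear_injective_left_inverse[OF lin[OF \<Omega>(2)] inj] by blast
  show ?thesis
  proof (rule has_derivative_locally_injective[OF \<Omega>(2,1) _ g'(2) der])
    show "bounded_linear g'" using g'(1) by (simp add: linear_conv_bounded_linear)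
    fix e :: real assume e: "0 < e"
    have "((\<lambda>x. \<Sum>b\<in>Basis. norm (\<Psi>' x b - \<Psi>' a b)) \<longlongrightarrow> (\<Sum>b\<in>Basis. norm (\<Psi>' a b - \<Psi>' a b))) (at a)"
      using cont \<Omega> by (intro tendsto_intros) (metis continuous_on_eq_continuous_at isCont_def)
    then have "\<forall>\<^sub>F x in at a. (\<Sum>b\<in>Basis. norm (\<Psi>' x b - \<Psi>' a b)) < e"
      using e by (intro order_tendstoD(2)) auto
    then obtain d1 where d1: "0 < d1" "\<And>x. x \<noteq> a \<Longrightarrow> dist x a < d1 \<Longrightarrow> (\<Sum>b\<in>Basis. norm (\<Psi>' x b - \<Psi>' a b)) < e"
      unfolding eventually_at by auto
    obtain d2 where d2: "0 < d2" "ball a d2 \<subseteq> \<Omega>" using \<Omega> open_contains_ball by blast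
    show "\<exists>d>0. \<forall>x. dist a x < d \<longrightarrow> onorm (\<lambda>v. \<Psi>' x v - \<Psi>' a v) < e"
    proof (intro exI[of _ "min d1 d2"] conjI allI impI)
      fix x assume x: "dist a x < min d1 d2"
      then have "x \<in> \<Omega>" using d2 by auto
      then have "bounded_linear (\<lambda>v. \<Psi>' x v - \<Psi>' a v)"
        using lin \<Omega>(2) by (intro bounded_linear_sub) (auto simp: linear_conv_bounded_linear)
      from onorm_componentwise[OF this]
      have "onorm (\<lambda>v. \<Psi>' x v - \<Psi>' a v) \<le> (\<Sum>b\<in>Basis. norm (\<Psi>' x b - \<Psi>' a b))" .
      also have "\<dots> < e" using d1(2)[of x] x e by (cases "x = a") (auto simp: dist_commute)
      finally show "onorm (\<lambda>v. \<Psi>' x v - \<Psi>' a v) < e" .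
    qed (use d1 d2 in auto)
  qed (use that in auto)
qed

lemma continuous_on_det_matrix:
  fixes \<Psi>' :: "'a::topological_space \<Rightarrow> real^'n::finite \<Rightarrow> real^'n"
  assumes "\<And>v. continuous_on \<Omega> (\<lambda>u. \<Psi>' u v)"
  shows "continuous_on \<Omega> (\<lambda>u. det (matrix (\<Psi>' u)))"
  unfolding det_def matrix_def using assms by (auto intro!: continuous_intros)

text \<open>
  The easy case of Sard's theorem.
\<close>

lemma negligible_critical_values:
  fixes \<Psi> :: "real^'n::finite \<Rightarrow> real^'n"
  assumes der: "\<And>u. u \<in> C \<Longrightarrow> (\<Psi> has_derivative \<Psi>' u) (at u)"
    and det: "\<And>u. u \<in> C \<Longrightarrow> det (matrix (\<Psi>' u)) = 0"
  shows "negligible (\<Psi> ` C)"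
proof -
  have blu: "bounded_linear unwo" and blm: "bounded_linear mkwo"
    using linear_unwo linear_mkwo by (simp_all add: linear_conv_bounded_linear)
  have "negligible ((mkwo \<circ> \<Psi> \<circ> unwo) ` (mkwo ` C))"
  proof (rule baby_Sard)
    fix x assume "x \<in> mkwo ` C"
    then have x: "unwo x \<in> C" by auto
    then have "(\<Psi> has_derivative \<Psi>' (unwo x)) (at (unwo x) within unwo ` (mkwo ` C))"
      by (rule der[THEN has_derivative_at_withinI])
    then have "((\<Psi> \<circ> unwo) has_derivative (\<Psi>' (unwo x) \<circ> unwo)) (at x within mkwo ` C)"
      by (intro diff_chain_within bounded_linear_imp_has_derivative[OF blu]) auto
    from diff_chain_within[OF this bounded_linear_imp_has_derivative[OF blm]]
    show "((mkwo \<circ> \<Psi> \<circ> unwo) has_derivative (mkwo \<circ> \<Psi>' (unwo x) \<circ> unwo)) (at x within mkwo ` C)"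
      by (simp only: comp_assoc)
    show "rank (matrix (mkwo \<circ> \<Psi>' (unwo x) \<circ> unwo)) < CARD('n wo)"
      using det[OF x] det_matrix_wo[of "\<Psi>' (unwo x)"] by (simp only: det_eq_0_rank[symmetric])
  qed simp
  then have "negligible (unwo ` ((mkwo \<circ> \<Psi> \<circ> unwo) ` (mkwo ` C)))"
  proof (rule negligible_differentiable_image_negligible[rotated])
    show "unwo differentiable_on (mkwo \<circ> \<Psi> \<circ> unwo) ` mkwo ` C"
      by (intro differentiable_at_imp_differentiable_on bounded_linear_imp_differentiable blu)
    have "CARD('n wo) = CARD('n)" using bij_betw_same_card[OF bij_from_wo] by simp
    then show "DIM(real^'n wo) \<le> DIM(real^'n)" by simp
  qed
  moreover have "unwo ` ((mkwo \<circ> \<Psi> \<circ> unwo) ` (mkwo ` C)) = \<Psi> ` C" by force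
  ultimately show ?thesis by (simp only:)
qed

text \<open>
  Away from critical points, whose image is null, countably many balls on which \<open>\<Psi>\<close> is injective
  cover the domain. On each compact part of such a ball the formula is the change of variables
  theorem, and both sides are countably additive. The fibre sum itself need not be Borel because
  of the critical values, hence the modification \<open>N\<close>.
\<close>

lemma area_formula:
  fixes \<Psi> :: "real^'n::finite \<Rightarrow> real^'n"
  assumes \<Omega>: "open \<Omega>" and der: "\<And>u. u \<in> \<Omega> \<Longrightarrow> (\<Psi> has_derivative \<Psi>' u) (at u)"
    and cont: "\<And>v. continuous_on \<Omega> (\<lambda>u. \<Psi>' u v)"
    and E: "sigma_compact E" "E \<subseteq> \<Omega>" and h: "continuous_on E h" "\<And>u. u \<in> E \<Longrightarrow> 0 \<le> h u"
  obtains N where "N \<in> borel_measurable borel" "AE x in lborel. fibre_sum \<Psi> h E x = N x"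
    "(\<integral>\<^sup>+x. N x \<partial>lborel) = (\<integral>\<^sup>+u. ennreal (h u * \<bar>det (matrix (\<Psi>' u))\<bar>) * indicator E u \<partial>lborel)"
proof -
  let ?d = "\<lambda>u. det (matrix (\<Psi>' u))"
  have cdet: "continuous_on \<Omega> ?d" by (rule continuous_on_det_matrix[OF cont])
  have lin: "linear (\<Psi>' u)" if "u \<in> \<Omega>" for u
    using der[OF that] by (rule has_derivative_linear)
  define R where "R = {u \<in> \<Omega>. ?d u \<noteq> 0}"
  have Ro: "open R"
    using continuous_open_preimage[OF cdet \<Omega>, of "- {0}"] open_Compl[OF closed_singleton[of "0::real"]]
    by (simp add: R_def vimage_def Int_def)
  define E1 where "E1 = E \<inter> R"
  define \<F> where "\<F> = {B. open B \<and> B \<subseteq> \<Omega> \<and> inj_on \<Psi> B}"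
  obtain \<G> where \<G>: "\<G> \<subseteq> \<F>" "countable \<G>" "\<Union>\<G> = \<Union>\<F>"
    using Lindelof[of \<F>] by (auto simp: \<F>_def)
  have cov: "R \<subseteq> \<Union>\<G>"
  proof
    fix a assume "a \<in> R"
    then have a: "a \<in> \<Omega>" "?d a \<noteq> 0" by (auto simp: R_def)
    have "inj (\<Psi>' a)"
      using a lin[OF a(1)] by (simp add: det_nz_iff_inj)
    then obtain r where "r > 0" "ball a r \<subseteq> \<Omega>" "inj_on \<Psi> (ball a r)"
      using locally_injective[OF \<Omega> a(1) der cont] by blast
    then have "a \<in> ball a r" "ball a r \<in> \<F>" by (auto simp: \<F>_def)
    then show "a \<in> \<Union>\<G>" using \<G>(3) by blast
  qed
  define B where "B k = (if \<G> = {} then {} else from_nat_into \<G> k)" for k :: nat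
  have B: "open (B k)" "inj_on \<Psi> (B k)" "B k \<subseteq> \<Omega>" for k
    using \<G>(1) from_nat_into[of \<G> k] by (auto simp: B_def \<F>_def)
  have UB: "R \<subseteq> (\<Union>k. B k)"
    using cov \<G>(2) range_from_nat_into[of \<G>] by (auto simp: B_def split: if_splits)
  define D where "D k = E1 \<inter> (B k \<inter> (- (\<Union>j<k. B j)))" for k
  have Dd: "disjoint_family D"
    unfolding disjoint_family_on_def
  proof (intro ballI impI)
    fix m n :: nat assume "m \<noteq> n"
    then consider "m < n" | "n < m" by linarith
    then show "D m \<inter> D n = {}" by cases (auto simp: D_def)
  qed
  have UD: "(\<Union>k. D k) = E1"
  proof (intro equalityI subsetI)
    fix u assume u: "u \<in> E1"
    then have ex: "\<exists>k. u \<in> B k" using UB by (auto simp: E1_def)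
    define k where "k = (LEAST k. u \<in> B k)"
    have "u \<in> B k" "\<And>j. j < k \<Longrightarrow> u \<notin> B j"
      unfolding k_def using ex by (auto intro: LeastI_ex dest: not_less_Least)
    then show "u \<in> (\<Union>k. D k)" using u by (auto simp: D_def)
  qed (auto simp: D_def)
  have Dsc: "sigma_compact (D k)" for k
    unfolding D_def E1_def
  proof (rule sigma_compact_Int[OF sigma_compact_Int[OF E(1) open_imp_sigma_compact[OF Ro]]
        sigma_compact_Int[OF open_imp_sigma_compact[OF B(1)] closed_imp_sigma_compact]])
    show "closed (- (\<Union>j<k. B j))" using B(1) by (intro closed_Compl open_UN) auto
  qed
  have DE: "D k \<subseteq> E" "D k \<subseteq> \<Omega>" "inj_on \<Psi> (D k)" for k
    using E(2) B by (auto simp: D_def E1_def intro: inj_on_subset)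
  have DN: "fibre_sum \<Psi> h (D k) \<in> borel_measurable borel \<and> (\<integral>\<^sup>+x. fibre_sum \<Psi> h (D k) x \<partial>lborel) =
      (\<integral>\<^sup>+u. ennreal (h u * \<bar>?d u\<bar>) * indicator (D k) u \<partial>lborel)" for k
  proof -
    obtain K where K: "\<And>n. compact (K n)" "incseq K" "D k = (\<Union>n. K n)"
      using sigma_compact_incseq[OF Dsc] by blast
    have KD: "K n \<subseteq> D k" for n using K(3) by auto
    note KE = order_trans[OF KD DE(1)] order_trans[OF KD DE(2)] inj_on_subset[OF DE(3) KD]
    have derK: "(\<Psi> has_derivative \<Psi>' u) (at u)" if "u \<in> K n" for u n
      using KE(2)[of n] that by (intro der) auto
    have hK: "continuous_on (K n) h" "continuous_on (K n) ?d" for n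
      using continuous_on_subset[OF h(1) KE(1)] continuous_on_subset[OF cdet KE(2)] by auto
    have hK0: "0 \<le> h u" if "u \<in> K n" for u n
      using KE(1)[of n] that by (intro h(2)) auto
    have a1: "fibre_sum \<Psi> h (K n) \<in> borel_measurable borel" for n
      by (rule area_formula_compact_inj(1)[OF K(1) derK KE(3) hK(1) hK0 hK(2)])
    have a2: "(\<integral>\<^sup>+x. fibre_sum \<Psi> h (K n) x \<partial>lborel) =
      (\<integral>\<^sup>+u. ennreal (h u * \<bar>?d u\<bar>) * indicator (K n) u \<partial>lborel)" for n
      by (rule area_formula_compact_inj(2)[OF K(1) derK KE(3) hK(1) hK0 hK(2)])
    have eq: "fibre_sum \<Psi> h (D k) = (\<lambda>x. SUP n. fibre_sum \<Psi> h (K n) x)"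
      unfolding K(3) by (rule ext, rule fibre_sum_incseq_UN[OF K(2)])
    have m: "(\<lambda>u. ennreal (h u * \<bar>?d u\<bar>) * indicator (K n) u) \<in> borel_measurable lborel" for n
      unfolding measurable_lborel1 measurable_lborel2
      by (intro borel_measurable_ennreal_continuous_on continuous_intros hK borel_closed compact_imp_closed K)
    have sub: "u \<in> K n" if "m \<le> n" "u \<in> K m" for u m n
      using K(2) that by (auto simp: incseq_def)
    have inc1: "incseq (\<lambda>n x. fibre_sum \<Psi> h (K n) x)"
      unfolding fibre_sum_def
      by (auto simp: incseq_def le_fun_def indicator_def dest: sub intro!: nn_integral_mono)
    have inc2: "incseq (\<lambda>n u. ennreal (h u * \<bar>?d u\<bar>) * indicator (K n) u)"
      by (auto simp: incseq_def le_fun_def indicator_def dest: sub)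
    have sup: "(SUP n. ennreal (h u * \<bar>?d u\<bar>) * indicator (K n) u) = ennreal (h u * \<bar>?d u\<bar>) * indicator (D k) u" for u
    proof (cases "\<exists>n. u \<in> K n")
      case True
      then obtain n where "u \<in> K n" by blast
      then show ?thesis
        unfolding K(3) by (intro antisym SUP_least SUP_upper2[of n]) (auto simp: indicator_def)
    next
      case False
      then show ?thesis unfolding K(3) by simp
    qed
    have "(\<integral>\<^sup>+x. fibre_sum \<Psi> h (D k) x \<partial>lborel) = (SUP n. \<integral>\<^sup>+x. fibre_sum \<Psi> h (K n) x \<partial>lborel)"
      unfolding eq using a1 by (intro nn_integral_monotone_convergence_SUP inc1) auto
    also have "\<dots> = (\<integral>\<^sup>+u. ennreal (h u * \<bar>?d u\<bar>) * indicator (D k) u \<partial>lborel)"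
      unfolding a2 sup[symmetric] using m by (intro nn_integral_monotone_convergence_SUP[symmetric] inc2)
    finally show ?thesis
      unfolding eq using a1 by simp
  qed
  define N where "N x = (\<Sum>k. fibre_sum \<Psi> h (D k) x)" for x
  have N: "N x = fibre_sum \<Psi> h E1 x" for x
    unfolding N_def UD[symmetric] by (rule fibre_sum_disjoint_UN[OF Dd, symmetric])
  have mD: "(\<lambda>u. ennreal (h u * \<bar>?d u\<bar>) * indicator (D k) u) \<in> borel_measurable lborel" for k
    unfolding measurable_lborel1 measurable_lborel2
    by (intro borel_measurable_ennreal_continuous_on continuous_intros sigma_compact_borel Dsc
        continuous_on_subset[OF h(1) DE(1)] continuous_on_subset[OF cdet DE(2)])
  show ?thesis
  proof
    show "N \<in> borel_measurable borel" unfolding N_def using DN by (intro borel_measurable_suminf_order) auto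
    have "negligible (\<Psi> ` {u \<in> \<Omega>. ?d u = 0})"
      using der by (intro negligible_critical_values[where \<Psi>'=\<Psi>']) auto
    then have "AE x in lebesgue. x \<notin> \<Psi> ` {u \<in> \<Omega>. ?d u = 0}"
      by (simp add: negligible_iff_null_sets AE_not_in)
    then have "AE x in lborel. x \<notin> \<Psi> ` {u \<in> \<Omega>. ?d u = 0}"
      by (simp add: AE_completion_iff)
    then show "AE x in lborel. fibre_sum \<Psi> h E x = N x"
    proof eventually_elim
      case (elim x)
      then have "indicator E u * indicator {x} (\<Psi> u) = (indicator E1 u * indicator {x} (\<Psi> u) :: ennreal)" for u
        using E(2) by (auto simp: indicator_def E1_def R_def)
      then show ?case unfolding N fibre_sum_def by (simp only: mult.assoc)
    qed
    have "(\<integral>\<^sup>+x. N x \<partial>lborel) = (\<Sum>k. \<integral>\<^sup>+x. fibre_sum \<Psi> h (D k) x \<partial>lborel)"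
      unfolding N_def using DN by (intro nn_integral_suminf) auto
    also have "\<dots> = (\<Sum>k. \<integral>\<^sup>+u. ennreal (h u * \<bar>?d u\<bar>) * indicator (D k) u \<partial>lborel)"
      using DN by simp
    also have "\<dots> = (\<integral>\<^sup>+u. (\<Sum>k. ennreal (h u * \<bar>?d u\<bar>) * indicator (D k) u) \<partial>lborel)"
      by (rule nn_integral_suminf[symmetric, OF mD])
    also have "\<dots> = (\<integral>\<^sup>+u. ennreal (h u * \<bar>?d u\<bar>) * indicator E u \<partial>lborel)"
    proof (rule nn_integral_cong)
      fix u
      have "(\<Sum>k. ennreal (h u * \<bar>?d u\<bar>) * indicator (D k) u) = ennreal (h u * \<bar>?d u\<bar>) * indicator E1 u"
        unfolding UD[symmetric] using suminf_indicator[OF Dd, of u] by simp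
      also have "\<dots> = ennreal (h u * \<bar>?d u\<bar>) * indicator E u"
        using E(2) by (cases "?d u = 0") (auto simp: E1_def R_def indicator_def)
      finally show "(\<Sum>k. ennreal (h u * \<bar>?d u\<bar>) * indicator (D k) u) = ennreal (h u * \<bar>?d u\<bar>) * indicator E u" .
    qed
    finally show "(\<integral>\<^sup>+x. N x \<partial>lborel) = (\<integral>\<^sup>+u. ennreal (h u * \<bar>?d u\<bar>) * indicator E u \<partial>lborel)" .
  qed
qed

section \<open>Second derivatives\<close>

lemma has_derivative_along_line:
  fixes f :: "'a::real_normed_vector \<Rightarrow> 'b::real_normed_vector"
  assumes "(f has_derivative D) (at (u + s *\<^sub>R v))"
  shows "((\<lambda>s. f (u + s *\<^sub>R v)) has_vector_derivative D v) (at s)"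
proof -
  have lin: "linear D" using assms by (rule has_derivative_linear)
  have "((\<lambda>s. u + s *\<^sub>R v) has_derivative (\<lambda>h. h *\<^sub>R v)) (at s)"
    by (auto intro!: derivative_eq_intros)
  then have "((\<lambda>s. f (u + s *\<^sub>R v)) has_derivative (\<lambda>h. D (h *\<^sub>R v))) (at s)"
    by (rule has_derivative_compose[where g = f and g' = D]) (rule assms)
  then show ?thesis
    by (simp add: has_vector_derivative_def linear_scale[OF lin])
qed

lemma difference_quotient_tendsto:
  fixes f :: "'a::real_normed_vector \<Rightarrow> 'b::real_normed_vector"
  assumes f: "(f has_derivative D) (at u)" and t: "t \<longlonglongrightarrow> 0" "\<And>n. 0 < t n"
  shows "(\<lambda>n. (1 / t n) *\<^sub>R (f (u + t n *\<^sub>R v) - f u)) \<longlonglongrightarrow> D v"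
proof (rule LIM_zero_cancel, rule tendsto_norm_zero_cancel, rule tendstoI)
  have lin: "linear D" using f by (rule has_derivative_linear)
  fix e :: real assume e: "0 < e"
  define e' where "e' = e / (norm v + 1)"
  have nn: "0 < norm v + 1" by (simp add: add_nonneg_pos)
  have e': "0 < e'" using e nn by (simp add: e'_def)
  obtain d where d: "0 < d" "\<And>y. norm (y - u) < d \<Longrightarrow> norm (f y - f u - D (y - u)) \<le> e' * norm (y - u)"
    using f e' unfolding has_derivative_at_alt by blast
  have "(\<lambda>n. t n *\<^sub>R v) \<longlonglongrightarrow> 0" using tendsto_scaleR[OF t(1) tendsto_const] by simp
  from tendstoD[OF this d(1)]
  show "\<forall>\<^sub>F n in sequentially. dist (norm ((1 / t n) *\<^sub>R (f (u + t n *\<^sub>R v) - f u) - D v)) 0 < e"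
  proof eventually_elim
    case (elim n)
    have "(1 / t n) *\<^sub>R (f (u + t n *\<^sub>R v) - f u) - D v = (1 / t n) *\<^sub>R (f (u + t n *\<^sub>R v) - f u - D (t n *\<^sub>R v))"
      using t(2)[of n] by (simp add: linear_scale[OF lin] scaleR_diff_right)
    then have "norm ((1 / t n) *\<^sub>R (f (u + t n *\<^sub>R v) - f u) - D v)
      = norm (f (u + t n *\<^sub>R v) - f u - D (t n *\<^sub>R v)) / t n"
      using t(2)[of n] by simp
    also have "\<dots> \<le> e' * norm (t n *\<^sub>R v) / t n"
      using d(2)[of "u + t n *\<^sub>R v"] elim t(2)[of n] by (intro divide_right_mono) (auto simp: dist_norm)
    also have "\<dots> = e' * norm v" using t(2)[of n] by simp
    also have "\<dots> < e' * (norm v + 1)" using e' by simp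
    also have "\<dots> = e" using nn by (simp add: e'_def)
    finally show ?case by simp
  qed
qed

lemma second_difference_mean_value:
  fixes f :: "'a::real_normed_vector \<Rightarrow> real"
  assumes s: "0 < s"
    and U: "\<And>a b. \<lbrakk>0 \<le> a; a \<le> s; 0 \<le> b; b \<le> s\<rbrakk> \<Longrightarrow> u + a *\<^sub>R v + b *\<^sub>R w \<in> U"
    and D: "\<And>x. x \<in> U \<Longrightarrow> (f has_derivative D x) (at x)"
    and D2: "\<And>x. x \<in> U \<Longrightarrow> ((\<lambda>x. D x v) has_derivative D2 x) (at x)"
  obtains a b where "0 < a" "a < s" "0 < b" "b < s"
    "f (u + s *\<^sub>R v + s *\<^sub>R w) - f (u + s *\<^sub>R v) - f (u + s *\<^sub>R w) + f u
      = s * s * D2 (u + a *\<^sub>R v + b *\<^sub>R w) w"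
proof -
  define g where "g a = f (u + s *\<^sub>R w + a *\<^sub>R v) - f (u + a *\<^sub>R v)" for a
  have g: "(g has_real_derivative D (u + s *\<^sub>R w + a *\<^sub>R v) v - D (u + a *\<^sub>R v) v) (at a)"
    if "0 \<le> a" "a \<le> s" for a
  proof -
    have "u + s *\<^sub>R w + a *\<^sub>R v \<in> U" "u + a *\<^sub>R v \<in> U"
      using U[of a s] U[of a 0] that s by (auto simp: algebra_simps)
    then show ?thesis
      unfolding g_def has_real_derivative_iff_has_vector_derivative
      by (intro has_vector_derivative_diff has_derivative_along_line D)
  qed
  obtain a where a: "0 < a" "a < s" "g s - g 0 = (s - 0) * (D (u + s *\<^sub>R w + a *\<^sub>R v) v - D (u + a *\<^sub>R v) v)"
    using MVT2[OF s, of g "\<lambda>a. D (u + s *\<^sub>R w + a *\<^sub>R v) v - D (u + a *\<^sub>R v) v"] g by auto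
  define k where "k b = D (u + a *\<^sub>R v + b *\<^sub>R w) v" for b
  have k: "(k has_real_derivative D2 (u + a *\<^sub>R v + b *\<^sub>R w) w) (at b)" if "0 \<le> b" "b \<le> s" for b
    unfolding k_def has_real_derivative_iff_has_vector_derivative
    using has_derivative_along_line[OF D2[OF U[of a b]]] that a by auto
  obtain b where b: "0 < b" "b < s" "k s - k 0 = (s - 0) * D2 (u + a *\<^sub>R v + b *\<^sub>R w) w"
    using MVT2[OF s, of k "\<lambda>b. D2 (u + a *\<^sub>R v + b *\<^sub>R w) w"] k by auto
  show ?thesis
  proof (rule that[OF a(1,2) b(1,2)])
    have "f (u + s *\<^sub>R v + s *\<^sub>R w) - f (u + s *\<^sub>R v) - f (u + s *\<^sub>R w) + f u = g s - g 0"
      by (simp add: g_def add_ac)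
    also have "\<dots> = s * (k s - k 0)"
      unfolding a(3) k_def by (simp add: add_ac)
    finally show "f (u + s *\<^sub>R v + s *\<^sub>R w) - f (u + s *\<^sub>R v) - f (u + s *\<^sub>R w) + f u
      = s * s * D2 (u + a *\<^sub>R v + b *\<^sub>R w) w" unfolding b(3) by simp
  qed
qed

text \<open>
  The classical argument: the second difference over a small parallelogram is symmetric in its two
  sides and, by the mean value theorem applied twice, equals each of the mixed derivatives at a
  nearby point.
\<close>

lemma second_derivative_symmetric_real:
  fixes f :: "'a::real_normed_vector \<Rightarrow> real"
  assumes U: "open U" "u \<in> U"
    and D: "\<And>x. x \<in> U \<Longrightarrow> (f has_derivative D x) (at x)"
    and D2: "\<And>x v. x \<in> U \<Longrightarrow> ((\<lambda>x. D x v) has_derivative D2 x v) (at x)"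
    and cont: "\<And>v w. continuous_on U (\<lambda>x. D2 x v w)"
  shows "D2 u v w = D2 u w v"
proof (rule ccontr)
  assume ne: "D2 u v w \<noteq> D2 u w v"
  define e where "e = \<bar>D2 u v w - D2 u w v\<bar> / 2"
  have e: "0 < e" using ne by (simp add: e_def)
  have lim: "((\<lambda>x. D2 x v w) \<longlongrightarrow> D2 u v w) (nhds u)" for v w
    using cont[of v w] U by (metis continuous_on_eq_continuous_at isCont_def tendsto_at_iff_tendsto_nhds)
  have "\<forall>\<^sub>F x in nhds u. x \<in> U \<and> \<bar>D2 x v w - D2 u v w\<bar> < e \<and> \<bar>D2 x w v - D2 u w v\<bar> < e"
    using tendstoD[OF lim[of v w] e] tendstoD[OF lim[of w v] e] eventually_nhds_in_open[OF U]
    by eventually_elim (auto simp: dist_real_def)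
  then obtain r where r: "0 < r"
    "\<And>x. dist x u < r \<Longrightarrow> x \<in> U \<and> \<bar>D2 x v w - D2 u v w\<bar> < e \<and> \<bar>D2 x w v - D2 u w v\<bar> < e"
    unfolding eventually_nhds_metric by blast
  obtain N where N: "N = norm v + norm w + 1" by simp
  define s where "s = r / (2 * N)"
  have nn: "0 < N" by (simp add: N add_nonneg_pos)
  have s: "0 < s" using r(1) nn by (simp add: s_def)
  have close: "dist (u + a *\<^sub>R v + b *\<^sub>R w) u < r" if "0 \<le> a" "a \<le> s" "0 \<le> b" "b \<le> s" for a b
  proof -
    have "dist (u + a *\<^sub>R v + b *\<^sub>R w) u = norm (a *\<^sub>R v + b *\<^sub>R w)"
      by (simp add: dist_norm algebra_simps)
    also have "\<dots> \<le> a * norm v + b * norm w"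
      using norm_triangle_ineq[of "a *\<^sub>R v" "b *\<^sub>R w"] that by simp
    also have "\<dots> \<le> s * norm v + s * norm w"
      using that by (intro add_mono mult_right_mono) auto
    also have "\<dots> \<le> s * N" using s by (simp add: N algebra_simps)
    also have "\<dots> = r / 2" using nn by (simp add: s_def)
    also have "\<dots> < r" using r(1) by simp
    finally show ?thesis .
  qed
  obtain a b where ab: "0 < a" "a < s" "0 < b" "b < s"
    "f (u + s *\<^sub>R v + s *\<^sub>R w) - f (u + s *\<^sub>R v) - f (u + s *\<^sub>R w) + f u
      = s * s * D2 (u + a *\<^sub>R v + b *\<^sub>R w) v w"
    by (rule second_difference_mean_value[OF s, of u v w U f D "\<lambda>x. D2 x v"]) (use r close D D2 in auto)
  obtain a' b' where ab': "0 < a'" "a' < s" "0 < b'" "b' < s"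
    "f (u + s *\<^sub>R w + s *\<^sub>R v) - f (u + s *\<^sub>R w) - f (u + s *\<^sub>R v) + f u
      = s * s * D2 (u + a' *\<^sub>R w + b' *\<^sub>R v) w v"
  proof (rule second_difference_mean_value[OF s, of u w v U f D "\<lambda>x. D2 x w"])
    fix a b assume "0 \<le> a" "a \<le> s" "0 \<le> b" "b \<le> s"
    then show "u + a *\<^sub>R w + b *\<^sub>R v \<in> U" using r close[of b a] by (simp add: add_ac)
  qed (use D D2 in auto)
  have sw: "u + s *\<^sub>R w + s *\<^sub>R v = u + s *\<^sub>R v + s *\<^sub>R w" by (simp add: algebra_simps)
  have "s * s * D2 (u + a *\<^sub>R v + b *\<^sub>R w) v w = s * s * D2 (u + a' *\<^sub>R w + b' *\<^sub>R v) w v"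
    using ab(5) ab'(5)[unfolded sw] by linarith
  then have eq: "D2 (u + a *\<^sub>R v + b *\<^sub>R w) v w = D2 (u + a' *\<^sub>R w + b' *\<^sub>R v) w v"
    using s by simp
  have "\<bar>D2 (u + a *\<^sub>R v + b *\<^sub>R w) v w - D2 u v w\<bar> < e"
    using r(2) close[of a b] ab by auto
  moreover have "\<bar>D2 (u + a' *\<^sub>R w + b' *\<^sub>R v) w v - D2 u w v\<bar> < e"
    using r(2) close[of b' a'] ab' by (auto simp: add_ac)
  ultimately show False using eq by (simp add: e_def abs_if split: if_splits)
qed

section \<open>Charts\<close>

definition dpar :: "'n::finite chart \<Rightarrow> real^'n \<Rightarrow> real^'n \<Rightarrow> 'n minkowski" where
  "dpar c u = frechet_derivative (par c) (at u)"

definition d2par :: "'n::finite chart \<Rightarrow> real^'n \<Rightarrow> real^'n \<Rightarrow> real^'n \<Rightarrow> 'n minkowski" where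
  "d2par c u v w = frechet_derivative (\<lambda>x. dpar c x v) (at u) w"

lemma bounded_bilinear_mink: "bounded_bilinear mink"
proof
  show "\<exists>K. \<forall>a b. norm (mink a b) \<le> norm a * norm b * K"
  proof (intro exI[of _ 2] allI)
    fix a b :: "'b minkowski"
    have 1: "norm (fst a) \<le> norm a" "norm (snd a) \<le> norm a" "norm (fst b) \<le> norm b" "norm (snd b) \<le> norm b"
      using norm_fst_le[of "fst a" "snd a"] norm_snd_le[of "snd a" "fst a"]
        norm_fst_le[of "fst b" "snd b"] norm_snd_le[of "snd b" "fst b"] by simp_all
    have "norm (mink a b) \<le> norm (fst a * fst b) + norm (snd a \<bullet> snd b)"
      unfolding mink_def using norm_triangle_ineq[of "- (fst a * fst b)" "snd a \<bullet> snd b"] by simp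
    also have "\<dots> \<le> norm (fst a) * norm (fst b) + norm (snd a) * norm (snd b)"
      using Cauchy_Schwarz_ineq2[of "snd a" "snd b"] by (simp add: abs_mult)
    also have "\<dots> \<le> norm a * norm b + norm a * norm b"
      using 1 by (intro add_mono mult_mono) auto
    finally show "norm (mink a b) \<le> norm a * norm b * 2" by simp
  qed
qed (simp_all add: mink_def algebra_simps)

lemmas mink_add_left = bounded_bilinear.add_left[OF bounded_bilinear_mink]
  and mink_add_right = bounded_bilinear.add_right[OF bounded_bilinear_mink]
  and mink_scaleR_left = bounded_bilinear.scaleR_left[OF bounded_bilinear_mink]
  and mink_scaleR_right = bounded_bilinear.scaleR_right[OF bounded_bilinear_mink]
  and mink_diff_left = bounded_bilinear.diff_left[OF bounded_bilinear_mink]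
  and mink_diff_right = bounded_bilinear.diff_right[OF bounded_bilinear_mink]
  and mink_minus_left = bounded_bilinear.minus_left[OF bounded_bilinear_mink]
  and mink_minus_right = bounded_bilinear.minus_right[OF bounded_bilinear_mink]
  and mink_sum_left = bounded_bilinear.sum_left[OF bounded_bilinear_mink]
  and mink_sum_right = bounded_bilinear.sum_right[OF bounded_bilinear_mink]
  and tendsto_mink = bounded_bilinear.tendsto[OF bounded_bilinear_mink]
  and continuous_on_mink [continuous_intros] = bounded_bilinear.continuous_on[OF bounded_bilinear_mink]
  and has_derivative_mink = bounded_bilinear.FDERIV[OF bounded_bilinear_mink]

lemma mink_commute: "mink X Y = mink Y X"
  by (simp add: mink_def inner_commute mult.commute)

lemma vec_eq_sum_axis: "(v :: real^'n::finite) = (\<Sum>i\<in>UNIV. (v $ i) *\<^sub>R axis i (1::real))"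
  by (simp add: vec_eq_iff axis_def if_distrib cong: if_cong)

lemma linear_eq_sum_axis:
  fixes L :: "real^'n::finite \<Rightarrow> 'b::real_vector"
  assumes "linear L" shows "L v = (\<Sum>i\<in>UNIV. (v $ i) *\<^sub>R L (axis i 1))"
  using linear_sum[OF assms, of "\<lambda>i. (v $ i) *\<^sub>R axis i 1" UNIV] vec_eq_sum_axis[of v]
  by (simp add: linear_scale[OF assms])

context
  fixes S :: "'n::finite minkowski set" and c :: "'n chart"
  assumes c: "c \<in> charts S"
begin

lemma open_region: "open (region c)"
  using c by (simp add: charts_def)

lemma half_region_subset: "half_region c \<subseteq> region c"
  by (auto simp: half_region_def)

lemma par_has_derivative:
  assumes "u \<in> region c" shows "(par c has_derivative dpar c u) (at u)"
proof -
  have "Ck_on (Suc 0) (region c) (par c)" using c by (simp add: charts_def smooth_on_def)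
  then have "par c differentiable (at u)"
    using assms open_region by (simp add: differentiable_on_eq_differentiable_at)
  then show ?thesis unfolding dpar_def by (simp add: frechet_derivative_works)
qed

lemma dpar_has_derivative:
  assumes "u \<in> region c" shows "((\<lambda>x. dpar c x v) has_derivative d2par c u v) (at u)"
proof -
  have "Ck_on (Suc (Suc 0)) (region c) (par c)" using c unfolding charts_def smooth_on_def by blast
  then have "(\<lambda>x. dpar c x v) differentiable (at u)"
    using assms open_region by (simp add: differentiable_on_eq_differentiable_at dpar_def)
  then show ?thesis unfolding d2par_def by (simp add: frechet_derivative_works)
qed

lemma continuous_on_d2par: "continuous_on (region c) (\<lambda>x. d2par c x v w)"
proof -
  have "Ck_on (Suc (Suc 0)) (region c) (par c)" using c unfolding charts_def smooth_on_def by blast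
  then show ?thesis by (simp add: d2par_def dpar_def)
qed

lemma continuous_on_dpar: "continuous_on (region c) (\<lambda>x. dpar c x v)"
  by (intro continuous_at_imp_continuous_on ballI has_derivative_continuous[OF dpar_has_derivative])

lemma continuous_on_par: "continuous_on (region c) (par c)"
  by (intro continuous_at_imp_continuous_on ballI has_derivative_continuous[OF par_has_derivative])

lemma linear_dpar: "u \<in> region c \<Longrightarrow> linear (dpar c u)"
  by (rule has_derivative_linear[OF par_has_derivative])

lemma linear_d2par_right: "u \<in> region c \<Longrightarrow> linear (d2par c u v)"
  by (rule has_derivative_linear[OF dpar_has_derivative])

lemma inj_dpar: "u \<in> half_region c \<Longrightarrow> inj (dpar c u)"
  using c by (auto simp: charts_def dpar_def)

lemma d2par_commute:
  assumes u: "u \<in> region c" shows "d2par c u v w = d2par c u w v"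
proof (rule euclidean_eqI)
  fix b :: "'n minkowski"
  show "d2par c u v w \<bullet> b = d2par c u w v \<bullet> b"
    by (rule second_derivative_symmetric_real[OF open_region u, of "\<lambda>x. par c x \<bullet> b" "\<lambda>x v. dpar c x v \<bullet> b"
        "\<lambda>x v w. d2par c x v w \<bullet> b"])
      (auto intro!: has_derivative_inner_left par_has_derivative dpar_has_derivative continuous_intros continuous_on_d2par)
qed

lemma linear_d2par_left: "u \<in> region c \<Longrightarrow> linear (\<lambda>v. d2par c u v w)"
  using linear_d2par_right[of u w] by (simp add: d2par_commute[of u _ w])

lemma d2par_expand:
  assumes u: "u \<in> region c"
  shows "d2par c u v w = (\<Sum>i\<in>UNIV. \<Sum>j\<in>UNIV. (v $ i * w $ j) *\<^sub>R d2par c u (axis i 1) (axis j 1))"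
  using linear_eq_sum_axis[OF linear_d2par_left[OF u], of v w]
    linear_eq_sum_axis[OF linear_d2par_right[OF u], of _ w]
  by (simp add: scaleR_sum_right)

text \<open>
  Taylor expansion of order two, tested against a normal vector so that the linear term drops out.
  The directions \<open>x n\<close> are allowed to vary, since a straight line in one chart is curved in another.
\<close>

lemma mink_par_second_order:
  assumes u: "u \<in> region c" and \<nu>: "\<And>x. mink \<nu> (dpar c u x) = 0"
    and x: "x \<longlonglongrightarrow> v" and t: "t \<longlonglongrightarrow> 0" "\<And>n. 0 < t n"
  shows "(\<lambda>n. mink \<nu> (par c (u + t n *\<^sub>R x n) - par c u) / (t n)\<^sup>2) \<longlonglongrightarrow> mink \<nu> (d2par c u v v) / 2"
proof -
  obtain r where r: "0 < r" "ball u r \<subseteq> region c"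
    using open_region u open_contains_ball by blast
  have tx: "(\<lambda>n. t n *\<^sub>R x n) \<longlonglongrightarrow> 0"
    using tendsto_scaleR[OF t(1) x] by simp
  have "\<forall>\<^sub>F n in sequentially. norm (t n *\<^sub>R x n) < r"
    using tendstoD[OF tx r(1)] by (simp add: dist_norm)
  then obtain n0 where n0: "\<And>n. n0 \<le> n \<Longrightarrow> norm (t n *\<^sub>R x n) < r"
    unfolding eventually_sequentially by blast
  have "\<exists>\<xi>. n0 \<le> n \<longrightarrow> 0 < \<xi> \<and> \<xi> < 1 \<and> mink \<nu> (par c (u + t n *\<^sub>R x n) - par c u) / (t n)\<^sup>2
      = mink \<nu> (d2par c (u + \<xi> *\<^sub>R (t n *\<^sub>R x n)) (x n) (x n)) / 2" for n
  proof (cases "n0 \<le> n")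
    case n: True
    define d where "d = t n *\<^sub>R x n"
    have seg: "u + s *\<^sub>R d \<in> region c" if "0 \<le> s" "s \<le> 1" for s
    proof -
      have "norm (s *\<^sub>R d) \<le> norm d" using that by (simp add: mult_left_le_one_le)
      also have "\<dots> < r" using n0[OF n] by (simp add: d_def)
      finally show ?thesis using r(2) by (auto simp: subset_iff dist_norm)
    qed
    define diff where "diff = (\<lambda>m::nat. \<lambda>s. if m = 0 then mink \<nu> (par c (u + s *\<^sub>R d))
        else if m = 1 then mink \<nu> (dpar c (u + s *\<^sub>R d) d) else mink \<nu> (d2par c (u + s *\<^sub>R d) d d))"
    have blm: "bounded_linear (mink \<nu>)" by (rule bounded_bilinear.bounded_linear_right[OF bounded_bilinear_mink])
    have diff0: "(diff 0 has_real_derivative diff 1 s) (at s)" if "0 \<le> s" "s \<le> 1" for s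
      using bounded_linear.has_vector_derivative[OF blm has_derivative_along_line[OF par_has_derivative[OF seg[OF that]]]]
      by (simp add: diff_def has_real_derivative_iff_has_vector_derivative)
    have diff1: "(diff 1 has_real_derivative diff 2 s) (at s)" if "0 \<le> s" "s \<le> 1" for s
      using bounded_linear.has_vector_derivative[OF blm has_derivative_along_line[OF dpar_has_derivative[OF seg[OF that]]], of d]
      by (simp add: diff_def has_real_derivative_iff_has_vector_derivative)
    have "\<exists>\<xi>>0. \<xi> < 1 \<and> diff 0 1 = (\<Sum>m<2. diff m 0 / fact m * 1 ^ m) + diff 2 \<xi> / fact 2 * 1 ^ 2"
    proof (rule Maclaurin)
      show "\<forall>m s. m < 2 \<and> 0 \<le> s \<and> s \<le> 1 \<longrightarrow> (diff m has_real_derivative diff (Suc m) s) (at s)"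
      proof (intro allI impI)
        fix m :: nat and s :: real assume ms: "m < 2 \<and> 0 \<le> s \<and> s \<le> 1"
        then consider "m = 0" | "m = 1" by linarith
        then show "(diff m has_real_derivative diff (Suc m) s) (at s)"
          by cases (use ms diff0[of s] diff1[of s] in \<open>simp_all add: numeral_2_eq_2\<close>)
      qed
    qed auto
    then obtain \<xi> where \<xi>: "0 < \<xi>" "\<xi> < 1" "diff 0 1 = diff 0 0 + diff 1 0 + diff 2 \<xi> / 2"
      by (auto simp: numeral_2_eq_2)
    have reg: "u + \<xi> *\<^sub>R d \<in> region c" using \<xi> seg by simp
    have "diff 0 1 - diff 0 0 = diff 2 \<xi> / 2"
      using \<xi>(3) \<nu>[of d] by (simp add: diff_def)
    then have "mink \<nu> (par c (u + d) - par c u) = (t n)\<^sup>2 * mink \<nu> (d2par c (u + \<xi> *\<^sub>R d) (x n) (x n)) / 2"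
      using linear_scale[OF linear_d2par_left[OF reg], of "t n" "x n"] linear_scale[OF linear_d2par_right[OF reg], of "x n" "t n" "x n"]
      by (simp add: diff_def mink_diff_right d_def power2_eq_square mink_scaleR_right)
    then have "mink \<nu> (par c (u + t n *\<^sub>R x n) - par c u) / (t n)\<^sup>2
      = mink \<nu> (d2par c (u + \<xi> *\<^sub>R (t n *\<^sub>R x n)) (x n) (x n)) / 2"
      using t(2)[of n] by (simp add: d_def)
    then show ?thesis using \<xi> by blast
  qed auto
  then obtain \<xi> where \<xi>: "\<And>n. n0 \<le> n \<Longrightarrow> 0 < \<xi> n \<and> \<xi> n < 1 \<and> mink \<nu> (par c (u + t n *\<^sub>R x n) - par c u) / (t n)\<^sup>2
      = mink \<nu> (d2par c (u + \<xi> n *\<^sub>R (t n *\<^sub>R x n)) (x n) (x n)) / 2"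
    by metis
  define p where "p n = u + \<xi> n *\<^sub>R (t n *\<^sub>R x n)" for n
  have p0: "(\<lambda>n. p n - u) \<longlonglongrightarrow> 0"
  proof (rule Lim_null_comparison[OF _ tendsto_norm_zero[OF tx]])
    show "\<forall>\<^sub>F n in sequentially. norm (p n - u) \<le> norm (t n *\<^sub>R x n)"
      unfolding eventually_sequentially
    proof (intro exI[of _ n0] allI impI)
      fix n assume "n0 \<le> n"
      then have "\<bar>\<xi> n\<bar> \<le> 1" using \<xi> by fastforce
      then show "norm (p n - u) \<le> norm (t n *\<^sub>R x n)"
        by (simp only: p_def add_diff_cancel_left' norm_scaleR[of "\<xi> n"]) (simp add: mult_left_le_one_le)
    qed
  qed
  then have pu: "p \<longlonglongrightarrow> u" by (simp add: LIM_zero_iff)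
  have preg: "\<forall>\<^sub>F n in sequentially. p n \<in> region c"
    using pu open_region u by (rule topological_tendstoD)
  have "(\<lambda>n. (\<Sum>i\<in>UNIV. \<Sum>j\<in>UNIV. (x n $ i * x n $ j) *\<^sub>R d2par c (p n) (axis i 1) (axis j 1)))
    \<longlonglongrightarrow> (\<Sum>i\<in>UNIV. \<Sum>j\<in>UNIV. (v $ i * v $ j) *\<^sub>R d2par c u (axis i 1) (axis j 1))"
  proof (intro tendsto_sum tendsto_scaleR tendsto_mult tendsto_vec_nth x)
    fix i j
    have "isCont (\<lambda>z. d2par c z (axis i 1) (axis j 1)) u"
      using continuous_on_d2par open_region u by (simp add: continuous_on_eq_continuous_at)
    then show "(\<lambda>n. d2par c (p n) (axis i 1) (axis j 1)) \<longlonglongrightarrow> d2par c u (axis i 1) (axis j 1)"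
      by (rule isCont_tendsto_compose[OF _ pu])
  qed
  then have "(\<lambda>n. d2par c (p n) (x n) (x n)) \<longlonglongrightarrow> d2par c u v v"
    unfolding d2par_expand[OF u, of v v]
    by (rule Lim_transform_eventually) (use preg in eventually_elim, simp add: d2par_expand)
  then have "(\<lambda>n. mink \<nu> (d2par c (p n) (x n) (x n)) / 2) \<longlonglongrightarrow> mink \<nu> (d2par c u v v) / 2"
    by (intro tendsto_intros tendsto_mink) auto
  then show ?thesis
    by (rule Lim_transform_eventually)
      (use \<xi> in \<open>auto simp: eventually_sequentially p_def intro!: exI[of _ n0]\<close>)
qed

end

section \<open>Change of charts\<close>

text \<open>
  The directions in which a half space can be left at \<open>u\<close> without leaving it at once; only they
  are visible from both of two overlapping charts.
\<close>

definition inward :: "'n::finite chart \<Rightarrow> real^'n \<Rightarrow> real^'n \<Rightarrow> bool" where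
  "inward c u v \<longleftrightarrow> (u $ face c = 0 \<longrightarrow> 0 \<le> v $ face c)"

text \<open>
  Charts are only homeomorphisms onto their images, so no smooth transition map is assumed. Instead
  the line \<open>u + t v\<close> is read in the second chart: injectivity of \<open>dpar c' u'\<close> bounds the difference
  quotients there, their limit is the direction \<open>v'\<close>, and the expansion
  \<open>mink_par_second_order\<close> in both charts identifies the second derivatives in normal directions.
\<close>

lemma chart_transition:
  fixes c c' :: "'n::finite chart"
  assumes c: "c \<in> charts S" "u \<in> half_region c" and c': "c' \<in> charts S" "u' \<in> half_region c'"
    and same: "par c u = par c' u'" and v: "inward c u v"
  obtains v' where "dpar c' u' v' = dpar c u v" "inward c' u' v'"
    "\<And>\<nu>. (\<And>x. mink \<nu> (dpar c u x) = 0) \<Longrightarrow> (\<And>x. mink \<nu> (dpar c' u' x) = 0) \<Longrightarrow>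
        mink \<nu> (d2par c u v v) = mink \<nu> (d2par c' u' v' v')"
proof -
  define y where "y = par c u"
  have ur: "u \<in> region c" "u' \<in> region c'"
    using half_region_subset[OF c(1)] half_region_subset[OF c'(1)] c c' by auto
  define t where "t n = inverse (real (Suc n))" for n
  have t0: "0 < t n" for n by (simp add: t_def)
  have t: "t \<longlonglongrightarrow> 0" unfolding t_def by (rule LIMSEQ_inverse_real_of_nat)
  have tv: "(\<lambda>n. u + t n *\<^sub>R v) \<longlonglongrightarrow> u"
    using tendsto_add[OF tendsto_const tendsto_scaleR[OF t tendsto_const], of u v] by simp
  have in_region: "\<forall>\<^sub>F n in sequentially. u + t n *\<^sub>R v \<in> region c"
    using tv open_region[OF c(1)] ur(1) by (rule topological_tendstoD)
  have in_half: "\<forall>\<^sub>F n in sequentially. u + t n *\<^sub>R v \<in> half_region c"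
  proof (cases "u $ face c = 0")
    case True
    then show ?thesis
      using in_region v t0 by (auto simp: half_region_def inward_def less_imp_le elim!: eventually_mono)
  next
    case False
    then have "0 < u $ face c" using c(2) by (simp add: half_region_def)
    then have "\<forall>\<^sub>F n in sequentially. 0 < (u + t n *\<^sub>R v) $ face c"
      by (rule order_tendstoD(1)[OF tendsto_vec_nth[OF tv]])
    with in_region show ?thesis
      by eventually_elim (simp add: half_region_def)
  qed
  define z where "z n = par c (u + t n *\<^sub>R v)" for n
  have zy: "z \<longlonglongrightarrow> y"
    unfolding z_def y_def
    by (rule isCont_tendsto_compose[OF has_derivative_continuous[OF par_has_derivative[OF c(1) ur(1)]] tv])
  obtain q' where q': "homeomorphism (half_region c') (patch c') (par c') q'"
    using c'(1) by (auto simp: charts_def)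
  obtain O' where O': "open O'" "patch c' = S \<inter> O'"
    using c'(1) by (auto simp: charts_def openin_open)
  have "y \<in> patch c'" using same c'(2) by (auto simp: y_def patch_def)
  then have "\<forall>\<^sub>F n in sequentially. z n \<in> O'"
    using O' by (intro topological_tendstoD[OF zy]) auto
  moreover have "\<forall>\<^sub>F n in sequentially. z n \<in> S"
  proof -
    have "patch c \<subseteq> S" using c(1) by (auto simp: charts_def dest: openin_imp_subset)
    then show ?thesis
      using in_half by (auto simp: z_def patch_def elim!: eventually_mono)
  qed
  ultimately have zp: "\<forall>\<^sub>F n in sequentially. z n \<in> patch c'"
    unfolding O'(2) by eventually_elim simp
  define w where "w n = q' (z n)" for n
  have q'y: "q' y = u'" using q' c'(2) same by (auto simp: homeomorphism_def y_def)
  have wu: "w \<longlonglongrightarrow> u'"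
    unfolding w_def q'y[symmetric]
    by (rule continuous_on_tendsto_compose[OF homeomorphism_cont2[OF q'] zy \<open>y \<in> patch c'\<close> zp])
  have w: "\<forall>\<^sub>F n in sequentially. w n \<in> half_region c' \<and> par c' (w n) = z n"
    using zp by eventually_elim (use q' in \<open>auto simp: w_def homeomorphism_def\<close>)
  let ?L = "dpar c u" and ?L' = "dpar c' u'"
  have lin: "linear ?L" "linear ?L'" using linear_dpar c c' ur by blast+
  have inj': "inj ?L'" using inj_dpar c' by blast
  define \<zeta> where "\<zeta> n = (1 / t n) *\<^sub>R (z n - y)" for n
  have \<zeta>: "\<zeta> \<longlonglongrightarrow> ?L v"
    unfolding \<zeta>_def z_def y_def
    by (rule difference_quotient_tendsto[OF par_has_derivative[OF c(1) ur(1)] t t0])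
  obtain B where B: "0 < B" "\<And>x. B * norm x \<le> norm (?L' x)"
    by (rule linear_inj_bounded_below_pos[OF lin(2) inj']) (rule that)
  define x where "x n = (1 / t n) *\<^sub>R (w n - u')" for n
  define \<rho> where "\<rho> n = (1 / t n) *\<^sub>R (par c' (w n) - par c' u' - ?L' (w n - u'))" for n
  have \<rho>x: "\<forall>\<^sub>F n in sequentially. norm (\<rho> n) \<le> e * norm (x n)" if "0 < e" for e
  proof -
    have "\<exists>d>0. \<forall>y. norm (y - u') < d \<longrightarrow> norm (par c' y - par c' u' - ?L' (y - u')) \<le> e * norm (y - u')"
      by (rule par_has_derivative[OF c'(1) ur(2), unfolded has_derivative_at_alt, THEN conjunct2, rule_format, OF that])
    then obtain d where d: "0 < d" "\<And>y. norm (y - u') < d \<Longrightarrow> norm (par c' y - par c' u' - ?L' (y - u')) \<le> e * norm (y - u')"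
      by blast
    have "\<forall>\<^sub>F n in sequentially. norm (w n - u') < d"
      using tendstoD[OF wu d(1)] by (simp add: dist_norm)
    then show ?thesis
    proof eventually_elim
      case (elim n)
      have "norm (\<rho> n) = norm (par c' (w n) - par c' u' - ?L' (w n - u')) / t n"
        using t0[of n] by (simp add: \<rho>_def)
      also have "\<dots> \<le> e * norm (w n - u') / t n"
        using d(2)[OF elim] t0[of n] by (intro divide_right_mono) auto
      also have "\<dots> = e * norm (x n)" using t0[of n] by (simp add: x_def)
      finally show ?case .
    qed
  qed
  have split: "\<forall>\<^sub>F n in sequentially. ?L' (x n) = \<zeta> n - \<rho> n"
    using w
  proof eventually_elim
    case (elim n)
    have "?L' (x n) = (1 / t n) *\<^sub>R ?L' (w n - u')"
      unfolding x_def by (rule linear_scale[OF lin(2)])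
    then show ?case
      using same elim by (simp add: \<zeta>_def \<rho>_def y_def scaleR_diff_right)
  qed
  obtain C where C: "\<And>n. norm (\<zeta> n) \<le> C"
    using convergent_imp_bounded[OF \<zeta>] by (auto simp: bounded_iff)
  have xb: "\<forall>\<^sub>F n in sequentially. norm (x n) \<le> 2 * C / B"
    using split \<rho>x[OF half_gt_zero[OF B(1)]]
  proof eventually_elim
    case (elim n)
    have "B * norm (x n) \<le> norm (\<zeta> n - \<rho> n)" using B(2)[of "x n"] elim(1) by simp
    also have "\<dots> \<le> norm (\<zeta> n) + norm (\<rho> n)" by (rule norm_triangle_ineq4)
    also have "\<dots> \<le> C + B / 2 * norm (x n)" using C[of n] elim(2) B(1) by simp
    finally have "norm (x n) * (B / 2) \<le> C" by (simp add: field_simps)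
    then show ?case using B(1) by (simp add: field_simps)
  qed
  have "\<rho> \<longlonglongrightarrow> 0"
  proof (rule tendsto_norm_zero_cancel, rule tendstoI)
    fix e :: real assume e: "0 < e"
    define M where "M = \<bar>2 * C / B\<bar> + 1"
    have M: "0 < M" by (simp add: M_def add_nonneg_pos)
    have "\<forall>\<^sub>F n in sequentially. norm (\<rho> n) \<le> e / (2 * M) * norm (x n)" using e M by (intro \<rho>x) simp
    then show "\<forall>\<^sub>F n in sequentially. dist (norm (\<rho> n)) 0 < e"
      using xb
    proof eventually_elim
      case (elim n)
      have "norm (\<rho> n) \<le> e / (2 * M) * norm (x n)" by (rule elim)
      also have "\<dots> \<le> e / (2 * M) * M"
      proof (rule mult_left_mono)
        show "norm (x n) \<le> M" unfolding M_def using elim(2) by linarith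
      qed (use e M in auto)
      also have "\<dots> < e" using e M by simp
      finally show ?case by simp
    qed
  qed
  then have "(\<lambda>n. \<zeta> n - \<rho> n) \<longlonglongrightarrow> ?L v" using tendsto_diff[OF \<zeta>] by fastforce
  then have Lx: "(\<lambda>n. ?L' (x n)) \<longlonglongrightarrow> ?L v"
    by (rule Lim_transform_eventually) (use split in eventually_elim, simp)
  obtain g where g: "linear g" "g \<circ> ?L' = id"
    using linear_injective_left_inverse[OF lin(2) inj'] by blast
  have gL: "g (?L' a) = a" for a using g(2) by (simp add: fun_eq_iff)
  define v' where "v' = g (?L v)"
  have xv: "x \<longlonglongrightarrow> v'"
  proof -
    have "isCont g (?L v)" using g(1) by (simp add: linear_continuous_at linear_conv_bounded_linear)
    from isCont_tendsto_compose[OF this Lx] show ?thesis by (simp add: gL v'_def)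
  qed
  have Lv': "?L' v' = ?L v"
  proof -
    have "isCont ?L' v'" using lin(2) by (simp add: linear_continuous_at linear_conv_bounded_linear)
    from isCont_tendsto_compose[OF this xv] show ?thesis using LIMSEQ_unique[OF Lx] by simp
  qed
  have "inward c' u' v'"
    unfolding inward_def
  proof
    assume 0: "u' $ face c' = 0"
    have "\<forall>\<^sub>F n in sequentially. 0 \<le> x n $ face c'"
      using w
    proof eventually_elim
      case (elim n)
      then show ?case using 0 t0[of n] by (simp add: x_def half_region_def)
    qed
    then show "0 \<le> v' $ face c'"
      by (intro tendsto_lowerbound[OF tendsto_vec_nth[OF xv]]) auto
  qed
  moreover have "mink \<nu> (d2par c u v v) = mink \<nu> (d2par c' u' v' v')"
    if \<nu>: "\<And>x. mink \<nu> (?L x) = 0" "\<And>x. mink \<nu> (?L' x) = 0" for \<nu>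
  proof -
    have 1: "(\<lambda>n. mink \<nu> (z n - y) / (t n)\<^sup>2) \<longlonglongrightarrow> mink \<nu> (d2par c u v v) / 2"
      unfolding z_def y_def by (rule mink_par_second_order[OF c(1) ur(1) \<nu>(1) tendsto_const t t0])
    have "(\<lambda>n. mink \<nu> (par c' (u' + t n *\<^sub>R x n) - par c' u') / (t n)\<^sup>2) \<longlonglongrightarrow> mink \<nu> (d2par c' u' v' v') / 2"
      by (rule mink_par_second_order[OF c'(1) ur(2) \<nu>(2) xv t t0])
    then have 2: "(\<lambda>n. mink \<nu> (z n - y) / (t n)\<^sup>2) \<longlonglongrightarrow> mink \<nu> (d2par c' u' v' v') / 2"
    proof (rule Lim_transform_eventually)
      show "\<forall>\<^sub>F n in sequentially. mink \<nu> (par c' (u' + t n *\<^sub>R x n) - par c' u') / (t n)\<^sup>2 = mink \<nu> (z n - y) / (t n)\<^sup>2"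
        using w
      proof eventually_elim
        case (elim n)
        have "u' + t n *\<^sub>R x n = w n" using t0[of n] by (simp add: x_def)
        then show ?case using elim same by (simp add: y_def)
      qed
    qed
    show ?thesis using LIMSEQ_unique[OF 1 2] by simp
  qed
  ultimately show ?thesis using that[OF Lv'] by blast
qed

section \<open>Determinants\<close>

lemma congruence_entry:
  fixes P M :: "real^'n^'n::finite"
  shows "(transpose P ** M ** P) $ i $ j = column i P \<bullet> (M *v column j P)"
proof -
  have "(transpose P ** M ** P) $ i $ j = (\<Sum>l\<in>UNIV. (\<Sum>k\<in>UNIV. P $ k $ i * M $ k $ l) * P $ l $ j)"
    by (simp add: matrix_matrix_mult_def transpose_def)
  also have "\<dots> = (\<Sum>l\<in>UNIV. \<Sum>k\<in>UNIV. P $ k $ i * (M $ k $ l * P $ l $ j))"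
    by (simp add: sum_distrib_right mult.assoc)
  also have "\<dots> = (\<Sum>k\<in>UNIV. \<Sum>l\<in>UNIV. P $ k $ i * (M $ k $ l * P $ l $ j))"
    by (rule sum.swap)
  also have "\<dots> = column i P \<bullet> (M *v column j P)"
    by (simp add: inner_vec_def column_def matrix_vector_mult_def sum_distrib_left)
  finally show ?thesis .
qed

text \<open>
  The induced metric seen through the projection to space: a tangent vector is \<open>(b \<bullet> x, x)\<close>, so its
  square is \<open>x \<bullet> x - (b \<bullet> x)\<^sup>2\<close>.
\<close>

definition rank_one_drop :: "real^'n \<Rightarrow> real^'n^'n::finite" where
  "rank_one_drop b = (\<chi> i j. (if i = j then 1 else 0) - b $ i * b $ j)"

lemma rank_one_drop_vector: "rank_one_drop b *v x = x - (b \<bullet> x) *\<^sub>R b"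
proof -
  have "(\<Sum>j\<in>UNIV. ((if i = j then 1 else 0) - b $ i * b $ j) * x $ j) = x $ i - (\<Sum>j\<in>UNIV. b $ j * x $ j) * b $ i" for i
  proof -
    have "((if i = j then 1 else 0) - b $ i * b $ j) * x $ j = (if i = j then x $ j else 0) - b $ j * x $ j * b $ i" for j
      by (simp add: algebra_simps)
    then show ?thesis by (simp add: sum_subtractf sum_distrib_right)
  qed
  then show ?thesis
    by (simp add: rank_one_drop_def matrix_vector_mult_def vec_eq_iff inner_vec_def)
qed

lemma det_rank_one_drop: "det (rank_one_drop (b :: real^'n::finite)) = 1 - b \<bullet> b"
proof -
  fix k :: 'n
  have "norm (norm b *\<^sub>R axis k (1::real)) = norm b" by simp
  then obtain f where f: "orthogonal_transformation f" "f (norm b *\<^sub>R axis k (1::real)) = b"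
    by (rule orthogonal_transformation_exists)
  define Q where "Q = matrix f"
  have lf: "linear f" using f(1) by (simp add: orthogonal_transformation_def)
  have col: "column j Q = f (axis j 1)" for j
    by (simp add: Q_def matrix_def column_def vec_eq_iff)
  have "orthogonal_matrix Q" using f(1) by (simp add: Q_def orthogonal_transformation_matrix)
  then have "det Q = 1 \<or> det Q = - 1" by (rule det_orthogonal_matrix)
  then have dQ: "det Q * det Q = 1" by auto
  have ip: "f x \<bullet> f y = x \<bullet> y" for x y using f(1) by (simp add: orthogonal_transformation_def)
  have bf: "b \<bullet> f (axis j 1) = (if j = k then norm b else 0)" for j
    using ip[of "norm b *\<^sub>R axis k 1" "axis j 1"] by (simp add: f(2) inner_axis_axis)
  have entry: "(transpose Q ** rank_one_drop b ** Q) $ i $ j =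
      (if i = j then (if i = k then 1 - norm b * norm b else 1) else 0)" for i j
    unfolding congruence_entry rank_one_drop_vector col
    by (auto simp: inner_diff_right ip bf inner_axis_axis inner_commute[of "f _" b])
  have "det (rank_one_drop b) = det (transpose Q ** rank_one_drop b ** Q)"
    using dQ by (simp add: det_mul det_transpose algebra_simps)
  also have "\<dots> = (\<Prod>i\<in>UNIV. (transpose Q ** rank_one_drop b ** Q) $ i $ i)"
    by (rule det_diagonal) (simp add: entry)
  also have "\<dots> = (\<Prod>i\<in>UNIV. if i = k then 1 - norm b * norm b else 1)" by (simp add: entry)
  also have "\<dots> = 1 - b \<bullet> b" by (simp add: prod.delta norm_eq_sqrt_inner)
  finally show ?thesis .
qed

lemma det_gram_rank_one:
  fixes P :: "real^'n^'n::finite"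
  shows "det (\<chi> i j. column i P \<bullet> column j P - (b \<bullet> column i P) * (b \<bullet> column j P)) = (det P)\<^sup>2 * (1 - b \<bullet> b)"
proof -
  have "(\<chi> i j. column i P \<bullet> column j P - (b \<bullet> column i P) * (b \<bullet> column j P)) = transpose P ** rank_one_drop b ** P"
    by (simp add: vec_eq_iff congruence_entry rank_one_drop_vector inner_diff_right inner_commute[of _ b] mult.commute)
  then show ?thesis
    by (simp add: det_mul det_transpose det_rank_one_drop power2_eq_square)
qed

lemma continuous_on_det:
  fixes M :: "'a::topological_space \<Rightarrow> real^'n^'n::finite"
  assumes "\<And>i j. continuous_on A (\<lambda>u. M u $ i $ j)"
  shows "continuous_on A (\<lambda>u. det (M u))"
  unfolding det_def
  by (intro continuous_on_sum continuous_on_mult continuous_on_prod continuous_on_const assms)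

text \<open>
  Cramer's rule: the solution of a regular linear system depends continuously on the data.
\<close>

lemma continuous_on_linear_solve:
  fixes M :: "'a::topological_space \<Rightarrow> real^'n^'n::finite"
  assumes M: "\<And>i j. continuous_on A (\<lambda>u. M u $ i $ j)" and d: "continuous_on A d"
    and det: "\<And>u. u \<in> A \<Longrightarrow> det (M u) \<noteq> 0" and x: "\<And>u. u \<in> A \<Longrightarrow> M u *v x u = d u"
  shows "continuous_on A x"
proof -
  define y where "y u = (\<chi> k. det (\<chi> i j. if j = k then d u $ i else M u $ i $ j) / det (M u))" for u
  have di: "continuous_on A (\<lambda>u. d u $ i)" for i
    using d by (intro continuous_intros)
  have "continuous_on A (\<lambda>u. (\<chi> i j. if j = k then d u $ i else M u $ i $ j) $ i $ j)" for i j k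
    using M[of i j] di[of i] by (cases "j = k") auto
  then have "continuous_on A y"
    unfolding y_def by (intro continuous_on_vec_lambda continuous_on_divide continuous_on_det M) (auto simp: det)
  moreover have "x u = y u" if "u \<in> A" for u
    using cramer[OF det[OF that], of "x u" "d u"] x[OF that] by (simp add: y_def)
  ultimately show ?thesis by (simp cong: continuous_on_cong)
qed

section \<open>Tangent spaces\<close>

lemma openin_chart_image:
  assumes "c \<in> charts S" "open W"
  shows "openin (top_of_set S) (par c ` (half_region c \<inter> W))"
proof -
  obtain q where q: "homeomorphism (half_region c) (patch c) (par c) q"
    using assms(1) by (auto simp: charts_def)
  have "openin (top_of_set (patch c)) (par c ` (half_region c \<inter> W))"
    by (rule homeomorphism_imp_open_map[OF q]) (use assms(2) in auto)
  moreover have "openin (top_of_set S) (patch c)" using assms(1) by (simp add: charts_def)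
  ultimately show ?thesis by (rule openin_trans)
qed

definition proj_matrix :: "'n::finite chart \<Rightarrow> real^'n \<Rightarrow> real^'n^'n" where
  "proj_matrix c u = matrix (\<lambda>v. snd (dpar c u v))"

lemma column_proj_matrix: "column j (proj_matrix c u) = snd (dpar c u (axis j 1))"
  by (simp add: proj_matrix_def matrix_def column_def vec_eq_iff)

locale spacelike_hypersurface =
  fixes S :: "'n::finite minkowski set"
  assumes hypersurface: "hypersurface S" and compact: "compact S" and spacelike: "spacelike S"
begin

definition rep :: "'n chart \<Rightarrow> real^'n \<Rightarrow> 'n minkowski \<Rightarrow> bool" where
  "rep c u y \<longleftrightarrow> c \<in> charts S \<and> u \<in> half_region c \<and> par c u = y"

lemma rep_exists:
  assumes "y \<in> S" shows "\<exists>c u. rep c u y"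
proof -
  obtain c where "c \<in> charts S" "y \<in> patch c"
    using hypersurface assms by (auto simp: hypersurface_def)
  moreover then obtain u where "u \<in> half_region c" "par c u = y" by (auto simp: patch_def)
  ultimately show ?thesis unfolding rep_def by blast
qed

lemma repD:
  assumes "rep c u y"
  shows "c \<in> charts S" "u \<in> half_region c" "u \<in> region c" "par c u = y" "y \<in> S"
    "linear (dpar c u)" "inj (dpar c u)" "open (region c)" "0 \<le> u $ face c"
proof -
  show *: "c \<in> charts S" "u \<in> half_region c" "par c u = y" using assms by (auto simp: rep_def)
  then show r: "u \<in> region c" "0 \<le> u $ face c" by (auto simp: half_region_def)
  have "patch c \<subseteq> S" using *(1) by (auto simp: charts_def dest: openin_imp_subset)
  then show "y \<in> S" using * by (auto simp: patch_def)
  show "linear (dpar c u)" by (rule linear_dpar[OF *(1) r(1)])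
  show "inj (dpar c u)" by (rule inj_dpar[OF *(1,2)])
  show "open (region c)" by (rule open_region[OF *(1)])
qed

lemma range_dpar_subset:
  assumes r: "rep c u y" and r': "rep c' u' y"
  shows "range (dpar c u) \<subseteq> range (dpar c' u')"
proof
  fix X assume "X \<in> range (dpar c u)"
  then obtain v where v: "X = dpar c u v" by blast
  have same: "par c u = par c' u'" using repD(4)[OF r] repD(4)[OF r'] by simp
  have "inward c u v \<or> inward c u (- v)" by (auto simp: inward_def)
  then show "X \<in> range (dpar c' u')"
  proof
    assume i: "inward c u v"
    obtain v' where "dpar c' u' v' = dpar c u v"
      by (rule chart_transition[OF repD(1,2)[OF r] repD(1,2)[OF r'] same i])
    then show ?thesis using v by (metis rangeI)
  next
    assume i: "inward c u (- v)"
    obtain v' where "dpar c' u' v' = dpar c u (- v)"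
      by (rule chart_transition[OF repD(1,2)[OF r] repD(1,2)[OF r'] same i])
    then have "X = dpar c' u' (- v')"
      using v linear_neg[OF repD(6)[OF r]] linear_neg[OF repD(6)[OF r']] by simp
    then show ?thesis by blast
  qed
qed

lemma tangent_space_eq:
  assumes r: "rep c u y" shows "tangent_space S y = range (dpar c u)"
proof (intro equalityI subsetI)
  fix X assume "X \<in> tangent_space S y"
  then obtain c' u' v where "rep c' u' y" "X = dpar c' u' v"
    unfolding tangent_space_def rep_def dpar_def by blast
  then show "X \<in> range (dpar c u)" using range_dpar_subset[OF _ r] by blast
next
  fix X assume "X \<in> range (dpar c u)"
  then show "X \<in> tangent_space S y"
    using r unfolding tangent_space_def rep_def dpar_def by blast
qed

text \<open>
  Whether a point is on the boundary does not depend on the chart. If \<open>u\<close> is on its face and \<open>u'\<close> is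
  not, every direction is inward at \<open>u'\<close>, hence, by \<open>chart_transition\<close>, every tangent vector is inward
  when read at \<open>u\<close>; but the direction opposite to the axis of the face is not.
\<close>

lemma face_iff:
  assumes r: "rep c u y" and r': "rep c' u' y"
  shows "u $ face c = 0 \<longleftrightarrow> u' $ face c' = 0"
proof -
  have *: "u' $ face c' = 0" if r: "rep c u y" and r': "rep c' u' y" and 0: "u $ face c = 0" for c u c' u'
  proof (rule ccontr)
    assume ne: "u' $ face c' \<noteq> 0"
    let ?e = "axis (face c) (1::real)"
    have same: "par c' u' = par c u" using repD(4)[OF r] repD(4)[OF r'] by simp
    obtain v' where v': "dpar c u (- ?e) = dpar c' u' v'"
      using range_dpar_subset[OF r r'] by blast
    have "inward c' u' v'" using ne by (simp add: inward_def)
    then obtain w where w: "dpar c u w = dpar c' u' v'" "inward c u w"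
      by (rule chart_transition[OF repD(1,2)[OF r'] repD(1,2)[OF r] same])
    then have "w = - ?e" using v' repD(7)[OF r] by (metis injD)
    then show False using w(2) 0 by (simp add: inward_def)
  qed
  show ?thesis using *[OF r r'] *[OF r' r] by blast
qed

definition Intr :: "'n minkowski set" where
  "Intr = {y. \<exists>c u. rep c u y \<and> u $ face c \<noteq> 0}"

definition Bd :: "'n minkowski set" where "Bd = S - Intr"

lemma rep_Int_iff: "rep c u y \<Longrightarrow> y \<in> Intr \<longleftrightarrow> u $ face c \<noteq> 0"
  unfolding Intr_def using face_iff by blast

lemma Intr_subset: "Intr \<subseteq> S" by (auto simp: Intr_def dest: repD(5))

lemma snd_tangent_zero:
  assumes "y \<in> S" "X \<in> tangent_space S y" "snd X = 0" shows "X = 0"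
proof (rule ccontr)
  assume "X \<noteq> 0"
  then have "mink X X > 0" using spacelike assms by (auto simp: spacelike_def)
  then show False using assms(3) by (simp add: mink_def not_less)
qed

lemma proj_linear: "rep c u y \<Longrightarrow> linear (\<lambda>v. snd (dpar c u v))"
  using linear_compose[OF repD(6) linear_snd] by (simp add: o_def)

lemma proj_inj:
  assumes r: "rep c u y" shows "inj (\<lambda>v. snd (dpar c u v))"
proof -
  have "v = 0" if "snd (dpar c u v) = 0" for v
  proof -
    have "dpar c u v = 0"
      using snd_tangent_zero[OF repD(5)[OF r]] tangent_space_eq[OF r] that by auto
    then show ?thesis using repD(6,7)[OF r] by (metis injD linear_0)
  qed
  then show ?thesis using linear_inj_iff_eq_0[OF proj_linear[OF r]] by blast
qed

lemma det_proj_matrix: "rep c u y \<Longrightarrow> det (proj_matrix c u) \<noteq> 0"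
  unfolding proj_matrix_def using det_nz_iff_inj[OF proj_linear] proj_inj by blast

lemma proj_surj: "rep c u y \<Longrightarrow> surj (\<lambda>v. snd (dpar c u v))"
  using linear_injective_imp_surjective[OF proj_linear proj_inj] by blast

lemma tangent_lift:
  assumes "y \<in> S" obtains X where "X \<in> tangent_space S y" "snd X = w"
proof -
  obtain c u where r: "rep c u y" using rep_exists[OF assms] by blast
  obtain v where "w = snd (dpar c u v)" using proj_surj[OF r] by (metis surjD)
  then show ?thesis using that[of "dpar c u v"] tangent_space_eq[OF r] by blast
qed

lemma tangent_functional:
  assumes y: "y \<in> S" and l: "linear (l :: 'n minkowski \<Rightarrow> real)"
  shows "\<exists>g. \<forall>X\<in>tangent_space S y. l X = g \<bullet> snd X"
proof -
  obtain c u where r: "rep c u y" using rep_exists[OF y] by blast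
  obtain k where k: "linear k" "k \<circ> (\<lambda>v. snd (dpar c u v)) = id"
    using linear_injective_left_inverse[OF proj_linear[OF r] proj_inj[OF r]] by blast
  define m where "m w = l (dpar c u (k w))" for w
  have "linear (l \<circ> (dpar c u \<circ> k))" by (intro linear_compose k(1) l repD(6)[OF r])
  moreover have "m = l \<circ> (dpar c u \<circ> k)" by (auto simp: m_def)
  ultimately have lm: "linear m" by (simp only:)
  define g where "g = (\<chi> i. m (axis i 1))"
  have mg: "m w = g \<bullet> w" for w
    using linear_eq_sum_axis[OF lm, of w] by (simp add: g_def inner_vec_def mult.commute)
  have "l X = g \<bullet> snd X" if X: "X \<in> tangent_space S y" for X
  proof -
    obtain v where v: "X = dpar c u v" using X unfolding tangent_space_eq[OF r] by blast
    have "k (snd X) = v" using k(2) v by (simp add: fun_eq_iff)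
    then show ?thesis using mg[of "snd X"] v by (simp add: m_def)
  qed
  then show ?thesis by blast
qed

text \<open>
  Spacelike tangent spaces are graphs over space. This is the vector of their slope.
\<close>

definition slope :: "'n minkowski \<Rightarrow> real^'n" where
  "slope y = (SOME b. \<forall>X\<in>tangent_space S y. fst X = b \<bullet> snd X)"

lemma slope: "y \<in> S \<Longrightarrow> X \<in> tangent_space S y \<Longrightarrow> fst X = slope y \<bullet> snd X"
  using someI_ex[OF tangent_functional[OF _ linear_fst]] unfolding slope_def by blast

lemma mink_tangent:
  assumes "y \<in> S" "X \<in> tangent_space S y" "Y \<in> tangent_space S y"
  shows "mink X Y = snd X \<bullet> snd Y - (slope y \<bullet> snd X) * (slope y \<bullet> snd Y)"
  using slope[OF assms(1,2)] slope[OF assms(1,3)] by (simp add: mink_def)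

lemma slope_lt_1:
  assumes y: "y \<in> S" shows "slope y \<bullet> slope y < 1"
proof (cases "slope y = 0")
  case False
  obtain X where X: "X \<in> tangent_space S y" "snd X = slope y" using tangent_lift[OF y] .
  have "X \<noteq> 0" using X False by auto
  then have "0 < mink X X" using spacelike y X by (auto simp: spacelike_def)
  then have "0 < slope y \<bullet> slope y - (slope y \<bullet> slope y) * (slope y \<bullet> slope y)"
    using mink_tangent[OF y X(1) X(1)] X by simp
  then have "0 < (slope y \<bullet> slope y) * (1 - slope y \<bullet> slope y)" by (simp add: algebra_simps)
  moreover have "0 < slope y \<bullet> slope y" using False by simp
  ultimately have "0 < 1 - slope y \<bullet> slope y" by (rule zero_less_mult_pos)
  then show ?thesis by simp
qed simp

lemma metric_entry:
  "metric (par c) u $ i $ j = mink (dpar c u (axis i 1)) (dpar c u (axis j 1))"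
  by (simp add: metric_def partial_def dpar_def)

lemma det_metric:
  assumes r: "rep c u y"
  shows "det (metric (par c) u) = (det (proj_matrix c u))\<^sup>2 * (1 - slope y \<bullet> slope y)"
proof -
  have "metric (par c) u = (\<chi> i j. column i (proj_matrix c u) \<bullet> column j (proj_matrix c u)
      - (slope y \<bullet> column i (proj_matrix c u)) * (slope y \<bullet> column j (proj_matrix c u)))"
    using mink_tangent[OF repD(5)[OF r]] tangent_space_eq[OF r]
    by (simp add: vec_eq_iff metric_entry column_proj_matrix)
  then show ?thesis by (simp add: det_gram_rank_one)
qed

lemma det_metric_pos: "rep c u y \<Longrightarrow> 0 < det (metric (par c) u)"
  using det_metric det_proj_matrix slope_lt_1 repD(5) by simp

lemma sqrt_det_metric:
  "rep c u y \<Longrightarrow> sqrt (det (metric (par c) u)) = \<bar>det (proj_matrix c u)\<bar> * sqrt (1 - slope y \<bullet> slope y)"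
  by (simp add: det_metric real_sqrt_mult)

lemma continuous_on_half_dpar: "c \<in> charts S \<Longrightarrow> continuous_on (half_region c) (\<lambda>u. dpar c u v)"
  using continuous_on_subset[OF continuous_on_dpar half_region_subset] .

lemma continuous_on_half_par: "c \<in> charts S \<Longrightarrow> continuous_on (half_region c) (par c)"
  using continuous_on_subset[OF continuous_on_par half_region_subset] .

lemma continuous_on_metric: "c \<in> charts S \<Longrightarrow> continuous_on (half_region c) (\<lambda>u. metric (par c) u $ i $ j)"
  unfolding metric_entry by (intro continuous_intros continuous_on_half_dpar)

lemma continuous_on_proj_matrix: "c \<in> charts S \<Longrightarrow> continuous_on (half_region c) (\<lambda>u. proj_matrix c u $ i $ j)"
proof -
  assume c: "c \<in> charts S"
  have "proj_matrix c u $ i $ j = snd (dpar c u (axis j 1)) $ i" for u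
    by (simp add: proj_matrix_def matrix_def)
  then show ?thesis using continuous_on_half_dpar[OF c] by (auto intro!: continuous_intros)
qed

lemma locally_bounded_imp_bounded:
  fixes \<Phi> :: "'n minkowski \<Rightarrow> real"
  assumes "\<And>y. y \<in> S \<Longrightarrow> \<exists>V C. open V \<and> y \<in> V \<and> (\<forall>z\<in>S \<inter> V. z \<in> X \<longrightarrow> \<Phi> z \<le> C)"
  obtains C where "\<And>z. z \<in> S \<Longrightarrow> z \<in> X \<Longrightarrow> \<Phi> z \<le> C"
proof -
  obtain V C where V: "\<And>y. y \<in> S \<Longrightarrow> open (V y) \<and> y \<in> V y \<and> (\<forall>z\<in>S \<inter> V y. z \<in> X \<longrightarrow> \<Phi> z \<le> C y)"
    using assms by metis
  have "S \<subseteq> \<Union>(V ` S)" using V by blast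
  then obtain T where T: "T \<subseteq> S" "finite T" "S \<subseteq> \<Union>(V ` T)"
    using compactE_image[OF compact, of S V] V by blast
  show ?thesis
  proof
    fix z assume z: "z \<in> S" "z \<in> X"
    then obtain t where t: "t \<in> T" "z \<in> V t" using T by blast
    then have "\<Phi> z \<le> C t" using V T z by blast
    also have "\<dots> \<le> \<bar>C t\<bar>" by simp
    also have "\<dots> \<le> (\<Sum>t\<in>T. \<bar>C t\<bar>)" using T t by (intro member_le_sum) auto
    finally show "\<Phi> z \<le> (\<Sum>t\<in>T. \<bar>C t\<bar>)" .
  qed
qed

lemma chart_nbhd:
  assumes r: "rep c u y" and W: "open W" "u \<in> W"
  obtains V where "open V" "y \<in> V" "S \<inter> V = par c ` (half_region c \<inter> W)"
proof -
  obtain V where "open V" "par c ` (half_region c \<inter> W) = S \<inter> V"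
    using openin_chart_image[OF repD(1)[OF r] W(1)] by (auto simp: openin_open)
  moreover have "y \<in> par c ` (half_region c \<inter> W)" using r W by (auto simp: rep_def)
  ultimately show ?thesis using that[of V] by auto
qed

text \<open>
  Continuity tested in charts, up to and including the faces. For the integrands below this is also
  what makes their coordinate expressions Borel on a face, a null set on which an arbitrary function
  could still fail to be measurable.
\<close>

definition chart_cts :: "('n minkowski \<Rightarrow> 'b::topological_space) \<Rightarrow> bool" where
  "chart_cts \<Phi> \<longleftrightarrow> (\<forall>c\<in>charts S. continuous_on (half_region c) (\<lambda>u. \<Phi> (par c u)))"

lemma chart_ctsD: "chart_cts \<Phi> \<Longrightarrow> c \<in> charts S \<Longrightarrow> continuous_on (half_region c) (\<lambda>u. \<Phi> (par c u))"
  by (simp add: chart_cts_def)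

lemma chart_bounded:
  fixes \<Phi> :: "'n minkowski \<Rightarrow> real"
  assumes loc: "\<And>c u. c \<in> charts S \<Longrightarrow> u \<in> half_region c \<Longrightarrow> \<exists>W g. open W \<and> u \<in> W \<and>
     continuous_on (half_region c \<inter> W) g \<and> (\<forall>w\<in>half_region c \<inter> W. par c w \<in> X \<longrightarrow> \<Phi> (par c w) \<le> g w)"
  obtains C where "\<And>z. z \<in> S \<Longrightarrow> z \<in> X \<Longrightarrow> \<Phi> z \<le> C"
proof -
  have L: "\<exists>V C. open V \<and> y \<in> V \<and> (\<forall>z\<in>S \<inter> V. z \<in> X \<longrightarrow> \<Phi> z \<le> C)" if y: "y \<in> S" for y
  proof -
    obtain c u where r: "rep c u y" using rep_exists[OF y] by blast
    obtain W g where "open W \<and> u \<in> W \<and> continuous_on (half_region c \<inter> W) g \<and>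
      (\<forall>w\<in>half_region c \<inter> W. par c w \<in> X \<longrightarrow> \<Phi> (par c w) \<le> g w)"
      using loc[OF repD(1,2)[OF r]] by (elim exE)
    then have W: "open W" "u \<in> W" and g: "continuous_on (half_region c \<inter> W) g"
      "\<And>w. w \<in> half_region c \<inter> W \<Longrightarrow> par c w \<in> X \<Longrightarrow> \<Phi> (par c w) \<le> g w"
      by simp_all
    have "\<exists>e>0. \<forall>w\<in>half_region c \<inter> W. dist w u < e \<longrightarrow> dist (g w) (g u) < 1"
      using g(1)[unfolded continuous_on_iff, rule_format, of u 1] W(2) repD(2)[OF r] by simp
    then obtain e where e: "0 < e" "\<And>w. w \<in> half_region c \<inter> W \<Longrightarrow> dist w u < e \<Longrightarrow> dist (g w) (g u) < 1"
      by blast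
    have oW: "open (W \<inter> ball u e)" "u \<in> W \<inter> ball u e" using W e by auto
    obtain V where V: "open V" "y \<in> V" "S \<inter> V = par c ` (half_region c \<inter> (W \<inter> ball u e))"
      by (rule chart_nbhd[OF r oW])
    have "\<Phi> z \<le> g u + 1" if z: "z \<in> S \<inter> V" "z \<in> X" for z
    proof -
      obtain w where w: "z = par c w" "w \<in> half_region c" "w \<in> W" "dist w u < e"
        using z(1) V(3) by (auto simp: dist_commute)
      then have "\<Phi> z \<le> g w" using g(2) z by simp
      moreover have "dist (g w) (g u) < 1" using e(2)[of w] w by blast
      ultimately show ?thesis by (simp add: dist_real_def)
    qed
    then show ?thesis using V by blast
  qed
  show ?thesis by (rule locally_bounded_imp_bounded[OF L], assumption) (rule that)
qed

lemma chart_cts_bounded: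
  fixes \<Phi> :: "'n minkowski \<Rightarrow> real"
  assumes "chart_cts \<Phi>"
  obtains C where "\<And>z. z \<in> S \<Longrightarrow> \<Phi> z \<le> C"
proof -
  have L: "\<exists>W g. open W \<and> u \<in> W \<and> continuous_on (half_region c \<inter> W) g \<and>
      (\<forall>w\<in>half_region c \<inter> W. par c w \<in> UNIV \<longrightarrow> \<Phi> (par c w) \<le> g w)"
    if c: "c \<in> charts S" "u \<in> half_region c" for c u
    by (rule exI[of _ UNIV], rule exI[of _ "\<lambda>w. \<Phi> (par c w)"]) (simp add: chart_ctsD[OF assms c(1)])
  obtain C where C: "\<And>z. z \<in> S \<Longrightarrow> z \<in> UNIV \<Longrightarrow> \<Phi> z \<le> C"
    by (rule chart_bounded[OF L], assumption+) (rule that)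
  show ?thesis by (rule that[OF C]) simp_all
qed

lemma chart_cts_continuous_on:
  assumes "chart_cts \<Phi>" "c \<in> charts S"
  shows "continuous_on {u \<in> half_region c. u $ face c \<noteq> 0} (\<lambda>u. \<Phi> (par c u))"
  by (rule continuous_on_subset[OF chart_ctsD[OF assms]]) auto

lemma chart_ctsI:
  assumes g: "\<And>c. c \<in> charts S \<Longrightarrow> continuous_on (half_region c) (g c)"
    and eq: "\<And>c u. rep c u (par c u) \<Longrightarrow> \<Phi> (par c u) = g c u"
  shows "chart_cts \<Phi>"
  unfolding chart_cts_def
proof
  fix c assume c: "c \<in> charts S"
  show "continuous_on (half_region c) (\<lambda>u. \<Phi> (par c u))"
    by (rule continuous_on_eq[OF g[OF c]]) (use eq c in \<open>simp add: rep_def\<close>)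
qed

lemma chart_cts_combine:
  assumes 1: "chart_cts \<Phi>1" and 2: "chart_cts \<Phi>2"
    and h: "continuous_on UNIV (\<lambda>(x, y). h x y)"
  shows "chart_cts (\<lambda>y. h (\<Phi>1 y) (\<Phi>2 y))"
  unfolding chart_cts_def
proof
  fix c assume c: "c \<in> charts S"
  from continuous_on_compose2[OF h continuous_on_Pair[OF chart_ctsD[OF 1 c] chart_ctsD[OF 2 c]]]
  show "continuous_on (half_region c) (\<lambda>u. h (\<Phi>1 (par c u)) (\<Phi>2 (par c u)))" by simp
qed

end

section \<open>Slope, conormal and mean curvature\<close>

lemma linear_det_column:
  fixes A :: "real^'n^'n::finite"
  shows "linear (\<lambda>v::real^'n. det (\<chi> i j. if j = k then v $ i else A $ i $ j))"
proof -
  have tr: "det (\<chi> i j. if j = k then v $ i else A $ i $ j) = det (\<chi> j. if j = k then v else column j A)" for v :: "real^'n"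
  proof -
    have "transpose (\<chi> i j. if j = k then v $ i else A $ i $ j) = (\<chi> j. if j = k then v else column j A)"
      by (simp add: transpose_def column_def vec_eq_iff)
    from arg_cong[OF this, of det] show ?thesis unfolding det_transpose .
  qed
  show ?thesis
    unfolding tr
  proof (rule linearI)
    fix v w :: "real^'n" and r :: real
    show "det (\<chi> j. if j = k then v + w else column j A) =
        det (\<chi> j. if j = k then v else column j A) + det (\<chi> j. if j = k then w else column j A)"
      by (rule det_row_add)
    show "det (\<chi> j. if j = k then r *\<^sub>R v else column j A) = r *\<^sub>R det (\<chi> j. if j = k then v else column j A)"
    proof -
      have "r *s v = r *\<^sub>R v" by (simp add: vec_eq_iff)
      with det_row_mul[of k r "\<lambda>_. v" "\<lambda>j. column j A"] show ?thesis by (simp only: real_scaleR_def)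
    qed
  qed
qed

lemma parallel_of_same_orthogonal:
  fixes n n' :: "'a::real_inner"
  assumes "n \<noteq> 0" "\<And>w. n \<bullet> w = 0 \<Longrightarrow> n' \<bullet> w = 0"
  shows "n' = ((n' \<bullet> n) / (n \<bullet> n)) *\<^sub>R n"
proof -
  define w where "w = n' - ((n' \<bullet> n) / (n \<bullet> n)) *\<^sub>R n"
  have 1: "n \<bullet> w = 0" using assms(1) by (simp add: w_def inner_diff_right inner_commute[of n n'])
  then have "n' \<bullet> w = 0" by (rule assms(2))
  then have "w \<bullet> w = 0" using 1 by (simp add: w_def inner_diff_left)
  then show ?thesis by (simp add: w_def)
qed

lemma
  fixes A :: "real^'n^'n::finite"
  assumes "invertible A"
  shows matrix_inv_right: "A ** matrix_inv A = mat 1" and matrix_inv_left: "matrix_inv A ** A = mat 1"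
  using someI_ex[OF assms[unfolded invertible_def]] unfolding matrix_inv_def by blast+

text \<open>
  A change of chart acts on the metric and on the second fundamental form by the same congruence;
  the trace of one with respect to the other is invariant.
\<close>

lemma trace_congruence:
  fixes P G T :: "real^'n^'n::finite"
  assumes P: "invertible P" and G: "invertible G"
  shows "trace (matrix_inv (transpose P ** G ** P) ** (transpose P ** T ** P)) = trace (matrix_inv G ** T)"
proof -
  have Pi: "P ** matrix_inv P = mat 1" "matrix_inv P ** P = mat 1" using matrix_inv_right[OF P] matrix_inv_left[OF P] by auto
  have Gi: "G ** matrix_inv G = mat 1" using matrix_inv_right[OF G] by auto
  have inv: "invertible (transpose P ** G ** P)"
    using P G by (intro invertible_mult transpose_invertible)
  define X where "X = matrix_inv P ** (matrix_inv G ** T) ** P"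
  have "(transpose P ** G ** P) ** X = transpose P ** (G ** ((P ** matrix_inv P) ** (matrix_inv G ** T))) ** P"
    by (simp add: X_def matrix_mul_assoc)
  also have "\<dots> = transpose P ** ((G ** matrix_inv G) ** T) ** P" by (simp add: Pi matrix_mul_assoc)
  also have "\<dots> = transpose P ** T ** P" by (simp add: Gi)
  finally have X: "(transpose P ** G ** P) ** X = transpose P ** T ** P" .
  have "matrix_inv (transpose P ** G ** P) ** (transpose P ** T ** P) = X"
    unfolding X[symmetric] matrix_mul_assoc[of "matrix_inv (transpose P ** G ** P)" "transpose P ** G ** P" X]
      matrix_inv_left[OF inv] by simp
  moreover have "trace X = trace (matrix_inv G ** T)"
    unfolding X_def using trace_mul_sym[of "matrix_inv P" "(matrix_inv G ** T) ** P"] Pi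
    by (simp add: matrix_mul_assoc[symmetric])
  ultimately show ?thesis by simp
qed

context spacelike_hypersurface
begin

subsection \<open>Slope\<close>

definition normal :: "'n minkowski \<Rightarrow> 'n minkowski" where
  "normal y = (1, slope y)"

lemma mink_normal_tangent: "y \<in> S \<Longrightarrow> X \<in> tangent_space S y \<Longrightarrow> mink (normal y) X = 0"
  by (simp add: normal_def mink_def slope)

lemma mink_normal_normal: "mink (normal y) (normal y) = - (1 - slope y \<bullet> slope y)"
  by (simp add: normal_def mink_def)

lemma normal_space_line:
  assumes y: "y \<in> S" and N: "\<And>X. X \<in> tangent_space S y \<Longrightarrow> mink N X = 0"
  shows "N = fst N *\<^sub>R normal y"
proof -
  have "snd N \<bullet> w = fst N * (slope y \<bullet> w)" for w
  proof -
    obtain X where X: "X \<in> tangent_space S y" "snd X = w" using tangent_lift[OF y] .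
    show ?thesis using N[OF X(1)] slope[OF y X(1)] X(2) by (simp add: mink_def)
  qed
  then have "(snd N - fst N *\<^sub>R slope y) \<bullet> w = 0" for w by (simp add: inner_diff_left)
  from this[of "snd N - fst N *\<^sub>R slope y"] show ?thesis by (simp add: normal_def prod_eq_iff)
qed

lemma unit_normal_time:
  assumes y: "y \<in> S" and N: "N \<in> normal_space S y" "mink N N = -1"
  shows "(fst N)\<^sup>2 = 1 / (1 - slope y \<bullet> slope y)"
proof -
  have line: "N = fst N *\<^sub>R normal y" using N by (intro normal_space_line y) (auto simp: normal_space_def)
  have "mink N N = mink (fst N *\<^sub>R normal y) (fst N *\<^sub>R normal y)"
    by (rule arg_cong2[where f = mink, OF line line])
  then have "mink N N = fst N * fst N * mink (normal y) (normal y)"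
    by (simp add: mink_scaleR_left mink_scaleR_right)
  then have "(fst N)\<^sup>2 * (1 - slope y \<bullet> slope y) = 1"
    using N(2) unfolding mink_normal_normal power2_eq_square by linarith
  then show ?thesis using slope_lt_1[OF y] by (simp add: field_simps)
qed

lemma slope_defect_bounded:
  obtains C where "\<And>y. y \<in> S \<Longrightarrow> 1 / (1 - slope y \<bullet> slope y) \<le> C"
proof -
  have L: "\<exists>W g. open W \<and> u \<in> W \<and> continuous_on (half_region c \<inter> W) g \<and>
      (\<forall>w\<in>half_region c \<inter> W. par c w \<in> UNIV \<longrightarrow> 1 / (1 - slope (par c w) \<bullet> slope (par c w)) \<le> g w)"
    if c: "c \<in> charts S" "u \<in> half_region c" for c u
  proof (rule exI[of _ UNIV], rule exI[of _ "\<lambda>w. (det (proj_matrix c w))\<^sup>2 / det (metric (par c) w)"], intro conjI ballI impI)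
    have r: "rep c w (par c w)" if "w \<in> half_region c" for w using that c by (simp add: rep_def)
    show "continuous_on (half_region c \<inter> UNIV) (\<lambda>w. (det (proj_matrix c w))\<^sup>2 / det (metric (par c) w))"
      using continuous_on_proj_matrix[OF c(1)] continuous_on_metric[OF c(1)]
        less_imp_neq[OF det_metric_pos[OF r], symmetric]
      by (intro continuous_on_divide continuous_on_power continuous_on_det) auto
    fix w assume w: "w \<in> half_region c \<inter> UNIV"
    then show "1 / (1 - slope (par c w) \<bullet> slope (par c w)) \<le> (det (proj_matrix c w))\<^sup>2 / det (metric (par c) w)"
      using det_metric[OF r[of w]] det_proj_matrix[OF r[of w]] by simp
  qed auto
  obtain C where C: "\<And>z. z \<in> S \<Longrightarrow> z \<in> UNIV \<Longrightarrow> 1 / (1 - slope z \<bullet> slope z) \<le> C"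
    by (rule chart_bounded[OF L], assumption+) (rule that)
  show ?thesis by (rule that, rule C) simp_all
qed

text \<open>
  The unit normals at \<open>y\<close> have time component \<open>1 / sqrt (1 - slope y \<bullet> slope y)\<close> up to sign. The
  supremum defining the maximal slope is over a bounded set because the slope is continuous
  on a compact hypersurface.
\<close>

lemma max_slope_bound:
  assumes y: "y \<in> S"
  shows "1 \<le> max_slope S * sqrt (1 - slope y \<bullet> slope y)" and "1 \<le> max_slope S"
proof -
  define T where "T = {\<bar>fst N\<bar> | N. \<exists>p\<in>S. N \<in> normal_space S p \<and> mink N N = -1}"
  define s where "s = sqrt (1 - slope y \<bullet> slope y)"
  have s: "0 < s" "s \<le> 1" "s * s = 1 - slope y \<bullet> slope y" using slope_lt_1[OF y] by (auto simp: s_def)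
  obtain C where C: "\<And>y. y \<in> S \<Longrightarrow> 1 / (1 - slope y \<bullet> slope y) \<le> C" by (rule slope_defect_bounded) (rule that)
  have bdd: "bdd_above T"
  proof (rule bdd_aboveI)
    fix t assume "t \<in> T"
    then obtain N p where N: "t = \<bar>fst N\<bar>" "p \<in> S" "N \<in> normal_space S p" "mink N N = -1"
      by (auto simp: T_def)
    have "t\<^sup>2 \<le> C" using unit_normal_time[OF N(2-4)] C[OF N(2)] N(1) by simp
    then show "t \<le> sqrt C" by (rule real_le_rsqrt)
  qed
  have "1 / s \<in> T"
  proof -
    have "(1 / s) *\<^sub>R normal y \<in> normal_space S y"
      using mink_normal_tangent[OF y] by (simp add: normal_space_def mink_scaleR_left)
    moreover have "mink ((1 / s) *\<^sub>R normal y) ((1 / s) *\<^sub>R normal y) = -1"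
      using s by (simp add: mink_scaleR_left mink_scaleR_right mink_normal_normal s(3)[symmetric])
    moreover have "1 / s = \<bar>fst ((1 / s) *\<^sub>R normal y)\<bar>" using s(1) by (simp add: normal_def)
    ultimately show ?thesis unfolding T_def using y by blast
  qed
  then have "1 / s \<le> max_slope S" unfolding max_slope_def T_def[symmetric] by (rule cSup_upper[OF _ bdd])
  then have 1: "1 \<le> max_slope S * s" using s by (simp add: field_simps)
  then show "1 \<le> max_slope S * sqrt (1 - slope y \<bullet> slope y)" by (simp add: s_def)
  have "0 < max_slope S" using 1 s by (metis less_le_trans zero_less_one zero_less_mult_pos2)
  then have "max_slope S * s \<le> max_slope S * 1" using s by (intro mult_left_mono) auto
  then show "1 \<le> max_slope S" using 1 by simp
qed

subsection \<open>The boundary conormal\<close>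

text \<open>
  The vector of maximal minors of the face: the generalised cross product of the projected
  coordinate directions inside the boundary. It is orthogonal to the projected boundary and its
  length is the flat area element there.
\<close>

definition conormal :: "'n chart \<Rightarrow> real^'n \<Rightarrow> real^'n" where
  "conormal c u = (\<chi> l. det (\<chi> i j. if j = face c then axis l 1 $ i else proj_matrix c u $ i $ j))"

lemma conormal_inner:
  "conormal c u \<bullet> v = det (\<chi> i j. if j = face c then v $ i else proj_matrix c u $ i $ j)"
  using linear_eq_sum_axis[OF linear_det_column[of "face c" "proj_matrix c u"], of v]
  by (simp add: conormal_def inner_vec_def mult.commute)

lemma conormal_column:
  "conormal c u \<bullet> column j (proj_matrix c u) = (if j = face c then det (proj_matrix c u) else 0)"
proof (cases "j = face c")
  case True
  have "(\<chi> i l. if l = face c then column (face c) (proj_matrix c u) $ i else proj_matrix c u $ i $ l) = proj_matrix c u"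
    by (simp add: vec_eq_iff column_def)
  then show ?thesis using True by (simp add: conormal_inner)
next
  case False
  have "det (\<chi> i l. if l = face c then column j (proj_matrix c u) $ i else proj_matrix c u $ i $ l) = 0"
    by (rule det_identical_columns[OF False]) (use False in \<open>simp add: column_def vec_eq_iff\<close>)
  then show ?thesis using False by (simp add: conormal_inner)
qed

lemma conormal_proj:
  assumes r: "rep c u y"
  shows "conormal c u \<bullet> snd (dpar c u v) = v $ face c * det (proj_matrix c u)"
proof -
  have "snd (dpar c u v) = (\<Sum>i\<in>UNIV. v $ i *\<^sub>R column i (proj_matrix c u))"
    using linear_eq_sum_axis[OF proj_linear[OF r], of v] by (simp add: column_proj_matrix)
  then show ?thesis
    by (simp add: inner_sum_right conormal_column if_distrib cong: if_cong)
qed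

lemma conormal_nonzero: "rep c u y \<Longrightarrow> conormal c u \<noteq> 0"
  using conormal_column[of c u "face c"] det_proj_matrix[of c u y] by auto

lemma conormal_parallel:
  assumes r: "rep c u y" and r': "rep c' u' y" and 0: "u $ face c = 0"
  obtains l where "conormal c' u' = l *\<^sub>R conormal c u"
proof -
  have z0: "u' $ face c' = 0" using face_iff[OF r r'] 0 by simp
  have same: "par c u = par c' u'" using repD(4)[OF r] repD(4)[OF r'] by simp
  have "conormal c' u' \<bullet> w = 0" if w: "conormal c u \<bullet> w = 0" for w
  proof -
    obtain v where v: "w = snd (dpar c u v)" using proj_surj[OF r] by (metis surjD)
    then have v0: "v $ face c = 0" using w conormal_proj[OF r] det_proj_matrix[OF r] by simp
    have i: "inward c u v" "inward c u (- v)" using v0 by (auto simp: inward_def)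
    obtain v1 where v1: "dpar c' u' v1 = dpar c u v" "inward c' u' v1"
      by (rule chart_transition[OF repD(1,2)[OF r] repD(1,2)[OF r'] same i(1)])
    obtain v2 where v2: "dpar c' u' v2 = dpar c u (- v)" "inward c' u' v2"
      by (rule chart_transition[OF repD(1,2)[OF r] repD(1,2)[OF r'] same i(2)])
    have "dpar c' u' (- v1) = dpar c' u' v2"
      using v1(1) v2(1) linear_neg[OF repD(6)[OF r]] linear_neg[OF repD(6)[OF r']] by simp
    then have "v2 = - v1" using repD(7)[OF r'] by (metis injD)
    then have "v1 $ face c' = 0" using v1(2) v2(2) z0 by (simp add: inward_def)
    then show ?thesis using conormal_proj[OF r', of v1] v1(1) v by simp
  qed
  from parallel_of_same_orthogonal[OF conormal_nonzero[OF r] this] show ?thesis by (rule that)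
qed

lemma continuous_on_conormal: "c \<in> charts S \<Longrightarrow> continuous_on (half_region c) (conormal c)"
proof -
  assume c: "c \<in> charts S"
  have "continuous_on (half_region c) (\<lambda>u. (\<chi> i j. if j = face c then axis l 1 $ i else proj_matrix c u $ i $ j) $ i $ j)" for l i j
    using continuous_on_proj_matrix[OF c, of i j] by (cases "j = face c") auto
  then show ?thesis unfolding conormal_def by (intro continuous_on_vec_lambda continuous_on_det)
qed

text \<open>
  With \<open>\<eta>\<close> the unit conormal, the induced area element of the boundary is the flat one times
  \<open>sqrt (1 - \<beta> \<bullet> \<beta>)\<close>, where \<open>\<beta>\<close> is the part of the slope orthogonal to \<open>\<eta>\<close>.
\<close>

lemma det_face_metric:
  assumes r: "rep c u y"
  shows "(norm (conormal c u))\<^sup>2 * (1 - slope y \<bullet> slope y) \<le> det (face_metric (face c) (par c) u)"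
    and "det (face_metric (face c) (par c) u) \<le> (norm (conormal c u))\<^sup>2"
proof -
  let ?n = "conormal c u" and ?k = "face c" and ?A = "proj_matrix c u" and ?b = "slope y"
  define \<eta> where "\<eta> = (1 / norm ?n) *\<^sub>R ?n"
  have n0: "?n \<noteq> 0" by (rule conormal_nonzero[OF r])
  have \<eta>\<eta>: "\<eta> \<bullet> \<eta> = 1" using n0 by (simp add: \<eta>_def dot_square_norm power2_eq_square)
  have n\<eta>: "?n \<bullet> \<eta> = norm ?n" using n0 by (simp add: \<eta>_def dot_square_norm power2_eq_square)
  define P where "P = (\<chi> i j. if j = ?k then \<eta> $ i else ?A $ i $ j)"
  have colP: "column j P = (if j = ?k then \<eta> else column j ?A)" for j
    by (simp add: P_def column_def vec_eq_iff)
  have detP: "det P = norm ?n" using conormal_inner[of c u \<eta>] n\<eta> by (simp add: P_def)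
  have \<eta>A: "\<eta> \<bullet> column j ?A = 0" if "j \<noteq> ?k" for j
    using conormal_column[of c u j] that by (simp add: \<eta>_def)
  define b' where "b' = ?b - (?b \<bullet> \<eta>) *\<^sub>R \<eta>"
  have b'\<eta>: "b' \<bullet> \<eta> = 0" by (simp add: b'_def inner_diff_left \<eta>\<eta>)
  have b'A: "b' \<bullet> column j ?A = ?b \<bullet> column j ?A" if "j \<noteq> ?k" for j
    using \<eta>A[OF that] by (simp add: b'_def inner_diff_left)
  have b'b': "b' \<bullet> b' = ?b \<bullet> ?b - (?b \<bullet> \<eta>)\<^sup>2"
    using b'\<eta> by (simp add: b'_def inner_diff_left inner_diff_right inner_commute[of \<eta> ?b] \<eta>\<eta> power2_eq_square)
  have g: "metric (par c) u $ i $ j = column i ?A \<bullet> column j ?A - (?b \<bullet> column i ?A) * (?b \<bullet> column j ?A)" for i j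
    using mink_tangent[OF repD(5)[OF r]] tangent_space_eq[OF r] by (simp add: metric_entry column_proj_matrix)
  have "face_metric ?k (par c) u = (\<chi> i j. column i P \<bullet> column j P - (b' \<bullet> column i P) * (b' \<bullet> column j P))"
    by (auto simp: vec_eq_iff face_metric_def colP g b'\<eta> b'A \<eta>A \<eta>\<eta> inner_commute[of "column _ _" \<eta>])
  then have D: "det (face_metric ?k (par c) u) = (norm ?n)\<^sup>2 * (1 - b' \<bullet> b')"
    by (simp add: det_gram_rank_one detP)
  show "(norm ?n)\<^sup>2 * (1 - ?b \<bullet> ?b) \<le> det (face_metric ?k (par c) u)"
    unfolding D b'b' by (intro mult_left_mono) auto
  show "det (face_metric ?k (par c) u) \<le> (norm ?n)\<^sup>2"
    unfolding D by (simp add: mult_left_le)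
qed

subsection \<open>Mean curvature\<close>

definition hessian :: "'n chart \<Rightarrow> real^'n \<Rightarrow> 'n minkowski \<Rightarrow> real^'n^'n" where
  "hessian c u y = (\<chi> i j. mink (normal y) (d2par c u (axis i 1) (axis j 1)))"

text \<open>
  The trace of the scalar second fundamental form taken with the normal \<open>(1, slope y)\<close>.
\<close>

definition bend :: "'n chart \<Rightarrow> real^'n \<Rightarrow> 'n minkowski \<Rightarrow> real" where
  "bend c u y = trace (matrix_inv (metric (par c) u) ** hessian c u y)"

lemma invertible_metric: "rep c u y \<Longrightarrow> invertible (metric (par c) u)"
  using det_metric_pos by (simp add: invertible_det_nz less_imp_neq[symmetric])

lemma partial_metric:
  assumes r: "rep c u y"
  shows "partial i (\<lambda>w. metric (par c) w $ j $ l) u =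
    mink (d2par c u (axis i 1) (axis j 1)) (dpar c u (axis l 1)) + mink (dpar c u (axis j 1)) (d2par c u (axis i 1) (axis l 1))"
proof -
  have "((\<lambda>w. metric (par c) w $ j $ l) has_derivative
     (\<lambda>v. mink (dpar c u (axis j 1)) (d2par c u (axis l 1) v) + mink (d2par c u (axis j 1) v) (dpar c u (axis l 1)))) (at u)"
    unfolding metric_entry
    by (intro has_derivative_mink dpar_has_derivative[OF repD(1,3)[OF r]])
  from frechet_derivative_at[OF this, symmetric] show ?thesis
    unfolding partial_def by (simp add: d2par_commute[OF repD(1,3)[OF r], of "axis i 1"] add.commute)
qed

text \<open>
  The Koszul formula in coordinates: the Christoffel term is the tangential part of the second
  derivative. What remains in the second fundamental form is normal.
\<close>

lemma christoffel_lower: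
  assumes r: "rep c u y"
  shows "mink (\<Sum>k\<in>UNIV. christoffel (par c) k i j u *\<^sub>R dpar c u (axis k 1)) (dpar c u (axis m 1))
    = mink (d2par c u (axis i 1) (axis j 1)) (dpar c u (axis m 1))"
proof -
  let ?g = "metric (par c) u" and ?D = "\<lambda>i j. d2par c u (axis i 1) (axis j 1)" and ?L = "\<lambda>i. dpar c u (axis i 1)"
  have sym: "?D i j = ?D j i" for i j by (rule d2par_commute[OF repD(1,3)[OF r]])
  have chr: "christoffel (par c) k i j u = (\<Sum>l\<in>UNIV. matrix_inv ?g $ k $ l * mink (?D i j) (?L l))" for k
  proof -
    have "partial i (\<lambda>w. metric (par c) w $ j $ l) u + partial j (\<lambda>w. metric (par c) w $ i $ l) u
        - partial l (\<lambda>w. metric (par c) w $ i $ j) u = 2 * mink (?D i j) (?L l)" for l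
      unfolding partial_metric[OF r]
      using sym[of i l] sym[of j l] sym[of i j] mink_commute[of "?L i" "?D j l"] mink_commute[of "?L j" "?D i l"] mink_commute[of "?L i" "?D l j"]
        mink_commute[of "?L j" "?D l i"] by simp
    then show ?thesis
      unfolding christoffel_def by (simp add: mult.left_commute[of _ 2] sum_distrib_left[symmetric])
  qed
  have gm: "mink (?L k) (?L m) = ?g $ m $ k" for k by (simp add: metric_entry mink_commute)
  have "mink (\<Sum>k\<in>UNIV. christoffel (par c) k i j u *\<^sub>R ?L k) (?L m)
     = (\<Sum>k\<in>UNIV. ?g $ m $ k * (\<Sum>l\<in>UNIV. matrix_inv ?g $ k $ l * mink (?D i j) (?L l)))"
    by (simp add: mink_sum_left mink_scaleR_left chr gm mult.commute)
  also have "\<dots> = (?g *v (matrix_inv ?g *v (\<chi> l. mink (?D i j) (?L l)))) $ m"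
    by (simp add: matrix_vector_mult_def)
  also have "\<dots> = mink (?D i j) (?L m)"
    using matrix_inv_right[OF invertible_metric[OF r]] by (simp add: matrix_vector_mul_assoc)
  finally show ?thesis .
qed

lemma partial_partial: "partial i (partial j (par c)) u = d2par c u (axis j 1) (axis i 1)"
proof -
  have "partial j (par c) = (\<lambda>x. dpar c x (axis j 1))" by (simp add: partial_def dpar_def fun_eq_iff)
  then show ?thesis by (simp add: partial_def d2par_def)
qed

lemma second_fundamental_form_eq:
  "second_fundamental_form (par c) i j u =
    (\<Sum>k\<in>UNIV. christoffel (par c) k i j u *\<^sub>R dpar c u (axis k 1)) - d2par c u (axis j 1) (axis i 1)"
  unfolding second_fundamental_form_def partial_partial by (simp add: partial_def dpar_def)

lemma chart_mean_curvature_eq: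
  assumes r: "rep c u y"
  shows "chart_mean_curvature (par c) u = (bend c u y / (1 - slope y \<bullet> slope y)) *\<^sub>R normal y"
proof -
  let ?H = "chart_mean_curvature (par c) u" and ?g = "metric (par c) u"
  let ?D = "\<lambda>i j. d2par c u (axis i 1) (axis j 1)" and ?L = "\<lambda>i. dpar c u (axis i 1)"
  have y: "y \<in> S" by (rule repD(5)[OF r])
  have sym: "?D i j = ?D j i" for i j by (rule d2par_commute[OF repD(1,3)[OF r]])
  have II: "mink (second_fundamental_form (par c) i j u) (?L m) = 0" for i j m
    unfolding second_fundamental_form_eq mink_diff_left christoffel_lower[OF r] by (simp add: sym[of i j])
  have "mink ?H (?L m) = 0" for m
    unfolding chart_mean_curvature_def by (simp add: mink_sum_left mink_scaleR_left II)
  then have "mink ?H (dpar c u v) = 0" for v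
    using linear_eq_sum_axis[OF repD(6)[OF r], of v] by (simp add: mink_sum_right mink_scaleR_right)
  then have line: "?H = fst ?H *\<^sub>R normal y"
    using tangent_space_eq[OF r] by (intro normal_space_line y) auto
  have nL: "mink (normal y) (?L m) = 0" for m
    using mink_normal_tangent[OF y] tangent_space_eq[OF r] by blast
  have IIn: "mink (second_fundamental_form (par c) i j u) (normal y) = - hessian c u y $ j $ i" for i j
    unfolding second_fundamental_form_eq
    by (simp add: mink_commute[of _ "normal y"] mink_diff_right mink_sum_right mink_scaleR_right nL hessian_def)
  have "mink ?H (normal y) = - bend c u y"
    unfolding chart_mean_curvature_def bend_def
    by (simp add: mink_sum_left mink_scaleR_left IIn trace_def matrix_matrix_mult_def sum_negf)
  moreover have "mink ?H (normal y) = - (fst ?H * (1 - slope y \<bullet> slope y))"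
    using arg_cong[OF line, of "\<lambda>X. mink X (normal y)"]
    unfolding mink_scaleR_left mink_normal_normal real_scaleR_def mult_minus_right .
  ultimately have H0: "fst ?H = bend c u y / (1 - slope y \<bullet> slope y)"
    using slope_lt_1[OF y] by (simp add: field_simps)
  show ?thesis by (rule trans[OF line]) (simp only: H0)
qed

lemma bend_unique_interior:
  assumes r: "rep c u y" and r': "rep c' u' y" and ne: "u $ face c \<noteq> 0"
  shows "bend c u y = bend c' u' y"
proof -
  have y: "y \<in> S" by (rule repD(5)[OF r])
  have same: "par c u = par c' u'" using repD(4)[OF r] repD(4)[OF r'] by simp
  let ?\<nu> = "normal y"
  have nL: "mink ?\<nu> (dpar c u x) = 0" "mink ?\<nu> (dpar c' u' x) = 0" for x
    using mink_normal_tangent[OF y] tangent_space_eq[OF r] tangent_space_eq[OF r'] by blast+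
  obtain k where k: "linear k" "k \<circ> dpar c' u' = id"
    using linear_injective_left_inverse[OF repD(6,7)[OF r']] by blast
  define \<theta> where "\<theta> v = k (dpar c u v)" for v
  have "linear (k \<circ> dpar c u)" by (intro linear_compose k(1) repD(6)[OF r])
  then have l\<theta>: "linear \<theta>" by (simp add: \<theta>_def[abs_def] o_def)
  have kL: "k (dpar c' u' x) = x" for x using k(2) by (simp add: fun_eq_iff)
  have tr: "dpar c' u' (\<theta> v) = dpar c u v \<and> mink ?\<nu> (d2par c u v v) = mink ?\<nu> (d2par c' u' (\<theta> v) (\<theta> v))" for v
  proof -
    have i: "inward c u v" using ne by (simp add: inward_def)
    show ?thesis
    proof (rule chart_transition[OF repD(1,2)[OF r] repD(1,2)[OF r'] same i])
      fix v' assume v': "dpar c' u' v' = dpar c u v"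
        and q: "\<And>\<nu>. (\<And>x. mink \<nu> (dpar c u x) = 0) \<Longrightarrow> (\<And>x. mink \<nu> (dpar c' u' x) = 0) \<Longrightarrow>
          mink \<nu> (d2par c u v v) = mink \<nu> (d2par c' u' v' v')"
      have "\<theta> v = v'" unfolding \<theta>_def v'[symmetric] by (rule kL)
      then show ?thesis using v' q[OF nL] by simp
    qed
  qed
  have quad: "mink ?\<nu> (d2par c u v w) = (mink ?\<nu> (d2par c u (v + w) (v + w)) - mink ?\<nu> (d2par c u v v) - mink ?\<nu> (d2par c u w w)) / 2"
    if r: "rep c u y" for c u v w
    using linear_add[OF linear_d2par_left[OF repD(1,3)[OF r]]] linear_add[OF linear_d2par_right[OF repD(1,3)[OF r]]]
      d2par_commute[OF repD(1,3)[OF r], of v w] by (simp add: mink_add_right)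
  have pol: "mink ?\<nu> (d2par c u v w) = mink ?\<nu> (d2par c' u' (\<theta> v) (\<theta> w))" for v w
    unfolding quad[OF r, of v w] quad[OF r', of "\<theta> v" "\<theta> w"]
    using tr[of "v + w"] tr[of v] tr[of w] linear_add[OF l\<theta>, of v w] by simp
  define P where "P = matrix \<theta>"
  have colP: "column i P = \<theta> (axis i 1)" for i by (simp add: P_def matrix_def column_def vec_eq_iff)
  have bil: "v \<bullet> (M *v w) = (\<Sum>i\<in>UNIV. \<Sum>j\<in>UNIV. v $ i * w $ j * M $ i $ j)" for M :: "real^'n^'n" and v w
    by (simp add: inner_vec_def matrix_vector_mult_def sum_distrib_left ac_simps)
  have G: "metric (par c) u = transpose P ** metric (par c') u' ** P"
  proof -
    have "metric (par c) u $ i $ j = column i P \<bullet> (metric (par c') u' *v column j P)" for i j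
    proof -
      have "metric (par c) u $ i $ j = mink (dpar c' u' (column i P)) (dpar c' u' (column j P))"
        using tr by (simp add: metric_entry colP)
      also have "\<dots> = (\<Sum>a\<in>UNIV. \<Sum>b\<in>UNIV. column i P $ a * column j P $ b * metric (par c') u' $ a $ b)"
        unfolding arg_cong2[where f = mink, OF linear_eq_sum_axis[OF repD(6)[OF r']] linear_eq_sum_axis[OF repD(6)[OF r']], of "column i P" "column j P"]
        unfolding mink_sum_left unfolding mink_sum_right
        by (simp add: mink_scaleR_left mink_scaleR_right metric_entry mult.assoc mult.left_commute)
      finally show ?thesis by (simp add: bil)
    qed
    then show ?thesis by (simp add: vec_eq_iff congruence_entry)
  qed
  have T: "hessian c u y = transpose P ** hessian c' u' y ** P"
  proof -
    have "hessian c u y $ i $ j = column i P \<bullet> (hessian c' u' y *v column j P)" for i j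
    proof -
      have "hessian c u y $ i $ j = mink ?\<nu> (d2par c' u' (column i P) (column j P))"
        by (simp add: hessian_def pol colP)
      also have "\<dots> = (\<Sum>a\<in>UNIV. \<Sum>b\<in>UNIV. column i P $ a * column j P $ b * hessian c' u' y $ a $ b)"
        using d2par_expand[OF repD(1,3)[OF r'], of "column i P" "column j P"]
        by (simp add: mink_sum_right mink_scaleR_right hessian_def)
      finally show ?thesis by (simp add: bil)
    qed
    then show ?thesis by (simp add: vec_eq_iff congruence_entry)
  qed
  have "inj \<theta>"
  proof (rule injI)
    fix v w assume "\<theta> v = \<theta> w"
    then have "dpar c u v = dpar c u w" using tr by metis
    then show "v = w" using repD(7)[OF r] by (metis injD)
  qed
  then have "invertible P" unfolding P_def invertible_det_nz using det_nz_iff_inj[OF l\<theta>] by blast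
  then show ?thesis
    unfolding bend_def G T by (rule trace_congruence[OF _ invertible_metric[OF r']])
qed

lemma continuous_on_slope: "c \<in> charts S \<Longrightarrow> continuous_on (half_region c) (\<lambda>u. slope (par c u))"
proof -
  assume c: "c \<in> charts S"
  have r: "rep c u (par c u)" if "u \<in> half_region c" for u using that c by (simp add: rep_def)
  show ?thesis
  proof (rule continuous_on_linear_solve[where M = "\<lambda>u. transpose (proj_matrix c u)" and d = "\<lambda>u. \<chi> j. fst (dpar c u (axis j 1))"])
    show "continuous_on (half_region c) (\<lambda>u. transpose (proj_matrix c u) $ i $ j)" for i j
      using continuous_on_proj_matrix[OF c] by (simp add: transpose_def)
    show "continuous_on (half_region c) (\<lambda>u. \<chi> j. fst (dpar c u (axis j 1)))"
      by (intro continuous_on_vec_lambda continuous_on_fst continuous_on_half_dpar c)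
    fix u assume u: "u \<in> half_region c"
    show "det (transpose (proj_matrix c u)) \<noteq> 0" using det_proj_matrix[OF r[OF u]] by (simp add: det_transpose)
    show "transpose (proj_matrix c u) *v slope (par c u) = (\<chi> j. fst (dpar c u (axis j 1)))"
    proof -
      have "(transpose (proj_matrix c u) *v slope (par c u)) $ j = slope (par c u) \<bullet> column j (proj_matrix c u)" for j
        by (simp add: matrix_vector_mult_def transpose_def inner_vec_def column_def mult.commute)
      then show ?thesis
        using slope[OF repD(5)[OF r[OF u]]] tangent_space_eq[OF r[OF u]] by (simp add: vec_eq_iff column_proj_matrix)
    qed
  qed
qed

lemma continuous_on_matrix_inv:
  fixes M :: "'a::topological_space \<Rightarrow> real^'n^'n"
  assumes M: "\<And>i j. continuous_on A (\<lambda>u. M u $ i $ j)" and det: "\<And>u. u \<in> A \<Longrightarrow> det (M u) \<noteq> 0"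
  shows "continuous_on A (\<lambda>u. matrix_inv (M u) $ i $ j)"
proof -
  have "continuous_on A (\<lambda>u. matrix_inv (M u) *v axis j 1)"
  proof (rule continuous_on_linear_solve[OF M continuous_on_const det])
    fix u assume "u \<in> A"
    then have "invertible (M u)" using det by (simp add: invertible_det_nz)
    then show "M u *v (matrix_inv (M u) *v axis j 1) = axis j 1"
      by (simp add: matrix_vector_mul_assoc matrix_inv_right)
  qed
  then have "continuous_on A (\<lambda>u. (matrix_inv (M u) *v axis j 1) $ i)" by (intro continuous_intros)
  then show ?thesis by (simp add: matrix_vector_mul_component inner_axis)
qed

lemma continuous_on_bend:
  assumes c: "c \<in> charts S" shows "continuous_on (half_region c) (\<lambda>u. bend c u (par c u))"
proof -
  have r: "rep c u (par c u)" if "u \<in> half_region c" for u using that c by (simp add: rep_def)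
  have h: "continuous_on (half_region c) (\<lambda>u. hessian c u (par c u) $ i $ j)" for i j
    unfolding hessian_def normal_def
    using continuous_on_subset[OF continuous_on_d2par[OF c] half_region_subset[OF c]] continuous_on_slope[OF c]
    by (auto intro!: continuous_intros)
  have g: "continuous_on (half_region c) (\<lambda>u. matrix_inv (metric (par c) u) $ i $ j)" for i j
    using less_imp_neq[OF det_metric_pos[OF r], symmetric]
    by (intro continuous_on_matrix_inv continuous_on_metric c)
  show ?thesis
    unfolding bend_def trace_def matrix_matrix_mult_def
    by (simp, intro continuous_on_sum continuous_on_mult g h)
qed

text \<open>
  Near an interior point the two charts are compared directly. A boundary point is approached from
  the interior, where both sides agree, and both are continuous up to the face.
\<close>

lemma bend_unique:
  assumes r: "rep c u y" and r': "rep c' u' y"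
  shows "bend c u y = bend c' u' y"
proof -
  have c: "c \<in> charts S" "c' \<in> charts S" by (rule repD(1)[OF r], rule repD(1)[OF r'])
  \<comment> \<open>interior points, also when \<open>u\<close> lies on the face\<close>
  define w where "w n = u + (1 / real (Suc n)) *\<^sub>R axis (face c) 1" for n
  have "(\<lambda>n. u + (1 / real (Suc n)) *\<^sub>R axis (face c) (1 :: real)) \<longlonglongrightarrow> u + 0 *\<^sub>R axis (face c) 1"
    by (intro tendsto_intros LIMSEQ_inverse_real_of_nat[unfolded inverse_eq_divide])
  then have wu: "w \<longlonglongrightarrow> u" by (simp add: w_def[abs_def])
  have wf: "0 < w n $ face c" for n using repD(9)[OF r] by (simp add: w_def add_nonneg_pos)
  have "eventually (\<lambda>n. w n \<in> region c) sequentially"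
    by (rule topological_tendstoD[OF wu open_region[OF c(1)] repD(3)[OF r]])
  then have wh: "eventually (\<lambda>n. w n \<in> half_region c) sequentially"
    by (rule eventually_mono) (use wf less_imp_le in \<open>auto simp: half_region_def\<close>)
  have lim: "(\<lambda>n. g (w n)) \<longlonglongrightarrow> g u" if "continuous_on (half_region c) g" for g :: "real^'n \<Rightarrow> 'c::topological_space"
    by (rule continuous_on_tendsto_compose[OF that wu repD(2)[OF r] wh])
  have py: "(\<lambda>n. par c (w n)) \<longlonglongrightarrow> y" using lim[OF continuous_on_half_par[OF c(1)]] by (simp only: repD(4)[OF r])
  obtain q where q: "homeomorphism (half_region c') (patch c') (par c') q"
    using c(2) by (auto simp: charts_def)
  obtain T where T: "open T" "patch c' = S \<inter> T" using c(2) by (auto simp: charts_def openin_open)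
  have yp: "y \<in> patch c'" using repD(2,4)[OF r'] by (auto simp: patch_def)
  have "eventually (\<lambda>n. par c (w n) \<in> T) sequentially"
    by (rule topological_tendstoD[OF py T(1)]) (use yp T(2) in blast)
  with wh have ev: "eventually (\<lambda>n. rep c (w n) (par c (w n)) \<and> par c (w n) \<in> patch c') sequentially"
  proof eventually_elim
    case (elim n)
    then have "rep c (w n) (par c (w n))" using c(1) by (simp add: rep_def)
    then show ?case using repD(5) elim T(2) by blast
  qed
  then have evp: "eventually (\<lambda>n. par c (w n) \<in> patch c') sequentially" by (rule eventually_mono) blast
  have qy: "q y = u'" using homeomorphism_apply1[OF q repD(2)[OF r']] by (simp only: repD(4)[OF r'])
  have "(\<lambda>n. q (par c (w n))) \<longlonglongrightarrow> q y"
    by (rule continuous_on_tendsto_compose[OF homeomorphism_cont2[OF q] py yp evp])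
  then have qu: "(\<lambda>n. q (par c (w n))) \<longlonglongrightarrow> u'" by (simp only: qy)
  have evq: "eventually (\<lambda>n. q (par c (w n)) \<in> half_region c') sequentially"
    using evp by (rule eventually_mono) (use homeomorphism_image2[OF q] in blast)
  have "(\<lambda>n. bend c' (q (par c (w n))) (par c' (q (par c (w n))))) \<longlonglongrightarrow> bend c' u' (par c' u')"
    by (rule continuous_on_tendsto_compose[OF continuous_on_bend[OF c(2)] qu repD(2)[OF r'] evq])
  then have A: "(\<lambda>n. bend c' (q (par c (w n))) (par c' (q (par c (w n))))) \<longlonglongrightarrow> bend c' u' y" by (simp only: repD(4)[OF r'])
  have "(\<lambda>n. bend c (w n) (par c (w n))) \<longlonglongrightarrow> bend c u (par c u)" by (rule lim[OF continuous_on_bend[OF c(1)]])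
  then have "(\<lambda>n. bend c (w n) (par c (w n))) \<longlonglongrightarrow> bend c u y" by (simp only: repD(4)[OF r])
  moreover have "eventually (\<lambda>n. bend c (w n) (par c (w n)) = bend c' (q (par c (w n))) (par c' (q (par c (w n))))) sequentially"
    using ev evq
  proof eventually_elim
    case (elim n)
    have pq: "par c' (q (par c (w n))) = par c (w n)" using homeomorphism_apply2[OF q] elim by blast
    then have "rep c' (q (par c (w n))) (par c (w n))" using elim c(2) by (simp add: rep_def)
    then show ?case using bend_unique_interior[of c "w n" "par c (w n)"] elim wf[of n] unfolding pq by simp
  qed
  ultimately have "(\<lambda>n. bend c' (q (par c (w n))) (par c' (q (par c (w n))))) \<longlonglongrightarrow> bend c u y"
    by (rule Lim_transform_eventually)
  then show ?thesis using A by (rule LIMSEQ_unique)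
qed

lemma mean_curvature_eq:
  assumes r: "rep c u y"
  shows "mean_curvature S y = (bend c u y / (1 - slope y \<bullet> slope y)) *\<^sub>R normal y"
proof -
  have "\<exists>H. \<exists>c\<in>charts S. \<exists>u\<in>half_region c. par c u = y \<and> H = chart_mean_curvature (par c) u"
    using r unfolding rep_def by blast
  then have "\<exists>c\<in>charts S. \<exists>u\<in>half_region c. par c u = y \<and> mean_curvature S y = chart_mean_curvature (par c) u"
    unfolding mean_curvature_def by (rule someI_ex)
  then obtain c' u' where r': "rep c' u' y" and H: "mean_curvature S y = chart_mean_curvature (par c') u'"
    unfolding rep_def by blast
  show ?thesis unfolding H chart_mean_curvature_eq[OF r'] bend_unique[OF r r'] ..
qed

lemma mean_curvature_norm:
  assumes r: "rep c u y"
  shows "- mink (mean_curvature S y) (mean_curvature S y) = (bend c u y)\<^sup>2 / (1 - slope y \<bullet> slope y)"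
proof -
  have "- ((K / d) * ((K / d) * - d)) = K\<^sup>2 / d" if "d \<noteq> 0" for K d :: real
    using that by (simp add: power2_eq_square)
  from this[of "1 - slope y \<bullet> slope y" "bend c u y"] slope_lt_1[OF repD(5)[OF r]] show ?thesis
    unfolding mean_curvature_eq[OF r] mink_scaleR_left mink_scaleR_right mink_normal_normal real_scaleR_def by simp
qed

text \<open>
  The mean curvature vector is a multiple of the timelike vector \<open>normal y\<close>.
\<close>

lemma mean_curvature_timelike:
  assumes "y \<in> S"
  shows "0 \<le> - mink (mean_curvature S y) (mean_curvature S y)"
proof -
  obtain c u where r: "rep c u y" using rep_exists[OF assms] by blast
  have "0 \<le> (bend c u y)\<^sup>2 / (1 - slope y \<bullet> slope y)"
    using slope_lt_1[OF repD(5)[OF r]] by (intro divide_nonneg_pos) auto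
  then show ?thesis unfolding mean_curvature_norm[OF r] .
qed

lemma chart_cts_mean_curvature: "chart_cts (\<lambda>y. - mink (mean_curvature S y) (mean_curvature S y))"
proof (rule chart_ctsI[where g = "\<lambda>c u. (bend c u (par c u))\<^sup>2 / (1 - slope (par c u) \<bullet> slope (par c u))"])
  fix c assume c: "c \<in> charts S"
  have r: "rep c u (par c u)" if "u \<in> half_region c" for u using that c by (simp add: rep_def)
  note B = continuous_on_power[OF continuous_on_bend[OF c], of 2]
  have ne: "\<forall>u\<in>half_region c. 1 - slope (par c u) \<bullet> slope (par c u) \<noteq> 0"
  proof
    fix u assume "u \<in> half_region c"
    from slope_lt_1[OF repD(5)[OF r[OF this]]] show "1 - slope (par c u) \<bullet> slope (par c u) \<noteq> 0" by simp
  qed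
  show "continuous_on (half_region c) (\<lambda>u. (bend c u (par c u))\<^sup>2 / (1 - slope (par c u) \<bullet> slope (par c u)))"
    by (rule continuous_on_divide[OF B continuous_on_diff[OF continuous_on_const continuous_on_inner[OF continuous_on_slope[OF c] continuous_on_slope[OF c]]] ne])
qed (rule mean_curvature_norm)

end

section \<open>The weight and its gradient\<close>

locale weighted_hypersurface = spacelike_hypersurface S for S :: "'n::finite minkowski set" +
  fixes f :: "'n minkowski \<Rightarrow> real"
  assumes smooth: "smooth_function S f" and pos: "\<And>y. y \<in> S \<Longrightarrow> 0 < f y"
begin

definition df :: "'n minkowski \<Rightarrow> 'n minkowski \<Rightarrow> real" where
  "df y = frechet_derivative f (at y within S)"

lemma local_extension:
  assumes "y \<in> S"
  obtains U F where "open U" "y \<in> U" "smooth_on U F" "\<And>x. x \<in> S \<inter> U \<Longrightarrow> F x = f x"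
proof -
  obtain U F where "open U \<and> y \<in> U \<and> smooth_on U F \<and> (\<forall>x\<in>S \<inter> U. F x = f x)"
    using bspec[OF smooth[unfolded smooth_function_def] assms] by (elim exE)
  then show ?thesis by (intro that[of U F]) simp_all
qed

lemma smooth_on_has_derivative:
  assumes "smooth_on U F" "open U" "x \<in> U"
  shows "(F has_derivative frechet_derivative F (at x)) (at x)"
proof -
  have "Ck_on (Suc 0) U F" using assms(1) unfolding smooth_on_def by blast
  then have "F differentiable (at x)" using assms(2,3) by (simp add: differentiable_on_eq_differentiable_at)
  then show ?thesis by (simp add: frechet_derivative_works)
qed

lemma df_has_derivative:
  assumes y: "y \<in> S" shows "(f has_derivative df y) (at y within S)"
proof -
  obtain U F where U: "open U" "y \<in> U" "smooth_on U F" and F: "\<And>x. x \<in> S \<inter> U \<Longrightarrow> F x = f x"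
    by (rule local_extension[OF y]) (rule that)
  have "(F has_derivative frechet_derivative F (at y)) (at y within S)"
    by (rule has_derivative_at_withinI[OF smooth_on_has_derivative[OF U(3,1,2)]])
  then have "(f has_derivative frechet_derivative F (at y)) (at y within S)"
  proof (rule has_derivative_transform_eventually)
    show "\<forall>\<^sub>F x in at y within S. F x = f x"
      using eventually_at_topological[of "\<lambda>x. F x = f x" y S] U(1,2) F by auto
    show "F y = f y" using F y U(2) by simp
  qed (rule y)
  then have "f differentiable (at y within S)" unfolding differentiable_def by blast
  then show ?thesis unfolding df_def by (simp add: frechet_derivative_works)
qed

lemma continuous_on_f: "continuous_on S f"
  unfolding continuous_on_eq_continuous_within
  by (intro ballI has_derivative_continuous[OF df_has_derivative])

text \<open>
  The differential of \<open>f\<close> represented in space: the Euclidean gradient of \<open>f\<close> as a function of the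
  spatial coordinates on the sheet through \<open>y\<close>.
\<close>

definition grad :: "'n minkowski \<Rightarrow> real^'n" where
  "grad y = (SOME g. \<forall>X\<in>tangent_space S y. df y X = g \<bullet> snd X)"

lemma df_eq_grad:
  assumes "y \<in> S" "X \<in> tangent_space S y" shows "df y X = grad y \<bullet> snd X"
  using someI_ex[OF tangent_functional[OF assms(1) has_derivative_linear[OF df_has_derivative[OF assms(1)]]]] assms(2)
  unfolding grad_def by simp

lemma tangent_subspace:
  assumes "y \<in> S" "X \<in> tangent_space S y" "Y \<in> tangent_space S y"
  shows "X - Y \<in> tangent_space S y"
proof -
  obtain c u where r: "rep c u y" using rep_exists[OF assms(1)] by blast
  have T: "tangent_space S y = range (dpar c u)" by (rule tangent_space_eq[OF r])
  obtain v w where "X = dpar c u v" "Y = dpar c u w" using assms(2,3) unfolding T by blast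
  then have "X - Y = dpar c u (v - w)" by (simp add: linear_diff[OF repD(6)[OF r]])
  then show ?thesis unfolding T by simp
qed

text \<open>
  The metric gradient inverts the rank one perturbation of the identity that expresses the metric
  in spatial coordinates. It is never shorter than the Euclidean gradient.
\<close>

lemma gradient_norm:
  assumes y: "y \<in> S"
  shows "mink (gradient S f y) (gradient S f y) =
    grad y \<bullet> grad y + (slope y \<bullet> grad y)\<^sup>2 * (1 / (1 - slope y \<bullet> slope y))"
proof -
  let ?b = "slope y" and ?G = "grad y" and ?T = "tangent_space S y"
  define d where "d = 1 - ?b \<bullet> ?b"
  have d: "0 < d" using slope_lt_1[OF y] by (simp add: d_def)
  have bb: "?b \<bullet> ?b = 1 - d" by (simp add: d_def)
  define x where "x = ?G + ((?b \<bullet> ?G) / d) *\<^sub>R ?b"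
  obtain X where X: "X \<in> ?T" "snd X = x" using tangent_lift[OF y] .
  have bx: "?b \<bullet> x = (?b \<bullet> ?G) / d"
    using d by (simp add: x_def inner_add_right bb field_simps)
  have mX: "mink X Y = df y Y" if "Y \<in> ?T" for Y
    unfolding mink_tangent[OF y X(1) that] df_eq_grad[OF y that] X(2) bx
    by (simp add: x_def inner_add_left)
  have "gradient S f y = X"
    unfolding gradient_def df_def[symmetric]
  proof (rule the_equality)
    show "X \<in> ?T \<and> (\<forall>Y\<in>?T. mink X Y = df y Y)" using X(1) mX by blast
    fix Z assume Z: "Z \<in> ?T \<and> (\<forall>Y\<in>?T. mink Z Y = df y Y)"
    then have ZX: "Z - X \<in> ?T" using tangent_subspace[OF y _ X(1)] by blast
    have "mink (Z - X) (Z - X) = 0" using Z mX[OF ZX] ZX by (simp add: mink_diff_left)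
    then have "Z - X = 0" using spacelike y ZX unfolding spacelike_def by (metis less_irrefl)
    then show "Z = X" by simp
  qed
  then have "mink (gradient S f y) (gradient S f y) = ?G \<bullet> x"
    using mX[OF X(1)] df_eq_grad[OF y X(1)] X(2) by simp
  also have "\<dots> = ?G \<bullet> ?G + (?b \<bullet> ?G)\<^sup>2 * (1 / d)"
    by (simp add: x_def inner_add_right inner_commute[of ?G ?b] power2_eq_square)
  finally show ?thesis by (simp add: d_def)
qed

lemma gradient_ge: "y \<in> S \<Longrightarrow> (norm (grad y))\<^sup>2 \<le> mink (gradient S f y) (gradient S f y)"
  using slope_lt_1[of y] by (simp add: gradient_norm dot_square_norm)

lemma f_par_has_derivative:
  assumes r: "rep c u y"
  shows "((\<lambda>x. f (par c x)) has_derivative (\<lambda>v. grad y \<bullet> snd (dpar c u v))) (at u within half_region c)"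
proof -
  have "par c ` half_region c \<subseteq> S"
    using repD(1)[OF r] by (auto simp: charts_def patch_def dest: openin_imp_subset)
  then have "(f has_derivative df y) (at (par c u) within par c ` half_region c)"
    using df_has_derivative[OF repD(5)[OF r]] unfolding repD(4)[OF r] by (rule has_derivative_subset[rotated])
  from has_derivative_in_compose[OF has_derivative_at_withinI[OF par_has_derivative[OF repD(1,3)[OF r]]] this]
  have "((\<lambda>x. f (par c x)) has_derivative (\<lambda>v. df y (dpar c u v))) (at u within half_region c)" .
  moreover have "df y (dpar c u v) = grad y \<bullet> snd (dpar c u v)" for v
    by (rule df_eq_grad[OF repD(5)[OF r]]) (simp add: tangent_space_eq[OF r])
  ultimately show ?thesis by (simp only:)
qed

text \<open>
  At a face the half space still contains a segment in each positive coordinate direction.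
\<close>

lemma half_region_derivative_unique:
  fixes g :: "real^'n \<Rightarrow> real"
  assumes u: "u \<in> half_region c" and c: "c \<in> charts S"
    and d: "(g has_derivative g1) (at u within half_region c)" "(g has_derivative g2) (at u within half_region c)"
  shows "g1 = g2"
proof (rule frechet_derivative_unique_within[OF d])
  fix i :: "real^'n" and e :: real assume i: "i \<in> Basis" and e: "0 < e"
  obtain j where j: "i = axis j 1" using i by (auto simp: Basis_vec_def)
  obtain r where r: "0 < r" "ball u r \<subseteq> region c"
    using open_region[OF c] u half_region_subset[OF c] by (meson open_contains_ball subsetD)
  define d where "d = min (e / 2) (r / 2)"
  have d: "0 < d" "d < e" "d < r" using e r by (auto simp: d_def)
  have "u + d *\<^sub>R i \<in> region c" using r(2) d by (auto simp: dist_norm j norm_axis_1)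
  then have "u + d *\<^sub>R i \<in> half_region c" using u d by (auto simp: half_region_def j axis_def)
  then show "\<exists>d. 0 < \<bar>d\<bar> \<and> \<bar>d\<bar> < e \<and> u + d *\<^sub>R i \<in> half_region c" using d by (intro exI[of _ d]) simp
qed

lemma chart_cts_grad: "chart_cts grad"
  unfolding chart_cts_def continuous_on_eq_continuous_within
proof (intro ballI)
  fix c u0 assume c: "c \<in> charts S" and u0: "u0 \<in> half_region c"
  have rp: "rep c u (par c u)" if "u \<in> half_region c" for u using that c by (simp add: rep_def)
  obtain U F where U: "open U" "par c u0 \<in> U" "smooth_on U F" and F: "\<And>x. x \<in> S \<inter> U \<Longrightarrow> F x = f x"
    by (rule local_extension[OF repD(5)[OF rp[OF u0]]]) (rule that)
  define W where "W = region c \<inter> par c -` U"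
  have Wo: "open W" unfolding W_def
    by (rule continuous_open_preimage[OF continuous_on_par[OF c] open_region[OF c] U(1)])
  have u0W: "u0 \<in> W" using u0 U half_region_subset[OF c] by (auto simp: W_def)
  define DF where "DF z = frechet_derivative F (at z)" for z
  have DF: "(F has_derivative DF z) (at z)" if "z \<in> U" for z
    unfolding DF_def by (rule smooth_on_has_derivative[OF U(3,1) that])
  have cDF: "continuous_on U (\<lambda>z. DF z v)" for v
  proof -
    have "Ck_on (Suc 0) U F" using U(3) unfolding smooth_on_def by blast
    then show ?thesis unfolding Ck_on.simps DF_def by blast
  qed
  define d where "d u = (\<chi> j. \<Sum>b\<in>Basis. (dpar c u (axis j 1) \<bullet> b) * DF (par c u) b)" for u
  have WU: "par c ` (half_region c \<inter> W) \<subseteq> U" by (auto simp: W_def)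
  have cd: "continuous_on (half_region c \<inter> W) d"
    unfolding d_def
    by (intro continuous_on_vec_lambda continuous_on_sum continuous_on_mult continuous_on_inner continuous_on_const
        continuous_on_subset[OF continuous_on_half_dpar[OF c] Int_lower1]
        continuous_on_compose2[OF cDF continuous_on_subset[OF continuous_on_half_par[OF c] Int_lower1] WU])
  define g where "g u = matrix_inv (transpose (proj_matrix c u)) *v d u" for u
  have detT: "det (transpose (proj_matrix c u)) \<noteq> 0" if "u \<in> half_region c" for u
    unfolding det_transpose by (rule det_proj_matrix[OF rp[OF that]])
  have cT: "continuous_on (half_region c) (\<lambda>u. transpose (proj_matrix c u) $ i $ j)" for i j
    using continuous_on_proj_matrix[OF c] by (simp add: transpose_def)
  have cg: "continuous_on (half_region c \<inter> W) g"
  proof (rule continuous_on_linear_solve[OF continuous_on_subset[OF cT Int_lower1] cd])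
    fix u assume u: "u \<in> half_region c \<inter> W"
    then show dT: "det (transpose (proj_matrix c u)) \<noteq> 0" using detT by blast
    then have "invertible (transpose (proj_matrix c u))" by (simp add: invertible_det_nz)
    then show "transpose (proj_matrix c u) *v g u = d u"
      by (simp add: g_def matrix_vector_mul_assoc matrix_inv_right)
  qed
  have "grad (par c u) = g u" if u: "u \<in> half_region c \<inter> W" for u
  proof -
    have r: "rep c u (par c u)" using rp u by blast
    have uU: "par c u \<in> U" using u by (simp add: W_def)
    have ur: "u \<in> region c" by (rule repD(3)[OF r])
    have eq: "F (par c x) = f (par c x)" if x: "x \<in> half_region c" "x \<in> W" for x
      using F[of "par c x"] repD(5)[OF rp[OF x(1)]] x(2) by (simp add: W_def)
    have "((\<lambda>x. F (par c x)) has_derivative (\<lambda>v. DF (par c u) (dpar c u v))) (at u within half_region c)"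
      by (rule has_derivative_at_withinI[OF has_derivative_compose[OF par_has_derivative[OF c ur] DF[OF uU]]])
    then have "((\<lambda>x. f (par c x)) has_derivative (\<lambda>v. DF (par c u) (dpar c u v))) (at u within half_region c)"
    proof (rule has_derivative_transform_eventually)
      show "\<forall>\<^sub>F x in at u within half_region c. F (par c x) = f (par c x)"
        using eventually_at_topological[of "\<lambda>x. F (par c x) = f (par c x)" u "half_region c"] Wo u eq by auto
    qed (use eq u in auto)
    from half_region_derivative_unique[OF IntD1[OF u] c f_par_has_derivative[OF r] this]
    have gv: "grad (par c u) \<bullet> snd (dpar c u v) = DF (par c u) (dpar c u v)" for v by (rule fun_cong)
    have "(transpose (proj_matrix c u) *v grad (par c u)) $ j = d u $ j" for j
    proof -
      have "(transpose (proj_matrix c u) *v grad (par c u)) $ j = grad (par c u) \<bullet> column j (proj_matrix c u)"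
        by (simp add: matrix_vector_mult_def transpose_def inner_vec_def column_def mult.commute)
      also have "\<dots> = DF (par c u) (dpar c u (axis j 1))" unfolding column_proj_matrix by (rule gv)
      also have "\<dots> = DF (par c u) (\<Sum>b\<in>Basis. (dpar c u (axis j 1) \<bullet> b) *\<^sub>R b)" by (simp only: euclidean_representation)
      also have "\<dots> = d u $ j"
        using has_derivative_linear[OF DF[OF uU]] by (simp add: linear_sum linear_scale d_def)
      finally show ?thesis .
    qed
    then have "transpose (proj_matrix c u) *v grad (par c u) = d u" by (simp add: vec_eq_iff)
    then have "g u = (matrix_inv (transpose (proj_matrix c u)) ** transpose (proj_matrix c u)) *v grad (par c u)"
      by (simp add: g_def matrix_vector_mul_assoc[symmetric])
    also have "\<dots> = grad (par c u)"
      using detT[of u] u by (simp add: matrix_inv_left invertible_det_nz)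
    finally show ?thesis by simp
  qed
  then have "continuous_on (half_region c \<inter> W) (\<lambda>u. grad (par c u))" by (intro continuous_on_eq[OF cg]) simp
  then have "continuous (at u0 within half_region c \<inter> W) (\<lambda>u. grad (par c u))"
    using u0 u0W by (simp add: continuous_on_eq_continuous_within)
  moreover have "at u0 within half_region c \<inter> W = at u0 within half_region c"
    by (rule at_within_nhd[OF u0W Wo]) auto
  ultimately show "continuous (at u0 within half_region c) (\<lambda>u. grad (par c u))" by (simp only:)
qed

lemma chart_cts_cong:
  assumes \<Phi>: "chart_cts \<Phi>" and eq: "\<And>y. y \<in> S \<Longrightarrow> \<Psi> y = \<Phi> y" shows "chart_cts \<Psi>"
proof (rule chart_ctsI[OF chart_ctsD[OF \<Phi>]])
  show "\<Psi> (par c u) = \<Phi> (par c u)" if "rep c u (par c u)" for c u by (rule eq[OF repD(5)[OF that]])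
qed

lemma chart_cts_slope: "chart_cts slope"
  by (rule chart_ctsI[of "\<lambda>c u. slope (par c u)"]) (auto intro: continuous_on_slope)

lemma chart_cts_f: "chart_cts f"
proof (rule chart_ctsI[of "\<lambda>c u. f (par c u)"])
  fix c assume c: "c \<in> charts S"
  have "par c ` half_region c \<subseteq> S" using c by (auto simp: charts_def patch_def dest: openin_imp_subset)
  then show "continuous_on (half_region c) (\<lambda>u. f (par c u))"
    by (rule continuous_on_compose2[OF continuous_on_f continuous_on_half_par[OF c]])
qed simp

definition integrand :: "'n minkowski \<Rightarrow> real" where
  "integrand y = sqrt (mink (gradient S f y) (gradient S f y)
     + (f y)\<^sup>2 * (- mink (mean_curvature S y) (mean_curvature S y)))"

lemma chart_cts_integrand: "chart_cts integrand"
proof -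
  have 1: "chart_cts (\<lambda>y. 1 / (1 - slope y \<bullet> slope y))"
  proof (rule chart_ctsI[of "\<lambda>c u. 1 / (1 - slope (par c u) \<bullet> slope (par c u))"])
    fix c assume c: "c \<in> charts S"
    have ne: "\<forall>u\<in>half_region c. 1 - slope (par c u) \<bullet> slope (par c u) \<noteq> 0"
    proof
      fix u assume "u \<in> half_region c"
      then have "rep c u (par c u)" using c by (simp add: rep_def)
      from slope_lt_1[OF repD(5)[OF this]] show "1 - slope (par c u) \<bullet> slope (par c u) \<noteq> 0" by simp
    qed
    show "continuous_on (half_region c) (\<lambda>u. 1 / (1 - slope (par c u) \<bullet> slope (par c u)))"
      by (rule continuous_on_divide[OF continuous_on_const continuous_on_diff[OF continuous_on_const
        continuous_on_inner[OF continuous_on_slope[OF c] continuous_on_slope[OF c]]] ne])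
  qed simp
  have cc: "continuous_on UNIV (\<lambda>(x, y). h x y)" if "continuous_on UNIV (\<lambda>p. h (fst p) (snd p))"
    for h :: "'x::topological_space \<Rightarrow> 'y::topological_space \<Rightarrow> 'z::topological_space"
    using that by (simp add: split_def)
  have 2: "chart_cts (\<lambda>y. (slope y \<bullet> grad y)\<^sup>2)"
    by (rule chart_cts_combine[OF chart_cts_slope chart_cts_grad, of "\<lambda>b g. (b \<bullet> g)\<^sup>2"])
      (intro cc continuous_intros)
  have 3: "chart_cts (\<lambda>y. (slope y \<bullet> grad y)\<^sup>2 * (1 / (1 - slope y \<bullet> slope y)))"
    by (rule chart_cts_combine[OF 2 1, of "(*)"]) (intro cc continuous_intros)
  have 4: "chart_cts (\<lambda>y. grad y \<bullet> grad y + (slope y \<bullet> grad y)\<^sup>2 * (1 / (1 - slope y \<bullet> slope y)))"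
    by (rule chart_cts_combine[OF chart_cts_grad 3, of "\<lambda>g r. g \<bullet> g + r"]) (intro cc continuous_intros)
  have 5: "chart_cts (\<lambda>y. (f y)\<^sup>2 * (- mink (mean_curvature S y) (mean_curvature S y)))"
    by (rule chart_cts_combine[OF chart_cts_f chart_cts_mean_curvature, of "\<lambda>a b. a\<^sup>2 * b"]) (intro cc continuous_intros)
  have 6: "chart_cts (\<lambda>y. sqrt ((grad y \<bullet> grad y + (slope y \<bullet> grad y)\<^sup>2 * (1 / (1 - slope y \<bullet> slope y)))
      + (f y)\<^sup>2 * (- mink (mean_curvature S y) (mean_curvature S y))))"
    by (rule chart_cts_combine[OF 4 5, of "\<lambda>a b. sqrt (a + b)"]) (intro cc continuous_intros)
  show ?thesis
    by (rule chart_cts_cong[OF 6]) (simp only: integrand_def gradient_norm)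
qed

text \<open>
  Here the mean curvature term is dropped.
\<close>

lemma integrand_ge: "y \<in> S \<Longrightarrow> norm (grad y) \<le> integrand y"
proof -
  assume yS: "y \<in> S"
  have "(norm (grad y))\<^sup>2 \<le> mink (gradient S f y) (gradient S f y)
     + (f y)\<^sup>2 * (- mink (mean_curvature S y) (mean_curvature S y))"
    using gradient_ge[OF yS] mult_nonneg_nonneg[OF zero_le_power2[of "f y"] mean_curvature_timelike[OF yS]] by linarith
  then show ?thesis unfolding integrand_def by (rule real_le_rsqrt)
qed

end

section \<open>Lifting straight lines\<close>

lemma sum_le_nn_integral_count_space:
  fixes F :: "'a \<Rightarrow> ennreal"
  assumes "finite Z"
  shows "(\<Sum>z\<in>Z. F z) \<le> (\<integral>\<^sup>+z. F z \<partial>count_space UNIV)"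
proof -
  have "(\<Sum>z\<in>Z. F z) = (\<integral>\<^sup>+z. F z \<partial>count_space Z)"
    using assms by (simp add: nn_integral_count_space_finite)
  also have "\<dots> = (\<integral>\<^sup>+z. F z * indicator Z z \<partial>count_space UNIV)"
    by (simp add: nn_integral_count_space_indicator)
  also have "\<dots> \<le> (\<integral>\<^sup>+z. F z \<partial>count_space UNIV)"
    by (intro nn_integral_mono) (simp add: indicator_def)
  finally show ?thesis .
qed

context spacelike_hypersurface
begin

text \<open>
  The projection to space is a local diffeomorphism in the interior, by the inverse function theorem
  in a chart.
\<close>

lemma local_section:
  assumes y: "y \<in> Intr"
  obtains B V s where "open B" "snd y \<in> B" "open V" "y \<in> V"
    "\<And>x. x \<in> B \<Longrightarrow> s x \<in> Intr" "\<And>x. x \<in> B \<Longrightarrow> snd (s x) = x"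
    "\<And>z. z \<in> S \<inter> V \<Longrightarrow> snd z \<in> B \<and> s (snd z) = z"
    "\<And>x. x \<in> B \<Longrightarrow> (s has_derivative (\<lambda>w. (slope (s x) \<bullet> w, w))) (at x)"
    "\<And>\<Phi> :: 'n minkowski \<Rightarrow> real^'n. chart_cts \<Phi> \<Longrightarrow> continuous_on B (\<lambda>x. \<Phi> (s x))"
proof -
  obtain c u where r: "rep c u y" and ne: "u $ face c \<noteq> 0" using y unfolding Intr_def by blast
  define U where "U = region c \<inter> {x. 0 < x $ face c}"
  have U: "open U" "u \<in> U"
    using repD(8,3,9)[OF r] ne unfolding U_def by (auto intro!: open_Int open_halfspace_component_gt_cart)
  have rU: "rep c x (par c x)" if "x \<in> U" for x
    using that repD(1)[OF r] by (simp add: rep_def U_def half_region_def)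
  have UI: "par c x \<in> Intr" if x: "x \<in> U" for x
    using rep_Int_iff[OF rU[OF x]] x by (simp add: U_def)
  define D where "D x = Blinfun (\<lambda>v. snd (dpar c x v))" for x
  have D: "blinfun_apply (D x) = (\<lambda>v. snd (dpar c x v))" if "x \<in> U" for x
    unfolding D_def using proj_linear[OF rU[OF that]]
    by (intro bounded_linear_Blinfun_apply) (simp add: linear_conv_bounded_linear)
  have der: "((\<lambda>x. snd (par c x)) has_derivative blinfun_apply (D x)) (at x)" if "x \<in> U" for x
    unfolding D[OF that]
    by (rule bounded_linear.has_derivative[OF bounded_linear_snd par_has_derivative[OF repD(1,3)[OF rU[OF that]]]])
  have contD: "continuous_on U D"
  proof (rule continuous_on_blinfun_componentwise)
    fix i :: "real^'n"
    have "continuous_on U (\<lambda>x. snd (dpar c x i))"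
      by (intro continuous_on_snd continuous_on_subset[OF continuous_on_dpar[OF repD(1)[OF r]]]) (auto simp: U_def)
    then show "continuous_on U (\<lambda>x. blinfun_apply (D x) i)"
      by (rule continuous_on_eq) (simp add: D)
  qed
  obtain k where k: "linear k" "k \<circ> (\<lambda>v. snd (dpar c u v)) = id"
    using linear_injective_left_inverse[OF proj_linear[OF r] proj_inj[OF r]] by blast
  have ki: "Blinfun k o\<^sub>L D u = id_blinfun"
  proof (rule blinfun_eqI)
    fix v
    have "blinfun_apply (Blinfun k) = k"
      using k(1) by (intro bounded_linear_Blinfun_apply) (simp add: linear_conv_bounded_linear)
    then show "blinfun_apply (Blinfun k o\<^sub>L D u) v = blinfun_apply id_blinfun v"
      using fun_cong[OF k(2), of v] by (simp add: D[OF U(2)])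
  qed
  obtain U' B g g' where ift: "open U'" "U' \<subseteq> U" "u \<in> U'" "open B" "snd (par c u) \<in> B"
    "homeomorphism U' B (\<lambda>x. snd (par c x)) g"
    "\<And>x. x \<in> B \<Longrightarrow> (g has_derivative g' x) (at x)" "\<And>x. x \<in> B \<Longrightarrow> g' x = inv (blinfun_apply (D (g x)))"
    "\<And>x. x \<in> B \<Longrightarrow> bij (blinfun_apply (D (g x)))"
    by (rule inverse_function_theorem[OF U(1) der contD U(2) ki]) (assumption | rule that)+
  have gU: "g x \<in> U'" "g x \<in> U" "snd (par c (g x)) = x" if "x \<in> B" for x
    using ift(6) ift(2) that by (auto simp: homeomorphism_def)
  have gw: "g (snd (par c w)) = w" "snd (par c w) \<in> B" if "w \<in> U'" for w
    using ift(6) that by (auto simp: homeomorphism_def)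
  obtain V where V: "open V" "y \<in> V" "S \<inter> V = par c ` (half_region c \<inter> U')"
    by (rule chart_nbhd[OF r ift(1,3)])
  define s where "s x = par c (g x)" for x
  show ?thesis
  proof (rule that[of B V s])
    show "open B" "open V" "y \<in> V" by (fact ift V)+
    show "snd y \<in> B" using ift(5) repD(4)[OF r] by simp
    show "s x \<in> Intr" if "x \<in> B" for x unfolding s_def by (rule UI[OF gU(2)[OF that]])
    show "snd (s x) = x" if "x \<in> B" for x unfolding s_def by (rule gU(3)[OF that])
    show "snd z \<in> B \<and> s (snd z) = z" if z: "z \<in> S \<inter> V" for z
    proof -
      obtain w where "z = par c w" "w \<in> U'" using z V(3) by blast
      then show ?thesis using gw[of w] by (simp add: s_def)
    qed
    show "(s has_derivative (\<lambda>w. (slope (s x) \<bullet> w, w))) (at x)" if x: "x \<in> B" for x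
    proof -
      have rx: "rep c (g x) (s x)" unfolding s_def by (rule rU[OF gU(2)[OF x]])
      have "(s has_derivative (\<lambda>w. dpar c (g x) (g' x w))) (at x)"
        unfolding s_def[abs_def]
        by (rule has_derivative_compose[OF ift(7)[OF x] par_has_derivative[OF repD(1,3)[OF rx]]])
      moreover have "dpar c (g x) (g' x w) = (slope (s x) \<bullet> w, w)" for w
      proof -
        have "blinfun_apply (D (g x)) (g' x w) = w"
          unfolding ift(8)[OF x] by (rule surj_f_inv_f[OF bij_is_surj[OF ift(9)[OF x]]])
        then have sw: "snd (dpar c (g x) (g' x w)) = w" unfolding D[OF gU(2)[OF x]] .
        moreover have "fst (dpar c (g x) (g' x w)) = slope (s x) \<bullet> w"
          using slope[OF repD(5)[OF rx], of "dpar c (g x) (g' x w)"] sw by (simp add: tangent_space_eq[OF rx])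
        ultimately show ?thesis by (simp add: prod_eq_iff)
      qed
      ultimately show ?thesis by (simp only:)
    qed
    show "continuous_on B (\<lambda>x. \<Phi> (s x))" if \<Phi>: "chart_cts \<Phi>" for \<Phi> :: "'n minkowski \<Rightarrow> real^'n"
      unfolding s_def
    proof (rule continuous_on_compose2[OF chart_cts_continuous_on[OF \<Phi> repD(1)[OF r]] homeomorphism_cont2[OF ift(6)]])
      show "g ` B \<subseteq> {u \<in> half_region c. u $ face c \<noteq> 0}"
      proof
        fix v assume "v \<in> g ` B"
        then obtain x where "v = g x" "x \<in> B" by blast
        then have "v \<in> region c" "0 < v $ face c" using gU(2) by (auto simp: U_def)
        then show "v \<in> {u \<in> half_region c. u $ face c \<noteq> 0}" by (simp add: half_region_def)
      qed
    qed
  qed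
qed

lemma local_projection_injective:
  assumes y: "y \<in> S"
  obtains V where "open V" "y \<in> V" "inj_on snd (S \<inter> V)"
proof -
  obtain c u where r: "rep c u y" using rep_exists[OF y] by blast
  have der: "((\<lambda>x. snd (par c x)) has_derivative (\<lambda>v. snd (dpar c x v))) (at x)" if "x \<in> region c" for x
    by (rule bounded_linear.has_derivative[OF bounded_linear_snd par_has_derivative[OF repD(1)[OF r] that]])
  have cont: "continuous_on (region c) (\<lambda>x. snd (dpar c x v))" for v
    by (intro continuous_on_snd continuous_on_dpar[OF repD(1)[OF r]])
  obtain e where e: "e > 0" "ball u e \<subseteq> region c" "inj_on (\<lambda>x. snd (par c x)) (ball u e)"
    by (rule locally_injective[OF repD(8,3)[OF r] der cont proj_inj[OF r]]) (assumption | rule that)+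
  have ub: "u \<in> ball u e" using e by simp
  obtain V where V: "open V" "y \<in> V" "S \<inter> V = par c ` (half_region c \<inter> ball u e)"
    by (rule chart_nbhd[OF r open_ball ub])
  have "inj_on snd (S \<inter> V)"
    unfolding V(3)
  proof (rule inj_onI)
    fix p q assume "p \<in> par c ` (half_region c \<inter> ball u e)" "q \<in> par c ` (half_region c \<inter> ball u e)" and eq: "snd p = snd q"
    then obtain a b where "p = par c a" "a \<in> ball u e" "q = par c b" "b \<in> ball u e" by blast
    then show "p = q" using inj_onD[OF e(3), of a b] eq by simp
  qed
  then show ?thesis using V that by blast
qed

lemma finite_fibre: "finite {y \<in> S. snd y = x}"
proof (rule ccontr)
  let ?Y = "{y \<in> S. snd y = x}"
  assume "infinite ?Y"
  moreover have "?Y \<subseteq> S" by auto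
  ultimately have "\<exists>z\<in>S. z islimpt ?Y"
    using compact unfolding compact_eq_Bolzano_Weierstrass by (elim allE[of _ ?Y]) simp
  then obtain z where z: "z \<in> S" "z islimpt ?Y" by blast
  obtain V where V: "open V" "z \<in> V" "inj_on snd (S \<inter> V)" by (rule local_projection_injective[OF z(1)])
  have "\<exists>a\<in>?Y. a \<in> V \<and> a \<noteq> z"
    by (rule z(2)[unfolded islimpt_def, rule_format, OF V(2,1)])
  then obtain a where a: "a \<in> ?Y" "a \<in> V" "a \<noteq> z" by (elim bexE conjE)
  have "z \<in> V - {a}" "open (V - {a})" using a V by (simp_all add: open_delete)
  then have "\<exists>b\<in>?Y. b \<in> V - {a} \<and> b \<noteq> z"
    by (rule z(2)[unfolded islimpt_def, rule_format])
  then obtain b where b: "b \<in> ?Y" "b \<in> V - {a}" by (elim bexE conjE)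
  show False using inj_onD[OF V(3), of a b] a b by auto
qed

text \<open>
  Two lifts agree on a closed set of parameters, which is also open because the projection is locally
  injective, at boundary points as well.
\<close>

lemma lift_unique:
  assumes I: "connected I" and \<gamma>: "continuous_on I \<gamma>" "\<And>t. t \<in> I \<Longrightarrow> \<gamma> t \<in> S"
    and \<delta>: "continuous_on I \<delta>" "\<And>t. t \<in> I \<Longrightarrow> \<delta> t \<in> S"
    and same: "\<And>t. t \<in> I \<Longrightarrow> snd (\<gamma> t) = snd (\<delta> t)"
    and t0: "t0 \<in> I" "\<gamma> t0 = \<delta> t0" and t: "t \<in> (I :: real set)"
  shows "\<gamma> t = \<delta> t"
proof -
  define E where "E = {t \<in> I. \<gamma> t - \<delta> t \<in> {0}}"
  have "closedin (top_of_set I) E"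
    using continuous_closedin_preimage[OF continuous_on_diff[OF \<gamma>(1) \<delta>(1)] closed_singleton[of 0]]
    by (simp add: E_def vimage_def Int_def)
  moreover have "openin (top_of_set I) E"
  proof (subst openin_subopen, intro ballI)
    fix a assume a: "a \<in> E"
    then have aI: "a \<in> I" and ea: "\<gamma> a = \<delta> a" by (auto simp: E_def)
    obtain V where V: "open V" "\<gamma> a \<in> V" "inj_on snd (S \<inter> V)" by (rule local_projection_injective[OF \<gamma>(2)[OF aI]])
    define T where "T = (I \<inter> \<gamma> -` V) \<inter> (I \<inter> \<delta> -` V)"
    have "openin (top_of_set I) T" unfolding T_def
      by (intro openin_Int continuous_openin_preimage_gen \<gamma> \<delta> V)
    moreover have "a \<in> T" using aI ea V(2) by (simp add: T_def)
    moreover have "T \<subseteq> E"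
    proof
      fix b assume "b \<in> T"
      then have "b \<in> I" "\<gamma> b \<in> S \<inter> V" "\<delta> b \<in> S \<inter> V" using \<gamma>(2) \<delta>(2) by (auto simp: T_def)
      then show "b \<in> E" using inj_onD[OF V(3) same] by (simp add: E_def)
    qed
    ultimately show "\<exists>T. openin (top_of_set I) T \<and> a \<in> T \<and> T \<subseteq> E" by blast
  qed
  moreover have "t0 \<in> E" using t0 by (simp add: E_def)
  ultimately have "E = I" using I unfolding connected_clopen by blast
  then show ?thesis using t by (auto simp: E_def)
qed

definition is_lift :: "'n minkowski \<Rightarrow> real^'n \<Rightarrow> real \<Rightarrow> (real \<Rightarrow> 'n minkowski) \<Rightarrow> bool" where
  "is_lift y e b \<gamma> \<longleftrightarrow> 0 < b \<and> \<gamma> 0 = y \<and> continuous_on {0..<b} \<gamma> \<and>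
     (\<forall>t\<in>{0..<b}. \<gamma> t \<in> Intr \<and> snd (\<gamma> t) = snd y + t *\<^sub>R e)"

lemma is_liftD:
  assumes "is_lift y e b \<gamma>"
  shows "0 < b" "\<gamma> 0 = y" "continuous_on {0..<b} \<gamma>" "\<And>t. 0 \<le> t \<Longrightarrow> t < b \<Longrightarrow> \<gamma> t \<in> Intr"
    "\<And>t. 0 \<le> t \<Longrightarrow> t < b \<Longrightarrow> \<gamma> t \<in> S" "\<And>t. 0 \<le> t \<Longrightarrow> t < b \<Longrightarrow> snd (\<gamma> t) = snd y + t *\<^sub>R e"
  using assms Intr_subset unfolding is_lift_def by auto

lemma is_lift_agree:
  assumes \<gamma>: "is_lift y e b \<gamma>" and \<delta>: "is_lift y e b' \<delta>" and t: "0 \<le> t" "t < b" "t < b'"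
  shows "\<gamma> t = \<delta> t"
proof (rule lift_unique[of "{0..t}" \<gamma> \<delta> 0])
  show "continuous_on {0..t} \<gamma>" "continuous_on {0..t} \<delta>"
    using t by (auto intro: continuous_on_subset[OF is_liftD(3)[OF \<gamma>]] continuous_on_subset[OF is_liftD(3)[OF \<delta>]])
  show "snd (\<gamma> a) = snd (\<delta> a)" "\<gamma> a \<in> S" "\<delta> a \<in> S" if "a \<in> {0..t}" for a
    using that t is_liftD(5,6)[OF \<gamma>] is_liftD(5,6)[OF \<delta>] by auto
  show "\<gamma> 0 = \<delta> 0" using is_liftD(2)[OF \<gamma>] is_liftD(2)[OF \<delta>] by simp
qed (use t in auto)

lemma is_lift_section:
  assumes \<gamma>: "is_lift y e b \<gamma>" and t: "0 < t" "t < b"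
  obtains B s where "open B" "snd y + t *\<^sub>R e \<in> B" "s (snd y + t *\<^sub>R e) = \<gamma> t"
    "\<And>x. x \<in> B \<Longrightarrow> (s has_derivative (\<lambda>w. (slope (s x) \<bullet> w, w))) (at x)"
    "\<And>\<Phi> :: 'n minkowski \<Rightarrow> real^'n. chart_cts \<Phi> \<Longrightarrow> continuous_on B (\<lambda>x. \<Phi> (s x))"
    "\<forall>\<^sub>F a in nhds t. s (snd y + a *\<^sub>R e) = \<gamma> a"
proof -
  have \<gamma>t: "\<gamma> t \<in> Intr" using is_liftD(4)[OF \<gamma>] t by simp
  obtain B V s where s: "open B" "snd (\<gamma> t) \<in> B" "open V" "\<gamma> t \<in> V" "\<And>x. x \<in> B \<Longrightarrow> s x \<in> Intr" "\<And>x. x \<in> B \<Longrightarrow> snd (s x) = x"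
    "\<And>z. z \<in> S \<inter> V \<Longrightarrow> snd z \<in> B \<and> s (snd z) = z"
    "\<And>x. x \<in> B \<Longrightarrow> (s has_derivative (\<lambda>w. (slope (s x) \<bullet> w, w))) (at x)"
    "\<And>\<Phi> :: 'n minkowski \<Rightarrow> real^'n. chart_cts \<Phi> \<Longrightarrow> continuous_on B (\<lambda>x. \<Phi> (s x))"
    by (rule local_section[OF \<gamma>t]) (rule that)
  have st: "s (snd (\<gamma> t)) = \<gamma> t" using s(4,7) \<gamma>t Intr_subset by blast
  have xt: "snd (\<gamma> t) = snd y + t *\<^sub>R e" using is_liftD(6)[OF \<gamma>] t by simp
  have "isCont \<gamma> t"
    using continuous_on_interior[OF is_liftD(3)[OF \<gamma>], of t] t by simp
  have tt: "\<forall>\<^sub>F a in nhds t. a \<in> {0<..<b}" using t by (intro eventually_nhds_in_open) auto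
  have "\<forall>\<^sub>F a in nhds t. \<gamma> a \<in> V"
    using \<open>isCont \<gamma> t\<close> unfolding isCont_def tendsto_at_iff_tendsto_nhds
    by (rule topological_tendstoD) (use s(3,4) in auto)
  then have ev: "\<forall>\<^sub>F a in nhds t. s (snd y + a *\<^sub>R e) = \<gamma> a"
    using tt
  proof eventually_elim
    case (elim a)
    then have a: "0 \<le> a" "a < b" using t by auto
    show ?case using s(7)[of "\<gamma> a"] is_liftD(5,6)[OF \<gamma> a] elim(1) by simp
  qed
  show ?thesis
    by (rule that[OF s(1) _ _ s(8,9) ev]) (use s(2) st xt in simp_all)
qed

lemma is_lift_derivative:
  assumes \<gamma>: "is_lift y e b \<gamma>" and t: "0 < t" "t < b"
  shows "(\<gamma> has_vector_derivative (slope (\<gamma> t) \<bullet> e, e)) (at t)"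
proof -
  obtain B s where s: "open B" "snd y + t *\<^sub>R e \<in> B" "s (snd y + t *\<^sub>R e) = \<gamma> t"
    "\<And>x. x \<in> B \<Longrightarrow> (s has_derivative (\<lambda>w. (slope (s x) \<bullet> w, w))) (at x)"
    "\<And>\<Phi> :: 'n minkowski \<Rightarrow> real^'n. chart_cts \<Phi> \<Longrightarrow> continuous_on B (\<lambda>x. \<Phi> (s x))"
    "\<forall>\<^sub>F a in nhds t. s (snd y + a *\<^sub>R e) = \<gamma> a"
    by (rule is_lift_section[OF \<gamma> t]) (rule that)
  have "((\<lambda>t. s (snd y + t *\<^sub>R e)) has_vector_derivative (slope (\<gamma> t) \<bullet> e, e)) (at t)"
    using has_derivative_along_line[OF s(4)[OF s(2)]] s(3) by simp
  then show ?thesis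
    using has_vector_derivative_cong_ev[of UNIV "\<lambda>a. s (snd y + a *\<^sub>R e)" \<gamma> t "(slope (\<gamma> t) \<bullet> e, e)"] s(3,6)
    by (simp add: eventually_mono)
qed

lemma is_lift_continuous:
  fixes \<Phi> :: "'n minkowski \<Rightarrow> real^'n"
  assumes \<gamma>: "is_lift y e b \<gamma>" and \<Phi>: "chart_cts \<Phi>"
  shows "continuous_on {0<..<b} (\<lambda>t. \<Phi> (\<gamma> t))"
proof (intro continuous_at_imp_continuous_on ballI)
  fix t assume "t \<in> {0<..<b}"
  then have t: "0 < t" "t < b" by auto
  obtain B s where s: "open B" "snd y + t *\<^sub>R e \<in> B" "s (snd y + t *\<^sub>R e) = \<gamma> t"
    "\<And>x. x \<in> B \<Longrightarrow> (s has_derivative (\<lambda>w. (slope (s x) \<bullet> w, w))) (at x)"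
    "\<And>\<Phi> :: 'n minkowski \<Rightarrow> real^'n. chart_cts \<Phi> \<Longrightarrow> continuous_on B (\<lambda>x. \<Phi> (s x))"
    "\<forall>\<^sub>F a in nhds t. s (snd y + a *\<^sub>R e) = \<gamma> a"
    by (rule is_lift_section[OF \<gamma> t]) (rule that)
  have "isCont (\<lambda>x. \<Phi> (s x)) (snd y + t *\<^sub>R e)"
    using s(5)[OF \<Phi>] s(1,2) by (simp add: continuous_on_eq_continuous_at)
  then have "isCont (\<lambda>a. \<Phi> (s (snd y + a *\<^sub>R e))) t"
    by (rule isCont_o2[where f = "\<lambda>a. snd y + a *\<^sub>R e", rotated]) (intro continuous_intros)
  moreover have "\<forall>\<^sub>F a in nhds t. \<Phi> (s (snd y + a *\<^sub>R e)) = \<Phi> (\<gamma> a)"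
    using s(6) by (rule eventually_mono) simp
  ultimately show "isCont (\<lambda>a. \<Phi> (\<gamma> a)) t" by (simp add: isCont_cong)
qed

lemma is_lift_lipschitz:
  assumes \<gamma>: "is_lift y e b \<gamma>" and e: "norm e = 1" and ab: "0 < p" "p \<le> q" "q < b"
  shows "norm (\<gamma> q - \<gamma> p) \<le> 2 * (q - p)"
proof -
  have "norm (\<gamma> q - \<gamma> p) \<le> 2 * norm (q - p)"
  proof (rule differentiable_bound[of "{p..q}" \<gamma> "\<lambda>t h. h *\<^sub>R (slope (\<gamma> t) \<bullet> e, e)"])
    fix t assume t: "t \<in> {p..q}"
    then have t': "0 < t" "t < b" "0 \<le> t" using ab by auto
    show "(\<gamma> has_derivative (\<lambda>h. h *\<^sub>R (slope (\<gamma> t) \<bullet> e, e))) (at t within {p..q})"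
      using has_vector_derivative_at_within[OF is_lift_derivative[OF \<gamma> t'(1,2)]]
      unfolding has_vector_derivative_def .
    have "slope (\<gamma> t) \<bullet> slope (\<gamma> t) < 1" by (rule slope_lt_1[OF is_liftD(5)[OF \<gamma> t'(3,2)]])
    then have "norm (slope (\<gamma> t)) < 1" by (simp add: dot_square_norm abs_square_less_1)
    then have "\<bar>slope (\<gamma> t) \<bullet> e\<bar> \<le> 1" using Cauchy_Schwarz_ineq2[of "slope (\<gamma> t)" e] e by simp
    then have n: "norm (slope (\<gamma> t) \<bullet> e, e) \<le> 2" using norm_Pair_le[of "slope (\<gamma> t) \<bullet> e" e] e by simp
    show "onorm (\<lambda>h. h *\<^sub>R (slope (\<gamma> t) \<bullet> e, e)) \<le> 2"
    proof (rule onorm_le)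
      fix h :: real
      have "norm (h *\<^sub>R (slope (\<gamma> t) \<bullet> e, e)) = \<bar>h\<bar> * norm (slope (\<gamma> t) \<bullet> e, e)" by (rule norm_scaleR)
      also have "\<dots> \<le> \<bar>h\<bar> * 2" using n by (rule mult_left_mono) simp
      finally show "norm (h *\<^sub>R (slope (\<gamma> t) \<bullet> e, e)) \<le> 2 * norm h" by simp
    qed
  qed (use ab in auto)
  then show ?thesis using ab by simp
qed

text \<open>
  A straight line in space lifts to the hypersurface until it meets the boundary. The lift is Lipschitz,
  as the slope has norm less than $1$, so it has an endpoint at the supremal time; an interior
  endpoint would allow continuation, and compactness bounds the time.
\<close>

lemma lift_exists:
  assumes y: "y \<in> Intr" and e: "norm e = 1"
  obtains b \<gamma> where "is_lift y e b \<gamma>" "continuous_on {0..b} \<gamma>" "\<gamma> b \<in> Bd" "snd (\<gamma> b) = snd y + b *\<^sub>R e"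
proof -
  \<comment> \<open>all times up to which the line can be lifted\<close>
  define T where "T = {b. \<exists>\<gamma>. is_lift y e b \<gamma>}"
  have yS: "y \<in> S" using y Intr_subset by blast
  have extend: "\<exists>\<epsilon>>0. \<exists>s. continuous_on {-\<epsilon><..<\<epsilon>} s \<and> s 0 = z \<and> (\<forall>a\<in>{-\<epsilon><..<\<epsilon>}. s a \<in> Intr \<and> snd (s a) = snd z + a *\<^sub>R e)
      \<and> (\<exists>V. open V \<and> z \<in> V \<and> (\<forall>x\<in>S \<inter> V. \<forall>a\<in>{-\<epsilon><..<\<epsilon>}. snd x = snd z + a *\<^sub>R e \<longrightarrow> x = s a))"
    if z: "z \<in> Intr" for z
  proof -
  obtain B V s where s: "open B" "snd z \<in> B" "open V" "z \<in> V" "\<And>x. x \<in> B \<Longrightarrow> s x \<in> Intr" "\<And>x. x \<in> B \<Longrightarrow> snd (s x) = x"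
    "\<And>z. z \<in> S \<inter> V \<Longrightarrow> snd z \<in> B \<and> s (snd z) = z"
    "\<And>x. x \<in> B \<Longrightarrow> (s has_derivative (\<lambda>w. (slope (s x) \<bullet> w, w))) (at x)"
    "\<And>\<Phi> :: 'n minkowski \<Rightarrow> real^'n. chart_cts \<Phi> \<Longrightarrow> continuous_on B (\<lambda>x. \<Phi> (s x))"
    by (rule local_section[OF z]) (rule that)
    obtain \<epsilon> where \<epsilon>: "0 < \<epsilon>" "ball (snd z) \<epsilon> \<subseteq> B" using s(1,2) open_contains_ball by blast
    have inB: "snd z + a *\<^sub>R e \<in> B" if "a \<in> {-\<epsilon><..<\<epsilon>}" for a
      using \<epsilon>(2) that e by (auto simp: subset_iff dist_norm)
    have zS: "z \<in> S" using z Intr_subset by blast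
    have "continuous_on B s"
      by (intro continuous_at_imp_continuous_on ballI has_derivative_continuous[OF s(8)])
    then have "continuous_on {-\<epsilon><..<\<epsilon>} (\<lambda>a. s (snd z + a *\<^sub>R e))"
      by (rule continuous_on_compose2) (use inB in \<open>auto intro!: continuous_intros\<close>)
    moreover have "s (snd z + 0 *\<^sub>R e) = z" using s(4,7) zS by simp
    moreover have "\<forall>x\<in>S \<inter> V. \<forall>a\<in>{-\<epsilon><..<\<epsilon>}. snd x = snd z + a *\<^sub>R e \<longrightarrow> x = s (snd z + a *\<^sub>R e)"
      using s(7) by metis
    ultimately show ?thesis
      using \<epsilon>(1) inB s(3-6) by (intro exI[of _ \<epsilon>] conjI exI[of _ "\<lambda>a. s (snd z + a *\<^sub>R e)"] exI[of _ V]) auto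
  qed
  obtain \<epsilon>0 s0 where s0: "0 < \<epsilon>0" "continuous_on {-\<epsilon>0<..<\<epsilon>0} s0" "s0 0 = y"
    "\<And>a. a \<in> {-\<epsilon>0<..<\<epsilon>0} \<Longrightarrow> s0 a \<in> Intr \<and> snd (s0 a) = snd y + a *\<^sub>R e"
    using extend[OF y] by (elim exE conjE) (simp add: that)
  have "is_lift y e \<epsilon>0 s0"
    unfolding is_lift_def using s0 by (auto intro: continuous_on_subset[OF s0(2)])
  then have Tne: "T \<noteq> {}" and e0T: "\<epsilon>0 \<in> T" by (auto simp: T_def)
  obtain R where R: "\<And>z. z \<in> S \<Longrightarrow> norm z \<le> R" using compact_imp_bounded[OF compact] by (auto simp: bounded_iff)
  have bdd: "b \<le> 2 * R + 1" if b: "b \<in> T" for b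
  proof (rule ccontr)
    assume "\<not> b \<le> 2 * R + 1"
    then have t: "0 \<le> 2 * R + 1" "2 * R + 1 < b" using R[OF yS] norm_ge_zero[of y] by linarith+
    obtain \<gamma> where \<gamma>: "is_lift y e b \<gamma>" using b by (auto simp: T_def)
    have "norm ((2 * R + 1) *\<^sub>R e) = norm (snd (\<gamma> (2 * R + 1)) - snd y)"
      using is_liftD(6)[OF \<gamma> t] by simp
    also have "\<dots> \<le> norm (\<gamma> (2 * R + 1)) + norm y"
      using norm_triangle_ineq4[of "snd (\<gamma> (2 * R + 1))" "snd y"] norm_snd_le[of "snd (\<gamma> (2 * R + 1))" "fst (\<gamma> (2 * R + 1))"]
        norm_snd_le[of "snd y" "fst y"] by simp
    also have "\<dots> \<le> 2 * R" using R[OF is_liftD(5)[OF \<gamma> t]] R[OF yS] by simp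
    finally show False using e t by simp
  qed
  then have bddT: "bdd_above T" by (rule bdd_aboveI)
  define b where "b = Sup T"
  have b0: "0 < b" using cSup_upper[OF e0T bddT] s0(1) by (simp add: b_def)
  define \<gamma> where "\<gamma> t = (SOME z. \<exists>b' \<delta>. is_lift y e b' \<delta> \<and> t < b' \<and> z = \<delta> t)" for t
  have \<gamma>_eq: "\<gamma> t = \<delta> t" if \<delta>: "is_lift y e b' \<delta>" "0 \<le> t" "t < b'" for t b' \<delta>
  proof -
    have "\<exists>z. \<exists>b' \<delta>. is_lift y e b' \<delta> \<and> t < b' \<and> z = \<delta> t" using \<delta> by blast
    from someI_ex[OF this, folded \<gamma>_def] obtain b'' \<delta>' where "is_lift y e b'' \<delta>'" "t < b''" "\<gamma> t = \<delta>' t" by blast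
    then show ?thesis using is_lift_agree[of y e b'' \<delta>' b' \<delta> t] \<delta> by simp
  qed
  have ex: "\<exists>b' \<delta>. is_lift y e b' \<delta> \<and> t < b' \<and> b' \<le> b" if tb: "t < b" for t
  proof -
    obtain b' where "b' \<in> T" "t < b'" using less_cSup_iff[OF Tne bddT, of t] tb by (auto simp: b_def)
    moreover then have "b' \<le> b" unfolding b_def by (intro cSup_upper bddT)
    ultimately show ?thesis by (auto simp: T_def)
  qed
  have lift: "is_lift y e b \<gamma>"
    unfolding is_lift_def
  proof (intro conjI ballI)
    show "0 < b" by (rule b0)
    obtain b' \<delta> where \<delta>: "is_lift y e b' \<delta>" "0 < b'" using ex[OF b0] by blast
    show "\<gamma> 0 = y" using \<gamma>_eq[OF \<delta>(1) _ \<delta>(2)] is_liftD(2)[OF \<delta>(1)] by simp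
    show "continuous_on {0..<b} \<gamma>"
      unfolding continuous_on_eq_continuous_within
    proof
      fix t assume t: "t \<in> {0..<b}"
      then obtain b' \<delta> where \<delta>: "is_lift y e b' \<delta>" "t < b'" "b' \<le> b" using ex[of t] by auto
      have "continuous_on {0..<b'} \<gamma>"
        using is_liftD(3)[OF \<delta>(1)] by (rule continuous_on_eq) (use \<gamma>_eq[OF \<delta>(1)] in auto)
      then have "continuous (at t within {0..<b'}) \<gamma>"
        using t \<delta>(2) by (simp add: continuous_on_eq_continuous_within)
      moreover have "at t within {0..<b'} = at t within {0..<b}"
        by (rule at_within_nhd[of t "{..<b'}"]) (use \<delta>(2,3) in auto)
      ultimately show "continuous (at t within {0..<b}) \<gamma>" by simp
    qed
    fix t assume t: "t \<in> {0..<b}"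
    then obtain b' \<delta> where \<delta>: "is_lift y e b' \<delta>" "t < b'" using ex[of t] by auto
    have "\<gamma> t = \<delta> t" using \<gamma>_eq[OF \<delta>(1) _ \<delta>(2)] t by simp
    then show "\<gamma> t \<in> Intr" "snd (\<gamma> t) = snd y + t *\<^sub>R e" using is_liftD(4,6)[OF \<delta>(1) _ \<delta>(2)] t by auto
  qed
  define \<tau> where "\<tau> n = b - b * inverse (real (Suc (Suc n)))" for n :: nat
  have \<tau>: "0 < \<tau> n" "\<tau> n < b" for n
  proof -
    have i: "0 < inverse (real (Suc (Suc n)))" "inverse (real (Suc (Suc n))) < 1" by (auto intro!: inverse_less_1_iff[THEN iffD2])
    show "\<tau> n < b" using mult_pos_pos[OF b0 i(1)] by (simp only: \<tau>_def)
    show "0 < \<tau> n" using mult_strict_left_mono[OF i(2) b0] by (simp only: \<tau>_def)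
  qed
  have \<tau>b: "\<tau> \<longlonglongrightarrow> b"
    unfolding \<tau>_def using tendsto_diff[OF tendsto_const tendsto_mult[OF tendsto_const LIMSEQ_Suc[OF LIMSEQ_inverse_real_of_nat]], of b b]
    by simp
  have "\<gamma> (\<tau> n) \<in> S" for n using is_liftD(5)[OF lift] \<tau>[of n] by (simp add: less_imp_le)
  then obtain z r where z: "z \<in> S" "strict_mono r" "((\<lambda>n. \<gamma> (\<tau> n)) \<circ> r) \<longlonglongrightarrow> z"
    using compact unfolding compact_def by meson
  have \<tau>r: "(\<tau> \<circ> r) \<longlonglongrightarrow> b" by (rule LIMSEQ_subseq_LIMSEQ[OF \<tau>b z(2)])
  have near: "norm (z - \<gamma> p) \<le> 2 * (b - p)" if p: "0 < p" "p < b" for p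
  proof -
    have l1: "(\<lambda>n. norm (\<gamma> (\<tau> (r n)) - \<gamma> p)) \<longlonglongrightarrow> norm (z - \<gamma> p)"
      using z(3) by (intro tendsto_intros) (simp add: o_def)
    have l2: "(\<lambda>n. 2 * (\<tau> (r n) - p)) \<longlonglongrightarrow> 2 * (b - p)"
      using \<tau>r by (intro tendsto_intros) (simp add: o_def)
    have l3: "\<forall>\<^sub>F n in sequentially. norm (\<gamma> (\<tau> (r n)) - \<gamma> p) \<le> 2 * (\<tau> (r n) - p)"
    proof -
      have "\<forall>\<^sub>F n in sequentially. p < (\<tau> \<circ> r) n" by (rule order_tendstoD(1)[OF \<tau>r p(2)])
      then show ?thesis
        by eventually_elim (rule is_lift_lipschitz[OF lift e p(1)], use \<tau> in auto)
    qed
    show ?thesis by (rule tendsto_le[OF sequentially_bot l2 l1 l3])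
  qed
  have zlim: "(\<gamma> \<longlongrightarrow> z) (at b within {0..b})"
  proof (rule tendstoI)
    fix \<epsilon> :: real assume \<epsilon>: "0 < \<epsilon>"
    show "\<forall>\<^sub>F t in at b within {0..b}. dist (\<gamma> t) z < \<epsilon>"
      unfolding eventually_at
    proof (intro exI[of _ "min b (\<epsilon> / 3)"] conjI ballI impI)
      fix t assume t: "t \<in> {0..b}" "t \<noteq> b \<and> dist t b < min b (\<epsilon> / 3)"
      then have t': "0 < t" "t < b" "b - t < \<epsilon> / 3" by (auto simp: dist_real_def)
      then show "dist (\<gamma> t) z < \<epsilon>" using near[OF t'(1,2)] by (simp add: dist_norm norm_minus_commute)
    qed (use b0 \<epsilon> in auto)
  qed
  have snz: "snd z = snd y + b *\<^sub>R e"
  proof (rule LIMSEQ_unique)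
    show "(\<lambda>n. snd (\<gamma> (\<tau> (r n)))) \<longlonglongrightarrow> snd z" using tendsto_snd[OF z(3)] by (simp add: o_def)
    have "(\<lambda>n. snd y + \<tau> (r n) *\<^sub>R e) \<longlonglongrightarrow> snd y + b *\<^sub>R e"
      using \<tau>r by (intro tendsto_intros) (simp add: o_def)
    then show "(\<lambda>n. snd (\<gamma> (\<tau> (r n)))) \<longlonglongrightarrow> snd y + b *\<^sub>R e"
      using is_liftD(6)[OF lift less_imp_le[OF \<tau>(1)] \<tau>(2)] by simp
  qed
  have zBd: "z \<notin> Intr"
  proof
    assume zI: "z \<in> Intr"
    obtain \<epsilon> s V where s: "0 < \<epsilon>" "continuous_on {-\<epsilon><..<\<epsilon>} s"
      "\<And>a. a \<in> {-\<epsilon><..<\<epsilon>} \<Longrightarrow> s a \<in> Intr \<and> snd (s a) = snd z + a *\<^sub>R e" and V: "open V" "z \<in> V"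
      "\<And>x a. x \<in> S \<inter> V \<Longrightarrow> a \<in> {-\<epsilon><..<\<epsilon>} \<Longrightarrow> snd x = snd z + a *\<^sub>R e \<Longrightarrow> x = s a"
      using extend[OF zI] by (elim exE conjE) (simp add: that)
    obtain d where d: "0 < d" "ball z d \<subseteq> V" using V(1,2) open_contains_ball by blast
    define p where "p = max (b / 2) (max (b - \<epsilon> / 2) (b - d / 3))"
    have p: "0 < p" "p < b" "b - \<epsilon> < p" "2 * (b - p) < d" using b0 s(1) d(1) by (auto simp: p_def max_def)
    have agree: "\<gamma> t = s (t - b)" if t: "p \<le> t" "t < b" for t
    proof (rule V(3))
      have "norm (z - \<gamma> t) < d" using near[of t] t p by auto
      then have "\<gamma> t \<in> V" using d(2) by (auto simp: dist_norm)
      then show "\<gamma> t \<in> S \<inter> V" using is_liftD(5)[OF lift, of t] t p by simp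
      show "t - b \<in> {-\<epsilon><..<\<epsilon>}" using t p s(1) by auto
      show "snd (\<gamma> t) = snd z + (t - b) *\<^sub>R e"
        using is_liftD(6)[OF lift, of t] t p snz by (simp add: algebra_simps)
    qed
    define \<eta> where "\<eta> t = (if t \<le> p then \<gamma> t else s (t - b))" for t
    have "is_lift y e (b + \<epsilon>) \<eta>"
      unfolding is_lift_def
    proof (intro conjI ballI)
      show "0 < b + \<epsilon>" using b0 s(1) by simp
      show "\<eta> 0 = y" using p is_liftD(2)[OF lift] by (simp add: \<eta>_def)
      have "continuous_on ({0..p} \<union> {p..<b + \<epsilon>}) (\<lambda>t. if t \<le> p then \<gamma> t else s (t - b))"
      proof (rule continuous_on_cases_le[where h = "\<lambda>t. t"])
        show "continuous_on {t \<in> {0..p} \<union> {p..<b + \<epsilon>}. t \<le> p} \<gamma>"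
          by (rule continuous_on_subset[OF is_liftD(3)[OF lift]]) (use p in auto)
        show "continuous_on {t \<in> {0..p} \<union> {p..<b + \<epsilon>}. p \<le> t} (\<lambda>t. s (t - b))"
          by (rule continuous_on_compose2[OF s(2)]) (use p s(1) in \<open>auto intro!: continuous_intros\<close>)
        show "\<gamma> t = s (t - b)" if "t \<in> {0..p} \<union> {p..<b + \<epsilon>}" "t = p" for t
          using agree[of p] p that by simp
      qed (auto intro!: continuous_intros)
      moreover have "{0..p} \<union> {p..<b + \<epsilon>} = {0..<b + \<epsilon>}" using p s(1) by auto
      ultimately show "continuous_on {0..<b + \<epsilon>} \<eta>" unfolding \<eta>_def by simp
      fix t assume t: "t \<in> {0..<b + \<epsilon>}"
      have tb: "t - b \<in> {-\<epsilon><..<\<epsilon>}" if "p < t" using that t p by auto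
      show "\<eta> t \<in> Intr" "snd (\<eta> t) = snd y + t *\<^sub>R e"
        using is_liftD(4,6)[OF lift, of t] s(3)[OF tb] t p snz by (auto simp: \<eta>_def algebra_simps)
    qed
    then have "b + \<epsilon> \<in> T" by (auto simp: T_def)
    then have "b + \<epsilon> \<le> b" unfolding b_def by (rule cSup_upper[OF _ bddT])
    then show False using s(1) by simp
  qed
  define \<gamma>1 where "\<gamma>1 t = (if t = b then z else \<gamma> t)" for t
  show ?thesis
  proof (rule that[of b \<gamma>1])
    show l1: "is_lift y e b \<gamma>1"
      using lift b0 unfolding is_lift_def \<gamma>1_def by (auto intro: continuous_on_eq)
    show "continuous_on {0..b} \<gamma>1"
      unfolding continuous_on_eq_continuous_within
    proof
      fix t assume t: "t \<in> {0..b}"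
      show "continuous (at t within {0..b}) \<gamma>1"
      proof (cases "t = b")
        case True
        have "(\<gamma>1 \<longlongrightarrow> z) (at b within {0..b})"
          using zlim by (rule Lim_transform_eventually) (auto simp: eventually_at_filter \<gamma>1_def)
        then show ?thesis using True by (simp add: continuous_within \<gamma>1_def)
      next
        case False
        then have "continuous (at t within {0..<b}) \<gamma>1"
          using is_liftD(3)[OF l1] t by (simp add: continuous_on_eq_continuous_within)
        moreover have "at t within {0..<b} = at t within {0..b}"
          by (rule at_within_nhd[of t "{..<b}"]) (use False t in auto)
        ultimately show ?thesis by simp
      qed
    qed
    show "\<gamma>1 b \<in> Bd" "snd (\<gamma>1 b) = snd y + b *\<^sub>R e" using zBd z(1) snz by (auto simp: \<gamma>1_def Bd_def)
  qed
qed

end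

context spacelike_hypersurface
begin

section \<open>The inequality along a line\<close>

lemma lift_start_eq:
  assumes \<gamma>: "continuous_on {0..t} \<gamma>" "\<And>a. 0 \<le> a \<Longrightarrow> a \<le> t \<Longrightarrow> \<gamma> a \<in> S \<and> snd (\<gamma> a) = x + a *\<^sub>R e"
    and \<delta>: "continuous_on {0..t} \<delta>" "\<And>a. 0 \<le> a \<Longrightarrow> a \<le> t \<Longrightarrow> \<delta> a \<in> S \<and> snd (\<delta> a) = x + a *\<^sub>R e"
    and t: "0 \<le> t" "\<gamma> t = \<delta> t"
  shows "\<gamma> 0 = \<delta> 0"
  by (rule lift_unique[of "{0..t}" \<gamma> \<delta> t 0]) (use assms in auto)

end

context weighted_hypersurface
begin

lemma lift_integrand_measurable:
  assumes "is_lift y e b \<gamma>"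
  shows "(\<lambda>t. ennreal \<bar>grad (\<gamma> t) \<bullet> e\<bar> * indicator {0<..<b} t) \<in> borel_measurable borel"
  by (intro borel_measurable_ennreal_continuous_on continuous_intros is_lift_continuous[OF assms chart_cts_grad]) simp

text \<open>
  The fundamental theorem of calculus along the lift. The estimate is made on compact subintervals,
  where \<open>f\<close> is differentiable along the lift, and passed to the limit by continuity at the ends.
\<close>

lemma lift_bound:
  assumes \<gamma>: "is_lift y e b \<gamma>" and cont: "continuous_on {0..b} \<gamma>" and end_pt: "\<gamma> b \<in> Bd"
  shows "ennreal (f y) \<le> ennreal (f (\<gamma> b)) + (\<integral>\<^sup>+t. ennreal \<bar>grad (\<gamma> t) \<bullet> e\<bar> * indicator {0<..<b} t \<partial>lborel)"
    (is "_ \<le> _ + ?I")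
proof (cases "?I = top")
  case False
  then obtain I where I: "?I = ennreal I" "0 \<le> I" by (cases ?I) auto
  have b: "0 < b" by (rule is_liftD(1)[OF \<gamma>])
  define h where "h t = f (\<gamma> t)" for t
  define k where "k t = grad (\<gamma> t) \<bullet> e" for t
  have inS: "\<gamma> t \<in> S" if "t \<in> {0..b}" for t
    using that is_liftD(5)[OF \<gamma>, of t] end_pt by (cases "t = b") (auto simp: Bd_def)
  have ch: "continuous_on {0..b} h" unfolding h_def
    by (rule continuous_on_compose2[OF continuous_on_f cont]) (use inS in auto)
  have ck: "continuous_on {0<..<b} k" unfolding k_def
    by (intro continuous_intros is_lift_continuous[OF \<gamma> chart_cts_grad])
  have hk: "(h has_vector_derivative k t) (at t)" if t: "0 < t" "t < b" for t
  proof -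
    have tS: "\<gamma> t \<in> S" using is_liftD(5)[OF \<gamma>] t by simp
    obtain X where X: "X \<in> tangent_space S (\<gamma> t)" "snd X = e" using tangent_lift[OF tS] .
    have Xeq: "X = (slope (\<gamma> t) \<bullet> e, e)" using slope[OF tS X(1)] X(2) by (simp add: prod_eq_iff)
    have d\<gamma>: "(\<gamma> has_derivative (\<lambda>r. r *\<^sub>R X)) (at t within {0<..<b})"
      using has_vector_derivative_at_within[OF is_lift_derivative[OF \<gamma> t]]
      unfolding has_vector_derivative_def Xeq .
    have "(f has_derivative df (\<gamma> t)) (at (\<gamma> t) within \<gamma> ` {0<..<b})"
      by (rule has_derivative_subset[OF df_has_derivative[OF tS]]) (use inS in auto)
    from has_derivative_in_compose[OF d\<gamma> this]
    have "(h has_derivative (\<lambda>r. df (\<gamma> t) (r *\<^sub>R X))) (at t within {0<..<b})" by (simp add: h_def[abs_def])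
    moreover have "df (\<gamma> t) (r *\<^sub>R X) = r *\<^sub>R k t" for r
      using linear_scale[OF has_derivative_linear[OF df_has_derivative[OF tS]], of r X] df_eq_grad[OF tS X(1)] X(2)
      by (simp add: k_def)
    moreover have "at t within {0<..<b} = at t" using t by (intro at_within_open) auto
    ultimately show ?thesis by (simp add: has_vector_derivative_def)
  qed
  have step: "h p \<le> h q + I" if pq: "0 < p" "p \<le> q" "q < b" for p q
  proof -
    have sub: "{p..q} \<subseteq> {0<..<b}" using pq by auto
    have ik: "(k has_integral h q - h p) {p..q}"
      by (rule fundamental_theorem_of_calculus[OF pq(2)])
        (use pq in \<open>auto intro!: has_vector_derivative_at_within[OF hk]\<close>)
    have ck': "continuous_on {p..q} (\<lambda>t. \<bar>k t\<bar>)" by (intro continuous_intros continuous_on_subset[OF ck sub])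
    define J where "J = integral {p..q} (\<lambda>t. \<bar>k t\<bar>)"
    have iJ: "((\<lambda>t. \<bar>k t\<bar>) has_integral J) {p..q}"
      unfolding J_def by (rule integrable_integral[OF integrable_continuous_interval[OF ck']])
    have "norm (integral {p..q} k) \<le> J"
      unfolding J_def
      by (rule integral_norm_bound_integral[OF has_integral_integrable[OF ik] has_integral_integrable[OF iJ]]) simp
    then have 1: "h p - h q \<le> J" using integral_unique[OF ik] by simp
    have "ennreal J = (\<integral>\<^sup>+t. ennreal \<bar>k t\<bar> * indicator {p..q} t \<partial>lborel)"
      by (rule nn_integral_has_integral_lebesgue'[OF _ iJ, symmetric]) simp
    also have "\<dots> \<le> ?I"
      unfolding k_def using sub by (intro nn_integral_mono) (auto simp: indicator_def)
    finally have "J \<le> I" using I by simp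
    then show ?thesis using 1 by simp
  qed
  define p where "p n = b * inverse (real (Suc (Suc n)))" for n :: nat
  have p: "0 < p n" "p n \<le> b - p n" "b - p n < b" for n
  proof -
    show p0: "0 < p n" using b by (simp add: p_def)
    have "inverse (real (Suc (Suc n))) \<le> 1 / 2" by (simp add: field_simps)
    from mult_left_mono[OF this, of b] have "p n \<le> b / 2" using b by (simp add: p_def)
    then show "p n \<le> b - p n" by simp
    show "b - p n < b" using p0 by simp
  qed
  have pin: "p n \<in> {0..b}" "b - p n \<in> {0..b}" for n
    using p[of n] by auto
  have plim: "p \<longlonglongrightarrow> 0"
    unfolding p_def using tendsto_mult[OF tendsto_const LIMSEQ_Suc[OF LIMSEQ_inverse_real_of_nat], of b] by simp
  have "(\<lambda>n. h (p n)) \<longlonglongrightarrow> h 0"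
    by (rule continuous_on_tendsto_compose[OF ch plim]) (use b pin in auto)
  moreover have "(\<lambda>n. h (b - p n) + I) \<longlonglongrightarrow> h b + I"
  proof (intro tendsto_intros continuous_on_tendsto_compose[OF ch])
    show "(\<lambda>n. b - p n) \<longlonglongrightarrow> b" using tendsto_diff[OF tendsto_const plim, of b] by simp
    show "\<forall>\<^sub>F n in sequentially. b - p n \<in> {0..b}"
      using pin by simp
  qed (use b in auto)
  moreover have "\<forall>\<^sub>F n in sequentially. h (p n) \<le> h (b - p n) + I" using step[OF p] by simp
  ultimately have "h 0 \<le> h b + I" by (intro tendsto_le[OF sequentially_bot])
  then have "f y \<le> f (\<gamma> b) + I" using is_liftD(2)[OF \<gamma>] by (simp add: h_def)
  moreover have "0 \<le> f (\<gamma> b)" using pos[OF inS[of b]] b by simp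
  ultimately show ?thesis unfolding I(1) using I(2) by (simp add: ennreal_plus[symmetric] del: ennreal_plus)
qed simp

text \<open>
  At each time the lifts from different points of one fibre are at different points of the fibre
  over the moving point.
\<close>

lemma lift_family_bound:
  assumes Y: "finite Y" and l: "\<And>y. y \<in> Y \<Longrightarrow> is_lift y e (b y) (\<gamma> y)" "\<And>y. y \<in> Y \<Longrightarrow> snd y = x"
  shows "(\<Sum>y\<in>Y. ennreal \<bar>grad (\<gamma> y t) \<bullet> e\<bar> * indicator {0<..<b y} t)
      \<le> fibre_sum snd (\<lambda>z. \<bar>grad z \<bullet> e\<bar>) Intr (x + t *\<^sub>R e) * indicator {0<..} t"
proof (cases "0 < t")
  case t: True
  define Y' where "Y' = {y \<in> Y. t < b y}"
  have inj: "inj_on (\<lambda>y. \<gamma> y t) Y'"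
  proof (rule inj_onI)
    fix y y' assume yy: "y \<in> Y'" "y' \<in> Y'" "\<gamma> y t = \<gamma> y' t"
    then have L: "is_lift y e (b y) (\<gamma> y)" "is_lift y' e (b y') (\<gamma> y')" "t < b y" "t < b y'" "snd y = x" "snd y' = x"
      using l by (auto simp: Y'_def)
    have "\<gamma> y 0 = \<gamma> y' 0"
    proof (rule lift_start_eq[where t = t and x = x and e = e])
      have sub: "{0..t} \<subseteq> {0..<b y}" "{0..t} \<subseteq> {0..<b y'}" using L(3,4) by auto
      show "continuous_on {0..t} (\<gamma> y)" by (rule continuous_on_subset[OF is_liftD(3)[OF L(1)] sub(1)])
      show "continuous_on {0..t} (\<gamma> y')" by (rule continuous_on_subset[OF is_liftD(3)[OF L(2)] sub(2)])
      show "\<gamma> y a \<in> S \<and> snd (\<gamma> y a) = x + a *\<^sub>R e" if "0 \<le> a" "a \<le> t" for a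
        using is_liftD(5,6)[OF L(1), of a] that L by simp
      show "\<gamma> y' a \<in> S \<and> snd (\<gamma> y' a) = x + a *\<^sub>R e" if "0 \<le> a" "a \<le> t" for a
        using is_liftD(5,6)[OF L(2), of a] that L by simp
    qed (use t yy in auto)
    then show "y = y'" using is_liftD(2)[OF L(1)] is_liftD(2)[OF L(2)] by simp
  qed
  let ?F = "\<lambda>z. ennreal \<bar>grad z \<bullet> e\<bar> * indicator Intr z * indicator {x + t *\<^sub>R e} (snd z)"
  have "(\<Sum>y\<in>Y. ennreal \<bar>grad (\<gamma> y t) \<bullet> e\<bar> * indicator {0<..<b y} t) = (\<Sum>y\<in>Y'. ?F (\<gamma> y t))"
  proof (rule sum.mono_neutral_cong_right)
    show "\<forall>y\<in>Y - Y'. ennreal \<bar>grad (\<gamma> y t) \<bullet> e\<bar> * indicator {0<..<b y} t = 0"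
      by (auto simp: Y'_def indicator_def)
    fix y assume "y \<in> Y'"
    then have "is_lift y e (b y) (\<gamma> y)" "snd y = x" "t < b y" using l by (auto simp: Y'_def)
    then show "ennreal \<bar>grad (\<gamma> y t) \<bullet> e\<bar> * indicator {0<..<b y} t = ?F (\<gamma> y t)"
      using is_liftD(4,6)[of y e "b y" "\<gamma> y" t] t by (simp add: indicator_def)
  qed (use Y in \<open>auto simp: Y'_def\<close>)
  also have "\<dots> = (\<Sum>z\<in>(\<lambda>y. \<gamma> y t) ` Y'. ?F z)" by (simp add: sum.reindex[OF inj])
  also have "\<dots> \<le> (\<integral>\<^sup>+z. ?F z \<partial>count_space UNIV)"
    using Y by (intro sum_le_nn_integral_count_space) (simp add: Y'_def)
  also have "\<dots> = fibre_sum snd (\<lambda>z. \<bar>grad z \<bullet> e\<bar>) Intr (x + t *\<^sub>R e)" by (simp only: fibre_sum_def)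
  finally show ?thesis using t by simp
qed (simp add: indicator_def)

lemma endpoint_inj:
  assumes l: "\<And>y. y \<in> Y \<Longrightarrow> is_lift y e (b y) (\<gamma> y)" "\<And>y. y \<in> Y \<Longrightarrow> snd y = x"
    "\<And>y. y \<in> Y \<Longrightarrow> continuous_on {0..b y} (\<gamma> y)" "\<And>y. y \<in> Y \<Longrightarrow> \<gamma> y (b y) \<in> Bd"
    "\<And>y. y \<in> Y \<Longrightarrow> snd (\<gamma> y (b y)) = x + b y *\<^sub>R e" and e: "e \<noteq> 0"
  shows "inj_on (\<lambda>y. \<gamma> y (b y)) Y"
proof (rule inj_onI)
  fix y y' assume yy: "y \<in> Y" "y' \<in> Y" "\<gamma> y (b y) = \<gamma> y' (b y')"
  then have bb: "b y' = b y" using l(5)[of y] l(5)[of y'] e by simp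
  have mem: "\<gamma> z a \<in> S \<and> snd (\<gamma> z a) = x + a *\<^sub>R e" if z: "z \<in> Y" "0 \<le> a" "a \<le> b z" for z a
    using is_liftD(5,6)[OF l(1)[OF z(1)], of a] l(2,4,5)[OF z(1)] z by (cases "a = b z") (auto simp: Bd_def)
  have "\<gamma> y 0 = \<gamma> y' 0"
    by (rule lift_start_eq[where t = "b y" and x = x and e = e])
      (use l(3)[OF yy(1)] l(3)[OF yy(2)] mem[OF yy(1)] mem[OF yy(2)] bb yy is_liftD(1)[OF l(1)[OF yy(1)]] in auto)
  then show "y = y'" using is_liftD(2)[OF l(1)[OF yy(1)]] is_liftD(2)[OF l(1)[OF yy(2)]] by simp
qed

definition boundary_line_sum :: "('n minkowski \<Rightarrow> real) \<Rightarrow> (real^'n) set \<Rightarrow> ennreal" where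
  "boundary_line_sum g l = (\<integral>\<^sup>+z. ennreal (g z) * indicator Bd z * indicator l (snd z) \<partial>count_space UNIV)"

text \<open>
  Each point of the fibre sends a lift in direction \<open>e\<close> and one in direction \<open>-e\<close>. Together they charge
  \<open>f\<close> twice against the derivative on the two halves of the line and against boundary values. On either
  half, lifts from different points never meet and end at different boundary points; the ends of
  forward and backward lifts differ because they project to opposite sides of \<open>x\<close>.
\<close>

lemma line_inequality:
  assumes e: "norm e = 1" and fib: "\<And>y. y \<in> S \<Longrightarrow> snd y = x \<Longrightarrow> y \<in> Intr"
  shows "2 * fibre_sum snd f Intr x \<le>
    (\<integral>\<^sup>+t. fibre_sum snd (\<lambda>z. \<bar>grad z \<bullet> e\<bar>) Intr (x + t *\<^sub>R e) \<partial>lborel)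
      + boundary_line_sum f (range (\<lambda>t. x + t *\<^sub>R e))"
proof -
  define Y where "Y = {y \<in> S. snd y = x}"
  have Y: "finite Y" "Y \<subseteq> Intr" "\<And>y. y \<in> Y \<Longrightarrow> snd y = x"
    using finite_fibre fib by (auto simp: Y_def)
  have "fibre_sum snd f Intr x = (\<integral>\<^sup>+y. ennreal (f y) * indicator Y y \<partial>count_space UNIV)"
    unfolding fibre_sum_def using Intr_subset fib
    by (intro nn_integral_cong) (auto simp: Y_def indicator_def)
  also have "\<dots> = (\<Sum>y\<in>Y. ennreal (f y))"
    using Y(1) by (simp add: nn_integral_count_space_indicator[symmetric] nn_integral_count_space_finite)
  finally have fs: "fibre_sum snd f Intr x = (\<Sum>y\<in>Y. ennreal (f y))" .
  have lifts: "\<exists>b \<gamma>. \<forall>y\<in>Y. is_lift y d (b y) (\<gamma> y) \<and> continuous_on {0..b y} (\<gamma> y) \<and> \<gamma> y (b y) \<in> Bd \<and>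
      snd (\<gamma> y (b y)) = x + b y *\<^sub>R d" if d: "norm d = 1" for d :: "real^'n"
  proof -
    have "\<forall>y\<in>Y. \<exists>p. is_lift y d (fst p) (snd p) \<and> continuous_on {0..fst p} (snd p) \<and> snd p (fst p) \<in> Bd \<and>
      snd (snd p (fst p)) = x + fst p *\<^sub>R d"
    proof
      fix y assume y: "y \<in> Y"
      obtain b \<gamma> where "is_lift y d b \<gamma>" "continuous_on {0..b} \<gamma>" "\<gamma> b \<in> Bd" "snd (\<gamma> b) = snd y + b *\<^sub>R d"
        by (rule lift_exists[OF subsetD[OF Y(2) y] d]) (rule that)
      then show "\<exists>p. is_lift y d (fst p) (snd p) \<and> continuous_on {0..fst p} (snd p) \<and> snd p (fst p) \<in> Bd \<and>
          snd (snd p (fst p)) = x + fst p *\<^sub>R d"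
        using Y(3)[OF y] by (intro exI[of _ "(b, \<gamma>)"]) simp
    qed
    from bchoice[OF this] obtain p where "\<forall>y\<in>Y. is_lift y d (fst (p y)) (snd (p y)) \<and> continuous_on {0..fst (p y)} (snd (p y)) \<and>
      snd (p y) (fst (p y)) \<in> Bd \<and> snd (snd (p y) (fst (p y))) = x + fst (p y) *\<^sub>R d" by (elim exE)
    then show ?thesis by (intro exI[of _ "\<lambda>y. fst (p y)"] exI[of _ "\<lambda>y. snd (p y)"])
  qed
  obtain b \<gamma> where \<gamma>': "\<forall>y\<in>Y. is_lift y e (b y) (\<gamma> y) \<and> continuous_on {0..b y} (\<gamma> y) \<and> \<gamma> y (b y) \<in> Bd \<and>
      snd (\<gamma> y (b y)) = x + b y *\<^sub>R e" using lifts[OF e] by (elim exE)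
  have e': "norm (- e) = 1" using e by simp
  obtain c \<delta> where \<delta>': "\<forall>y\<in>Y. is_lift y (- e) (c y) (\<delta> y) \<and> continuous_on {0..c y} (\<delta> y) \<and> \<delta> y (c y) \<in> Bd \<and>
      snd (\<delta> y (c y)) = x + c y *\<^sub>R (- e)" using lifts[OF e'] by (elim exE)
  have \<gamma>: "is_lift y e (b y) (\<gamma> y)" "continuous_on {0..b y} (\<gamma> y)" "\<gamma> y (b y) \<in> Bd" "snd (\<gamma> y (b y)) = x + b y *\<^sub>R e"
    if "y \<in> Y" for y using bspec[OF \<gamma>' that] by simp_all
  have \<delta>: "is_lift y (- e) (c y) (\<delta> y)" "continuous_on {0..c y} (\<delta> y)" "\<delta> y (c y) \<in> Bd" "snd (\<delta> y (c y)) = x + c y *\<^sub>R (- e)"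
    if "y \<in> Y" for y using bspec[OF \<delta>' that] by simp_all
  define A where "A y t = ennreal \<bar>grad (\<gamma> y t) \<bullet> e\<bar> * indicator {0<..<b y} t" for y t
  define A' where "A' y t = ennreal \<bar>grad (\<delta> y t) \<bullet> (- e)\<bar> * indicator {0<..<c y} t" for y t
  have mA: "A y \<in> borel_measurable borel" "A' y \<in> borel_measurable borel" if "y \<in> Y" for y
    unfolding A_def A'_def by (rule lift_integrand_measurable[OF \<gamma>(1)[OF that]], rule lift_integrand_measurable[OF \<delta>(1)[OF that]])
  have mA': "(\<lambda>t. A' y (- t)) \<in> borel_measurable borel" if "y \<in> Y" for y
    by (rule measurable_compose[OF _ mA(2)[OF that]]) simp
  have e0: "e \<noteq> 0" "- e \<noteq> 0" using e by auto
  let ?l = "range (\<lambda>t. x + t *\<^sub>R e)"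
  have ends: "(\<Sum>y\<in>Y. ennreal (f (\<gamma> y (b y)))) + (\<Sum>y\<in>Y. ennreal (f (\<delta> y (c y)))) \<le> boundary_line_sum f ?l"
  proof -
    let ?F = "\<lambda>z. ennreal (f z) * indicator Bd z * indicator ?l (snd z)"
    define Z1 where "Z1 = (\<lambda>y. \<gamma> y (b y)) ` Y"
    define Z2 where "Z2 = (\<lambda>y. \<delta> y (c y)) ` Y"
    have i1: "inj_on (\<lambda>y. \<gamma> y (b y)) Y" by (rule endpoint_inj[OF \<gamma>(1) Y(3) \<gamma>(2,3,4) e0(1)])
    have i2: "inj_on (\<lambda>y. \<delta> y (c y)) Y" by (rule endpoint_inj[OF \<delta>(1) Y(3) \<delta>(2,3,4) e0(2)])
    have on_l: "x + t *\<^sub>R e \<in> ?l" "x - t *\<^sub>R e \<in> ?l" for t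
      by (rule range_eqI[of _ _ t], simp) (rule range_eqI[of _ _ "- t"], simp)
    have F1: "?F (\<gamma> y (b y)) = ennreal (f (\<gamma> y (b y)))" and F2: "?F (\<delta> y (c y)) = ennreal (f (\<delta> y (c y)))" if "y \<in> Y" for y
      using \<gamma>(3,4)[OF that] \<delta>(3,4)[OF that] on_l by (simp_all add: indicator_def)
    have dis: "Z1 \<inter> Z2 = {}"
    proof (rule ccontr)
      assume "Z1 \<inter> Z2 \<noteq> {}"
      then obtain w where w: "w \<in> Z1" "w \<in> Z2" by blast
      obtain y where y: "y \<in> Y" "w = \<gamma> y (b y)" using w(1) unfolding Z1_def by blast
      obtain y' where y': "y' \<in> Y" "w = \<delta> y' (c y')" using w(2) unfolding Z2_def by blast
      have yy: "y \<in> Y" "y' \<in> Y" "\<gamma> y (b y) = \<delta> y' (c y')" using y y' by simp_all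
      then have "x + b y *\<^sub>R e = x + c y' *\<^sub>R (- e)" using \<gamma>(4)[OF yy(1)] \<delta>(4)[OF yy(2)] by simp
      then have "(b y + c y') *\<^sub>R e = 0" by (simp add: scaleR_add_left)
      then show False using e0(1) is_liftD(1)[OF \<gamma>(1)[OF yy(1)]] is_liftD(1)[OF \<delta>(1)[OF yy(2)]] by simp
    qed
    have fin: "finite Z1" "finite Z2" using Y(1) by (auto simp: Z1_def Z2_def)
    have "(\<Sum>z\<in>Z1. ?F z) + (\<Sum>z\<in>Z2. ?F z) = (\<Sum>z\<in>Z1 \<union> Z2. ?F z)"
      by (rule sum.union_disjoint[OF fin dis, symmetric])
    also have "\<dots> \<le> boundary_line_sum f ?l"
      unfolding boundary_line_sum_def using fin by (intro sum_le_nn_integral_count_space) simp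
    also have "(\<Sum>z\<in>Z1. ?F z) = (\<Sum>y\<in>Y. ennreal (f (\<gamma> y (b y))))"
      unfolding Z1_def sum.reindex[OF i1] o_def using F1 by (intro sum.cong) auto
    also have "(\<Sum>z\<in>Z2. ?F z) = (\<Sum>y\<in>Y. ennreal (f (\<delta> y (c y))))"
      unfolding Z2_def sum.reindex[OF i2] o_def using F2 by (intro sum.cong) auto
    finally show ?thesis .
  qed
  have integrals: "(\<Sum>y\<in>Y. \<integral>\<^sup>+t. A y t \<partial>lborel) + (\<Sum>y\<in>Y. \<integral>\<^sup>+t. A' y t \<partial>lborel)
      \<le> (\<integral>\<^sup>+t. fibre_sum snd (\<lambda>z. \<bar>grad z \<bullet> e\<bar>) Intr (x + t *\<^sub>R e) \<partial>lborel)"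
  proof -
    have refl: "(\<integral>\<^sup>+t. A' y t \<partial>lborel) = (\<integral>\<^sup>+t. A' y (- t) \<partial>lborel)" if "y \<in> Y" for y
      using nn_integral_real_affine[of "A' y" "-1" 0] mA(2)[OF that] by simp
    have "(\<Sum>y\<in>Y. \<integral>\<^sup>+t. A y t \<partial>lborel) + (\<Sum>y\<in>Y. \<integral>\<^sup>+t. A' y t \<partial>lborel)
      = (\<integral>\<^sup>+t. (\<Sum>y\<in>Y. A y t) \<partial>lborel) + (\<integral>\<^sup>+t. (\<Sum>y\<in>Y. A' y (- t)) \<partial>lborel)"
      using mA mA' refl by (simp add: nn_integral_sum)
    also have "\<dots> = (\<integral>\<^sup>+t. (\<Sum>y\<in>Y. A y t) + (\<Sum>y\<in>Y. A' y (- t)) \<partial>lborel)"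
      using mA mA' by (intro nn_integral_add[symmetric] borel_measurable_sum) auto
    also have "\<dots> \<le> (\<integral>\<^sup>+t. fibre_sum snd (\<lambda>z. \<bar>grad z \<bullet> e\<bar>) Intr (x + t *\<^sub>R e) \<partial>lborel)"
    proof (rule nn_integral_mono)
      fix t
      have 1: "(\<Sum>y\<in>Y. A y t) \<le> fibre_sum snd (\<lambda>z. \<bar>grad z \<bullet> e\<bar>) Intr (x + t *\<^sub>R e) * indicator {0<..} t"
        unfolding A_def by (rule lift_family_bound[OF Y(1) \<gamma>(1) Y(3)])
      have 2: "(\<Sum>y\<in>Y. A' y (- t)) \<le> fibre_sum snd (\<lambda>z. \<bar>grad z \<bullet> (- e)\<bar>) Intr (x + (- t) *\<^sub>R (- e)) * indicator {0<..} (- t)"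
        unfolding A'_def by (rule lift_family_bound[OF Y(1) \<delta>(1) Y(3)])
      from add_mono[OF 1 2]
      show "(\<Sum>y\<in>Y. A y t) + (\<Sum>y\<in>Y. A' y (- t)) \<le> fibre_sum snd (\<lambda>z. \<bar>grad z \<bullet> e\<bar>) Intr (x + t *\<^sub>R e)"
        by (cases "0 < t"; cases "t < 0") (simp_all add: indicator_def)
    qed
    finally show ?thesis .
  qed
  have "2 * fibre_sum snd f Intr x = (\<Sum>y\<in>Y. ennreal (f y)) + (\<Sum>y\<in>Y. ennreal (f y))"
    unfolding fs by (simp add: mult_2)
  also have "\<dots> \<le> (\<Sum>y\<in>Y. ennreal (f (\<gamma> y (b y))) + (\<integral>\<^sup>+t. A y t \<partial>lborel)) + (\<Sum>y\<in>Y. ennreal (f (\<delta> y (c y))) + (\<integral>\<^sup>+t. A' y t \<partial>lborel))"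
    unfolding A_def A'_def using lift_bound[OF \<gamma>(1-3)] lift_bound[OF \<delta>(1-3)] by (intro add_mono sum_mono) auto
  also have "\<dots> = ((\<Sum>y\<in>Y. \<integral>\<^sup>+t. A y t \<partial>lborel) + (\<Sum>y\<in>Y. \<integral>\<^sup>+t. A' y t \<partial>lborel))
     + ((\<Sum>y\<in>Y. ennreal (f (\<gamma> y (b y)))) + (\<Sum>y\<in>Y. ennreal (f (\<delta> y (c y)))))"
    by (simp add: sum.distrib ac_simps)
  also have "\<dots> \<le> (\<integral>\<^sup>+t. fibre_sum snd (\<lambda>z. \<bar>grad z \<bullet> e\<bar>) Intr (x + t *\<^sub>R e) \<partial>lborel) + boundary_line_sum f ?l"
    by (rule add_mono[OF integrals ends])
  finally show ?thesis .
qed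

end

section \<open>Pieces of the atlas and projected area\<close>

lemma has_derivative_upd:
  fixes g :: "'a::real_normed_vector \<Rightarrow> real^'n::finite"
  assumes g: "(g has_derivative g') F" and t: "(t has_derivative t') F"
  shows "((\<lambda>u. upd (g u) i (t u)) has_derivative (\<lambda>v. upd (g' v) i (t' v))) F"
proof -
  have u: "upd x i r = x + (r - x $ i) *\<^sub>R axis i 1" for x :: "real^'n" and r
    by (simp add: vec_eq_iff axis_def)
  show ?thesis
    unfolding u
    by (intro has_derivative_add g has_derivative_scaleR_left has_derivative_diff t
        bounded_linear.has_derivative[OF bounded_linear_vec_nth])
qed

lemma has_derivative_upd_const:
  "((\<lambda>u. upd u k (0::real)) has_derivative (\<lambda>v. upd v k 0)) (at (u :: real^'n::finite))"
  by (rule has_derivative_upd[where g = "\<lambda>u. u" and g' = "\<lambda>v. v" and t = "\<lambda>_. 0" and t' = "\<lambda>_. 0"]) auto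

lemma continuous_on_upd [continuous_intros]:
  fixes g :: "'a::topological_space \<Rightarrow> real^'n::finite"
  assumes "continuous_on A g" "continuous_on A t"
  shows "continuous_on A (\<lambda>u. upd (g u) i (t u))"
proof -
  have "continuous_on A (\<lambda>u. g u + (t u - g u $ i) *\<^sub>R axis i 1)"
    using assms by (intro continuous_intros)
  moreover have "g u + (t u - g u $ i) *\<^sub>R axis i 1 = upd (g u) i (t u)" for u
    by (simp add: vec_eq_iff axis_def)
  ultimately show ?thesis by simp
qed

text \<open>
  Subtracting multiples of the unit column \<open>k\<close> from the other columns clears row \<open>i\<close> and changes
  nothing else.
\<close>

lemma det_replace_row:
  fixes B :: "real^'n^'n::finite"
  shows "det (\<chi> r j. if r = i then (if j = k then 1 else 0) else (if j = k then 0 else B $ r $ j))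
      = det (\<chi> r j. if j = k then axis i 1 $ r else B $ r $ j)" (is "det ?M = det ?B'")
proof -
  define w :: "real^'n" where "w = (\<chi> j. if j = k then 0 else - B $ i $ j)"
  define T :: "real^'n^'n" where "T = (\<chi> r. if r = k then row k (mat 1) + w else row r (mat 1))"
  have "w \<in> vec.span {row j (mat 1 :: real^'n^'n) |j. j \<noteq> k}"
  proof -
    have "w = (\<Sum>j\<in>UNIV - {k}. w $ j *s row j (mat 1))"
    proof (subst vec_eq_iff, intro allI)
      fix l
      have "(\<Sum>j\<in>UNIV - {k}. w $ j *s row j (mat 1)) $ l = (\<Sum>j\<in>UNIV - {k}. (w $ j *s row j (mat 1)) $ l)"
        by (rule sum_component)
      also have "\<dots> = (\<Sum>j\<in>UNIV - {k}. if l = j then w $ j else 0)"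
        by (rule sum.cong) (simp_all add: row_def mat_def)
      also have "\<dots> = w $ l" by (simp add: w_def)
      finally show "w $ l = (\<Sum>j\<in>UNIV - {k}. w $ j *s row j (mat 1)) $ l" by (rule sym)
    qed
    also have "\<dots> \<in> vec.span {row j (mat 1 :: real^'n^'n) |j. j \<noteq> k}"
      by (intro vec.span_sum vec.span_scale vec.span_base) auto
    finally show ?thesis .
  qed
  then have detT: "det T = 1"
    unfolding T_def by (subst det_row_span) auto
  have T: "T $ l $ j = (if l = j then 1 else 0) + (if l = k then w $ j else 0)" for l j
    by (simp add: T_def row_def mat_def)
  have "?M = ?B' ** T"
  proof (subst vec_eq_iff, intro allI, subst vec_eq_iff, intro allI)
    fix r j
    have "(?B' ** T) $ r $ j = (\<Sum>l\<in>UNIV. ?B' $ r $ l * (if l = j then 1 else 0)) + (\<Sum>l\<in>UNIV. ?B' $ r $ l * (if l = k then w $ j else 0))"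
      by (simp add: matrix_matrix_mult_def T distrib_left sum.distrib)
    also have "\<dots> = ?B' $ r $ j + ?B' $ r $ k * w $ j" by (simp add: if_distrib[of "\<lambda>x. _ * x"] cong: if_cong)
    also have "\<dots> = ?M $ r $ j" by (simp add: w_def axis_def)
    finally show "?M $ r $ j = (?B' ** T) $ r $ j" by simp
  qed
  then show ?thesis by (simp add: det_mul detT)
qed

context spacelike_hypersurface
begin

definition atlas :: "'n chart list" where "atlas = finite_atlas S"

lemma atlas: "set atlas \<subseteq> charts S" "S \<subseteq> (\<Union>c\<in>set atlas. patch c)"
proof -
  have "\<exists>cs. set cs \<subseteq> charts S \<and> S \<subseteq> (\<Union>c\<in>set cs. patch c)"
  proof -
    have "\<forall>c\<in>charts S. \<exists>T. open T \<and> patch c = S \<inter> T" by (auto simp: charts_def openin_open)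
    from bchoice[OF this] obtain T where T: "\<forall>c\<in>charts S. open (T c) \<and> patch c = S \<inter> T c" by (elim exE)
    have "S \<subseteq> (\<Union>c\<in>charts S. T c)"
    proof
      fix y assume "y \<in> S"
      then obtain c where "c \<in> charts S" "y \<in> patch c" using hypersurface unfolding hypersurface_def by blast
      then show "y \<in> (\<Union>c\<in>charts S. T c)" using T by blast
    qed
    note cov = this
    have oT: "open (T c)" if "c \<in> charts S" for c using T that by blast
    obtain C where C: "C \<subseteq> charts S" "finite C" "S \<subseteq> (\<Union>c\<in>C. T c)"
      by (rule compactE_image[OF compact oT cov]) (assumption | rule that)+
    obtain cs where cs: "set cs = C" using finite_list[OF C(2)] by blast
    have "S \<subseteq> (\<Union>c\<in>set cs. patch c)"
    proof
      fix y assume y: "y \<in> S"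
      then obtain c where c: "c \<in> C" "y \<in> T c" using C by blast
      then have "patch c = S \<inter> T c" using T C by blast
      then show "y \<in> (\<Union>c\<in>set cs. patch c)" using y c cs by blast
    qed
    then show ?thesis using cs C(1) by blast
  qed
  from someI_ex[OF this] show "set atlas \<subseteq> charts S" "S \<subseteq> (\<Union>c\<in>set atlas. patch c)"
    unfolding atlas_def finite_atlas_def by simp_all
qed

abbreviation chart_of :: "nat \<Rightarrow> 'n chart" where "chart_of m \<equiv> atlas ! m"

lemma chart_of: "m < length atlas \<Longrightarrow> chart_of m \<in> charts S"
  using atlas(1) by auto

lemma piece_subset: "piece atlas m \<subseteq> half_region (chart_of m)"
  by (auto simp: piece_def)

lemma piece_rep: "m < length atlas \<Longrightarrow> u \<in> piece atlas m \<Longrightarrow> rep (chart_of m) u (par (chart_of m) u)"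
  using chart_of piece_subset by (auto simp: rep_def)

lemma chart_inj:
  assumes "rep c u y" "rep c v y" shows "u = v"
proof -
  obtain q where "homeomorphism (half_region c) (patch c) (par c) q"
    using repD(1)[OF assms(1)] by (auto simp: charts_def)
  then have "q (par c u) = u" "q (par c v) = v" using repD(2)[OF assms(1)] repD(2)[OF assms(2)] by (auto simp: homeomorphism_def)
  then show ?thesis using repD(4)[OF assms(1)] repD(4)[OF assms(2)] by simp
qed

lemma piece_exists:
  assumes y: "y \<in> S"
  obtains m u where "m < length atlas" "u \<in> piece atlas m" "par (chart_of m) u = y"
proof -
  obtain c where c: "c \<in> set atlas" "y \<in> patch c" using atlas(2) y by blast
  then obtain j where "j < length atlas" "chart_of j = c" by (metis in_set_conv_nth)
  then have ex: "\<exists>m. m < length atlas \<and> y \<in> patch (chart_of m)" using c(2) by blast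
  define m where "m = (LEAST m. m < length atlas \<and> y \<in> patch (chart_of m))"
  have m: "m < length atlas" "y \<in> patch (chart_of m)" using LeastI_ex[OF ex] by (auto simp: m_def)
  have min: "y \<notin> patch (chart_of j)" if "j < m" for j
    using not_less_Least[of j "\<lambda>m. m < length atlas \<and> y \<in> patch (chart_of m)"] that m(1) by (auto simp: m_def[symmetric])
  obtain u where u: "u \<in> half_region (chart_of m)" "par (chart_of m) u = y" using m(2) by (auto simp: patch_def)
  then have "u \<in> piece atlas m" using min by (simp add: piece_def)
  then show ?thesis using that m(1) u(2) by blast
qed

lemma piece_unique:
  assumes "m < length atlas" "u \<in> piece atlas m" "m' < length atlas" "u' \<in> piece atlas m'"
    "par (chart_of m) u = par (chart_of m') u'"
  shows "m = m'" "u = u'"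
proof -
  have p: "par (chart_of m) u \<in> patch (chart_of m)" "par (chart_of m') u' \<in> patch (chart_of m')"
    using assms(2,4) piece_subset by (auto simp: patch_def)
  have "\<not> m < m'" "\<not> m' < m" using assms(2,4,5) p by (auto simp: piece_def)
  then show "m = m'" by simp
  then show "u = u'" using chart_inj[OF piece_rep[OF assms(1,2)]] piece_rep[OF assms(3,4)] assms(5) by simp
qed

lemma sigma_compact_half_region:
  assumes "c \<in> charts S" shows "sigma_compact (half_region c)"
proof -
  have "half_region c = region c \<inter> {u. 0 \<le> u $ face c}" by (auto simp: half_region_def)
  moreover have "closed {u :: real^'n. 0 \<le> u $ face c}" by (rule closed_halfspace_component_ge_cart)
  ultimately show ?thesis
    using sigma_compact_Int[OF open_imp_sigma_compact[OF open_region[OF assms]] closed_imp_sigma_compact] by simp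
qed

lemma sigma_compact_piece:
  assumes m: "m < length atlas" shows "sigma_compact (piece atlas m)"
proof -
  let ?c = "chart_of m"
  have "\<forall>c\<in>charts S. \<exists>T. open T \<and> patch c = S \<inter> T" by (auto simp: charts_def openin_open)
  from bchoice[OF this] obtain T where T: "\<forall>c\<in>charts S. open (T c) \<and> patch c = S \<inter> T c" by (elim exE)
  have Tj: "open (T (chart_of j))" "patch (chart_of j) = S \<inter> T (chart_of j)" if "j < m" for j
    using T chart_of[of j] m that by auto
  have "piece atlas m = half_region ?c \<inter> par ?c -` (- (\<Union>j<m. T (chart_of j)))"
  proof -
    have "par ?c u \<in> S" if "u \<in> half_region ?c" for u
      using that chart_of[OF m] by (intro repD(5)[of ?c u]) (simp add: rep_def)
    then show ?thesis using Tj(2) by (auto simp: piece_def)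
  qed
  moreover have "closedin (top_of_set (half_region ?c)) (half_region ?c \<inter> par ?c -` (- (\<Union>j<m. T (chart_of j))))"
    by (rule continuous_closedin_preimage[OF continuous_on_half_par[OF chart_of[OF m]]]) (use Tj(1) in auto)
  ultimately show ?thesis
    using sigma_compact_closedin[OF sigma_compact_half_region[OF chart_of[OF m]]] by simp
qed

lemma count_space_pieces:
  fixes F :: "'n minkowski \<Rightarrow> ennreal"
  assumes X: "X \<subseteq> S"
  shows "(\<integral>\<^sup>+y. F y * indicator X y \<partial>count_space UNIV) =
    (\<Sum>m<length atlas. \<integral>\<^sup>+u. F (par (chart_of m) u) * indicator {u \<in> piece atlas m. par (chart_of m) u \<in> X} u \<partial>count_space UNIV)"
proof -
  define P where "P m = {u \<in> piece atlas m. par (chart_of m) u \<in> X}" for m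
  have split: "indicator X y = (\<Sum>m<length atlas. indicator (par (chart_of m) ` P m) y :: ennreal)" for y
  proof (cases "y \<in> X")
    case True
    obtain m u where mu: "m < length atlas" "u \<in> piece atlas m" "par (chart_of m) u = y"
      by (rule piece_exists[OF subsetD[OF X True]]) (rule that)
    have "indicator (par (chart_of j) ` P j) y = (if j = m then 1 else 0 :: ennreal)" if j: "j < length atlas" for j
    proof (cases "j = m")
      case jm: True
      have "u \<in> P m" using mu(2,3) True by (simp add: P_def)
      then have "y \<in> par (chart_of m) ` P m" using mu(3) by blast
      then show ?thesis using jm by simp
    next
      case jm: False
      have "y \<notin> par (chart_of j) ` P j"
      proof
        assume "y \<in> par (chart_of j) ` P j"
        then obtain v where v: "y = par (chart_of j) v" "v \<in> P j" by blast
        have "v \<in> piece atlas j" using v(2) by (simp add: P_def)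
        then have "j = m" by (rule piece_unique(1)[OF j _ mu(1,2)]) (simp only: v(1)[symmetric] mu(3))
        then show False using jm by simp
      qed
      then show ?thesis using jm by simp
    qed
    then have "(\<Sum>j<length atlas. indicator (par (chart_of j) ` P j) y :: ennreal) = (\<Sum>j<length atlas. if j = m then 1 else 0)"
      by (intro sum.cong) auto
    then show ?thesis using True mu(1) by simp
  qed (auto simp: P_def indicator_def)
  have piece: "(\<integral>\<^sup>+y. F y * indicator (par (chart_of m) ` P m) y \<partial>count_space UNIV) =
    (\<integral>\<^sup>+u. F (par (chart_of m) u) * indicator (P m) u \<partial>count_space UNIV)" if m: "m < length atlas" for m
  proof -
    have bij: "bij_betw (par (chart_of m)) (P m) (par (chart_of m) ` P m)"
    proof (rule inj_on_imp_bij_betw, rule inj_onI)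
      fix v w assume "v \<in> P m" "w \<in> P m" "par (chart_of m) v = par (chart_of m) w"
      then show "v = w" using piece_unique(2)[OF m _ m, of v w] by (simp add: P_def)
    qed
    show ?thesis
      using nn_integral_bij_count_space[OF bij, of F]
      by (simp add: nn_integral_count_space_indicator)
  qed
  have "(\<integral>\<^sup>+y. F y * indicator X y \<partial>count_space UNIV) =
    (\<integral>\<^sup>+y. (\<Sum>m<length atlas. F y * indicator (par (chart_of m) ` P m) y) \<partial>count_space UNIV)"
    unfolding split by (simp add: sum_distrib_left)
  also have "\<dots> = (\<Sum>m<length atlas. \<integral>\<^sup>+y. F y * indicator (par (chart_of m) ` P m) y \<partial>count_space UNIV)"
    by (rule nn_integral_sum) simp
  finally show ?thesis using piece by (simp add: P_def)
qed

definition Ipiece :: "nat \<Rightarrow> (real^'n) set" where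
  "Ipiece m = {u \<in> piece atlas m. u $ face (chart_of m) \<noteq> 0}"

definition Fpiece :: "nat \<Rightarrow> (real^'n) set" where
  "Fpiece m = {u \<in> piece atlas m. u $ face (chart_of m) = 0}"

lemma Ipiece_eq: "m < length atlas \<Longrightarrow> Ipiece m = {u \<in> piece atlas m. par (chart_of m) u \<in> Intr}"
  unfolding Ipiece_def using rep_Int_iff[OF piece_rep] by blast

lemma Fpiece_eq: "m < length atlas \<Longrightarrow> Fpiece m = {u \<in> piece atlas m. par (chart_of m) u \<in> Bd}"
  unfolding Fpiece_def Bd_def using rep_Int_iff[OF piece_rep] repD(5)[OF piece_rep] by blast

lemma sigma_compact_Ipiece: "m < length atlas \<Longrightarrow> sigma_compact (Ipiece m)"
proof -
  assume m: "m < length atlas"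
  have "Ipiece m = piece atlas m \<inter> {u. 0 < u $ face (chart_of m)}"
    unfolding Ipiece_def using repD(9)[OF piece_rep[OF m]] by (auto simp: less_le)
  then show ?thesis
    using sigma_compact_Int[OF sigma_compact_piece[OF m] open_imp_sigma_compact[OF open_halfspace_component_gt_cart]] by simp
qed

lemma sigma_compact_Fpiece: "m < length atlas \<Longrightarrow> sigma_compact (Fpiece m)"
proof -
  assume m: "m < length atlas"
  have "Fpiece m = piece atlas m \<inter> ({u. 0 \<le> u $ face (chart_of m)} \<inter> {u. u $ face (chart_of m) \<le> 0})"
    unfolding Fpiece_def by auto
  then show ?thesis
    using sigma_compact_Int[OF sigma_compact_piece[OF m] closed_imp_sigma_compact[OF closed_Int[OF
      closed_halfspace_component_ge_cart closed_halfspace_component_le_cart]]] by simp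
qed

lemma det_isometry_proj:
  assumes Q: "orthogonal_transformation (Q :: real^'n \<Rightarrow> real^'n)" and r: "rep c u y"
  shows "\<bar>det (matrix (\<lambda>v. Q (snd (dpar c u v))))\<bar> = \<bar>det (proj_matrix c u)\<bar>"
proof -
  have lQ: "linear Q" using Q by (rule orthogonal_transformation_linear)
  have "matrix (\<lambda>v. Q (snd (dpar c u v))) = matrix Q ** proj_matrix c u"
    unfolding proj_matrix_def using matrix_compose[OF proj_linear[OF r] lQ] by (simp add: o_def)
  moreover have "\<bar>det (matrix Q)\<bar> = 1"
    using det_orthogonal_matrix[of "matrix Q"] Q orthogonal_transformation_matrix by fastforce
  ultimately show ?thesis by (simp add: det_mul abs_mult)
qed

lemma isometry_bounded_linear:
  fixes Q :: "real^'n \<Rightarrow> real^'n"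
  shows "orthogonal_transformation Q \<Longrightarrow> bounded_linear Q"
  by (simp add: linear_conv_bounded_linear[symmetric] orthogonal_transformation_linear)

text \<open>
  The area formula for the rotated projection, summed over the pieces, which meet each fibre in
  disjoint sets.
\<close>

lemma interior_area:
  fixes Q :: "real^'n \<Rightarrow> real^'n"
  assumes Q: "orthogonal_transformation Q" and h: "\<And>y. y \<in> Intr \<Longrightarrow> 0 \<le> h y"
    and c: "\<And>m. m < length atlas \<Longrightarrow> continuous_on (Ipiece m) (\<lambda>u. h (par (chart_of m) u))"
  obtains N where "N \<in> borel_measurable borel" "AE x in lborel. fibre_sum (\<lambda>y. Q (snd y)) h Intr x = N x"
    "(\<integral>\<^sup>+x. N x \<partial>lborel) = (\<Sum>m<length atlas. \<integral>\<^sup>+u. ennreal (h (par (chart_of m) u) * \<bar>det (proj_matrix (chart_of m) u)\<bar>) * indicator (Ipiece m) u \<partial>lborel)"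
proof -
  have "\<exists>N. N \<in> borel_measurable borel \<and>
      (AE x in lborel. fibre_sum (\<lambda>u. Q (snd (par (chart_of m) u))) (\<lambda>u. h (par (chart_of m) u)) (Ipiece m) x = N x) \<and>
      (\<integral>\<^sup>+x. N x \<partial>lborel) = (\<integral>\<^sup>+u. ennreal (h (par (chart_of m) u) * \<bar>det (proj_matrix (chart_of m) u)\<bar>) * indicator (Ipiece m) u \<partial>lborel)"
    if m: "m < length atlas" for m
  proof -
    let ?c = "chart_of m"
    have der: "((\<lambda>u. Q (snd (par ?c u))) has_derivative (\<lambda>v. Q (snd (dpar ?c u v)))) (at u)" if "u \<in> region ?c" for u
      by (intro bounded_linear.has_derivative[OF isometry_bounded_linear[OF Q]] bounded_linear.has_derivative[OF bounded_linear_snd par_has_derivative[OF chart_of[OF m] that]])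
    have cont: "continuous_on (region ?c) (\<lambda>u. Q (snd (dpar ?c u v)))" for v
      by (intro bounded_linear.continuous_on[OF isometry_bounded_linear[OF Q]] continuous_on_snd continuous_on_dpar[OF chart_of[OF m]])
    have sub: "Ipiece m \<subseteq> region ?c"
      using piece_subset half_region_subset[OF chart_of[OF m]] by (auto simp: Ipiece_def)
    have pos: "0 \<le> h (par ?c u)" if "u \<in> Ipiece m" for u using that h Ipiece_eq[OF m] by blast
    obtain N where N: "N \<in> borel_measurable borel"
      "AE x in lborel. fibre_sum (\<lambda>u. Q (snd (par ?c u))) (\<lambda>u. h (par ?c u)) (Ipiece m) x = N x"
      "(\<integral>\<^sup>+x. N x \<partial>lborel) = (\<integral>\<^sup>+u. ennreal (h (par ?c u) * \<bar>det (matrix (\<lambda>v. Q (snd (dpar ?c u v))))\<bar>) * indicator (Ipiece m) u \<partial>lborel)"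
      by (rule area_formula[OF open_region[OF chart_of[OF m]] der cont sigma_compact_Ipiece[OF m] sub c[OF m] pos]) (assumption | rule that)+
    have "(\<integral>\<^sup>+x. N x \<partial>lborel) = (\<integral>\<^sup>+u. ennreal (h (par ?c u) * \<bar>det (proj_matrix ?c u)\<bar>) * indicator (Ipiece m) u \<partial>lborel)"
      unfolding N(3)
    proof (rule nn_integral_cong)
      fix u
      show "ennreal (h (par ?c u) * \<bar>det (matrix (\<lambda>v. Q (snd (dpar ?c u v))))\<bar>) * indicator (Ipiece m) u =
          ennreal (h (par ?c u) * \<bar>det (proj_matrix ?c u)\<bar>) * indicator (Ipiece m) u"
        using det_isometry_proj[OF Q piece_rep[OF m, of u]] by (cases "u \<in> Ipiece m") (auto simp: Ipiece_def)
    qed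
    then show ?thesis using N(1,2) by (intro exI[of _ N]) simp
  qed
  then have "\<forall>m\<in>{..<length atlas}. \<exists>N. N \<in> borel_measurable borel \<and>
      (AE x in lborel. fibre_sum (\<lambda>u. Q (snd (par (chart_of m) u))) (\<lambda>u. h (par (chart_of m) u)) (Ipiece m) x = N x) \<and>
      (\<integral>\<^sup>+x. N x \<partial>lborel) = (\<integral>\<^sup>+u. ennreal (h (par (chart_of m) u) * \<bar>det (proj_matrix (chart_of m) u)\<bar>) * indicator (Ipiece m) u \<partial>lborel)"
    by simp
  from bchoice[OF this] obtain N where N': "\<forall>m\<in>{..<length atlas}. N m \<in> borel_measurable borel \<and>
      (AE x in lborel. fibre_sum (\<lambda>u. Q (snd (par (chart_of m) u))) (\<lambda>u. h (par (chart_of m) u)) (Ipiece m) x = N m x) \<and>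
      (\<integral>\<^sup>+x. N m x \<partial>lborel) = (\<integral>\<^sup>+u. ennreal (h (par (chart_of m) u) * \<bar>det (proj_matrix (chart_of m) u)\<bar>) * indicator (Ipiece m) u \<partial>lborel)"
    by (elim exE)
  have N: "N m \<in> borel_measurable borel"
      "AE x in lborel. fibre_sum (\<lambda>u. Q (snd (par (chart_of m) u))) (\<lambda>u. h (par (chart_of m) u)) (Ipiece m) x = N m x"
      "(\<integral>\<^sup>+x. N m x \<partial>lborel) = (\<integral>\<^sup>+u. ennreal (h (par (chart_of m) u) * \<bar>det (proj_matrix (chart_of m) u)\<bar>) * indicator (Ipiece m) u \<partial>lborel)"
    if "m < length atlas" for m
    using bspec[OF N', of m] that by simp_all
  have fs: "fibre_sum (\<lambda>y. Q (snd y)) h Intr x =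
      (\<Sum>m<length atlas. fibre_sum (\<lambda>u. Q (snd (par (chart_of m) u))) (\<lambda>u. h (par (chart_of m) u)) (Ipiece m) x)" for x
  proof -
    have "fibre_sum (\<lambda>y. Q (snd y)) h Intr x =
      (\<integral>\<^sup>+y. (ennreal (h y) * indicator {x} (Q (snd y))) * indicator Intr y \<partial>count_space UNIV)"
      by (simp add: fibre_sum_def mult_ac)
    also have "\<dots> = (\<Sum>m<length atlas. \<integral>\<^sup>+u. (ennreal (h (par (chart_of m) u)) * indicator {x} (Q (snd (par (chart_of m) u)))) *
        indicator {u \<in> piece atlas m. par (chart_of m) u \<in> Intr} u \<partial>count_space UNIV)"
      by (rule count_space_pieces[OF Intr_subset])
    also have "\<dots> = (\<Sum>m<length atlas. fibre_sum (\<lambda>u. Q (snd (par (chart_of m) u))) (\<lambda>u. h (par (chart_of m) u)) (Ipiece m) x)"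
      by (intro sum.cong) (simp_all add: fibre_sum_def Ipiece_eq mult_ac)
    finally show ?thesis .
  qed
  show ?thesis
  proof (rule that[of "\<lambda>x. \<Sum>m<length atlas. N m x"])
    show "(\<lambda>x. \<Sum>m<length atlas. N m x) \<in> borel_measurable borel" using N(1) by (intro borel_measurable_sum) auto
    have "AE x in lborel. \<forall>m\<in>{..<length atlas}. fibre_sum (\<lambda>u. Q (snd (par (chart_of m) u))) (\<lambda>u. h (par (chart_of m) u)) (Ipiece m) x = N m x"
      unfolding AE_finite_all[OF finite_lessThan] using N(2) by simp
    then show "AE x in lborel. fibre_sum (\<lambda>y. Q (snd y)) h Intr x = (\<Sum>m<length atlas. N m x)"
      by eventually_elim (simp add: fs)
    show "(\<integral>\<^sup>+x. (\<Sum>m<length atlas. N m x) \<partial>lborel) = (\<Sum>m<length atlas. \<integral>\<^sup>+u. ennreal (h (par (chart_of m) u) * \<bar>det (proj_matrix (chart_of m) u)\<bar>) * indicator (Ipiece m) u \<partial>lborel)"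
      using N(1,3) by (subst nn_integral_sum) auto
  qed
qed

lemma null_face:
  fixes F :: "real^'n \<Rightarrow> ennreal"
  shows "(\<integral>\<^sup>+u. F u * indicator {u. u $ k = 0} u \<partial>lborel) = 0"
proof -
  have "negligible {u :: real^'n. u $ k = 0}"
    by (rule negligible_standard_hyperplane_cart)
  then have "{u :: real^'n. u $ k = 0} \<in> null_sets lebesgue" by (simp add: negligible_iff_null_sets)
  then have "AE u in lebesgue. u \<notin> {u :: real^'n. u $ k = 0}" by (rule AE_not_in)
  then have "AE u in lborel. u \<notin> {u :: real^'n. u $ k = 0}" by (simp add: AE_completion_iff)
  then have "AE u in lborel. F u * indicator {u. u $ k = 0} u = 0" by eventually_elim (simp add: indicator_def)
  then have "(\<integral>\<^sup>+u. F u * indicator {u. u $ k = 0} u \<partial>lborel) = (\<integral>\<^sup>+u. 0 \<partial>(lborel :: (real^'n) measure))" by (rule nn_integral_cong_AE)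
  then show ?thesis by simp
qed

text \<open>
  The projected boundary is the image of a null set under a smooth map between spaces of equal
  dimension.
\<close>

lemma AE_fibre_interior: "AE x in lborel. \<forall>y\<in>S. snd y = x \<longrightarrow> y \<in> Intr"
proof -
  have "AE x in lborel. \<forall>u\<in>Fpiece m. snd (par (chart_of m) u) \<noteq> x" if m: "m < length atlas" for m
  proof -
    let ?c = "chart_of m"
    have der: "((\<lambda>u. snd (par ?c u)) has_derivative (\<lambda>v. snd (dpar ?c u v))) (at u)" if "u \<in> region ?c" for u
      by (intro bounded_linear.has_derivative[OF bounded_linear_snd par_has_derivative[OF chart_of[OF m] that]])
    have cont: "continuous_on (region ?c) (\<lambda>u. snd (dpar ?c u v))" for v
      by (intro continuous_on_snd continuous_on_dpar[OF chart_of[OF m]])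
    have c1: "continuous_on (Fpiece m) (\<lambda>u. 1 :: real)" by simp
    have p1: "0 \<le> (1 :: real)" if "u \<in> Fpiece m" for u by simp
    have sub: "Fpiece m \<subseteq> region ?c"
      using piece_subset half_region_subset[OF chart_of[OF m]] by (auto simp: Fpiece_def)
    obtain N where N: "N \<in> borel_measurable borel"
      "AE x in lborel. fibre_sum (\<lambda>u. snd (par ?c u)) (\<lambda>u. 1) (Fpiece m) x = N x"
      "(\<integral>\<^sup>+x. N x \<partial>lborel) = (\<integral>\<^sup>+u. ennreal (1 * \<bar>det (matrix (\<lambda>v. snd (dpar ?c u v)))\<bar>) * indicator (Fpiece m) u \<partial>lborel)"
      by (rule area_formula[where h = "\<lambda>_. 1", OF open_region[OF chart_of[OF m]] der cont sigma_compact_Fpiece[OF m] sub c1 p1])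
        (assumption | rule that)+
    have "(\<integral>\<^sup>+u. ennreal (1 * \<bar>det (matrix (\<lambda>v. snd (dpar ?c u v)))\<bar>) * indicator (Fpiece m) u \<partial>lborel)
      \<le> (\<integral>\<^sup>+u. ennreal (1 * \<bar>det (matrix (\<lambda>v. snd (dpar ?c u v)))\<bar>) * indicator {u. u $ face ?c = 0} u \<partial>lborel)"
      by (intro nn_integral_mono) (auto simp: Fpiece_def indicator_def)
    then have "(\<integral>\<^sup>+x. N x \<partial>lborel) = 0" unfolding N(3) null_face by simp
    then have "AE x in lborel. N x = 0" using N(1) by (subst (asm) nn_integral_0_iff_AE) auto
    with N(2) show ?thesis
    proof eventually_elim
      case (elim x)
      show ?case
      proof (intro ballI notI)
        fix u assume u: "u \<in> Fpiece m" "snd (par ?c u) = x"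
        have "(\<Sum>v\<in>{u}. ennreal 1 * indicator (Fpiece m) v * indicator {x} (snd (par ?c v))) \<le> fibre_sum (\<lambda>u. snd (par ?c u)) (\<lambda>u. 1) (Fpiece m) x"
          unfolding fibre_sum_def by (rule sum_le_nn_integral_count_space) simp
        then show False using elim u by simp
      qed
    qed
  qed
  then have "AE x in lborel. \<forall>m\<in>{..<length atlas}. \<forall>u\<in>Fpiece m. snd (par (chart_of m) u) \<noteq> x"
    unfolding AE_finite_all[OF finite_lessThan] by simp
  then show ?thesis
  proof eventually_elim
    case (elim x)
    show ?case
    proof (intro ballI impI, rule ccontr)
      fix y assume y: "y \<in> S" "snd y = x" "y \<notin> Intr"
      obtain m u where "m < length atlas" "u \<in> piece atlas m" "par (chart_of m) u = y" by (rule piece_exists[OF y(1)])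
      then have "u \<in> Fpiece m" "m < length atlas" "snd (par (chart_of m) u) = x" using y by (auto simp: Fpiece_eq Bd_def)
      then show False using elim by blast
    qed
  qed
qed

end

section \<open>Area swept out by the boundary\<close>

lemma upd_idem: "x $ i = t \<Longrightarrow> upd x i t = x"
  by (auto simp: vec_eq_iff)

context spacelike_hypersurface
begin

text \<open>
  The projected face, freed from its \<open>i\<close>-th coordinate: that coordinate becomes a parameter of its own.
  Thus the boundary points whose projection lies on a line parallel to the \<open>i\<close>-th axis become the fibre
  of a map between spaces of equal dimension, to which the area formula applies.
\<close>

definition slab :: "(real^'n \<Rightarrow> real^'n) \<Rightarrow> 'n \<Rightarrow> 'n chart \<Rightarrow> real^'n \<Rightarrow> real^'n" where
  "slab Q i c u = upd (Q (snd (par c (upd u (face c) 0)))) i (u $ face c)"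

definition dslab :: "(real^'n \<Rightarrow> real^'n) \<Rightarrow> 'n \<Rightarrow> 'n chart \<Rightarrow> real^'n \<Rightarrow> real^'n \<Rightarrow> real^'n" where
  "dslab Q i c u v = upd (Q (snd (dpar c (upd u (face c) 0) (upd v (face c) 0)))) i (v $ face c)"

definition slab_region :: "'n chart \<Rightarrow> (real^'n) set" where
  "slab_region c = {u. upd u (face c) 0 \<in> region c}"

context
  fixes Q :: "real^'n \<Rightarrow> real^'n" and c :: "'n chart" and i :: 'n
  assumes Q: "orthogonal_transformation Q" and c: "c \<in> charts S"
begin

lemma open_slab_region: "open (slab_region c)"
proof -
  have "continuous_on UNIV (\<lambda>u :: real^'n. upd u (face c) 0)" by (intro continuous_intros)
  from continuous_open_preimage[OF this open_UNIV open_region[OF c]] show ?thesis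
    by (simp add: slab_region_def vimage_def)
qed

lemma slab_has_derivative:
  assumes u: "u \<in> slab_region c" shows "(slab Q i c has_derivative dslab Q i c u) (at u)"
proof -
  have "((\<lambda>u. par c (upd u (face c) 0)) has_derivative (\<lambda>v. dpar c (upd u (face c) 0) (upd v (face c) 0))) (at u)"
    by (rule has_derivative_compose[OF has_derivative_upd_const par_has_derivative[OF c]])
      (use u in \<open>simp add: slab_region_def\<close>)
  from bounded_linear.has_derivative[OF isometry_bounded_linear[OF Q] bounded_linear.has_derivative[OF bounded_linear_snd this]]
  have "((\<lambda>u. Q (snd (par c (upd u (face c) 0)))) has_derivative
      (\<lambda>v. Q (snd (dpar c (upd u (face c) 0) (upd v (face c) 0))))) (at u)" .
  from has_derivative_upd[OF this bounded_linear_imp_has_derivative[OF bounded_linear_vec_nth]]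
  show ?thesis unfolding slab_def[abs_def] dslab_def[abs_def] .
qed

lemma continuous_on_dslab: "continuous_on (slab_region c) (\<lambda>u. dslab Q i c u v)"
proof -
  have "continuous_on (slab_region c) (\<lambda>u. dpar c (upd u (face c) 0) (upd v (face c) 0))"
    by (rule continuous_on_compose2[OF continuous_on_dpar[OF c]])
      (auto intro!: continuous_intros simp: slab_region_def)
  then show ?thesis
    unfolding dslab_def
    by (intro continuous_on_upd continuous_on_const bounded_linear.continuous_on[OF isometry_bounded_linear[OF Q]] continuous_on_snd)
qed

text \<open>
  Its Jacobian is the \<open>i\<close>-th component of the conormal: replacing the \<open>i\<close>-th row by that of the
  parameter leaves exactly one maximal minor.
\<close>

lemma det_dslab:
  assumes r: "rep c (upd u (face c) 0) y"
  shows "\<bar>det (matrix (dslab Q i c u))\<bar> = \<bar>Q (conormal c (upd u (face c) 0)) $ i\<bar>"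
proof -
  let ?k = "face c" and ?u = "upd u (face c) 0"
  let ?A = "proj_matrix c ?u"
  define B :: "real^'n^'n" where "B = matrix Q ** ?A"
  have lQ: "linear Q" by (rule orthogonal_transformation_linear[OF Q])
  have Qv: "matrix Q *v v = Q v" for v by (rule fun_cong[OF matrix_vector_mul(2)[OF lQ]])
  have Bcol: "B $ p $ j = Q (snd (dpar c ?u (axis j 1))) $ p" for p j
  proof -
    have "B $ p $ j = (matrix Q *v column j ?A) $ p"
      by (simp add: B_def matrix_matrix_mult_def matrix_vector_mult_def column_def)
    then show ?thesis by (simp only: Qv column_proj_matrix)
  qed
  obtain w where w: "Q w = axis i 1" using orthogonal_transformation_surj[OF Q] by (metis surjD)
  have "matrix (dslab Q i c u) = (\<chi> p j. if p = i then (if j = ?k then 1 else 0) else (if j = ?k then 0 else B $ p $ j))"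
  proof (subst vec_eq_iff, intro allI, subst vec_eq_iff, intro allI)
    fix p j
    have ax: "upd (axis j (1::real)) ?k 0 = (if j = ?k then 0 else axis j 1)" by (auto simp: vec_eq_iff axis_def)
    have "matrix (dslab Q i c u) $ p $ j = dslab Q i c u (axis j 1) $ p" by (simp add: matrix_def)
    also have "\<dots> = (if p = i then (if j = ?k then 1 else 0) else (if j = ?k then 0 else B $ p $ j))"
      unfolding dslab_def ax Bcol
      using linear_0[OF lQ] linear_0[OF repD(6)[OF r]] by (auto simp: axis_def)
    finally show "matrix (dslab Q i c u) $ p $ j =
        (\<chi> p j. if p = i then (if j = ?k then 1 else 0) else (if j = ?k then 0 else B $ p $ j)) $ p $ j" by simp
  qed
  then have "det (matrix (dslab Q i c u)) = det (\<chi> p j. if j = ?k then axis i 1 $ p else B $ p $ j)"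
    by (simp only: det_replace_row)
  also have "(\<chi> p j. if j = ?k then axis i 1 $ p else B $ p $ j) = matrix Q ** (\<chi> p j. if j = ?k then w $ p else ?A $ p $ j)"
  proof (subst vec_eq_iff, intro allI, subst vec_eq_iff, intro allI)
    fix p j
    have "(matrix Q *v w) $ p = axis i 1 $ p" by (simp only: Qv w)
    then have "(\<Sum>l\<in>UNIV. matrix Q $ p $ l * w $ l) = axis i 1 $ p" by (simp add: matrix_vector_mult_def)
    then show "(\<chi> p j. if j = ?k then axis i 1 $ p else B $ p $ j) $ p $ j =
        (matrix Q ** (\<chi> p j. if j = ?k then w $ p else ?A $ p $ j)) $ p $ j"
      by (simp add: matrix_matrix_mult_def B_def)
  qed
  also have "det \<dots> = det (matrix Q) * (conormal c ?u \<bullet> w)" by (simp add: det_mul conormal_inner)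
  also have "conormal c ?u \<bullet> w = Q (conormal c ?u) $ i"
  proof -
    have "conormal c ?u \<bullet> w = Q (conormal c ?u) \<bullet> Q w" using Q by (simp add: orthogonal_transformation_def)
    then show ?thesis by (simp add: w inner_axis)
  qed
  finally have "det (matrix (dslab Q i c u)) = det (matrix Q) * Q (conormal c ?u) $ i" .
  moreover have "\<bar>det (matrix Q)\<bar> = 1"
    using det_orthogonal_matrix[of "matrix Q"] Q orthogonal_transformation_matrix by fastforce
  ultimately show ?thesis by (simp add: abs_mult)
qed

end

text \<open>
  The area formula for the slab over the unit interval. The indicator of that interval integrates to
  $1$ along the line and records that each boundary point is counted once.
\<close>

lemma boundary_area:
  fixes Q :: "real^'n \<Rightarrow> real^'n"
  assumes Q: "orthogonal_transformation Q" and m: "m < length atlas"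
    and P: "sigma_compact P" "P \<subseteq> Fpiece m" and g: "continuous_on P g" "\<And>u. u \<in> P \<Longrightarrow> 0 \<le> g u"
  obtains N where "N \<in> borel_measurable borel"
    "AE x in lborel. N x = indicator {0..1} (x $ i) *
      (\<integral>\<^sup>+u. ennreal (g u) * indicator P u * indicator {w. \<forall>j. j \<noteq> i \<longrightarrow> Q w $ j = x $ j} (snd (par (chart_of m) u)) \<partial>count_space UNIV)"
    "(\<integral>\<^sup>+x. N x \<partial>lborel) = (\<integral>\<^sup>+y. ennreal (g (face_point (face (chart_of m)) y) *
        \<bar>Q (conormal (chart_of m) (face_point (face (chart_of m)) y)) $ i\<bar>) * indicator P (face_point (face (chart_of m)) y)
        \<partial>PiM (UNIV - {face (chart_of m)}) (\<lambda>_. lborel))"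
proof -
  let ?c = "chart_of m"
  let ?k = "face ?c"
  have c: "?c \<in> charts S" by (rule chart_of[OF m])
  have P0: "u $ ?k = 0" "upd u ?k 0 = u" "u \<in> half_region ?c" "rep ?c u (par ?c u)" if "u \<in> P" for u
    using that P(2) piece_rep[OF m, of u] piece_subset[of m] by (auto simp: Fpiece_def upd_idem)
  define E where "E = {u. upd u ?k 0 \<in> P \<and> u $ ?k \<in> {0..1}}"
  have E_eq: "E = (\<lambda>(u, t). upd u ?k t) ` (P \<times> {0..1})"
  proof (intro equalityI subsetI)
    fix u assume "u \<in> E"
    then show "u \<in> (\<lambda>(u, t). upd u ?k t) ` (P \<times> {0..1})"
      by (intro image_eqI[of _ _ "(upd u ?k 0, u $ ?k)"]) (auto simp: E_def)
  qed (auto simp: E_def P0)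
  have Esc: "sigma_compact E"
  proof -
    obtain K where K: "\<And>n. compact (K n)" "P = (\<Union>n::nat. K n)" using P(1) unfolding sigma_compact_def by blast
    have "continuous_on UNIV (\<lambda>p :: (real^'n) \<times> real. upd (fst p) ?k (snd p))" by (intro continuous_intros)
    then have "compact ((\<lambda>p. upd (fst p) ?k (snd p)) ` (K n \<times> {0..1}))" for n
      by (intro compact_continuous_image compact_Times K) (auto intro: continuous_on_subset)
    moreover have "E = (\<Union>n. (\<lambda>p. upd (fst p) ?k (snd p)) ` (K n \<times> {0..1}))"
    proof -
      have "E = (\<lambda>p. upd (fst p) ?k (snd p)) ` ((\<Union>n. K n) \<times> {0..1})" by (simp only: E_eq split_def K(2))
      also have "(\<Union>n. K n) \<times> {0..1::real} = (\<Union>n. K n \<times> {0..1})" by (simp add: set_eq_iff)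
      also have "(\<lambda>p. upd (fst p) ?k (snd p)) ` (\<Union>n. K n \<times> {0..1}) = (\<Union>n. (\<lambda>p. upd (fst p) ?k (snd p)) ` (K n \<times> {0..1}))"
        by (rule image_UN)
      finally show ?thesis .
    qed
    ultimately show ?thesis unfolding sigma_compact_def
      by (intro exI[of _ "\<lambda>n. (\<lambda>p. upd (fst p) ?k (snd p)) ` (K n \<times> {0..1})"] conjI allI)
  qed
  have Esub: "E \<subseteq> slab_region ?c"
    using P0(3) half_region_subset[OF c] by (auto simp: E_def slab_region_def)
  have ch: "continuous_on E (\<lambda>u. g (upd u ?k 0))"
    by (rule continuous_on_compose2[OF g(1)]) (auto intro!: continuous_intros simp: E_def)
  have hpos: "0 \<le> g (upd u ?k 0)" if "u \<in> E" for u using that g(2) by (simp add: E_def)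
  obtain N where N: "N \<in> borel_measurable borel"
    "AE x in lborel. fibre_sum (slab Q i ?c) (\<lambda>u. g (upd u ?k 0)) E x = N x"
    "(\<integral>\<^sup>+x. N x \<partial>lborel) = (\<integral>\<^sup>+u. ennreal (g (upd u ?k 0) * \<bar>det (matrix (dslab Q i ?c u))\<bar>) * indicator E u \<partial>lborel)"
    by (rule area_formula[OF open_slab_region[OF Q c] slab_has_derivative[OF Q c] continuous_on_dslab[OF Q c] Esc Esub ch hpos])
      (assumption | rule that)+
  show ?thesis
  proof (rule that[OF N(1)])
    have fs: "fibre_sum (slab Q i ?c) (\<lambda>u. g (upd u ?k 0)) E x = indicator {0..1} (x $ i) *
      (\<integral>\<^sup>+u. ennreal (g u) * indicator P u * indicator {w. \<forall>j. j \<noteq> i \<longrightarrow> Q w $ j = x $ j} (snd (par ?c u)) \<partial>count_space UNIV)" for x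
    proof -
      let ?F = "\<lambda>u. ennreal (g (upd u ?k 0)) * indicator {0..1} (x $ i) * indicator {w. \<forall>j. j \<noteq> i \<longrightarrow> Q w $ j = x $ j} (snd (par ?c (upd u ?k 0)))"
      define E' where "E' = (\<lambda>u. upd u ?k (x $ i)) ` P"
      have E': "u \<in> E' \<longleftrightarrow> upd u ?k 0 \<in> P \<and> u $ ?k = x $ i" for u
      proof
        assume "upd u ?k 0 \<in> P \<and> u $ ?k = x $ i"
        then show "u \<in> E'" unfolding E'_def by (intro image_eqI[of _ _ "upd u ?k 0"]) (auto simp: upd_idem)
      qed (auto simp: E'_def P0)
      have bij: "bij_betw (\<lambda>u. upd u ?k (x $ i)) P E'"
        unfolding E'_def
      proof (rule inj_on_imp_bij_betw, rule inj_onI)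
        fix u v assume "u \<in> P" "v \<in> P" "upd u ?k (x $ i) = upd v ?k (x $ i)"
        then show "u = v" using P0(2) by (metis upd_upd)
      qed
      have "fibre_sum (slab Q i ?c) (\<lambda>u. g (upd u ?k 0)) E x = (\<integral>\<^sup>+u. ?F u * indicator E' u \<partial>count_space UNIV)"
        unfolding fibre_sum_def
      proof (rule nn_integral_cong)
        fix u
        have "slab Q i ?c u = x \<longleftrightarrow> u $ ?k = x $ i \<and> (\<forall>j. j \<noteq> i \<longrightarrow> Q (snd (par ?c (upd u ?k 0))) $ j = x $ j)"
          by (auto simp: slab_def vec_eq_iff)
        then show "ennreal (g (upd u ?k 0)) * indicator E u * indicator {x} (slab Q i ?c u) = ?F u * indicator E' u"
          by (auto simp: indicator_def E_def E')
      qed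
      also have "\<dots> = (\<integral>\<^sup>+u. ?F (upd u ?k (x $ i)) * indicator P u \<partial>count_space UNIV)"
        using nn_integral_bij_count_space[OF bij, of ?F] by (simp add: nn_integral_count_space_indicator)
      also have "\<dots> = (\<integral>\<^sup>+u. indicator {0..1} (x $ i) * (ennreal (g u) * indicator P u * indicator {w. \<forall>j. j \<noteq> i \<longrightarrow> Q w $ j = x $ j} (snd (par ?c u))) \<partial>count_space UNIV)"
        by (rule nn_integral_cong) (auto simp: indicator_def P0)
      finally show ?thesis by (simp add: nn_integral_cmult)
    qed
    show "AE x in lborel. N x = indicator {0..1} (x $ i) *
      (\<integral>\<^sup>+u. ennreal (g u) * indicator P u * indicator {w. \<forall>j. j \<noteq> i \<longrightarrow> Q w $ j = x $ j} (snd (par ?c u)) \<partial>count_space UNIV)"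
      using N(2) by eventually_elim (simp only: fs[symmetric])
    let ?G = "\<lambda>u. g (upd u ?k 0) * \<bar>Q (conormal ?c (upd u ?k 0)) $ i\<bar>"
    have "(\<integral>\<^sup>+x. N x \<partial>lborel) = (\<integral>\<^sup>+u. ennreal (?G u) * indicator E u \<partial>lborel)"
      unfolding N(3)
    proof (rule nn_integral_cong)
      fix u
      show "ennreal (g (upd u ?k 0) * \<bar>det (matrix (dslab Q i ?c u))\<bar>) * indicator E u = ennreal (?G u) * indicator E u"
      proof (cases "u \<in> E")
        case True
        then have "rep ?c (upd u ?k 0) (par ?c (upd u ?k 0))" using P0(4) by (simp add: E_def)
        then show ?thesis by (simp only: det_dslab[OF Q c])
      qed simp
    qed
    also have "\<dots> = (\<integral>\<^sup>+y. (\<integral>\<^sup>+t. ennreal (?G (\<chi> j. if j = ?k then t else y j)) * indicator E (\<chi> j. if j = ?k then t else y j) \<partial>lborel)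
        \<partial>PiM (UNIV - {?k}) (\<lambda>_. lborel))"
    proof (rule nn_integral_lborel_vec_line)
      have "continuous_on E (\<lambda>u. conormal ?c (upd u ?k 0))"
        by (rule continuous_on_compose2[OF continuous_on_conormal[OF c]]) (auto intro!: continuous_intros simp: E_def P0)
      then have "continuous_on E ?G"
        by (intro continuous_on_mult ch continuous_on_rabs continuous_on_component bounded_linear.continuous_on[OF isometry_bounded_linear[OF Q]])
      then show "(\<lambda>u. ennreal (?G u) * indicator E u) \<in> borel_measurable borel"
        by (intro borel_measurable_ennreal_continuous_on sigma_compact_borel Esc)
    qed
    also have "\<dots> = (\<integral>\<^sup>+y. ennreal (g (face_point ?k y) * \<bar>Q (conormal ?c (face_point ?k y)) $ i\<bar>) * indicator P (face_point ?k y)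
        \<partial>PiM (UNIV - {?k}) (\<lambda>_. lborel))"
    proof (rule nn_integral_cong)
      fix y :: "'n \<Rightarrow> real"
      have fp: "upd (\<chi> j. if j = ?k then t else y j) ?k 0 = face_point ?k y" for t
        by (simp add: vec_eq_iff face_point_def)
      have "(\<integral>\<^sup>+t. ennreal (?G (\<chi> j. if j = ?k then t else y j)) * indicator E (\<chi> j. if j = ?k then t else y j) \<partial>lborel)
        = (\<integral>\<^sup>+t. (ennreal (g (face_point ?k y) * \<bar>Q (conormal ?c (face_point ?k y)) $ i\<bar>) * indicator P (face_point ?k y)) * indicator {0..1::real} t \<partial>lborel)"
        unfolding fp by (intro nn_integral_cong) (auto simp: E_def fp indicator_def)
      then show "(\<integral>\<^sup>+t. ennreal (?G (\<chi> j. if j = ?k then t else y j)) * indicator E (\<chi> j. if j = ?k then t else y j) \<partial>lborel)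
        = ennreal (g (face_point ?k y) * \<bar>Q (conormal ?c (face_point ?k y)) $ i\<bar>) * indicator P (face_point ?k y)"
        by (simp add: nn_integral_cmult_indicator)
    qed
    finally show "(\<integral>\<^sup>+x. N x \<partial>lborel) = (\<integral>\<^sup>+y. ennreal (g (face_point ?k y) * \<bar>Q (conormal ?c (face_point ?k y)) $ i\<bar>) * indicator P (face_point ?k y)
        \<partial>PiM (UNIV - {?k}) (\<lambda>_. lborel))" .
  qed
qed

text \<open>
  At a boundary point some component of the conormal is non-zero, and it dominates the others up
  to a constant nearby. The projection along that axis is then locally injective on the boundary.
\<close>

lemma boundary_locally_transverse:
  assumes y: "y \<in> S"
  shows "\<exists>V i \<delta>. open V \<and> y \<in> V \<and> 0 < (\<delta> :: real) \<and>
    (\<forall>z\<in>Bd \<inter> V. \<forall>z'\<in>Bd \<inter> V. (\<forall>j. j \<noteq> i \<longrightarrow> snd z $ j = snd z' $ j) \<longrightarrow> z = z') \<and>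
    (\<forall>z\<in>Bd \<inter> V. \<forall>c u. rep c u z \<longrightarrow> \<delta> * norm (conormal c u) \<le> \<bar>conormal c u $ i\<bar>)"
proof (cases "y \<in> Intr")
  case True
  obtain B V s where "open B" "snd y \<in> B" "open V" "y \<in> V" "\<And>x. x \<in> B \<Longrightarrow> s x \<in> Intr" "\<And>x. x \<in> B \<Longrightarrow> snd (s x) = x"
    "\<And>z. z \<in> S \<inter> V \<Longrightarrow> snd z \<in> B \<and> s (snd z) = z"
    "\<And>x. x \<in> B \<Longrightarrow> (s has_derivative (\<lambda>w. (slope (s x) \<bullet> w, w))) (at x)"
    "\<And>\<Phi> :: 'n minkowski \<Rightarrow> real^'n. chart_cts \<Phi> \<Longrightarrow> continuous_on B (\<lambda>x. \<Phi> (s x))"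
    by (rule local_section[OF True]) (rule that)
  then have "open V" "y \<in> V" "Bd \<inter> V = {}" unfolding Bd_def by (auto, metis IntI)
  then show ?thesis by (intro exI[of _ V] exI[of _ undefined] exI[of _ 1]) simp
next
  case False
  obtain c u where r: "rep c u y" using rep_exists[OF y] by blast
  have c: "c \<in> charts S" by (rule repD(1)[OF r])
  have u0: "u $ face c = 0" using rep_Int_iff[OF r] False by simp
  then have uu: "upd u (face c) 0 = u" by (rule upd_idem)
  obtain i where i: "conormal c u $ i \<noteq> 0" using conormal_nonzero[OF r] by (auto simp: vec_eq_iff)
  have I: "orthogonal_transformation (\<lambda>x :: real^'n. x)" by (rule orthogonal_transformation_id[unfolded id_def])
  have usr: "u \<in> slab_region c" using repD(3)[OF r] by (simp add: slab_region_def uu)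
  have "det (matrix (dslab (\<lambda>x. x) i c u)) \<noteq> 0"
    using det_dslab[OF I c, of u y i] r i by (simp add: uu)
  then have inj: "inj (dslab (\<lambda>x. x) i c u)"
    using det_nz_iff_inj[OF has_derivative_linear[OF slab_has_derivative[OF I c usr, of i]]] by simp
  obtain e where e: "e > 0" "ball u e \<subseteq> slab_region c" "inj_on (slab (\<lambda>x. x) i c) (ball u e)"
    by (rule locally_injective[OF open_slab_region[OF I c] usr slab_has_derivative[OF I c] continuous_on_dslab[OF I c] inj])
      (assumption | rule that)+
  define \<delta> where "\<delta> = \<bar>conormal c u $ i\<bar> / (2 * norm (conormal c u))"
  have n0: "0 < norm (conormal c u)" using conormal_nonzero[OF r] by simp
  have \<delta>: "0 < \<delta>" using i n0 by (simp add: \<delta>_def)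
  define q where "q w = \<bar>conormal c w $ i\<bar> - \<delta> * norm (conormal c w)" for w
  have qc: "continuous_on (half_region c) q" unfolding q_def
    by (intro continuous_on_diff continuous_on_rabs continuous_on_component continuous_on_mult continuous_on_const continuous_on_norm continuous_on_conormal c)
  have qu: "0 < q u" using i n0 by (simp add: q_def \<delta>_def)
  have "\<exists>e'>0. \<forall>w\<in>half_region c. dist w u < e' \<longrightarrow> dist (q w) (q u) < q u"
    using qc[unfolded continuous_on_iff, rule_format, of u "q u"] repD(2)[OF r] qu by simp
  then obtain e' where e': "e' > 0" "\<And>w. w \<in> half_region c \<Longrightarrow> dist w u < e' \<Longrightarrow> dist (q w) (q u) < q u" by blast
  define W where "W = ball u (min e e')"
  have W: "open W" "u \<in> W" using e e' by (auto simp: W_def)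
  obtain V where V: "open V" "y \<in> V" "S \<inter> V = par c ` (half_region c \<inter> W)"
    by (rule chart_nbhd[OF r W])
  have lift: "\<exists>w. rep c w z \<and> w \<in> ball u e \<and> upd w (face c) 0 = w \<and> w $ face c = 0 \<and> \<delta> * norm (conormal c w) \<le> \<bar>conormal c w $ i\<bar>"
    if z: "z \<in> Bd \<inter> V" for z
  proof -
    have "z \<in> S \<inter> V" using z by (simp add: Bd_def)
    then obtain w where w: "z = par c w" "w \<in> half_region c" "w \<in> W" unfolding V(3) by blast
    then have rw: "rep c w z" using c by (simp add: rep_def)
    have "w $ face c = 0" using rep_Int_iff[OF rw] z by (simp add: Bd_def)
    moreover have "dist w u < e'" "w \<in> ball u e" using w(3) by (auto simp: W_def dist_commute)
    moreover have "0 < q w" using e'(2)[OF w(2) \<open>dist w u < e'\<close>] by (simp add: dist_real_def)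
    ultimately show ?thesis using rw by (intro exI[of _ w]) (simp add: upd_idem q_def)
  qed
  have 1: "z = z'" if z: "z \<in> Bd \<inter> V" "z' \<in> Bd \<inter> V" and eq: "\<forall>j. j \<noteq> i \<longrightarrow> snd z $ j = snd z' $ j" for z z'
  proof -
    obtain w where w: "rep c w z" "w \<in> ball u e" "upd w (face c) 0 = w" "w $ face c = 0" using lift[OF z(1)] by blast
    obtain w' where w': "rep c w' z'" "w' \<in> ball u e" "upd w' (face c) 0 = w'" "w' $ face c = 0" using lift[OF z(2)] by blast
    have "slab (\<lambda>x. x) i c w = slab (\<lambda>x. x) i c w'"
      using eq unfolding slab_def w(3) w'(3) w(4) w'(4) repD(4)[OF w(1)] repD(4)[OF w'(1)] by (simp add: vec_eq_iff)
    then have "w = w'" by (rule inj_onD[OF e(3) _ w(2) w'(2)])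
    then show ?thesis using repD(4)[OF w(1)] repD(4)[OF w'(1)] by simp
  qed
  have 2: "\<delta> * norm (conormal c' u') \<le> \<bar>conormal c' u' $ i\<bar>" if z: "z \<in> Bd \<inter> V" and r': "rep c' u' z" for z c' u'
  proof -
    obtain w where w: "rep c w z" "w $ face c = 0" "\<delta> * norm (conormal c w) \<le> \<bar>conormal c w $ i\<bar>" using lift[OF z] by blast
    obtain l where l: "conormal c' u' = l *\<^sub>R conormal c w" by (rule conormal_parallel[OF w(1) r' w(2)])
    show ?thesis using mult_left_mono[OF w(3), of "\<bar>l\<bar>"] by (simp add: l abs_mult mult.left_commute)
  qed
  show ?thesis using V(1,2) \<delta> 1 2 by (intro exI[of _ V] exI[of _ i] exI[of _ \<delta>]) blast
qed

lemma measurable_face_point: "face_point k \<in> borel_measurable (PiM (UNIV - {k}) (\<lambda>_. lborel :: real measure))"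
proof -
  have "(\<lambda>y. if i = k then 0 else y i) \<in> borel_measurable (PiM (UNIV - {k}) (\<lambda>_. lborel :: real measure))" for i
    by (cases "i = k") auto
  then show ?thesis unfolding face_point_def[abs_def] by (rule measurable_vec_lambda)
qed

text \<open>
  Finitely many of the neighbourhoods above cover the hypersurface. In each the area is bounded by
  that of a bounded projection, with multiplicity one.
\<close>

lemma boundary_area_finite:
  assumes m: "m < length atlas"
  shows "(\<integral>\<^sup>+y. ennreal (norm (conormal (chart_of m) (face_point (face (chart_of m)) y))) * indicator (Fpiece m) (face_point (face (chart_of m)) y)
        \<partial>PiM (UNIV - {face (chart_of m)}) (\<lambda>_. lborel)) < top"
proof -
  let ?c = "chart_of m"
  let ?k = "face ?c" and ?M = "PiM (UNIV - {face (chart_of m)}) (\<lambda>_. lborel :: real measure)"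
  have c: "?c \<in> charts S" by (rule chart_of[OF m])
  have "\<forall>y\<in>S. \<exists>p. open (fst p) \<and> y \<in> fst p \<and> 0 < (snd (snd p) :: real) \<and>
    (\<forall>z\<in>Bd \<inter> fst p. \<forall>z'\<in>Bd \<inter> fst p. (\<forall>j. j \<noteq> fst (snd p) \<longrightarrow> snd z $ j = snd z' $ j) \<longrightarrow> z = z') \<and>
    (\<forall>z\<in>Bd \<inter> fst p. \<forall>c u. rep c u z \<longrightarrow> snd (snd p) * norm (conormal c u) \<le> \<bar>conormal c u $ fst (snd p)\<bar>)"
  proof
    fix y assume "y \<in> S"
    from boundary_locally_transverse[OF this] obtain V i \<delta> where
      "open V \<and> y \<in> V \<and> 0 < (\<delta> :: real) \<and>
    (\<forall>z\<in>Bd \<inter> V. \<forall>z'\<in>Bd \<inter> V. (\<forall>j. j \<noteq> i \<longrightarrow> snd z $ j = snd z' $ j) \<longrightarrow> z = z') \<and>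
    (\<forall>z\<in>Bd \<inter> V. \<forall>c u. rep c u z \<longrightarrow> \<delta> * norm (conormal c u) \<le> \<bar>conormal c u $ i\<bar>)" by (elim exE)
    then show "\<exists>p. open (fst p) \<and> y \<in> fst p \<and> 0 < (snd (snd p) :: real) \<and>
    (\<forall>z\<in>Bd \<inter> fst p. \<forall>z'\<in>Bd \<inter> fst p. (\<forall>j. j \<noteq> fst (snd p) \<longrightarrow> snd z $ j = snd z' $ j) \<longrightarrow> z = z') \<and>
    (\<forall>z\<in>Bd \<inter> fst p. \<forall>c u. rep c u z \<longrightarrow> snd (snd p) * norm (conormal c u) \<le> \<bar>conormal c u $ fst (snd p)\<bar>)"
      by (intro exI[of _ "(V, i, \<delta>)"]) simp
  qed
  from bchoice[OF this] obtain p where p: "\<forall>y\<in>S. open (fst (p y)) \<and> y \<in> fst (p y) \<and> 0 < (snd (snd (p y)) :: real) \<and>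
    (\<forall>z\<in>Bd \<inter> fst (p y). \<forall>z'\<in>Bd \<inter> fst (p y). (\<forall>j. j \<noteq> fst (snd (p y)) \<longrightarrow> snd z $ j = snd z' $ j) \<longrightarrow> z = z') \<and>
    (\<forall>z\<in>Bd \<inter> fst (p y). \<forall>c u. rep c u z \<longrightarrow> snd (snd (p y)) * norm (conormal c u) \<le> \<bar>conormal c u $ fst (snd (p y))\<bar>)"
    by (elim exE)
  define V where "V y = fst (p y)" for y
  define i where "i y = fst (snd (p y))" for y
  define \<delta> where "\<delta> y = snd (snd (p y))" for y
  have V: "open (V y)" "y \<in> V y" "0 < \<delta> y" if "y \<in> S" for y using bspec[OF p that] by (simp_all add: V_def \<delta>_def)
  have inj: "z = z'" if "y \<in> S" "z \<in> Bd" "z \<in> V y" "z' \<in> Bd" "z' \<in> V y" "\<And>j. j \<noteq> i y \<Longrightarrow> snd z $ j = snd z' $ j" for y z z'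
    using bspec[OF p that(1)] that(2-) by (simp add: V_def i_def)
  have trans: "\<delta> y * norm (conormal c u) \<le> \<bar>conormal c u $ i y\<bar>" if "y \<in> S" "z \<in> Bd" "z \<in> V y" "rep c u z" for y z c u
    using bspec[OF p that(1)] that(2-) by (simp add: V_def i_def \<delta>_def)
  obtain T where T: "T \<subseteq> S" "finite T" "S \<subseteq> (\<Union>y\<in>T. V y)"
    by (rule compactE_image[OF compact, of S V]) (use V in \<open>auto intro: that\<close>)
  obtain R where R: "\<And>z. z \<in> S \<Longrightarrow> norm z \<le> R" using compact_imp_bounded[OF compact] by (auto simp: bounded_iff)
  define P where "P y = Fpiece m \<inter> par ?c -` V y" for y
  have Fp: "rep ?c u (par ?c u)" "par ?c u \<in> Bd" "u \<in> half_region ?c" if "u \<in> Fpiece m" for u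
    using that Fpiece_eq[OF m] piece_rep[OF m, of u] piece_subset[of m] by auto
  have one: "(\<integral>\<^sup>+x. ennreal (norm (conormal ?c (face_point ?k x))) * indicator (P y) (face_point ?k x) \<partial>?M) < top" if y: "y \<in> S" for y
  proof -
    have cF: "continuous_on (Fpiece m) (par ?c)" by (rule continuous_on_subset[OF continuous_on_half_par[OF c]]) (use Fp(3) in blast)
    have sc: "sigma_compact (P y)" unfolding P_def
      by (rule sigma_compact_openin[OF sigma_compact_Fpiece[OF m] continuous_openin_preimage_gen[OF cF V(1)[OF y]]])
    have sub: "P y \<subseteq> Fpiece m" by (auto simp: P_def)
    have c1: "continuous_on (P y) (\<lambda>u. 1 :: real)" by simp
    have p1: "0 \<le> (1 :: real)" if "u \<in> P y" for u by simp
    have I: "orthogonal_transformation (\<lambda>x :: real^'n. x)" by (rule orthogonal_transformation_id[unfolded id_def])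
    obtain N where N: "N \<in> borel_measurable borel"
      "AE x in lborel. N x = indicator {0..1} (x $ i y) *
        (\<integral>\<^sup>+u. ennreal 1 * indicator (P y) u * indicator {w. \<forall>j. j \<noteq> i y \<longrightarrow> w $ j = x $ j} (snd (par ?c u)) \<partial>count_space UNIV)"
      "(\<integral>\<^sup>+x. N x \<partial>lborel) = (\<integral>\<^sup>+x. ennreal (1 * \<bar>conormal ?c (face_point ?k x) $ i y\<bar>) * indicator (P y) (face_point ?k x) \<partial>?M)"
      by (rule boundary_area[where i = "i y", OF I m sc sub c1 p1]) (assumption | rule that)+
    define b :: "real^'n" where "b = (\<chi> j. R + 1)"
    have "AE x in lborel. N x \<le> indicator (cbox (- b) b) x"
      using N(2)
    proof eventually_elim
      case (elim x)
      show ?case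
      proof (cases "x $ i y \<in> {0..1} \<and> (\<exists>u\<in>P y. \<forall>j. j \<noteq> i y \<longrightarrow> snd (par ?c u) $ j = x $ j)")
        case True
        then obtain u where u: "u \<in> P y" "\<And>j. j \<noteq> i y \<Longrightarrow> snd (par ?c u) $ j = x $ j" and xi: "x $ i y \<in> {0..1}" by blast
        have uS: "par ?c u \<in> S" using Fp(1) sub u(1) repD(5) by blast
        have R0: "0 \<le> R" using R[OF uS] norm_ge_zero order_trans by blast
        have "x \<in> cbox (- b) b"
          unfolding mem_box_cart
        proof (intro allI)
          fix j
          have "\<bar>x $ j\<bar> \<le> R + 1"
          proof (cases "j = i y")
            case False
            then have "\<bar>x $ j\<bar> \<le> norm (snd (par ?c u))" using u(2)[of j] component_le_norm_cart[of "snd (par ?c u)" j] by simp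
            also have "\<dots> \<le> norm (par ?c u)" using norm_snd_le[of "snd (par ?c u)" "fst (par ?c u)"] by simp
            finally show ?thesis using R[OF uS] by simp
          qed (use xi R0 in auto)
          then show "(- b) $ j \<le> x $ j \<and> x $ j \<le> b $ j" by (auto simp: b_def)
        qed
        moreover have "(\<integral>\<^sup>+v. ennreal 1 * indicator (P y) v * indicator {w. \<forall>j. j \<noteq> i y \<longrightarrow> w $ j = x $ j} (snd (par ?c v)) \<partial>count_space UNIV)
          \<le> (\<integral>\<^sup>+v. indicator {u} v \<partial>count_space UNIV)"
        proof (rule nn_integral_mono)
          fix v
          have "v = u" if v: "v \<in> P y" "\<forall>j. j \<noteq> i y \<longrightarrow> snd (par ?c v) $ j = x $ j"
          proof -
            have "par ?c v = par ?c u"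
              by (rule inj[OF y]) (use v u Fp(2) in \<open>auto simp: P_def\<close>)
            moreover have "rep ?c v (par ?c v)" "rep ?c u (par ?c u)" using Fp(1) v(1) u(1) sub by blast+
            ultimately show ?thesis using chart_inj by simp
          qed
          then show "ennreal 1 * indicator (P y) v * indicator {w. \<forall>j. j \<noteq> i y \<longrightarrow> w $ j = x $ j} (snd (par ?c v)) \<le> (indicator {u} v :: ennreal)"
            by (auto simp: indicator_def)
        qed
        ultimately show ?thesis unfolding elim using xi by simp
      next
        case False
        then consider "x $ i y \<notin> {0..1}" | "\<And>u. indicator (P y) u * indicator {w. \<forall>j. j \<noteq> i y \<longrightarrow> w $ j = x $ j} (snd (par ?c u)) = (0 :: ennreal)"
          by (auto simp: indicator_def)
        then show ?thesis
        proof cases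
          case 1
          then show ?thesis unfolding elim by simp
        next
          case 2
          then have "(\<integral>\<^sup>+u. ennreal 1 * indicator (P y) u * indicator {w. \<forall>j. j \<noteq> i y \<longrightarrow> w $ j = x $ j} (snd (par ?c u)) \<partial>count_space UNIV)
            = (\<integral>\<^sup>+u. 0 \<partial>count_space (UNIV :: (real^'n) set))"
            by (intro nn_integral_cong) (simp only: mult.assoc mult_zero_right)
          then show ?thesis unfolding elim by simp
        qed
      qed
    qed
    then have "(\<integral>\<^sup>+x. N x \<partial>lborel) \<le> (\<integral>\<^sup>+x. indicator (cbox (- b) b) x \<partial>lborel)" by (rule nn_integral_mono_AE)
    also have "\<dots> < top" using emeasure_bounded_finite[OF bounded_cbox[of "- b" b]] by simp
    finally have fin: "(\<integral>\<^sup>+x. N x \<partial>lborel) < top" .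
    have "(\<integral>\<^sup>+x. ennreal (norm (conormal ?c (face_point ?k x))) * indicator (P y) (face_point ?k x) \<partial>?M)
      \<le> (\<integral>\<^sup>+x. ennreal (1 / \<delta> y) * (ennreal (1 * \<bar>conormal ?c (face_point ?k x) $ i y\<bar>) * indicator (P y) (face_point ?k x)) \<partial>?M)"
    proof (rule nn_integral_mono)
      fix x
      let ?u = "face_point ?k x"
      show "ennreal (norm (conormal ?c ?u)) * indicator (P y) ?u
        \<le> ennreal (1 / \<delta> y) * (ennreal (1 * \<bar>conormal ?c ?u $ i y\<bar>) * indicator (P y) ?u)"
      proof (cases "?u \<in> P y")
        case True
        then have "\<delta> y * norm (conormal ?c ?u) \<le> \<bar>conormal ?c ?u $ i y\<bar>"
          using True sub by (intro trans[OF y, of "par ?c ?u"] Fp) (auto simp: P_def)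
        then have "norm (conormal ?c ?u) \<le> (1 / \<delta> y) * \<bar>conormal ?c ?u $ i y\<bar>" using V(3)[OF y] by (simp add: field_simps)
        then show ?thesis using True V(3)[OF y] by (simp add: ennreal_mult'[symmetric] ennreal_leI)
      qed simp
    qed
    also have "\<dots> = ennreal (1 / \<delta> y) * (\<integral>\<^sup>+x. N x \<partial>lborel)"
      unfolding N(3)
    proof (rule nn_integral_cmult)
      have "(\<lambda>u. ennreal (1 * \<bar>conormal ?c u $ i y\<bar>) * indicator (P y) u) \<in> borel_measurable borel"
        using sub Fp(3)
        by (intro borel_measurable_ennreal_continuous_on sigma_compact_borel sc continuous_on_mult continuous_on_const continuous_on_rabs
            continuous_on_component continuous_on_subset[OF continuous_on_conormal[OF c]]) blast
      from measurable_compose[OF measurable_face_point this]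
      show "(\<lambda>x. ennreal (1 * \<bar>conormal ?c (face_point ?k x) $ i y\<bar>) * indicator (P y) (face_point ?k x)) \<in> borel_measurable ?M" .
    qed
    also have "\<dots> < top" using fin by (simp add: ennreal_mult_less_top)
    finally show ?thesis .
  qed
  have "(\<integral>\<^sup>+x. ennreal (norm (conormal ?c (face_point ?k x))) * indicator (Fpiece m) (face_point ?k x) \<partial>?M)
    \<le> (\<integral>\<^sup>+x. (\<Sum>y\<in>T. ennreal (norm (conormal ?c (face_point ?k x))) * indicator (P y) (face_point ?k x)) \<partial>?M)"
  proof (rule nn_integral_mono)
    fix x
    let ?u = "face_point ?k x"
    show "ennreal (norm (conormal ?c ?u)) * indicator (Fpiece m) ?u \<le> (\<Sum>y\<in>T. ennreal (norm (conormal ?c ?u)) * indicator (P y) ?u)"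
    proof (cases "?u \<in> Fpiece m")
      case True
      then have "par ?c ?u \<in> S" using Fp(1) repD(5) by blast
      then obtain t where t: "t \<in> T" "par ?c ?u \<in> V t" using T(3) by blast
      then have "?u \<in> P t" using True by (simp add: P_def)
      then have "ennreal (norm (conormal ?c ?u)) * indicator (Fpiece m) ?u = ennreal (norm (conormal ?c ?u)) * indicator (P t) ?u"
        using True by simp
      also have "\<dots> \<le> (\<Sum>y\<in>T. ennreal (norm (conormal ?c ?u)) * indicator (P y) ?u)"
        using T(2) t(1) by (intro member_le_sum) auto
      finally show ?thesis .
    qed simp
  qed
  also have "\<dots> = (\<Sum>y\<in>T. \<integral>\<^sup>+x. ennreal (norm (conormal ?c (face_point ?k x))) * indicator (P y) (face_point ?k x) \<partial>?M)"
  proof (rule nn_integral_sum)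
    fix y assume "y \<in> T"
    then have y: "y \<in> S" using T(1) by blast
    have cF: "continuous_on (Fpiece m) (par ?c)" by (rule continuous_on_subset[OF continuous_on_half_par[OF c]]) (use Fp(3) in blast)
    have sc: "sigma_compact (P y)" unfolding P_def
      by (rule sigma_compact_openin[OF sigma_compact_Fpiece[OF m] continuous_openin_preimage_gen[OF cF V(1)[OF y]]])
    have sub: "P y \<subseteq> half_region ?c" using Fp(3) by (auto simp: P_def)
    have "(\<lambda>u. ennreal (norm (conormal ?c u)) * indicator (P y) u) \<in> borel_measurable borel"
      by (intro borel_measurable_ennreal_continuous_on sigma_compact_borel sc continuous_on_norm continuous_on_subset[OF continuous_on_conormal[OF c] sub])
    from measurable_compose[OF measurable_face_point this]
    show "(\<lambda>x. ennreal (norm (conormal ?c (face_point ?k x))) * indicator (P y) (face_point ?k x)) \<in> borel_measurable ?M" .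
  qed
  also have "\<dots> < top" using T(1,2) one by (auto simp: less_top)
  finally show ?thesis .
qed

end

section \<open>Numerical inequalities\<close>

lemma sum_powr_le_powr_sum:
  fixes a :: "'a \<Rightarrow> real"
  assumes a: "\<And>i. i \<in> I \<Longrightarrow> 0 \<le> a i" and p: "1 \<le> p" and I: "finite I"
  shows "(\<Sum>i\<in>I. a i powr p) \<le> (\<Sum>i\<in>I. a i) powr p"
proof -
  let ?s = "sum a I"
  have "(\<Sum>i\<in>I. a i powr p) \<le> (\<Sum>i\<in>I. a i * ?s powr (p - 1))"
  proof (rule sum_mono)
    fix i assume i: "i \<in> I"
    have "a i \<le> ?s" using I a i by (intro member_le_sum) auto
    then have "a i powr (p - 1) \<le> ?s powr (p - 1)" using a[OF i] p by (intro powr_mono2) auto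
    then have "a i * a i powr (p - 1) \<le> a i * ?s powr (p - 1)" using a[OF i] by (rule mult_left_mono)
    moreover have "a i powr p = a i * a i powr (p - 1)" using a[OF i] by (cases "a i = 0") (simp_all add: powr_diff)
    ultimately show "a i powr p \<le> a i * ?s powr (p - 1)" by simp
  qed
  also have "\<dots> = ?s * ?s powr (p - 1)" by (simp only: sum_distrib_right)
  also have "\<dots> = ?s powr p" using sum_nonneg[of I a] a by (cases "?s = 0") (simp_all add: powr_diff)
  finally show ?thesis .
qed

lemma fibre_sum_finite:
  assumes "finite {u \<in> A. \<Psi> u = x}"
  shows "fibre_sum \<Psi> h A x = (\<Sum>u\<in>{u \<in> A. \<Psi> u = x}. ennreal (h u))"
proof -
  have "fibre_sum \<Psi> h A x = (\<integral>\<^sup>+u. ennreal (h u) * indicator {u \<in> A. \<Psi> u = x} u \<partial>count_space UNIV)"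
    unfolding fibre_sum_def by (intro nn_integral_cong) (auto simp: indicator_def)
  also have "\<dots> = (\<integral>\<^sup>+u. ennreal (h u) \<partial>count_space {u \<in> A. \<Psi> u = x})"
    by (simp add: nn_integral_count_space_indicator)
  also have "\<dots> = (\<Sum>u\<in>{u \<in> A. \<Psi> u = x}. ennreal (h u))"
    by (rule nn_integral_count_space_finite[OF assms])
  finally show ?thesis .
qed

lemma fibre_sum_powr:
  assumes fin: "finite {u \<in> A. \<Psi> u = x}" and h: "\<And>u. u \<in> A \<Longrightarrow> 0 \<le> h u" and p: "1 \<le> p"
  shows "fibre_sum \<Psi> (\<lambda>u. h u powr p) A x \<le> epow (fibre_sum \<Psi> h A x) p"
proof -
  let ?Y = "{u \<in> A. \<Psi> u = x}"
  have "epow (fibre_sum \<Psi> h A x) p = ennreal ((\<Sum>u\<in>?Y. h u) powr p)"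
    unfolding fibre_sum_finite[OF fin] using h by (subst sum_ennreal) (auto intro!: epow_ennreal sum_nonneg)
  moreover have "fibre_sum \<Psi> (\<lambda>u. h u powr p) A x = ennreal (\<Sum>u\<in>?Y. h u powr p)"
    unfolding fibre_sum_finite[OF fin] by (rule sum_ennreal) simp
  ultimately show ?thesis using h p fin by (auto intro!: ennreal_leI sum_powr_le_powr_sum)
qed

lemma ennreal_arith_geom_mean:
  fixes x :: "'n::finite \<Rightarrow> ennreal"
  shows "(\<Prod>i\<in>UNIV. epow (x i) (1 / real CARD('n))) \<le> ennreal (1 / real CARD('n)) * (\<Sum>i\<in>UNIV. x i)"
proof (cases "\<exists>i. x i = top")
  case True
  then obtain i where "x i = top" ..
  then have "top \<le> (\<Sum>i\<in>UNIV. x i)" using member_le_sum[of i UNIV x] by simp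
  then have "(\<Sum>i\<in>UNIV. x i) = top" by (simp only: top_unique)
  then show ?thesis by (simp only: ennreal_mult_top) simp
next
  case False
  define r where "r i = enn2real (x i)" for i
  have x: "x i = ennreal (r i)" and r: "0 \<le> r i" for i using False by (simp_all add: r_def top.not_eq_extremum)
  have "(\<Prod>i\<in>UNIV. r i powr (1 / real CARD('n))) \<le> (\<Sum>i\<in>UNIV. 1 / real CARD('n) * r i)"
    by (rule weighted_arith_geom_mean) (simp_all add: r)
  then have "ennreal (\<Prod>i\<in>UNIV. r i powr (1 / real CARD('n))) \<le> ennreal (1 / real CARD('n) * (\<Sum>i\<in>UNIV. r i))"
    by (intro ennreal_leI) (simp only: sum_distrib_left)
  then show ?thesis
    using r by (simp add: x epow_ennreal prod_ennreal sum_ennreal ennreal_mult[symmetric] sum_nonneg)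
qed

text \<open>
  An involution that pairs all indices but at most one, with a sign that tells the two members of a
  pair apart.
\<close>

lemma pairing_exists:
  obtains \<sigma> :: "'n::finite \<Rightarrow> 'n" and \<epsilon> :: "'n \<Rightarrow> real" where
    "\<And>a. \<sigma> (\<sigma> a) = a" "\<And>a. \<epsilon> a * \<epsilon> a = 1" "\<And>a. \<sigma> a \<noteq> a \<Longrightarrow> \<epsilon> (\<sigma> a) = - \<epsilon> a" "card {a. \<sigma> a = a} \<le> 1"
proof -
  obtain b where b: "bij_betw b (UNIV :: 'n set) {..<CARD('n)}"
    using ex_bij_betw_finite_nat[OF finite_class.finite_UNIV] by (auto simp: atLeast0LessThan)
  define g where "g k = (if even k then if k + 1 < CARD('n) then k + 1 else k else k - 1)" for k :: nat
  define \<sigma> where "\<sigma> a = inv_into UNIV b (g (b a))" for a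
  have lt: "b a < CARD('n)" for a using bij_betwE[OF b] by auto
  have glt: "g k < CARD('n)" if "k < CARD('n)" for k using that by (auto simp: g_def)
  have gg: "g (g k) = k" if "k < CARD('n)" for k using that by (auto simp: g_def elim!: oddE)
  have b\<sigma>: "b (\<sigma> a) = g (b a)" for a
    unfolding \<sigma>_def using glt[OF lt[of a]] b by (intro bij_betw_inv_into_right) auto
  have binj: "a = a'" if "b a = b a'" for a a' using b that by (auto simp: bij_betw_def dest: injD)
  define \<epsilon> where "\<epsilon> a = (if even (b a) then 1 else - 1 :: real)" for a
  show ?thesis
  proof (rule that[of \<sigma> \<epsilon>])
    show "\<sigma> (\<sigma> a) = a" for a by (rule binj) (simp add: b\<sigma> gg lt)
    show "\<epsilon> a * \<epsilon> a = 1" for a by (simp add: \<epsilon>_def)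
    show "\<epsilon> (\<sigma> a) = - \<epsilon> a" if "\<sigma> a \<noteq> a" for a
    proof -
      have "g (b a) \<noteq> b a" using that binj[of "\<sigma> a" a] by (auto simp: b\<sigma>)
      then show ?thesis by (auto simp: \<epsilon>_def b\<sigma> g_def split: if_splits)
    qed
    have "b a = CARD('n) - 1" if "\<sigma> a = a" for a
    proof -
      have "g (b a) = b a" using b\<sigma>[of a] that by simp
      then show ?thesis using lt[of a] by (auto simp: g_def split: if_splits elim!: oddE)
    qed
    then have "a = a'" if "\<sigma> a = a" "\<sigma> a' = a'" for a a' using that by (intro binj) metis
    then have "\<forall>a\<in>{a. \<sigma> a = a}. \<forall>a'\<in>{a. \<sigma> a = a}. a = a'" by blast
    then show "card {a. \<sigma> a = a} \<le> 1" unfolding One_nat_def by (subst card_le_Suc0_iff_eq) simp_all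
  qed
qed

lemma pair_l1_bound:
  fixes a b :: real
  shows "(\<bar>a\<bar> + \<bar>b\<bar> + (\<bar>b + a\<bar> + \<bar>a - b\<bar>) / sqrt 2)\<^sup>2 \<le> 6.88 * (a\<^sup>2 + b\<^sup>2)"
proof -
  have t: "sqrt 2 \<le> 1.44" by (rule real_le_lsqrt) (simp_all add: power2_eq_square)
  have *: "(\<bar>a\<bar> + \<bar>b\<bar> + (\<bar>b + a\<bar> + \<bar>a - b\<bar>) / sqrt 2)\<^sup>2 \<le> 6.88 * (a\<^sup>2 + b\<^sup>2)" if le: "\<bar>b\<bar> \<le> \<bar>a\<bar>" for a b :: real
  proof -
    have "\<bar>b + a\<bar> + \<bar>a - b\<bar> = 2 * \<bar>a\<bar>" using le by (auto simp: abs_if split: if_splits)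
    then have "\<bar>a\<bar> + \<bar>b\<bar> + (\<bar>b + a\<bar> + \<bar>a - b\<bar>) / sqrt 2 = (1 + sqrt 2) * \<bar>a\<bar> + \<bar>b\<bar>"
      by (simp add: real_div_sqrt field_simps)
    also have "((1 + sqrt 2) * \<bar>a\<bar> + \<bar>b\<bar>)\<^sup>2 = (4 + 2 * sqrt 2) * (a\<^sup>2 + b\<^sup>2) - (\<bar>a\<bar> - (1 + sqrt 2) * \<bar>b\<bar>)\<^sup>2"
    proof -
      have "((1 + t) * x + y)\<^sup>2 = ((1 + t)\<^sup>2 + 1) * (x\<^sup>2 + y\<^sup>2) - (x - (1 + t) * y)\<^sup>2" for t x y :: real by algebra
      moreover have "(1 + sqrt 2)\<^sup>2 + 1 = 4 + 2 * sqrt 2" by (simp add: power2_sum)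
      ultimately show ?thesis by simp
    qed
    also have "\<dots> \<le> (4 + 2 * sqrt 2) * (a\<^sup>2 + b\<^sup>2)" by simp
    also have "\<dots> \<le> 6.88 * (a\<^sup>2 + b\<^sup>2)" using t by (intro mult_right_mono) auto
    finally show ?thesis .
  qed
  show ?thesis using *[of b a] *[of a b] by (cases "\<bar>b\<bar> \<le> \<bar>a\<bar>") (auto simp: abs_minus_commute add.commute)
qed

text \<open>
  The $\ell^1$ norm of a vector exceeds its length by up to $\sqrt n$, and is largest on the diagonals.
  Rotating pairs of coordinates by 45 degrees moves the diagonals onto the axes, so the average of
  the $\ell^1$ norms in the two frames is at most $\sqrt{0.86\, n + 0.14}$ times the length. A
  plane contributes $(4 + 2\sqrt 2)$ to the square, and $0.14$ covers an unpaired coordinate.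
\<close>

lemma balanced_frame:
  obtains R :: "real^'n \<Rightarrow> real^'n::finite" where "orthogonal_transformation R"
    "\<And>w. (\<Sum>i\<in>UNIV. \<bar>w $ i\<bar>) + (\<Sum>i\<in>UNIV. \<bar>R w $ i\<bar>) \<le> 2 * sqrt (0.86 * real CARD('n) + 0.14) * norm w"
proof -
  obtain \<sigma> :: "'n \<Rightarrow> 'n" and \<epsilon> :: "'n \<Rightarrow> real" where \<sigma>: "\<And>a. \<sigma> (\<sigma> a) = a" and \<epsilon>: "\<And>a. \<epsilon> a * \<epsilon> a = 1"
    and \<epsilon>\<sigma>: "\<And>a. \<sigma> a \<noteq> a \<Longrightarrow> \<epsilon> (\<sigma> a) = - \<epsilon> a" and fix1: "card {a. \<sigma> a = a} \<le> 1"
    by (rule pairing_exists) (rule that)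
  have re: "(\<Sum>a\<in>UNIV. g (\<sigma> a)) = (\<Sum>a\<in>UNIV. g a)" for g :: "'n \<Rightarrow> real"
    by (rule sum.reindex_bij_witness[of _ \<sigma> \<sigma>]) (simp_all add: \<sigma>)
  \<comment> \<open>a reflection in each coordinate plane spanned by a pair\<close>
  define R :: "real^'n \<Rightarrow> real^'n" where "R w = (\<chi> a. if \<sigma> a = a then w $ a else (w $ \<sigma> a + \<epsilon> a * w $ a) / sqrt 2)" for w
  have R1: "R w $ a = w $ a" if "\<sigma> a = a" for w a using that by (simp add: R_def)
  have R2: "R w $ a = (w $ \<sigma> a + \<epsilon> a * w $ a) / sqrt 2" "R w $ \<sigma> a = (w $ a - \<epsilon> a * w $ \<sigma> a) / sqrt 2"
    if "\<sigma> a \<noteq> a" for w a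
    using that \<epsilon>\<sigma>[OF that] \<sigma>[of a] by (auto simp: R_def)
  have lin: "linear R"
    by (rule linearI) (simp_all add: R_def vec_eq_iff algebra_simps add_divide_distrib)
  have sq: "(R w $ a)\<^sup>2 + (R w $ \<sigma> a)\<^sup>2 = (w $ a)\<^sup>2 + (w $ \<sigma> a)\<^sup>2" for w a
  proof (cases "\<sigma> a = a")
    case False
    have "(x + \<epsilon> a * y)\<^sup>2 + (y - \<epsilon> a * x)\<^sup>2 = 2 * (y\<^sup>2 + x\<^sup>2)" for x y using \<epsilon>[of a] by algebra
    then show ?thesis unfolding R2[OF False] by (simp add: power_divide add_divide_distrib[symmetric])
  qed (simp add: R1)
  have nsq: "(norm w)\<^sup>2 = (\<Sum>a\<in>UNIV. (w $ a)\<^sup>2 + (w $ \<sigma> a)\<^sup>2) / 2" for w :: "real^'n"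
    using re[of "\<lambda>a. (w $ a)\<^sup>2"] by (simp add: power2_norm_eq_inner inner_vec_def sum.distrib power2_eq_square[symmetric])
  have "norm (R w) = norm w" for w
  proof -
    have "(norm (R w))\<^sup>2 = (norm w)\<^sup>2" unfolding nsq sq ..
    then show ?thesis by simp
  qed
  with lin have ortho: "orthogonal_transformation R" by (simp add: orthogonal_transformation)
  have "(\<Sum>i\<in>UNIV. \<bar>w $ i\<bar>) + (\<Sum>i\<in>UNIV. \<bar>R w $ i\<bar>) \<le> 2 * sqrt (0.86 * real CARD('n) + 0.14) * norm w" for w
  proof -
    define s where "s a = \<bar>w $ a\<bar> + \<bar>R w $ a\<bar>" for a
    define r where "r a = sqrt ((w $ a)\<^sup>2 + (w $ \<sigma> a)\<^sup>2)" for a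
    \<comment> \<open>\<open>6.88\<close> exceeds \<open>4 + 2 * sqrt 2\<close>; a fixed index is counted twice in \<open>s a + s (\<sigma> a)\<close> and needs \<open>8\<close>\<close>
    define \<gamma> where "\<gamma> a = sqrt (if \<sigma> a = a then 8 else 6.88)" for a
    have s: "s a + s (\<sigma> a) \<le> \<gamma> a * r a" for a
    proof (cases "\<sigma> a = a")
      case True
      have "sqrt 8 * sqrt ((w $ a)\<^sup>2 + (w $ a)\<^sup>2) = sqrt ((4 * \<bar>w $ a\<bar>)\<^sup>2)"
        by (subst real_sqrt_mult[symmetric]) (simp add: power_mult_distrib)
      also have "\<dots> = 4 * \<bar>w $ a\<bar>" by (simp only: real_sqrt_abs abs_mult abs_abs abs_numeral)
      finally have "sqrt 8 * sqrt ((w $ a)\<^sup>2 + (w $ a)\<^sup>2) = 4 * \<bar>w $ a\<bar>" .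
      then show ?thesis using True by (simp add: s_def R1 \<gamma>_def r_def)
    next
      case False
      have "s a + s (\<sigma> a) = \<bar>w $ a\<bar> + \<bar>w $ \<sigma> a\<bar> + (\<bar>w $ \<sigma> a + w $ a\<bar> + \<bar>w $ a - w $ \<sigma> a\<bar>) / sqrt 2"
      proof -
        have "\<epsilon> a = 1 \<or> \<epsilon> a = - 1" using \<epsilon>[of a] by (simp add: square_eq_1_iff)
        then have "\<bar>R w $ a\<bar> + \<bar>R w $ \<sigma> a\<bar> = \<bar>w $ \<sigma> a + w $ a\<bar> / sqrt 2 + \<bar>w $ a - w $ \<sigma> a\<bar> / sqrt 2"
          unfolding R2[OF False] by (elim disjE) (simp_all add: abs_minus_commute add.commute)
        then show ?thesis by (simp only: s_def add_divide_distrib ac_simps)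
      qed
      then have "(s a + s (\<sigma> a))\<^sup>2 \<le> 6.88 * ((w $ a)\<^sup>2 + (w $ \<sigma> a)\<^sup>2)" using pair_l1_bound by simp
      then have "s a + s (\<sigma> a) \<le> sqrt (6.88 * ((w $ a)\<^sup>2 + (w $ \<sigma> a)\<^sup>2))" by (rule real_le_rsqrt)
      then show ?thesis using False unfolding real_sqrt_mult \<gamma>_def r_def by simp
    qed
    have "2 * (\<Sum>a\<in>UNIV. s a) = (\<Sum>a\<in>UNIV. s a + s (\<sigma> a))" by (simp add: sum.distrib re)
    also have "\<dots> \<le> (\<Sum>a\<in>UNIV. \<gamma> a * r a)" by (intro sum_mono s)
    also have "\<dots> \<le> sqrt ((\<Sum>a\<in>UNIV. (\<gamma> a)\<^sup>2) * (\<Sum>a\<in>UNIV. (r a)\<^sup>2))"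
      by (rule real_le_rsqrt) (rule Cauchy_Schwarz_ineq_sum)
    also have "(\<Sum>a\<in>UNIV. (r a)\<^sup>2) = 2 * (norm w)\<^sup>2" by (simp add: r_def nsq)
    also have "sqrt ((\<Sum>a\<in>UNIV. (\<gamma> a)\<^sup>2) * (2 * (norm w)\<^sup>2)) \<le> sqrt ((4 * (0.86 * real CARD('n) + 0.14)) * (2 * (2 * (norm w)\<^sup>2)))"
    proof -
      have "(\<Sum>a\<in>UNIV. (\<gamma> a)\<^sup>2) = (\<Sum>a\<in>UNIV. 6.88 + (if \<sigma> a = a then 1.12 else 0))"
        by (intro sum.cong) (auto simp: \<gamma>_def)
      also have "\<dots> = 6.88 * real CARD('n) + 1.12 * real (card {a. \<sigma> a = a})"
        by (simp add: sum.distrib sum.If_cases)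
      also have "\<dots> \<le> 8 * (0.86 * real CARD('n) + 0.14)" using fix1 by simp
      finally have "(\<Sum>a\<in>UNIV. (\<gamma> a)\<^sup>2) * (2 * (norm w)\<^sup>2) \<le> 8 * (0.86 * real CARD('n) + 0.14) * (2 * (norm w)\<^sup>2)"
        by (rule mult_right_mono) simp
      then show ?thesis by (simp add: algebra_simps)
    qed
    also have "\<dots> = 2 * (2 * sqrt (0.86 * real CARD('n) + 0.14) * norm w)"
    proof -
      have "(4 * q) * (2 * (2 * (norm w)\<^sup>2)) = (4 * norm w)\<^sup>2 * q" for q by (simp add: power2_eq_square)
      then show ?thesis by (simp only: real_sqrt_mult real_sqrt_abs abs_mult abs_norm_cancel abs_numeral) simp
    qed
    finally show ?thesis by (simp add: s_def sum.distrib)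
  qed
  with ortho show ?thesis by (rule that)
qed

lemma unit_ball_vol_step: "unit_ball_vol (real (n + 2)) = unit_ball_vol (real n) * (2 * pi / real (n + 2))"
proof -
  have "Gamma (real (n + 2) / 2 + 1) = Gamma ((real n / 2 + 1) + 1)" by (simp add: field_simps)
  also have "\<dots> = (real n / 2 + 1) * Gamma (real n / 2 + 1)"
    by (rule Gamma_plus1) (auto elim!: nonpos_Ints_cases)
  finally have G: "Gamma (real (n + 2) / 2 + 1) = (real n / 2 + 1) * Gamma (real n / 2 + 1)" .
  have p: "pi powr (real (n + 2) / 2) = pi * pi powr (real n / 2)"
    using powr_add[of pi 1 "real n / 2"] by (simp add: field_simps)
  have "pi * P / (A * B) = P / B * (2 * pi / (2 * A))" for A B P :: real by (simp add: mult.commute)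
  moreover have "real (n + 2) = 2 * (real n / 2 + 1)" by simp
  ultimately show ?thesis unfolding unit_ball_vol_def G p by (simp only:)
qed

text \<open>
  Induction in steps of two. The volume gains the factor $2\pi/(n+2)$, the power at most the factor
  $0.93\,(n+2)\,e$, and $2\pi \cdot 0.93 \cdot e < 16$.
\<close>

lemma unit_ball_vol_bound:
  "unit_ball_vol (real n) * (0.86 * real n + 0.14) powr (real n / 2) \<le> 4 ^ n * (real n + 1)"
proof (induction n rule: nat_induct2)
  case (step n)
  let ?q = "\<lambda>n. 0.86 * real n + 0.14"
  have q: "0 < ?q n" by simp
  have "(?q (n + 2) / ?q n) powr (real n / 2) \<le> exp 1"
  proof -
    have "?q (n + 2) / ?q n = 1 + 1.72 / ?q n" using q by (simp add: field_simps)
    also have "\<dots> \<le> exp (1.72 / ?q n)" by (rule exp_ge_add_one_self)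
    finally have "(?q (n + 2) / ?q n) powr (real n / 2) \<le> exp (1.72 / ?q n) powr (real n / 2)"
      using q by (intro powr_mono2) auto
    also have "\<dots> = exp (1.72 / ?q n * (real n / 2))" by (simp add: powr_def)
    also have "\<dots> \<le> exp 1" using q by (simp add: field_simps)
    finally show ?thesis .
  qed
  moreover have "?q (n + 2) powr (real n / 2) = (?q (n + 2) / ?q n) powr (real n / 2) * ?q n powr (real n / 2)"
    using q by (subst powr_mult[symmetric]) auto
  ultimately have e: "?q (n + 2) powr (real n / 2) \<le> 2.72 * ?q n powr (real n / 2)"
    using e_less_272 by (simp only:) (intro mult_right_mono, auto)
  have c: "2 * pi / real (n + 2) * ?q (n + 2) * 2.72 \<le> 16"
  proof -
    have "?q (n + 2) \<le> 0.93 * real (n + 2)" by simp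
    then have "pi * ?q (n + 2) \<le> 3.15 * (0.93 * real (n + 2))" using pi_approx by (intro mult_mono) auto
    then have "pi * ?q (n + 2) * (2 * 2.72) \<le> 16 * real (n + 2)" by simp
    then show ?thesis by (simp add: field_simps)
  qed
  have "unit_ball_vol (real (n + 2)) * ?q (n + 2) powr (real (n + 2) / 2) =
      unit_ball_vol (real n) * (2 * pi / real (n + 2)) * (?q (n + 2) * ?q (n + 2) powr (real n / 2))"
    using powr_add[of "?q (n + 2)" 1 "real n / 2"] unfolding unit_ball_vol_step by (simp add: add_divide_distrib add.commute)
  also have "\<dots> \<le> unit_ball_vol (real n) * (2 * pi / real (n + 2)) * (?q (n + 2) * (2.72 * ?q n powr (real n / 2)))"
    using e by (intro mult_left_mono) (auto intro!: mult_nonneg_nonneg)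
  also have "\<dots> = (2 * pi / real (n + 2) * ?q (n + 2) * 2.72) * (unit_ball_vol (real n) * ?q n powr (real n / 2))"
    by (simp only: ac_simps)
  also have "\<dots> \<le> 16 * (4 ^ n * (real n + 1))"
    by (rule mult_mono[OF c step]) auto
  also have "\<dots> \<le> 4 ^ (n + 2) * (real (n + 2) + 1)" by simp
  finally show ?case .
qed (simp_all add: unit_ball_vol_0 unit_ball_vol_1)

text \<open>
  In \<open>\<tau>\<close> only $\tau^{-1/n} \le 1$ and $(\tau + \sqrt{\tau^2-1})^{-1} \le \tau^{-1}$ enter.
\<close>

lemma sobolev_constant_bound:
  assumes t: "1 \<le> \<tau>"
  shows "sobolev_constant TYPE('n::finite) \<tau> * (\<tau> * sqrt (0.86 * real CARD('n) + 0.14) / (2 * real CARD('n))) \<le> 1"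
    and "0 \<le> sobolev_constant TYPE('n::finite) \<tau>"
proof -
  let ?n = "real CARD('n)"
  define w where "w = measure lborel (ball (0::real^'n) 1)"
  define k where "k = sqrt (0.86 * ?n + 0.14)"
  have n: "0 < ?n" by simp
  have w: "w = unit_ball_vol ?n" unfolding w_def by (simp add: content_ball)
  have w0: "0 \<le> w" by (simp add: w_def)
  have k0: "0 < k" by (simp add: k_def)
  have C: "sobolev_constant TYPE('n) \<tau> = 1 / 2 * ?n * w powr (1 / ?n) * (?n + 1) powr (- 1 / ?n) * \<tau> powr (- 1 / ?n) * inverse (\<tau> + sqrt (\<tau>\<^sup>2 - 1))"
    unfolding sobolev_constant_def w_def Let_def ..
  show "0 \<le> sobolev_constant TYPE('n::finite) \<tau>" unfolding C using t by simp
  have "w * k powr ?n \<le> 4 powr ?n * (?n + 1)"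
  proof -
    have "k powr ?n = (0.86 * ?n + 0.14) powr (?n / 2)"
      unfolding k_def by (simp add: powr_half_sqrt[symmetric] powr_powr)
    then show ?thesis using unit_ball_vol_bound[of "CARD('n)"] by (simp add: w powr_realpow)
  qed
  then have "(w * k powr ?n) powr (1 / ?n) \<le> (4 powr ?n * (?n + 1)) powr (1 / ?n)"
    using w0 by (intro powr_mono2) auto
  then have "w powr (1 / ?n) * k \<le> 4 * (?n + 1) powr (1 / ?n)"
    using w0 k0 by (simp add: powr_mult powr_powr)
  then have 1: "w powr (1 / ?n) * k * (?n + 1) powr (- 1 / ?n) \<le> 4"
    by (simp add: powr_minus_divide divide_simps)
  have 2: "\<tau> powr (- 1 / ?n) \<le> 1" using powr_mono[of "- 1 / ?n" 0 \<tau>] t by simp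
  have 3: "inverse (\<tau> + sqrt (\<tau>\<^sup>2 - 1)) * \<tau> \<le> 1" 
  proof -
    have "\<tau> \<le> \<tau> + sqrt (\<tau>\<^sup>2 - 1)" "0 < \<tau> + sqrt (\<tau>\<^sup>2 - 1)" using t by (auto intro: add_pos_nonneg)
    then show ?thesis by (simp add: divide_inverse[symmetric] inverse_eq_divide)
  qed
  have "1 / 2 * N * A * B * T * D * (\<tau> * k / (2 * N)) = 1 / 4 * (A * k * B) * T * (D * \<tau>)" if "N \<noteq> 0" for N A B T D :: real
    using that by (simp add: field_simps)
  from this[of ?n "w powr (1 / ?n)" "(?n + 1) powr (- 1 / ?n)" "\<tau> powr (- 1 / ?n)" "inverse (\<tau> + sqrt (\<tau>\<^sup>2 - 1))"]
  have "sobolev_constant TYPE('n) \<tau> * (\<tau> * k / (2 * ?n)) =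
      1 / 4 * (w powr (1 / ?n) * k * (?n + 1) powr (- 1 / ?n)) * \<tau> powr (- 1 / ?n) * (inverse (\<tau> + sqrt (\<tau>\<^sup>2 - 1)) * \<tau>)"
    unfolding C by simp
  also have "\<dots> \<le> 1 * 1 * 1"
  proof (rule mult_mono[OF mult_mono[OF _ 2] 3])
    show "1 / 4 * (w powr (1 / ?n) * k * (?n + 1) powr (- 1 / ?n)) \<le> 1" using 1 by linarith
    show "0 \<le> inverse (\<tau> + sqrt (\<tau>\<^sup>2 - 1)) * \<tau>" using t by simp
  qed simp_all
  finally show "sobolev_constant TYPE('n::finite) \<tau> * (\<tau> * sqrt (0.86 * ?n + 0.14) / (2 * ?n)) \<le> 1"
    by (simp only: k_def mult_1_left)
qed

section \<open>The flat Sobolev inequality\<close>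

lemma AE_isometry:
  fixes Q :: "real^'n \<Rightarrow> real^'n::finite"
  assumes Q: "orthogonal_transformation Q" "\<And>x. Q (Q' x) = x" and P: "AE x in lborel. P x"
  shows "AE x in lborel. P (Q' x)"
proof -
  have "AE x in lebesgue. P x" using P by (rule AE_completion)
  then obtain N where N: "{x. \<not> P x} \<subseteq> N" "N \<in> null_sets lebesgue" by (auto simp: eventually_ae_filter)
  have "negligible (Q ` N)"
    using N(2) orthogonal_transformation_linear[OF Q(1)]
    by (intro negligible_differentiable_image_negligible linear_imp_differentiable_on) (simp_all add: negligible_iff_null_sets)
  then have "AE x in lebesgue. x \<notin> Q ` N" by (intro AE_not_in) (simp add: negligible_iff_null_sets)
  moreover have "{x. \<not> P (Q' x)} \<subseteq> Q ` N"
  proof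
    fix x assume "x \<in> {x. \<not> P (Q' x)}"
    then have "Q' x \<in> N" using N(1) by blast
    then have "Q (Q' x) \<in> Q ` N" by (rule imageI)
    then show "x \<in> Q ` N" by (simp only: Q(2))
  qed
  ultimately have "AE x in lebesgue. P (Q' x)" by (elim eventually_mono) blast
  then show ?thesis by (simp add: AE_completion_iff)
qed

context weighted_hypersurface
begin

text \<open>
  Integration against the area of the projection to space, counted with multiplicity.
\<close>

definition flat_integral :: "('n minkowski \<Rightarrow> real) \<Rightarrow> ennreal" where
  "flat_integral h = (\<Sum>m<length atlas. \<integral>\<^sup>+u. ennreal (h (par (chart_of m) u) * \<bar>det (proj_matrix (chart_of m) u)\<bar>) * indicator (Ipiece m) u \<partial>lborel)"

definition flat_boundary_integral :: "(real^'n \<Rightarrow> real) \<Rightarrow> ennreal" where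
  "flat_boundary_integral w = (\<Sum>m<length atlas.
     \<integral>\<^sup>+y. ennreal (f (par (chart_of m) (face_point (face (chart_of m)) y)) * w (conormal (chart_of m) (face_point (face (chart_of m)) y)))
       * indicator (Fpiece m) (face_point (face (chart_of m)) y) \<partial>PiM (UNIV - {face (chart_of m)}) (\<lambda>_. lborel))"

text \<open>
  The line inequality for all lines in direction \<open>i\<close> of a rotated frame at once. The function \<open>M\<close> is half
  the fibre sum of the directional derivative plus half the boundary term, the latter smeared out
  over a unit interval of the line so that both are integrated in the same way.
\<close>

lemma projected_line_inequality:
  fixes Q :: "real^'n \<Rightarrow> real^'n"
  assumes Q: "orthogonal_transformation Q"
  obtains M where "M \<in> borel_measurable borel"
    "AE x in lborel. fibre_sum (\<lambda>y. Q (snd y)) f Intr x \<le> (\<integral>\<^sup>+t. M (upd x i t) \<partial>lborel)"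
    "(\<integral>\<^sup>+x. M x \<partial>lborel) = ennreal (1 / 2) * (flat_integral (\<lambda>y. \<bar>Q (grad y) $ i\<bar>) + flat_boundary_integral (\<lambda>v. \<bar>Q v $ i\<bar>))"
proof -
  define Q' where "Q' = inv Q"
  have QQ: "Q (Q' x) = x" "Q' (Q x) = x" for x
    using orthogonal_transformation_bij[OF Q] by (simp_all add: Q'_def bij_is_surj surj_f_inv_f bij_is_inj)
  have Q': "orthogonal_transformation Q'" unfolding Q'_def by (rule orthogonal_transformation_inv[OF Q])
  have lQ': "linear Q'" by (rule orthogonal_transformation_linear[OF Q'])
  define e where "e = Q' (axis i 1)"
  have e: "norm e = 1" using orthogonal_transformation_norm[OF Q'] by (simp add: e_def norm_axis_1)
  have line: "Q' x + t *\<^sub>R e = Q' (upd x i (x $ i + t))" for x t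
  proof -
    have "upd x i (x $ i + t) = x + t *\<^sub>R axis i 1" by (simp add: vec_eq_iff axis_def)
    then show ?thesis by (simp add: e_def linear_add[OF lQ'] linear_scale[OF lQ'])
  qed
  have ge: "v \<bullet> e = Q v $ i" for v
  proof -
    have "v \<bullet> e = Q v \<bullet> Q e" using Q by (simp add: orthogonal_transformation_def)
    then show ?thesis by (simp add: e_def QQ inner_axis)
  qed
  have fs: "fibre_sum (\<lambda>y. Q (snd y)) h Intr x = fibre_sum snd h Intr (Q' x)" for h x
  proof -
    have "Q (snd u) = x \<longleftrightarrow> snd u = Q' x" for u :: "'n minkowski" using QQ by metis
    then show ?thesis unfolding fibre_sum_def by (intro nn_integral_cong) (simp add: indicator_def)
  qed
  define h where "h y = \<bar>Q (grad y) $ i\<bar>" for y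
  have h0: "0 \<le> h y" for y by (simp add: h_def)
  have hc: "continuous_on (Ipiece m) (\<lambda>u. h (par (chart_of m) u))" if m: "m < length atlas" for m
  proof -
    have sub: "Ipiece m \<subseteq> {u \<in> half_region (chart_of m). u $ face (chart_of m) \<noteq> 0}"
      using piece_subset[of m] by (auto simp: Ipiece_def)
    show ?thesis unfolding h_def
      by (intro continuous_on_rabs continuous_on_component bounded_linear.continuous_on[OF isometry_bounded_linear[OF Q]]
          continuous_on_subset[OF chart_cts_continuous_on[OF chart_cts_grad chart_of[OF m]] sub])
  qed
  obtain D where D: "D \<in> borel_measurable borel" "AE x in lborel. fibre_sum (\<lambda>y. Q (snd y)) h Intr x = D x"
    "(\<integral>\<^sup>+x. D x \<partial>lborel) = flat_integral h"
    unfolding flat_integral_def by (rule interior_area[where h = h, OF Q h0 hc]) (assumption | rule that)+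
  define l where "l x = {w. \<forall>j. j \<noteq> i \<longrightarrow> Q w $ j = x $ j}" for x :: "real^'n"
  let ?L = "\<lambda>m x. \<integral>\<^sup>+u. ennreal (f (par (chart_of m) u)) * indicator (Fpiece m) u * indicator (l x) (snd (par (chart_of m) u)) \<partial>count_space UNIV"
  let ?I = "\<lambda>m. \<integral>\<^sup>+y. ennreal (f (par (chart_of m) (face_point (face (chart_of m)) y)) * \<bar>Q (conormal (chart_of m) (face_point (face (chart_of m)) y)) $ i\<bar>)
       * indicator (Fpiece m) (face_point (face (chart_of m)) y) \<partial>PiM (UNIV - {face (chart_of m)}) (\<lambda>_. lborel)"
  have "\<forall>m\<in>{..<length atlas}. \<exists>N. N \<in> borel_measurable borel \<and>
      (AE x in lborel. N x = indicator {0..1} (x $ i) * ?L m x) \<and> (\<integral>\<^sup>+x. N x \<partial>lborel) = ?I m"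
  proof
    fix m assume "m \<in> {..<length atlas}"
    then have m: "m < length atlas" by simp
    have "Fpiece m \<subseteq> half_region (chart_of m)" using piece_subset[of m] by (auto simp: Fpiece_def)
    from continuous_on_subset[OF continuous_on_half_par[OF chart_of[OF m]] this]
    have "continuous_on (Fpiece m) (\<lambda>u. f (par (chart_of m) u))"
      by (rule continuous_on_compose2[OF continuous_on_f]) (use m repD(5)[OF piece_rep] in \<open>auto simp: Fpiece_def\<close>)
    moreover have "0 \<le> f (par (chart_of m) u)" if "u \<in> Fpiece m" for u
      using pos[OF repD(5)[OF piece_rep[OF m]]] that by (fastforce simp: Fpiece_def)
    ultimately show "\<exists>N. N \<in> borel_measurable borel \<and>
        (AE x in lborel. N x = indicator {0..1} (x $ i) * ?L m x) \<and> (\<integral>\<^sup>+x. N x \<partial>lborel) = ?I m"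
      by (rule boundary_area[where i = i, OF Q m sigma_compact_Fpiece[OF m] order_refl])
        (use l_def in \<open>auto intro!: exI simp only:\<close>)
  qed
  from bchoice[OF this] obtain N where N: "\<And>m. m < length atlas \<Longrightarrow> N m \<in> borel_measurable borel"
    "\<And>m. m < length atlas \<Longrightarrow> AE x in lborel. N m x = indicator {0..1} (x $ i) * ?L m x"
    "\<And>m. m < length atlas \<Longrightarrow> (\<integral>\<^sup>+x. N m x \<partial>lborel) = ?I m" by auto
  define B where "B x = (\<Sum>m<length atlas. N m x)" for x
  have Bm: "B \<in> borel_measurable borel" unfolding B_def using N(1) by (intro borel_measurable_sum) simp
  have BI: "(\<integral>\<^sup>+x. B x \<partial>lborel) = flat_boundary_integral (\<lambda>v. \<bar>Q v $ i\<bar>)"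
    unfolding B_def flat_boundary_integral_def
    by (subst nn_integral_sum) (use N(1,3) in auto)
  have "AE x in lborel. \<forall>m\<in>{..<length atlas}. N m x = indicator {0..1} (x $ i) * ?L m x"
    using N(2) by (simp add: AE_finite_all)
  then have BL: "AE x in lborel. B x = indicator {0..1} (x $ i) * boundary_line_sum f (l x)"
  proof eventually_elim
    case (elim x)
    have "boundary_line_sum f (l x) = (\<integral>\<^sup>+z. (ennreal (f z) * indicator (l x) (snd z)) * indicator Bd z \<partial>count_space UNIV)"
      unfolding boundary_line_sum_def by (intro nn_integral_cong) (simp only: ac_simps)
    also have "\<dots> = (\<Sum>m<length atlas. \<integral>\<^sup>+u. (ennreal (f (par (chart_of m) u)) * indicator (l x) (snd (par (chart_of m) u))) *
        indicator {u \<in> piece atlas m. par (chart_of m) u \<in> Bd} u \<partial>count_space UNIV)"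
      by (rule count_space_pieces) (simp add: Bd_def)
    also have "\<dots> = (\<Sum>m<length atlas. ?L m x)"
    proof (rule sum.cong[OF refl])
      fix m assume "m \<in> {..<length atlas}"
      then have m: "{u \<in> piece atlas m. par (chart_of m) u \<in> Bd} = Fpiece m" by (simp add: Fpiece_eq)
      show "(\<integral>\<^sup>+u. (ennreal (f (par (chart_of m) u)) * indicator (l x) (snd (par (chart_of m) u))) *
        indicator {u \<in> piece atlas m. par (chart_of m) u \<in> Bd} u \<partial>count_space UNIV) = ?L m x"
        unfolding m by (intro nn_integral_cong) (simp only: ac_simps)
    qed
    finally show ?case using elim by (simp add: B_def sum_distrib_left)
  qed
  define M where "M x = ennreal (1 / 2) * (D x + B x)" for x
  show ?thesis
  proof (rule that[of M])
    show "M \<in> borel_measurable borel" unfolding M_def using D(1) Bm by measurable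
    show "(\<integral>\<^sup>+x. M x \<partial>lborel) = ennreal (1 / 2) * (flat_integral (\<lambda>y. \<bar>Q (grad y) $ i\<bar>) + flat_boundary_integral (\<lambda>v. \<bar>Q v $ i\<bar>))"
      unfolding M_def using D Bm BI by (simp add: nn_integral_cmult nn_integral_add h_def[abs_def])
    show "AE x in lborel. fibre_sum (\<lambda>y. Q (snd y)) f Intr x \<le> (\<integral>\<^sup>+t. M (upd x i t) \<partial>lborel)"
      using AE_line[OF D(2), of i] AE_line[OF BL, of i] AE_isometry[OF Q QQ(1) AE_fibre_interior]
    proof eventually_elim
      case (elim x)
      have Dm: "(\<lambda>t. D (upd x i t)) \<in> borel_measurable borel" "(\<lambda>t. B (upd x i t)) \<in> borel_measurable borel"
        using D(1) Bm by measurable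
      have "AE t in distr lborel borel ((+) (x $ i)). fibre_sum (\<lambda>y. Q (snd y)) h Intr (upd x i t) = D (upd x i t)"
        unfolding lborel_distr_plus by (rule elim(1))
      then have "AE t in lborel. fibre_sum (\<lambda>y. Q (snd y)) h Intr (upd x i (x $ i + t)) = D (upd x i (x $ i + t))"
        by (rule AE_distrD[rotated]) simp
      then have "(\<integral>\<^sup>+t. fibre_sum (\<lambda>y. Q (snd y)) h Intr (upd x i (x $ i + t)) \<partial>lborel) = (\<integral>\<^sup>+t. D (upd x i (x $ i + t)) \<partial>lborel)"
        by (rule nn_integral_cong_AE)
      also have "\<dots> = (\<integral>\<^sup>+t. D (upd x i t) \<partial>lborel)"
        using nn_integral_real_affine[OF Dm(1), of 1 "x $ i"] by simp
      finally have 1: "(\<integral>\<^sup>+t. fibre_sum snd (\<lambda>z. \<bar>grad z \<bullet> e\<bar>) Intr (Q' x + t *\<^sub>R e) \<partial>lborel) = (\<integral>\<^sup>+t. D (upd x i t) \<partial>lborel)"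
        unfolding fs line ge h_def .
      have "l (upd x i t) = range (\<lambda>t. Q' x + t *\<^sub>R e)" for t
      proof (intro equalityI subsetI)
        fix w assume "w \<in> l (upd x i t)"
        then have "Q w = upd x i (x $ i + (Q w $ i - x $ i))" by (auto simp: l_def vec_eq_iff)
        then have "Q' (Q w) = Q' x + (Q w $ i - x $ i) *\<^sub>R e" unfolding line by (rule arg_cong)
        then show "w \<in> range (\<lambda>t. Q' x + t *\<^sub>R e)" unfolding QQ by (rule range_eqI)
      next
        fix w assume "w \<in> range (\<lambda>t. Q' x + t *\<^sub>R e)"
        then obtain s where "w = Q' (upd x i (x $ i + s))" unfolding line by blast
        then show "w \<in> l (upd x i t)" by (simp add: l_def QQ)
      qed
      then have "(\<integral>\<^sup>+t. B (upd x i t) \<partial>lborel) = (\<integral>\<^sup>+t. boundary_line_sum f (range (\<lambda>t. Q' x + t *\<^sub>R e)) * indicator {0..1::real} t \<partial>lborel)"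
        using elim(2) by (intro nn_integral_cong_AE) (auto elim!: eventually_mono simp: mult.commute)
      also have "\<dots> = boundary_line_sum f (range (\<lambda>t. Q' x + t *\<^sub>R e))" by (simp add: nn_integral_cmult_indicator)
      finally have 2: "(\<integral>\<^sup>+t. B (upd x i t) \<partial>lborel) = boundary_line_sum f (range (\<lambda>t. Q' x + t *\<^sub>R e))" .
      have "2 * fibre_sum snd f Intr (Q' x) \<le> (\<integral>\<^sup>+t. D (upd x i t) \<partial>lborel) + (\<integral>\<^sup>+t. B (upd x i t) \<partial>lborel)"
        using line_inequality[OF e, of "Q' x"] elim(3) unfolding 1 2 by blast
      then have "ennreal (1 / 2) * (2 * fibre_sum snd f Intr (Q' x)) \<le> ennreal (1 / 2) * ((\<integral>\<^sup>+t. D (upd x i t) \<partial>lborel) + (\<integral>\<^sup>+t. B (upd x i t) \<partial>lborel))"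
        by (rule mult_left_mono) simp
      moreover have "ennreal (1 / 2) * (2 * a) = a" for a
      proof -
        have "ennreal (1 / 2) * 2 = ennreal (1 / 2) * ennreal 2" by simp
        also have "\<dots> = 1" by (subst ennreal_mult[symmetric]) auto
        finally show ?thesis by (simp only: mult.assoc[symmetric] mult_1_left)
      qed
      moreover have "(\<integral>\<^sup>+t. M (upd x i t) \<partial>lborel) = ennreal (1 / 2) * ((\<integral>\<^sup>+t. D (upd x i t) \<partial>lborel) + (\<integral>\<^sup>+t. B (upd x i t) \<partial>lborel))"
        unfolding M_def using Dm by (simp add: nn_integral_cmult nn_integral_add)
      ultimately show ?case unfolding fs by simp
    qed
  qed
qed

end

section \<open>Comparing the induced and the projected volume\<close>

text \<open>
  A function that is not integrable has Bochner integral $0$.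
\<close>

lemma ennreal_integral_le_nn_integral:
  fixes g :: "'a \<Rightarrow> real"
  assumes "\<And>x. 0 \<le> g x"
  shows "ennreal (integral\<^sup>L M g) \<le> (\<integral>\<^sup>+x. ennreal (g x) \<partial>M)"
proof (cases "integrable M g")
  case True
  then show ?thesis using nn_integral_eq_integral[of M g] assms by simp
qed (simp add: not_integrable_integral_eq)

lemma AE_not_face: "AE u :: real^'n::finite in lborel. u $ k \<noteq> 0"
proof -
  have "{u :: real^'n. u $ k = 0} \<in> null_sets lebesgue"
    using negligible_standard_hyperplane_cart[of k] by (simp add: negligible_iff_null_sets)
  then have "AE u in lebesgue. u \<notin> {u :: real^'n. u $ k = 0}" by (rule AE_not_in)
  then show ?thesis by (simp add: AE_completion_iff)
qed

context spacelike_hypersurface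
begin

lemma Ipiece_half: "Ipiece m \<subseteq> half_region (chart_of m)" and Fpiece_half: "Fpiece m \<subseteq> half_region (chart_of m)"
  using piece_subset[of m] by (auto simp: Ipiece_def Fpiece_def)

lemma par_piece: "m < length atlas \<Longrightarrow> u \<in> piece atlas m \<Longrightarrow> par (chart_of m) u \<in> S"
  by (rule repD(5)[OF piece_rep])

lemma continuous_on_det_proj: "c \<in> charts S \<Longrightarrow> continuous_on (half_region c) (\<lambda>u. det (proj_matrix c u))"
  by (intro continuous_on_det continuous_on_proj_matrix)

text \<open>
  A finite cover by sets on which the projection is injective bounds the number of sheets.
\<close>

lemma fibre_card_bounded: obtains K where "\<And>x. card {y \<in> S. snd y = x} \<le> K"
proof -
  have "\<forall>y\<in>S. \<exists>V. open V \<and> y \<in> V \<and> inj_on snd (S \<inter> V)"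
  proof
    fix y assume "y \<in> S"
    then show "\<exists>V. open V \<and> y \<in> V \<and> inj_on snd (S \<inter> V)" by (rule local_projection_injective) blast
  qed
  from bchoice[OF this] obtain V where V: "\<And>y. y \<in> S \<Longrightarrow> open (V y)" "\<And>y. y \<in> S \<Longrightarrow> y \<in> V y"
    "\<And>y. y \<in> S \<Longrightarrow> inj_on snd (S \<inter> V y)" by auto
  obtain T where T: "T \<subseteq> S" "finite T" "S \<subseteq> (\<Union>y\<in>T. V y)"
    by (rule compactE_image[OF compact, of S V]) (use V in \<open>auto intro: that\<close>)
  have "card {y \<in> S. snd y = x} \<le> card T" for x
  proof -
    have "\<forall>y\<in>{y \<in> S. snd y = x}. \<exists>t. t \<in> T \<and> y \<in> V t" using T(3) by blast
    from bchoice[OF this] obtain t where t0: "\<forall>y\<in>{y \<in> S. snd y = x}. t y \<in> T \<and> y \<in> V (t y)" by (elim exE)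
    have t: "t y \<in> T \<and> y \<in> V (t y)" if "y \<in> S" "snd y = x" for y using bspec[OF t0] that by simp
    show ?thesis
    proof (rule card_inj_on_le[of t])
      show "inj_on t {y \<in> S. snd y = x}"
      proof (rule inj_onI)
        fix y z assume yz: "y \<in> {y \<in> S. snd y = x}" "z \<in> {y \<in> S. snd y = x}" "t y = t z"
        then have "t y \<in> S" "y \<in> S \<inter> V (t y)" "z \<in> S \<inter> V (t y)" using t[of y] t[of z] T(1) by auto
        moreover have "snd y = snd z" using yz by simp
        ultimately show "y = z" using inj_onD[OF V(3)] by blast
      qed
      show "t ` {y \<in> S. snd y = x} \<subseteq> T" using t by auto
    qed (rule T(2))
  qed
  then show ?thesis by (rule that)
qed

text \<open>
  The projection has bounded image and boundedly many sheets.
\<close>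

lemma flat_area_finite:
  assumes m: "m < length atlas"
  shows "(\<integral>\<^sup>+u. ennreal (1 * \<bar>det (proj_matrix (chart_of m) u)\<bar>) * indicator (Ipiece m) u \<partial>lborel) < top"
proof -
  have I: "orthogonal_transformation (\<lambda>x :: real^'n. x)" by (rule orthogonal_transformation_id[unfolded id_def])
  have p1: "0 \<le> (1 :: real)" for y :: "'n minkowski" by simp
  have c1: "continuous_on (Ipiece m) (\<lambda>u. 1 :: real)" for m by simp
  obtain N where N: "AE x in lborel. fibre_sum (\<lambda>y. snd y) (\<lambda>y. 1) Intr x = N x"
    "(\<integral>\<^sup>+x. N x \<partial>lborel) = (\<Sum>m<length atlas. \<integral>\<^sup>+u. ennreal (1 * \<bar>det (proj_matrix (chart_of m) u)\<bar>) * indicator (Ipiece m) u \<partial>lborel)"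
    by (rule interior_area[where h = "\<lambda>_. 1", OF I p1 c1]) (rule that)
  obtain K where K: "\<And>x. card {y \<in> S. snd y = x} \<le> K" by (rule fibre_card_bounded) (rule that)
  obtain R where R: "\<And>z. z \<in> S \<Longrightarrow> norm z \<le> R" using compact_imp_bounded[OF compact] by (auto simp: bounded_iff)
  have "AE x in lborel. N x \<le> ennreal (real K) * indicator (cball 0 R) x"
    using N(1)
  proof eventually_elim
    case (elim x)
    let ?Y = "{y \<in> Intr. snd y = x}"
    have fin: "finite ?Y" by (rule finite_subset[OF _ finite_fibre[of x]]) (use Intr_subset in auto)
    have "N x = ennreal (real (card ?Y))"
      using elim fibre_sum_finite[OF fin, of "\<lambda>_. 1"] by (simp add: ennreal_of_nat_eq_real_of_nat)
    moreover have "card ?Y \<le> card {y \<in> S. snd y = x}" by (rule card_mono[OF finite_fibre]) (use Intr_subset in auto)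
    moreover have "x \<in> cball 0 R" if "?Y \<noteq> {}"
    proof -
      obtain y where y: "y \<in> Intr" "snd y = x" using \<open>?Y \<noteq> {}\<close> by blast
      then have "norm y \<le> R" using R Intr_subset by blast
      then show ?thesis using norm_snd_le[of "snd y" "fst y", unfolded prod.collapse] y(2) by simp
    qed
    ultimately show ?case using K[of x] by (cases "?Y = {}") (auto intro!: ennreal_leI)
  qed
  then have "(\<integral>\<^sup>+x. N x \<partial>lborel) \<le> (\<integral>\<^sup>+x. ennreal (real K) * indicator (cball 0 R) (x :: real^'n) \<partial>lborel)" by (rule nn_integral_mono_AE)
  also have "\<dots> = ennreal (real K) * emeasure lborel (cball (0 :: real^'n) R)" by (rule nn_integral_cmult_indicator) simp
  also have "\<dots> < top" using emeasure_bounded_finite[OF bounded_cball, of "0 :: real^'n" R] by (simp add: ennreal_mult_less_top)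
  finally show ?thesis unfolding N(2) using m by (simp add: less_top[symmetric])
qed

end

context weighted_hypersurface
begin

text \<open>
  The total variation of \<open>f\<close> extended by zero across the boundary, with lengths of gradients and
  conormals measured by \<open>g\<close>.
\<close>

definition anisotropic_variation :: "(real^'n \<Rightarrow> real) \<Rightarrow> ennreal" where
  "anisotropic_variation g = flat_integral (\<lambda>y. g (grad y)) + flat_boundary_integral g"

lemma measurable_flat:
  assumes m: "m < length atlas" and h: "chart_cts h"
  shows "(\<lambda>u. ennreal (h (par (chart_of m) u) * \<bar>det (proj_matrix (chart_of m) u)\<bar>) * indicator (Ipiece m) u) \<in> borel_measurable borel"
  by (intro borel_measurable_ennreal_continuous_on sigma_compact_borel sigma_compact_Ipiece m continuous_on_mult continuous_on_rabs
      continuous_on_subset[OF chart_ctsD[OF h chart_of[OF m]] Ipiece_half] continuous_on_subset[OF continuous_on_det_proj[OF chart_of[OF m]] Ipiece_half])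

lemma measurable_flat_boundary:
  assumes m: "m < length atlas" and w: "continuous_on UNIV w"
  shows "(\<lambda>y. ennreal (f (par (chart_of m) (face_point (face (chart_of m)) y)) * w (conormal (chart_of m) (face_point (face (chart_of m)) y)))
       * indicator (Fpiece m) (face_point (face (chart_of m)) y)) \<in> borel_measurable (PiM (UNIV - {face (chart_of m)}) (\<lambda>_. lborel))"
proof -
  have "continuous_on (Fpiece m) (\<lambda>u. w (conormal (chart_of m) u))"
    by (rule continuous_on_compose2[OF w continuous_on_subset[OF continuous_on_conormal[OF chart_of[OF m]] Fpiece_half]]) simp
  then have "(\<lambda>u. ennreal (f (par (chart_of m) u) * w (conormal (chart_of m) u)) * indicator (Fpiece m) u) \<in> borel_measurable borel"
    by (intro borel_measurable_ennreal_continuous_on sigma_compact_borel sigma_compact_Fpiece m continuous_on_mult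
        continuous_on_subset[OF chart_ctsD[OF chart_cts_f chart_of[OF m]] Fpiece_half])
  from measurable_compose[OF measurable_face_point this] show ?thesis .
qed

lemma chart_cts_of_grad: "continuous_on UNIV g \<Longrightarrow> chart_cts (\<lambda>y. g (grad y))"
  unfolding chart_cts_def using continuous_on_compose2[OF _ chart_ctsD[OF chart_cts_grad]] by blast

lemma anisotropic_variation_sum:
  fixes g :: "'i \<Rightarrow> real^'n \<Rightarrow> real"
  assumes c: "\<And>i. continuous_on UNIV (g i)" and p: "\<And>i v. 0 \<le> g i v"
  shows "anisotropic_variation (\<lambda>v. \<Sum>i\<in>I. g i v) = (\<Sum>i\<in>I. anisotropic_variation (g i))"
proof -
  have 1: "flat_integral (\<lambda>y. \<Sum>i\<in>I. g i (grad y)) = (\<Sum>i\<in>I. flat_integral (\<lambda>y. g i (grad y)))"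
    unfolding flat_integral_def
  proof (subst sum.swap, rule sum.cong[OF refl])
    fix m assume "m \<in> {..<length atlas}"
    then have m: "m < length atlas" by simp
    have "(\<Sum>i\<in>I. \<integral>\<^sup>+u. ennreal (g i (grad (par (chart_of m) u)) * \<bar>det (proj_matrix (chart_of m) u)\<bar>) * indicator (Ipiece m) u \<partial>lborel)
      = (\<integral>\<^sup>+u. (\<Sum>i\<in>I. ennreal (g i (grad (par (chart_of m) u)) * \<bar>det (proj_matrix (chart_of m) u)\<bar>) * indicator (Ipiece m) u) \<partial>lborel)"
      by (rule nn_integral_sum[symmetric]) (use measurable_flat[OF m chart_cts_of_grad[OF c]] in simp)
    also have "\<dots> = (\<integral>\<^sup>+u. ennreal ((\<Sum>i\<in>I. g i (grad (par (chart_of m) u))) * \<bar>det (proj_matrix (chart_of m) u)\<bar>) * indicator (Ipiece m) u \<partial>lborel)"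
      by (intro nn_integral_cong) (simp only: sum_distrib_right[symmetric] sum_ennreal p mult_nonneg_nonneg abs_ge_zero)
    finally show "(\<integral>\<^sup>+u. ennreal ((\<Sum>i\<in>I. g i (grad (par (chart_of m) u))) * \<bar>det (proj_matrix (chart_of m) u)\<bar>) * indicator (Ipiece m) u \<partial>lborel)
      = (\<Sum>i\<in>I. \<integral>\<^sup>+u. ennreal (g i (grad (par (chart_of m) u)) * \<bar>det (proj_matrix (chart_of m) u)\<bar>) * indicator (Ipiece m) u \<partial>lborel)" ..
  qed
  have 2: "flat_boundary_integral (\<lambda>v. \<Sum>i\<in>I. g i v) = (\<Sum>i\<in>I. flat_boundary_integral (g i))"
    unfolding flat_boundary_integral_def
  proof (subst sum.swap, rule sum.cong[OF refl])
    fix m assume "m \<in> {..<length atlas}"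
    then have m: "m < length atlas" by simp
    let ?p = "\<lambda>y. face_point (face (chart_of m)) y" and ?M = "PiM (UNIV - {face (chart_of m)}) (\<lambda>_. lborel :: real measure)"
    have f0: "0 \<le> f (par (chart_of m) u)" if "u \<in> Fpiece m" for u
      using pos[OF par_piece[OF m, of u]] that by (simp add: Fpiece_def)
    have "(\<Sum>i\<in>I. \<integral>\<^sup>+y. ennreal (f (par (chart_of m) (?p y)) * g i (conormal (chart_of m) (?p y))) * indicator (Fpiece m) (?p y) \<partial>?M)
      = (\<integral>\<^sup>+y. (\<Sum>i\<in>I. ennreal (f (par (chart_of m) (?p y)) * g i (conormal (chart_of m) (?p y))) * indicator (Fpiece m) (?p y)) \<partial>?M)"
      by (rule nn_integral_sum[symmetric]) (rule measurable_flat_boundary[OF m c])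
    also have "\<dots> = (\<integral>\<^sup>+y. ennreal (f (par (chart_of m) (?p y)) * (\<Sum>i\<in>I. g i (conormal (chart_of m) (?p y)))) * indicator (Fpiece m) (?p y) \<partial>?M)"
    proof (intro nn_integral_cong)
      fix y
      show "(\<Sum>i\<in>I. ennreal (f (par (chart_of m) (?p y)) * g i (conormal (chart_of m) (?p y))) * indicator (Fpiece m) (?p y))
        = ennreal (f (par (chart_of m) (?p y)) * (\<Sum>i\<in>I. g i (conormal (chart_of m) (?p y)))) * indicator (Fpiece m) (?p y)"
        using f0[of "?p y"] by (cases "?p y \<in> Fpiece m") (simp_all add: sum_ennreal p sum_distrib_left)
    qed
    finally show "(\<integral>\<^sup>+y. ennreal (f (par (chart_of m) (?p y)) * (\<Sum>i\<in>I. g i (conormal (chart_of m) (?p y)))) * indicator (Fpiece m) (?p y) \<partial>?M)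
      = (\<Sum>i\<in>I. \<integral>\<^sup>+y. ennreal (f (par (chart_of m) (?p y)) * g i (conormal (chart_of m) (?p y))) * indicator (Fpiece m) (?p y) \<partial>?M)" ..
  qed
  show ?thesis unfolding anisotropic_variation_def 1 2 by (simp only: sum.distrib)
qed

lemma anisotropic_variation_mono_scaled:
  assumes c: "continuous_on UNIV g" and a: "0 \<le> a" and le: "\<And>v. g' v \<le> a * g v"
  shows "anisotropic_variation g' \<le> ennreal a * anisotropic_variation g"
proof -
  have 1: "flat_integral (\<lambda>y. g' (grad y)) \<le> ennreal a * flat_integral (\<lambda>y. g (grad y))"
    unfolding flat_integral_def sum_distrib_left
  proof (rule sum_mono)
    fix m assume "m \<in> {..<length atlas}"
    then have m: "m < length atlas" by simp
    have "(\<integral>\<^sup>+u. ennreal (g' (grad (par (chart_of m) u)) * \<bar>det (proj_matrix (chart_of m) u)\<bar>) * indicator (Ipiece m) u \<partial>lborel)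
      \<le> (\<integral>\<^sup>+u. ennreal a * (ennreal (g (grad (par (chart_of m) u)) * \<bar>det (proj_matrix (chart_of m) u)\<bar>) * indicator (Ipiece m) u) \<partial>lborel)"
      using a mult_right_mono[OF le abs_ge_zero]
      by (intro nn_integral_mono) (auto simp: indicator_def ennreal_mult'[symmetric] mult.assoc[symmetric] intro!: ennreal_leI)
    then show "(\<integral>\<^sup>+u. ennreal (g' (grad (par (chart_of m) u)) * \<bar>det (proj_matrix (chart_of m) u)\<bar>) * indicator (Ipiece m) u \<partial>lborel)
      \<le> ennreal a * (\<integral>\<^sup>+u. ennreal (g (grad (par (chart_of m) u)) * \<bar>det (proj_matrix (chart_of m) u)\<bar>) * indicator (Ipiece m) u \<partial>lborel)"
      by (subst nn_integral_cmult[symmetric]) (use measurable_flat[OF m chart_cts_of_grad[OF c]] in simp_all)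
  qed
  have 2: "flat_boundary_integral g' \<le> ennreal a * flat_boundary_integral g"
    unfolding flat_boundary_integral_def sum_distrib_left
  proof (rule sum_mono)
    fix m assume "m \<in> {..<length atlas}"
    then have m: "m < length atlas" by simp
    let ?p = "\<lambda>y. face_point (face (chart_of m)) y" and ?M = "PiM (UNIV - {face (chart_of m)}) (\<lambda>_. lborel :: real measure)"
    have "(\<integral>\<^sup>+y. ennreal (f (par (chart_of m) (?p y)) * g' (conormal (chart_of m) (?p y))) * indicator (Fpiece m) (?p y) \<partial>?M)
      \<le> (\<integral>\<^sup>+y. ennreal a * (ennreal (f (par (chart_of m) (?p y)) * g (conormal (chart_of m) (?p y))) * indicator (Fpiece m) (?p y)) \<partial>?M)"
    proof (intro nn_integral_mono)
      fix y
      have "f (par (chart_of m) (?p y)) * g' (conormal (chart_of m) (?p y)) \<le> a * (f (par (chart_of m) (?p y)) * g (conormal (chart_of m) (?p y)))"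
        if "?p y \<in> Fpiece m"
        using mult_left_mono[OF le less_imp_le[OF pos[OF par_piece[OF m, of "?p y"]]]] that
        by (simp add: Fpiece_def mult.left_commute)
      then show "ennreal (f (par (chart_of m) (?p y)) * g' (conormal (chart_of m) (?p y))) * indicator (Fpiece m) (?p y)
        \<le> ennreal a * (ennreal (f (par (chart_of m) (?p y)) * g (conormal (chart_of m) (?p y))) * indicator (Fpiece m) (?p y))"
        using a by (cases "?p y \<in> Fpiece m") (simp_all add: ennreal_mult'[symmetric] ennreal_leI)
    qed
    also have "\<dots> = ennreal a * (\<integral>\<^sup>+y. ennreal (f (par (chart_of m) (?p y)) * g (conormal (chart_of m) (?p y))) * indicator (Fpiece m) (?p y) \<partial>?M)"
      by (rule nn_integral_cmult[OF measurable_flat_boundary[OF m c]])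
    finally show "(\<integral>\<^sup>+y. ennreal (f (par (chart_of m) (?p y)) * g' (conormal (chart_of m) (?p y))) * indicator (Fpiece m) (?p y) \<partial>?M)
      \<le> ennreal a * (\<integral>\<^sup>+y. ennreal (f (par (chart_of m) (?p y)) * g (conormal (chart_of m) (?p y))) * indicator (Fpiece m) (?p y) \<partial>?M)" .
  qed
  show ?thesis unfolding anisotropic_variation_def distrib_left by (rule add_mono[OF 1 2])
qed

text \<open>
  The fibre sum \<open>F\<close> of \<open>f\<close> obeys the hypothesis of Gagliardo--Nirenberg, and the fibre sum of a power
  of \<open>f\<close> is at most that power of \<open>F\<close>. The geometric mean over the axes is replaced by the
  arithmetic one to reach an integrand that is additive in the axes.
\<close>

lemma frame_sobolev:
  fixes Q :: "real^'n \<Rightarrow> real^'n"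
  assumes n: "2 \<le> CARD('n)" and Q: "orthogonal_transformation Q"
  shows "epow (flat_integral (\<lambda>y. f y powr (real CARD('n) / (real CARD('n) - 1)))) ((real CARD('n) - 1) / real CARD('n))
    \<le> ennreal (1 / (2 * real CARD('n))) * anisotropic_variation (\<lambda>v. \<Sum>i\<in>UNIV. \<bar>Q v $ i\<bar>)"
proof -
  let ?n = "real CARD('n)"
  let ?p = "?n / (?n - 1)"
  have p: "1 \<le> ?p" and n1: "0 < (?n - 1) / ?n" using n by (simp_all add: field_simps)
  have f0: "0 \<le> f y" if "y \<in> Intr" for y using pos that Intr_subset by (blast intro: less_imp_le)
  have fc: "continuous_on (Ipiece m) (\<lambda>u. f (par (chart_of m) u))" if m: "m < length atlas" for m
    by (rule continuous_on_subset[OF chart_ctsD[OF chart_cts_f chart_of[OF m]] Ipiece_half])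
  have fp0: "0 \<le> f y powr ?p" if "y \<in> Intr" for y by simp
  have fpc: "continuous_on (Ipiece m) (\<lambda>u. f (par (chart_of m) u) powr ?p)" if m: "m < length atlas" for m
    using pos[OF par_piece[OF m]] by (intro continuous_on_powr fc m continuous_on_const) (force simp: Ipiece_def)
  obtain F where F: "F \<in> borel_measurable borel" "AE x in lborel. fibre_sum (\<lambda>y. Q (snd y)) f Intr x = F x"
    by (rule interior_area[where h = f, OF Q f0 fc]) (assumption | rule that)+
  obtain G where G: "AE x in lborel. fibre_sum (\<lambda>y. Q (snd y)) (\<lambda>y. f y powr ?p) Intr x = G x"
    "(\<integral>\<^sup>+x. G x \<partial>lborel) = flat_integral (\<lambda>y. f y powr ?p)"
    unfolding flat_integral_def by (rule interior_area[where h = "\<lambda>y. f y powr ?p", OF Q fp0 fpc]) (assumption | rule that)+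
  have fin: "finite {u \<in> Intr. Q (snd u) = x}" for x
  proof (rule finite_subset[OF _ finite_fibre[of "inv Q x"]])
    show "{u \<in> Intr. Q (snd u) = x} \<subseteq> {y \<in> S. snd y = inv Q x}"
      using Intr_subset inv_f_f[OF orthogonal_transformation_inj[OF Q]] by fastforce
  qed
  have "AE x in lborel. G x \<le> epow (F x) ?p"
    using F(2) G(1)
  proof eventually_elim
    case (elim x)
    have "fibre_sum (\<lambda>y. Q (snd y)) (\<lambda>y. f y powr ?p) Intr x \<le> epow (fibre_sum (\<lambda>y. Q (snd y)) f Intr x) ?p"
      by (rule fibre_sum_powr[OF fin f0 p])
    then show ?case by (simp only: elim)
  qed
  then have "flat_integral (\<lambda>y. f y powr ?p) \<le> (\<integral>\<^sup>+x. epow (F x) ?p \<partial>lborel)"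
    unfolding G(2)[symmetric] by (rule nn_integral_mono_AE)
  then have 1: "epow (flat_integral (\<lambda>y. f y powr ?p)) ((?n - 1) / ?n) \<le> epow (\<integral>\<^sup>+x. epow (F x) ?p \<partial>lborel) ((?n - 1) / ?n)"
    using n1 by (rule epow_mono)
  have "\<forall>i. \<exists>M. M \<in> borel_measurable borel \<and> (AE x in lborel. fibre_sum (\<lambda>y. Q (snd y)) f Intr x \<le> (\<integral>\<^sup>+t. M (upd x i t) \<partial>lborel)) \<and>
    (\<integral>\<^sup>+x. M x \<partial>lborel) = ennreal (1 / 2) * anisotropic_variation (\<lambda>v. \<bar>Q v $ i\<bar>)"
  proof
    fix i
    show "\<exists>M. M \<in> borel_measurable borel \<and> (AE x in lborel. fibre_sum (\<lambda>y. Q (snd y)) f Intr x \<le> (\<integral>\<^sup>+t. M (upd x i t) \<partial>lborel)) \<and>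
      (\<integral>\<^sup>+x. M x \<partial>lborel) = ennreal (1 / 2) * anisotropic_variation (\<lambda>v. \<bar>Q v $ i\<bar>)"
      unfolding anisotropic_variation_def by (rule projected_line_inequality[OF Q, of i]) blast
  qed
  from choice[OF this] obtain M where M: "\<And>i. M i \<in> borel_measurable borel"
    "\<And>i. AE x in lborel. fibre_sum (\<lambda>y. Q (snd y)) f Intr x \<le> (\<integral>\<^sup>+t. M i (upd x i t) \<partial>lborel)"
    "\<And>i. (\<integral>\<^sup>+x. M i x \<partial>lborel) = ennreal (1 / 2) * anisotropic_variation (\<lambda>v. \<bar>Q v $ i\<bar>)" by auto
  have FM: "AE x in lborel. F x \<le> (\<integral>\<^sup>+t. M i (upd x i t) \<partial>lborel)" for i
    using F(2) M(2)[of i] by eventually_elim simp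
  note 1
  also have "epow (\<integral>\<^sup>+x. epow (F x) ?p \<partial>lborel) ((?n - 1) / ?n) \<le> (\<Prod>i\<in>UNIV. epow (\<integral>\<^sup>+x. M i x \<partial>lborel) (1 / ?n))"
    by (rule gagliardo_nirenberg[OF n F(1) M(1) FM])
  also have "\<dots> \<le> ennreal (1 / ?n) * (\<Sum>i\<in>UNIV. \<integral>\<^sup>+x. M i x \<partial>lborel)" by (rule ennreal_arith_geom_mean)
  also have "(\<Sum>i\<in>UNIV. \<integral>\<^sup>+x. M i x \<partial>lborel) = ennreal (1 / 2) * anisotropic_variation (\<lambda>v. \<Sum>i\<in>UNIV. \<bar>Q v $ i\<bar>)"
  proof -
    have "continuous_on UNIV (\<lambda>v. \<bar>Q v $ i\<bar>)" for i
      by (intro continuous_on_rabs continuous_on_component bounded_linear.continuous_on[OF isometry_bounded_linear[OF Q]] continuous_on_id)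
    from anisotropic_variation_sum[where g = "\<lambda>i v. \<bar>Q v $ i\<bar>", OF this abs_ge_zero, of UNIV]
    show ?thesis unfolding M(3) by (simp only: sum_distrib_left)
  qed
  also have "ennreal (1 / ?n) * (ennreal (1 / 2) * A) = ennreal (1 / (2 * ?n)) * A" for A
  proof -
    have "ennreal (1 / ?n) * ennreal (1 / 2) = ennreal (1 / (2 * ?n))" by (subst ennreal_mult[symmetric]) simp_all
    then show ?thesis by (simp only: mult.assoc[symmetric])
  qed
  finally show ?thesis .
qed

text \<open>
  The average of the estimates in the standard frame and in the frame of \<open>balanced_frame\<close>.
\<close>

lemma flat_sobolev:
  assumes n: "2 \<le> CARD('n)"
  shows "epow (flat_integral (\<lambda>y. f y powr (real CARD('n) / (real CARD('n) - 1)))) ((real CARD('n) - 1) / real CARD('n))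
    \<le> ennreal (sqrt (0.86 * real CARD('n) + 0.14) / (2 * real CARD('n))) * anisotropic_variation norm" (is "?X \<le> _")
proof -
  let ?n = "real CARD('n)"
  let ?k = "sqrt (0.86 * ?n + 0.14)"
  obtain R :: "real^'n \<Rightarrow> real^'n" where R: "orthogonal_transformation R"
    "\<And>w. (\<Sum>i\<in>UNIV. \<bar>w $ i\<bar>) + (\<Sum>i\<in>UNIV. \<bar>R w $ i\<bar>) \<le> 2 * ?k * norm w" by (rule balanced_frame) (rule that)
  have I: "orthogonal_transformation (\<lambda>x :: real^'n. x)" by (rule orthogonal_transformation_id[unfolded id_def])
  define g where "g b v = (\<Sum>i\<in>UNIV. \<bar>(if b then v else R v) $ i\<bar>)" for b and v :: "real^'n"
  have gc: "continuous_on UNIV (g b)" for b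
    unfolding g_def
    by (cases b) (auto intro!: continuous_on_sum continuous_on_rabs continuous_on_component continuous_on_id
      bounded_linear.continuous_on[OF isometry_bounded_linear[OF R(1)]])
  have g0: "0 \<le> g b v" for b v unfolding g_def by (rule sum_nonneg) simp
  have "anisotropic_variation (g True) + anisotropic_variation (g False) = anisotropic_variation (\<lambda>v. \<Sum>b\<in>UNIV. g b v)"
    by (subst anisotropic_variation_sum[OF gc g0]) (simp add: UNIV_bool)
  also have "\<dots> \<le> ennreal (2 * ?k) * anisotropic_variation norm"
    by (rule anisotropic_variation_mono_scaled) (use R(2) in \<open>simp_all add: UNIV_bool g_def continuous_on_norm_id add.commute\<close>)
  finally have A: "anisotropic_variation (g True) + anisotropic_variation (g False) \<le> ennreal (2 * ?k) * anisotropic_variation norm" .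
  have "?X \<le> ennreal (1 / (2 * ?n)) * anisotropic_variation (g True)" "?X \<le> ennreal (1 / (2 * ?n)) * anisotropic_variation (g False)"
    using frame_sobolev[OF n I] frame_sobolev[OF n R(1)] by (simp_all add: g_def[abs_def])
  then have "?X + ?X \<le> ennreal (1 / (2 * ?n)) * (anisotropic_variation (g True) + anisotropic_variation (g False))"
    unfolding distrib_left by (rule add_mono)
  also have "\<dots> \<le> ennreal (1 / (2 * ?n)) * (ennreal (2 * ?k) * anisotropic_variation norm)"
    by (rule mult_left_mono[OF A]) simp
  finally have B: "?X + ?X \<le> ennreal (1 / (2 * ?n)) * (ennreal (2 * ?k) * anisotropic_variation norm)" .
  have "?X = ennreal (1 / 2) * (?X + ?X)"
  proof -
    have "ennreal (1 / 2) + ennreal (1 / 2) = 1" by (subst ennreal_plus[symmetric]) simp_all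
    then have "?X = (ennreal (1 / 2) + ennreal (1 / 2)) * ?X" by (simp only: mult_1_left)
    then show ?thesis by (simp only: distrib_left distrib_right)
  qed
  also have "\<dots> \<le> ennreal (1 / 2) * (ennreal (1 / (2 * ?n)) * (ennreal (2 * ?k) * anisotropic_variation norm))"
    by (rule mult_left_mono[OF B]) simp
  also have "\<dots> = (ennreal (1 / 2) * ennreal (1 / (2 * ?n)) * ennreal (2 * ?k)) * anisotropic_variation norm"
    by (simp only: mult.assoc)
  also have "ennreal (1 / 2) * ennreal (1 / (2 * ?n)) * ennreal (2 * ?k) = ennreal (1 / 2 * (1 / (2 * ?n)) * (2 * ?k))"
    by (subst ennreal_mult[symmetric], simp, simp, subst ennreal_mult[symmetric], simp, simp) (rule refl)
  also have "1 / 2 * (1 / (2 * ?n)) * (2 * ?k) = ?k / (2 * ?n)" by simp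
  finally show ?thesis .
qed

end

context weighted_hypersurface
begin

text \<open>
  The two densities differ by \<open>sqrt (1 - slope y \<bullet> slope y)\<close>, which lies between \<open>1 / max_slope S\<close> and $1$.
\<close>

lemma volume_density_bounds:
  assumes m: "m < length atlas" and u: "u \<in> piece atlas m"
  shows "sqrt (det (metric (par (chart_of m)) u)) \<le> \<bar>det (proj_matrix (chart_of m) u)\<bar>"
    and "\<bar>det (proj_matrix (chart_of m) u)\<bar> \<le> max_slope S * sqrt (det (metric (par (chart_of m)) u))"
proof -
  let ?d = "\<bar>det (proj_matrix (chart_of m) u)\<bar>" and ?y = "par (chart_of m) u"
  have r: "rep (chart_of m) u ?y" by (rule piece_rep[OF m u])
  have "sqrt (1 - slope ?y \<bullet> slope ?y) \<le> 1" by simp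
  from mult_left_mono[OF this, of ?d] show "sqrt (det (metric (par (chart_of m)) u)) \<le> ?d"
    unfolding sqrt_det_metric[OF r] by simp
  from mult_left_mono[OF max_slope_bound(1)[OF repD(5)[OF r]], of ?d]
  show "?d \<le> max_slope S * sqrt (det (metric (par (chart_of m)) u))"
    unfolding sqrt_det_metric[OF r] by (simp add: ac_simps)
qed

lemma surface_integral_atlas: "surface_integral S h =
    (\<Sum>m<length atlas. \<integral>u. indicator (piece atlas m) u * (h (par (chart_of m) u) * sqrt (det (metric (par (chart_of m)) u))) \<partial>lborel)"
  by (simp add: surface_integral_def atlas_def set_lebesgue_integral_def Let_def)

lemma surface_density_nonneg:
  assumes m: "m < length atlas" and h: "\<And>y. y \<in> S \<Longrightarrow> 0 \<le> h y"
  shows "0 \<le> indicator (piece atlas m) u * (h (par (chart_of m) u) * sqrt (det (metric (par (chart_of m)) u)))"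
proof (cases "u \<in> piece atlas m")
  case True
  from less_imp_le[OF det_metric_pos[OF piece_rep[OF m True]]] show ?thesis
    using h[OF par_piece[OF m True]] by simp
qed simp

lemma surface_integral_nonneg:
  assumes "\<And>y. y \<in> S \<Longrightarrow> 0 \<le> h y" shows "0 \<le> surface_integral S h"
  unfolding surface_integral_atlas using surface_density_nonneg[of _ h] assms by (intro sum_nonneg integral_nonneg) auto

lemma surface_integral_le_flat:
  assumes h: "\<And>y. y \<in> S \<Longrightarrow> 0 \<le> h y"
  shows "ennreal (surface_integral S h) \<le> flat_integral h"
proof -
  let ?g = "\<lambda>m u. indicator (piece atlas m) u * (h (par (chart_of m) u) * sqrt (det (metric (par (chart_of m)) u)))"
  have g0: "0 \<le> ?g m u" if "m < length atlas" for m u by (rule surface_density_nonneg[OF that h])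
  have "ennreal (surface_integral S h) = (\<Sum>m<length atlas. ennreal (\<integral>u. ?g m u \<partial>lborel))"
    unfolding surface_integral_atlas using g0 by (intro sum_ennreal[symmetric] integral_nonneg) auto
  also have "\<dots> \<le> flat_integral h"
    unfolding flat_integral_def
  proof (rule sum_mono)
    fix m assume "m \<in> {..<length atlas}"
    then have m: "m < length atlas" by simp
    have "ennreal (\<integral>u. ?g m u \<partial>lborel) \<le> (\<integral>\<^sup>+u. ennreal (?g m u) \<partial>lborel)"
      by (rule ennreal_integral_le_nn_integral[OF g0[OF m]])
    also have "\<dots> \<le> (\<integral>\<^sup>+u. ennreal (h (par (chart_of m) u) * \<bar>det (proj_matrix (chart_of m) u)\<bar>) * indicator (Ipiece m) u \<partial>lborel)"
    proof (rule nn_integral_mono_AE)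
      show "AE u in lborel. ennreal (?g m u) \<le> ennreal (h (par (chart_of m) u) * \<bar>det (proj_matrix (chart_of m) u)\<bar>) * indicator (Ipiece m) u"
        using AE_not_face[of "face (chart_of m)"]
      proof eventually_elim
        case (elim u)
        show ?case
        proof (cases "u \<in> piece atlas m")
          case True
          then have "u \<in> Ipiece m" using elim piece_subset[of m] by (auto simp: Ipiece_def half_region_def)
          then show ?thesis
            using True mult_left_mono[OF volume_density_bounds(1)[OF m True] h[OF par_piece[OF m True]]] by (simp add: ennreal_leI)
        qed simp
      qed
    qed
    finally show "ennreal (\<integral>u. ?g m u \<partial>lborel)
      \<le> (\<integral>\<^sup>+u. ennreal (h (par (chart_of m) u) * \<bar>det (proj_matrix (chart_of m) u)\<bar>) * indicator (Ipiece m) u \<partial>lborel)" .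
  qed
  finally show ?thesis .
qed

text \<open>
  The induced integral is a Bochner integral, so a lower bound for it needs integrability: the
  integrand is bounded and the projected area finite.
\<close>

lemma flat_le_surface_integral:
  assumes h: "chart_cts h" "\<And>y. y \<in> S \<Longrightarrow> 0 \<le> h y" and t: "0 \<le> max_slope S"
  shows "flat_integral h \<le> ennreal (max_slope S * surface_integral S h)"
proof -
  let ?g = "\<lambda>m u. indicator (piece atlas m) u * (h (par (chart_of m) u) * sqrt (det (metric (par (chart_of m)) u)))"
  have g0: "0 \<le> ?g m u" if "m < length atlas" for m u by (rule surface_density_nonneg[OF that h(2)])
  obtain C where C: "\<And>z. z \<in> S \<Longrightarrow> h z \<le> C" by (rule chart_cts_bounded[OF h(1)]) (rule that)
  have "flat_integral h \<le> (\<Sum>m<length atlas. ennreal (max_slope S) * ennreal (\<integral>u. ?g m u \<partial>lborel))"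
    unfolding flat_integral_def
  proof (rule sum_mono)
    fix m assume "m \<in> {..<length atlas}"
    then have m: "m < length atlas" by simp
    have gm: "?g m \<in> borel_measurable borel"
    proof -
      have "continuous_on (piece atlas m) (\<lambda>u. h (par (chart_of m) u) * sqrt (det (metric (par (chart_of m)) u)))"
        by (intro continuous_on_mult continuous_on_real_sqrt continuous_on_det
            continuous_on_subset[OF chart_ctsD[OF h(1) chart_of[OF m]] piece_subset]
            continuous_on_subset[OF continuous_on_metric[OF chart_of[OF m]] piece_subset])
      from borel_measurable_continuous_on_indicator[OF sigma_compact_borel[OF sigma_compact_piece[OF m]] this]
      show ?thesis by simp
    qed
    have "(\<integral>\<^sup>+u. ennreal (?g m u) \<partial>lborel) \<le> (\<integral>\<^sup>+u. ennreal (max C 0) * (ennreal (1 * \<bar>det (proj_matrix (chart_of m) u)\<bar>) * indicator (Ipiece m) u) \<partial>lborel)"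
    proof (rule nn_integral_mono_AE)
      show "AE u in lborel. ennreal (?g m u) \<le> ennreal (max C 0) * (ennreal (1 * \<bar>det (proj_matrix (chart_of m) u)\<bar>) * indicator (Ipiece m) u)"
        using AE_not_face[of "face (chart_of m)"]
      proof eventually_elim
        case (elim u)
        show ?case
        proof (cases "u \<in> piece atlas m")
          case True
          then have I: "u \<in> Ipiece m" using elim piece_subset[of m] by (auto simp: Ipiece_def half_region_def)
          have "h (par (chart_of m) u) * sqrt (det (metric (par (chart_of m)) u)) \<le> max C 0 * \<bar>det (proj_matrix (chart_of m) u)\<bar>"
          proof (rule mult_mono)
            show "h (par (chart_of m) u) \<le> max C 0" using C[OF par_piece[OF m True]] by simp
            show "0 \<le> sqrt (det (metric (par (chart_of m)) u))" using det_metric_pos[OF piece_rep[OF m True]] by simp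
          qed (use volume_density_bounds(1)[OF m True] in simp_all)
          then show ?thesis using True I by (simp add: ennreal_mult'[symmetric] ennreal_leI)
        qed simp
      qed
    qed
    also have "\<dots> = ennreal (max C 0) * (\<integral>\<^sup>+u. ennreal (1 * \<bar>det (proj_matrix (chart_of m) u)\<bar>) * indicator (Ipiece m) u \<partial>lborel)"
    proof (rule nn_integral_cmult)
      have "chart_cts (\<lambda>y. 1 :: real)" by (simp add: chart_cts_def)
      from measurable_flat[OF m this]
      show "(\<lambda>u. ennreal (1 * \<bar>det (proj_matrix (chart_of m) u)\<bar>) * indicator (Ipiece m) u) \<in> borel_measurable lborel" by simp
    qed
    also have "\<dots> < top" using flat_area_finite[OF m] by (simp add: ennreal_mult_less_top)
    finally have fin: "(\<integral>\<^sup>+u. ennreal (?g m u) \<partial>lborel) < top" .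
    have "integrable lborel (?g m)"
      by (rule integrableI_nonneg) (use gm g0[OF m] fin in \<open>simp_all add: less_top[symmetric]\<close>)
    then have eq: "(\<integral>\<^sup>+u. ennreal (?g m u) \<partial>lborel) = ennreal (\<integral>u. ?g m u \<partial>lborel)"
      by (rule nn_integral_eq_integral) (simp add: g0[OF m])
    have "(\<integral>\<^sup>+u. ennreal (h (par (chart_of m) u) * \<bar>det (proj_matrix (chart_of m) u)\<bar>) * indicator (Ipiece m) u \<partial>lborel)
      \<le> (\<integral>\<^sup>+u. ennreal (max_slope S) * ennreal (?g m u) \<partial>lborel)"
    proof (rule nn_integral_mono)
      fix u
      show "ennreal (h (par (chart_of m) u) * \<bar>det (proj_matrix (chart_of m) u)\<bar>) * indicator (Ipiece m) u
        \<le> ennreal (max_slope S) * ennreal (?g m u)"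
      proof (cases "u \<in> Ipiece m")
        case True
        then have u: "u \<in> piece atlas m" by (simp add: Ipiece_def)
        from mult_left_mono[OF volume_density_bounds(2)[OF m u] h(2)[OF par_piece[OF m u]]]
        show ?thesis using True u t by (simp add: ennreal_mult'[symmetric] ennreal_leI mult.left_commute)
      qed simp
    qed
    also have "\<dots> = ennreal (max_slope S) * ennreal (\<integral>u. ?g m u \<partial>lborel)"
      unfolding eq[symmetric] using gm by (intro nn_integral_cmult) simp
    finally show "(\<integral>\<^sup>+u. ennreal (h (par (chart_of m) u) * \<bar>det (proj_matrix (chart_of m) u)\<bar>) * indicator (Ipiece m) u \<partial>lborel)
      \<le> ennreal (max_slope S) * ennreal (\<integral>u. ?g m u \<partial>lborel)" .
  qed
  also have "\<dots> = ennreal (max_slope S) * ennreal (surface_integral S h)"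
    unfolding surface_integral_atlas sum_distrib_left[symmetric] using g0
    by (subst sum_ennreal) (auto intro!: integral_nonneg)
  also have "\<dots> = ennreal (max_slope S * surface_integral S h)" using t by (simp add: ennreal_mult')
  finally show ?thesis .
qed

lemma boundary_integral_atlas: "boundary_integral S f =
    (\<Sum>m<length atlas. \<integral>y. indicator (Fpiece m) (face_point (face (chart_of m)) y) * (f (par (chart_of m) (face_point (face (chart_of m)) y))
      * sqrt (det (face_metric (face (chart_of m)) (par (chart_of m)) (face_point (face (chart_of m)) y)))) \<partial>PiM (UNIV - {face (chart_of m)}) (\<lambda>_. lborel))"
proof -
  have "indicator {y. face_point (face (chart_of m)) y \<in> piece atlas m} y = (indicator (Fpiece m) (face_point (face (chart_of m)) y) :: real)" for m y
    by (simp add: indicator_def Fpiece_def face_point_def)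
  then show ?thesis
    by (simp add: boundary_integral_def atlas_def[symmetric] set_lebesgue_integral_def Let_def)
qed

lemma boundary_density_nonneg:
  assumes m: "m < length atlas"
  shows "0 \<le> indicator (Fpiece m) u * (f (par (chart_of m) u) * sqrt (det (face_metric (face (chart_of m)) (par (chart_of m)) u)))"
proof (cases "u \<in> Fpiece m")
  case True
  then have u: "u \<in> piece atlas m" by (simp add: Fpiece_def)
  have "0 \<le> (norm (conormal (chart_of m) u))\<^sup>2 * (1 - slope (par (chart_of m) u) \<bullet> slope (par (chart_of m) u))"
    using slope_lt_1[OF par_piece[OF m u]] by simp
  also have "\<dots> \<le> det (face_metric (face (chart_of m)) (par (chart_of m)) u)" by (rule det_face_metric(1)[OF piece_rep[OF m u]])
  finally show ?thesis using pos[OF par_piece[OF m u]] by simp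
qed simp

lemma boundary_integral_nonneg: "0 \<le> boundary_integral S f"
  unfolding boundary_integral_atlas using boundary_density_nonneg by (intro sum_nonneg integral_nonneg) auto

lemma flat_le_boundary_integral:
  assumes t: "0 \<le> max_slope S"
  shows "flat_boundary_integral norm \<le> ennreal (max_slope S * boundary_integral S f)"
proof -
  let ?G = "\<lambda>m u. indicator (Fpiece m) u * (f (par (chart_of m) u) * sqrt (det (face_metric (face (chart_of m)) (par (chart_of m)) u)))"
  let ?p = "\<lambda>m y. face_point (face (chart_of m)) y" and ?M = "\<lambda>m. PiM (UNIV - {face (chart_of m)}) (\<lambda>_. lborel :: real measure)"
  note G0 = boundary_density_nonneg
  obtain C where C: "\<And>z. z \<in> S \<Longrightarrow> f z \<le> C" by (rule chart_cts_bounded[OF chart_cts_f]) (rule that)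
  have "flat_boundary_integral norm \<le> (\<Sum>m<length atlas. ennreal (max_slope S) * ennreal (\<integral>y. ?G m (?p m y) \<partial>?M m))"
    unfolding flat_boundary_integral_def
  proof (rule sum_mono)
    fix m assume "m \<in> {..<length atlas}"
    then have m: "m < length atlas" by simp
    have c: "chart_of m \<in> charts S" by (rule chart_of[OF m])
    have face: "u \<in> piece atlas m" if "u \<in> Fpiece m" for u using that by (simp add: Fpiece_def)
    have "?G m \<in> borel_measurable borel"
    proof -
      have ent: "continuous_on (half_region (chart_of m)) (\<lambda>u. face_metric (face (chart_of m)) (par (chart_of m)) u $ i $ j)" for i j
        by (cases "i = face (chart_of m) \<or> j = face (chart_of m)") (auto simp: face_metric_def continuous_on_metric[OF c])
      have "continuous_on (Fpiece m) (\<lambda>u. f (par (chart_of m) u) * sqrt (det (face_metric (face (chart_of m)) (par (chart_of m)) u)))"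
        by (intro continuous_on_mult continuous_on_real_sqrt continuous_on_det
            continuous_on_subset[OF chart_ctsD[OF chart_cts_f c] Fpiece_half] continuous_on_subset[OF ent Fpiece_half])
      from borel_measurable_continuous_on_indicator[OF sigma_compact_borel[OF sigma_compact_Fpiece[OF m]] this]
      show ?thesis by simp
    qed
    from measurable_compose[OF measurable_face_point this] have gm: "(\<lambda>y. ?G m (?p m y)) \<in> borel_measurable (?M m)" .
    have nm: "(\<lambda>u. ennreal (norm (conormal (chart_of m) u)) * indicator (Fpiece m) u) \<in> borel_measurable borel"
      by (intro borel_measurable_ennreal_continuous_on sigma_compact_borel sigma_compact_Fpiece m continuous_on_norm
          continuous_on_subset[OF continuous_on_conormal[OF c] Fpiece_half])
    have "(\<integral>\<^sup>+y. ennreal (?G m (?p m y)) \<partial>?M m)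
      \<le> (\<integral>\<^sup>+y. ennreal (max C 0) * (ennreal (norm (conormal (chart_of m) (?p m y))) * indicator (Fpiece m) (?p m y)) \<partial>?M m)"
    proof (rule nn_integral_mono)
      fix y
      let ?u = "?p m y"
      show "ennreal (?G m ?u) \<le> ennreal (max C 0) * (ennreal (norm (conormal (chart_of m) ?u)) * indicator (Fpiece m) ?u)"
      proof (cases "?u \<in> Fpiece m")
        case True
        note u = face[OF True]
        have "f (par (chart_of m) ?u) * sqrt (det (face_metric (face (chart_of m)) (par (chart_of m)) ?u)) \<le> max C 0 * norm (conormal (chart_of m) ?u)"
        proof (rule mult_mono')
          show "f (par (chart_of m) ?u) \<le> max C 0" using C[OF par_piece[OF m u]] by simp
          show "sqrt (det (face_metric (face (chart_of m)) (par (chart_of m)) ?u)) \<le> norm (conormal (chart_of m) ?u)"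
            by (rule real_le_lsqrt) (simp_all add: det_face_metric(2)[OF piece_rep[OF m u]])
          show "0 \<le> f (par (chart_of m) ?u)" using pos[OF par_piece[OF m u]] by simp
          show "0 \<le> sqrt (det (face_metric (face (chart_of m)) (par (chart_of m)) ?u))"
            using G0[OF m, of ?u] True pos[OF par_piece[OF m u]] by (simp add: zero_le_mult_iff)
        qed
        then show ?thesis using True by (simp add: ennreal_mult'[symmetric] ennreal_leI)
      qed simp
    qed
    also have "\<dots> = ennreal (max C 0) * (\<integral>\<^sup>+y. ennreal (norm (conormal (chart_of m) (?p m y))) * indicator (Fpiece m) (?p m y) \<partial>?M m)"
      by (rule nn_integral_cmult[OF measurable_compose[OF measurable_face_point nm]])
    also have "\<dots> < top" using boundary_area_finite[OF m] by (simp add: ennreal_mult_less_top)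
    finally have fin: "(\<integral>\<^sup>+y. ennreal (?G m (?p m y)) \<partial>?M m) < top" .
    have "integrable (?M m) (\<lambda>y. ?G m (?p m y))"
      by (rule integrableI_nonneg[OF gm _ fin[folded infinity_ennreal_def]]) (simp only: G0[OF m] AE_I2)
    then have eq: "(\<integral>\<^sup>+y. ennreal (?G m (?p m y)) \<partial>?M m) = ennreal (\<integral>y. ?G m (?p m y) \<partial>?M m)"
      by (rule nn_integral_eq_integral) (simp only: G0[OF m] AE_I2)
    have "(\<integral>\<^sup>+y. ennreal (f (par (chart_of m) (?p m y)) * norm (conormal (chart_of m) (?p m y))) * indicator (Fpiece m) (?p m y) \<partial>?M m)
      \<le> (\<integral>\<^sup>+y. ennreal (max_slope S) * ennreal (?G m (?p m y)) \<partial>?M m)"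
    proof (rule nn_integral_mono)
      fix y
      let ?u = "?p m y"
      show "ennreal (f (par (chart_of m) ?u) * norm (conormal (chart_of m) ?u)) * indicator (Fpiece m) ?u \<le> ennreal (max_slope S) * ennreal (?G m ?u)"
      proof (cases "?u \<in> Fpiece m")
        case True
        note u = face[OF True]
        let ?D = "det (face_metric (face (chart_of m)) (par (chart_of m)) ?u)" and ?b = "slope (par (chart_of m) ?u)"
        have "norm (conormal (chart_of m) ?u) * 1 \<le> norm (conormal (chart_of m) ?u) * (max_slope S * sqrt (1 - ?b \<bullet> ?b))"
          by (rule mult_left_mono[OF max_slope_bound(1)[OF par_piece[OF m u]]]) simp
        also have "\<dots> = max_slope S * sqrt ((norm (conormal (chart_of m) ?u))\<^sup>2 * (1 - ?b \<bullet> ?b))"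
          by (simp add: real_sqrt_mult)
        also have "\<dots> \<le> max_slope S * sqrt ?D"
          using det_face_metric(1)[OF piece_rep[OF m u]] t by (intro mult_left_mono real_sqrt_le_mono)
        finally have "norm (conormal (chart_of m) ?u) \<le> max_slope S * sqrt ?D" by simp
        from mult_left_mono[OF this less_imp_le[OF pos[OF par_piece[OF m u]]]]
        show ?thesis using True t by (simp add: ennreal_mult'[symmetric] ennreal_leI mult.left_commute)
      qed simp
    qed
    also have "\<dots> = ennreal (max_slope S) * ennreal (\<integral>y. ?G m (?p m y) \<partial>?M m)"
      unfolding eq[symmetric] by (rule nn_integral_cmult[OF measurable_compose[OF gm measurable_ennreal]])
    finally show "(\<integral>\<^sup>+y. ennreal (f (par (chart_of m) (?p m y)) * norm (conormal (chart_of m) (?p m y))) * indicator (Fpiece m) (?p m y) \<partial>?M m)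
      \<le> ennreal (max_slope S) * ennreal (\<integral>y. ?G m (?p m y) \<partial>?M m)" .
  qed
  also have "\<dots> = ennreal (max_slope S) * ennreal (boundary_integral S f)"
    unfolding boundary_integral_atlas sum_distrib_left[symmetric] using G0
    by (subst sum_ennreal) (auto intro!: integral_nonneg)
  also have "\<dots> = ennreal (max_slope S * boundary_integral S f)" using t by (simp add: ennreal_mult')
  finally show ?thesis .
qed

text \<open>
  The factor \<open>max_slope S\<close> is lost once, in passing from the projected to the induced measure on the side
  of the gradient; on the other side the induced measure is the smaller one.
\<close>

theorem sobolev_inequality:
  assumes n: "2 \<le> CARD('n)"
  shows "sobolev_constant TYPE('n) (max_slope S)
      * surface_integral S (\<lambda>x. f x powr (real CARD('n) / (real CARD('n) - 1))) powr ((real CARD('n) - 1) / real CARD('n))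
    \<le> surface_integral S integrand + boundary_integral S f"
proof (cases "S = {}")
  case True
  \<comment> \<open>the lower bound \<open>1\<close> for the maximal slope requires a point\<close>
  have "piece atlas m = {}" if "m < length atlas" for m using par_piece[OF that] True by blast
  then have "surface_integral S h = 0" for h by (simp add: surface_integral_atlas)
  then show ?thesis using boundary_integral_nonneg by simp
next
  case False
  then obtain y where y: "y \<in> S" by blast
  let ?n = "real CARD('n)" and ?t = "max_slope S"
  let ?k = "sqrt (0.86 * ?n + 0.14) / (2 * ?n)"
  let ?Y = "surface_integral S (\<lambda>x. f x powr (?n / (?n - 1)))" and ?Z = "surface_integral S integrand + boundary_integral S f"
  have t: "1 \<le> ?t" by (rule max_slope_bound(2)[OF y])
  have i0: "0 \<le> integrand y" if "y \<in> S" for y using integrand_ge[OF that] norm_ge_zero order_trans by blast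
  have Y0: "0 \<le> ?Y" by (rule surface_integral_nonneg) simp
  have SI: "0 \<le> surface_integral S integrand" by (rule surface_integral_nonneg[OF i0])
  have k: "0 \<le> ?k" by simp
  have "flat_integral (\<lambda>y. norm (grad y)) \<le> flat_integral integrand"
    unfolding flat_integral_def
  proof (intro sum_mono nn_integral_mono)
    fix m u assume "m \<in> {..<length atlas}"
    then have "u \<in> Ipiece m \<Longrightarrow> norm (grad (par (chart_of m) u)) \<le> integrand (par (chart_of m) u)"
      by (intro integrand_ge par_piece) (simp_all add: Ipiece_def)
    from mult_right_mono[OF this abs_ge_zero]
    show "ennreal (norm (grad (par (chart_of m) u)) * \<bar>det (proj_matrix (chart_of m) u)\<bar>) * indicator (Ipiece m) u
      \<le> ennreal (integrand (par (chart_of m) u) * \<bar>det (proj_matrix (chart_of m) u)\<bar>) * indicator (Ipiece m) u"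
      by (cases "u \<in> Ipiece m") (simp_all add: ennreal_leI)
  qed
  also have "\<dots> \<le> ennreal (?t * surface_integral S integrand)"
    by (rule flat_le_surface_integral[OF chart_cts_integrand i0]) (use t in auto)
  finally have "anisotropic_variation norm \<le> ennreal (?t * surface_integral S integrand) + ennreal (?t * boundary_integral S f)"
    unfolding anisotropic_variation_def using t by (intro add_mono flat_le_boundary_integral) auto
  also have "\<dots> = ennreal (?t * ?Z)"
    using t SI boundary_integral_nonneg by (subst ennreal_plus[symmetric]) (simp_all add: distrib_left)
  finally have A: "anisotropic_variation norm \<le> ennreal (?t * ?Z)" .
  have "ennreal (?Y powr ((?n - 1) / ?n)) = epow (ennreal ?Y) ((?n - 1) / ?n)" by (rule epow_ennreal[OF Y0, symmetric])
  also have "\<dots> \<le> epow (flat_integral (\<lambda>y. f y powr (?n / (?n - 1)))) ((?n - 1) / ?n)"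
    by (rule epow_mono[OF surface_integral_le_flat]) (use n in auto)
  also have "\<dots> \<le> ennreal ?k * anisotropic_variation norm" by (rule flat_sobolev[OF n])
  also have "\<dots> \<le> ennreal ?k * ennreal (?t * ?Z)" by (rule mult_left_mono[OF A]) simp
  also have "\<dots> = ennreal (?k * (?t * ?Z))" by (rule ennreal_mult'[OF k, symmetric])
  finally have "?Y powr ((?n - 1) / ?n) \<le> ?k * (?t * ?Z)"
    using t SI boundary_integral_nonneg by (subst (asm) ennreal_le_iff) auto
  from mult_left_mono[OF this sobolev_constant_bound(2)[OF t]]
  have "sobolev_constant TYPE('n) ?t * ?Y powr ((?n - 1) / ?n) \<le> sobolev_constant TYPE('n) ?t * (?k * (?t * ?Z))" .
  also have "\<dots> = (sobolev_constant TYPE('n) ?t * (?t * sqrt (0.86 * ?n + 0.14) / (2 * ?n))) * ?Z" by simp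
  also have "\<dots> \<le> 1 * ?Z"
    by (rule mult_right_mono[OF sobolev_constant_bound(1)[OF t]]) (use SI boundary_integral_nonneg in simp)
  finally show ?thesis by simp
qed

end

theorem theorem1p2:
  fixes S :: "(real \<times> (real^'n)) set"
    and f :: "real \<times> (real^'n) \<Rightarrow> real"
  assumes "CARD('n) \<ge> 2"
    and "hypersurface S"
    and "compact S"
    and "spacelike S"
    and "smooth_function S f"
    and "\<forall>x\<in>S. f x > 0"
  shows "surface_integral S (\<lambda>x. sqrt (mink (gradient S f x) (gradient S f x)
             + (f x)\<^sup>2 * (- mink (mean_curvature S x) (mean_curvature S x))))
           + boundary_integral S f
         \<ge> sobolev_constant TYPE('n) (max_slope S)
           * surface_integral S (\<lambda>x. f x powr (real CARD('n) / (real CARD('n) - 1)))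
               powr ((real CARD('n) - 1) / real CARD('n))"
proof -
  interpret weighted_hypersurface S f
    by unfold_locales (use assms in auto)
  show ?thesis using sobolev_inequality[OF assms(1)] by (simp only: integrand_def[abs_def])
qed

end
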